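(* Let $n\ge 2$, and suppose either $n=2$ and $p\geq 2$, or $n\geq 3$ and $p\geq\frac{2n}{n-1}$. Let $u \in W^{1,p}(\mathbb{H}^n)$, and let $u^\sharp_g$ and $u^\sharp_e$ be as defined in the context. Then \[ \int_{\mathbb{B}^n}|\nabla_g u^\sharp_g|_g^p\,dV - \left(\frac{n-1}{p}\right)^p\int_{\mathbb{B}^n}|u^\sharp_g|^p\,dV \geq \int_{\mathbb{R}^n}|\nabla u^\sharp_e|^p\,dx. \]
   Context: $\mathbb{H}^n$ is the Poincaré ball model: the unit ball $\mathbb{B}^n\subset\mathbb{R}^n$ with metric $g(x)=\frac{4}{(1-|x|^2)^2}\sum_i dx_i^2$, volume element $dV=\left(\frac{2}{1-|x|^2}\right)^n dx$, $V(E)=\int_E dV$, hyperbolic gradient $\nabla_g=\left(\frac{1-|x|^2}{2}\right)^2\nabla$ and $|\nabla_g u|_g=\sqrt{g(\nabla_g u,\nabla_g u)}=\frac{1-|x|^2}{2}|\nabla u|$. $W^{1,p}(\mathbb{H}^n)$ is the completion of $C_0^\infty(\mathbb{B}^n)$ under the norm $\left(\int|\nabla_g u|_g^p dV+\int|u|^p dV\right)^{1/p}$. For $u$ with $V(\{|u|>t\})<\infty$ for all $t>0$, let $\mu_u(t)=V(\{x:|u(x)|>t\})$ and define the decreasing rearrangement $u^*(t)=\sup\{s>0:\mu_u(s)>t\}$ on $(0,\infty)$. Let $\rho(x)=\ln\frac{1+|x|}{1-|x|}$ be the hyperbolic distance from $x$ to $0$, $B_g(0,r)$ the open geodesic ball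 of radius $r$ centered at $0$ (so $V(B_g(0,r)) = n\sigma_n\int_0^r(\sinh t)^{n-1}dt$), and $\sigma_n$ the volume of the Euclidean unit ball. Define $u^\sharp_g(x)=u^*(V(B_g(0,\rho(x))))$ for $x\in\mathbb{B}^n$ and $u^\sharp_e(x)=u^*(\sigma_n|x|^n)$ for $x\in\mathbb{R}^n$. *)

theory Defs
  imports "HOL-Analysis.Analysis"
begin

definition partial_deriv :: "'n::finite \<Rightarrow> (real^'n \<Rightarrow> real) \<Rightarrow> real^'n \<Rightarrow> real" where
  "partial_deriv i f x = frechet_derivative f (at x) (axis i 1)"

fun iter_partial :: "'n::finite list \<Rightarrow> (real^'n \<Rightarrow> real) \<Rightarrow> real^'n \<Rightarrow> real" where
  "iter_partial [] f = f"
| "iter_partial (i # is) f = partial_deriv i (iter_partial is f)"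

definition smooth_fun :: "(real^'n::finite \<Rightarrow> real) \<Rightarrow> bool" where
  "smooth_fun f \<longleftrightarrow> (\<forall>is. (\<forall>x. iter_partial is f differentiable (at x))
                            \<and> continuous_on UNIV (iter_partial is f))"

definition egrad :: "(real^'n::finite \<Rightarrow> real) \<Rightarrow> real^'n \<Rightarrow> real^'n" where
  "egrad f x = (\<chi> i. partial_deriv i f x)"

definition test_fun :: "(real^'n::finite) set \<Rightarrow> (real^'n \<Rightarrow> real) \<Rightarrow> bool" where
  "test_fun U f \<longleftrightarrow> smooth_fun f \<and> compact (closure {x. f x \<noteq> 0})
                     \<and> closure {x. f x \<noteq> 0} \<subseteq> U"

definition weak_grad :: "(real^'n::finite) set \<Rightarrow> (real^'n \<Rightarrow> real) \<Rightarrow> (real^'n \<Rightarrow> real^'n) \<Rightarrow> bool" where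
  "weak_grad U f G \<longleftrightarrow>
     (\<forall>K. compact K \<and> K \<subseteq> U \<longrightarrow>
        set_integrable lebesgue K f \<and> (\<forall>i. set_integrable lebesgue K (\<lambda>x. G x $ i))) \<and>
     (\<forall>\<phi> i. test_fun U \<phi> \<longrightarrow>
        (\<integral>x. f x * partial_deriv i \<phi> x \<partial>lebesgue) = - (\<integral>x. G x $ i * \<phi> x \<partial>lebesgue))"

definition hyp_weight :: "real^'n::finite \<Rightarrow> real" where
  "hyp_weight x = (2 / (1 - (norm x)\<^sup>2)) ^ CARD('n)"

definition hypV :: "(real^'n::finite) measure" where
  "hypV = density (lebesgue_on (ball 0 1)) (\<lambda>x. ennreal (hyp_weight x))"

text \<open>|grad_g u|_g in terms of the Euclidean gradient vector G.\<close>
definition hyp_norm :: "real^'n::finite \<Rightarrow> real^'n \<Rightarrow> real" where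
  "hyp_norm x G = (1 - (norm x)\<^sup>2) / 2 * norm G"

text \<open>W^{1,p}(H^n): completion of C_0^infinity(B^n) under the norm
  (int |grad_g u|_g^p dV + int |u|^p dV)^(1/p), realised concretely: u (with gradient G)
  is the limit in this norm of a sequence of test functions.\<close>
definition W1p_hyp :: "real \<Rightarrow> (real^'n::finite \<Rightarrow> real) set" where
  "W1p_hyp p = {u. \<exists>G \<phi>.
       u \<in> borel_measurable hypV \<and> G \<in> borel_measurable hypV \<and>
       (\<integral>\<^sup>+ x. ennreal (\<bar>u x\<bar> powr p) \<partial>hypV) < \<infinity> \<and>
       (\<integral>\<^sup>+ x. ennreal (hyp_norm x (G x) powr p) \<partial>hypV) < \<infinity> \<and>
       (\<forall>k. test_fun (ball 0 1) (\<phi> k)) \<and>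
       ((\<lambda>k. \<integral>\<^sup>+ x. ennreal (\<bar>\<phi> k x - u x\<bar> powr p) \<partial>hypV) \<longlonglongrightarrow> 0) \<and>
       ((\<lambda>k. \<integral>\<^sup>+ x. ennreal (hyp_norm x (egrad (\<phi> k) x - G x) powr p) \<partial>hypV) \<longlonglongrightarrow> 0)}"

definition distr_hyp :: "(real^'n::finite \<Rightarrow> real) \<Rightarrow> real \<Rightarrow> ennreal" where
  "distr_hyp u t = emeasure hypV {x \<in> space hypV. \<bar>u x\<bar> > t}"

text \<open>Decreasing rearrangement u^*(t) = sup {s > 0. mu_u(s) > t} (sup of the empty set := 0).\<close>
definition decr_rearr :: "(real^'n::finite \<Rightarrow> real) \<Rightarrow> real \<Rightarrow> real" where
  "decr_rearr u t = Sup (insert 0 {s. s > 0 \<and> distr_hyp u s > ennreal t})"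

definition hyp_dist0 :: "real^'n::finite \<Rightarrow> real" where
  "hyp_dist0 x = ln ((1 + norm x) / (1 - norm x))"

definition hyp_ball_vol :: "'n::finite itself \<Rightarrow> real \<Rightarrow> real" where
  "hyp_ball_vol _ r = measure (hypV :: (real^'n) measure) {x \<in> ball 0 1. hyp_dist0 x < r}"

definition hyp_sym_rearr :: "(real^'n::finite \<Rightarrow> real) \<Rightarrow> real^'n \<Rightarrow> real" where
  "hyp_sym_rearr u x = decr_rearr u (hyp_ball_vol TYPE('n) (hyp_dist0 x))"

definition unit_ball_vol :: "'n::finite itself \<Rightarrow> real" where
  "unit_ball_vol _ = measure lborel (ball (0::real^'n) 1)"

definition euc_sym_rearr :: "(real^'n::finite \<Rightarrow> real) \<Rightarrow> real^'n \<Rightarrow> real" where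
  "euc_sym_rearr u x = decr_rearr u (unit_ball_vol TYPE('n) * norm x ^ CARD('n))"

end

theory Submission
  imports Defs
begin

text \<open>Everything is expressed through the volume coordinate \<open>s\<close>. If \<open>f\<close> is the decreasing
  rearrangement and \<open>h = - f'\<close>, then the three integrals in the theorem are the integrals over
  \<open>s > 0\<close> of \<open>(h K\<^sub>g)\<^sup>p\<close>, \<open>f\<^sup>p\<close> and \<open>(h K\<^sub>e)\<^sup>p\<close>, where \<open>K\<^sub>g\<close> and \<open>K\<^sub>e\<close> are the perimeters of the
  hyperbolic and the Euclidean ball of volume \<open>s\<close>. The condition on \<open>p\<close> gives the pointwise
  inequality \<open>K\<^sub>g\<^sup>p \<ge> K\<^sub>e\<^sup>p + ((n - 1) s)\<^sup>p\<close>, and Hardy's inequality bounds the integral of \<open>(s h)\<^sup>p\<close>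
  from below by \<open>p\<^sup>-\<^sup>p\<close> times that of \<open>f\<^sup>p\<close>.

  That \<open>h\<close> exists with a finite integral of \<open>(h K\<^sub>g)\<^sup>p\<close> only needs an isoperimetric inequality with
  some constant, in the weak form (level gap) * (volume) <= C * (gradient integral between the two
  levels). On sets of large volume it follows from the divergence theorem for a radial field, on
  sets of small volume from comparing a function with its averages over balls. It bounds the
  difference quotients of the rearrangements of test functions in a weighted \<open>L\<^sup>p\<close> space, and
  the bound passes to the limit by Fatou's lemma.\<close>

section \<open>Hoelder and Hardy inequalities\<close>

text \<open>The statement concerns only the two rearrangements, so \<open>u\<close> enters through
  \<open>f\<close> and through the existence and integrability of \<open>h\<close>; this is why an
  isoperimetric constant of any size suffices. What has to be excluded is a jump or a singular part
  of \<open>f\<close>, for then the rearrangements would have no weak gradient, and an infinite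
  hyperbolic energy, for then the difference of real integrals would be meaningless. The lower bound
  on \<open>p\<close> reflects large balls. For \<open>n \<ge> 4\<close> the excess of
  \<open>Kg\<close> over \<open>(n - 1) * s\<close> has order
  \<open>s powr ((n - 3) / (n - 1))\<close>, so \<open>Kg powr p - ((n - 1) * s) powr p\<close> has
  order \<open>s powr (p - 2 / (n - 1))\<close>. The order of \<open>Ke powr p\<close> is
  \<open>s powr (p - p / n)\<close>, and the two orders agree precisely at
  \<open>p = 2 * n / (n - 1)\<close>. At that exponent \<open>Ke powr p\<close> is a multiple of the
  square of \<open>s\<close>, which makes the comparison accessible by differentiation in the
  radius; larger exponents then follow from it. All estimates on \<open>u\<close> are made on bands
  between two levels and not on level sets, so truncations of class C1 and volume integrals take the
  place of surface measures.\<close>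

lemma nn_integral_Holder:
  fixes f g :: "'a \<Rightarrow> real"
  assumes pq: "p > 1" "q > 1" "1 / p + 1 / q = 1"
    and [measurable]: "f \<in> borel_measurable M" "g \<in> borel_measurable M"
    and nonneg: "\<And>x. x \<in> space M \<Longrightarrow> f x \<ge> 0" "\<And>x. x \<in> space M \<Longrightarrow> g x \<ge> 0"
    and A: "(\<integral>\<^sup>+x. ennreal (f x powr p) \<partial>M) \<le> ennreal A" "A > 0"
    and B: "(\<integral>\<^sup>+x. ennreal (g x powr q) \<partial>M) \<le> ennreal B" "B > 0"
  shows "(\<integral>\<^sup>+x. ennreal (f x * g x) \<partial>M) \<le> ennreal (A powr (1 / p) * B powr (1 / q))"
proof -
  define a b where "a = A powr (1 / p)" and "b = B powr (1 / q)"
  have ab: "a > 0" "b > 0" "a powr p = A" "b powr q = B"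
    using A(2) B(2) pq by (auto simp: a_def b_def powr_powr)
  \<comment> \<open>Dividing by \<open>a\<close> and \<open>b\<close> normalizes both norms to at
    most 1, so after integration Young's inequality contributes \<open>1 / p + 1 / q = 1\<close>.
    Positive upper bounds \<open>A\<close> and \<open>B\<close> in place of the integrals themselves
    keep these divisions legitimate.\<close>
  have pt: "f x * g x \<le> (a * b) * (f x powr p / (p * A) + g x powr q / (q * B))"
    if "x \<in> space M" for x
  proof -
    have "(f x / a) * (g x / b) \<le> (f x / a) powr p / p + (g x / b) powr q / q"
      using pq nonneg[OF that] ab by (intro Youngs_inequality) auto
    also have "\<dots> = f x powr p / (p * A) + g x powr q / (q * B)"
      using nonneg[OF that] ab by (simp add: powr_divide mult.commute)
    finally have "(a * b) * ((f x / a) * (g x / b)) \<le> (a * b) * (f x powr p / (p * A) + g x powr q / (q * B))"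
      using ab by (intro mult_left_mono) auto
    thus ?thesis using ab by (simp add: field_simps)
  qed
  have "(\<integral>\<^sup>+x. ennreal (f x * g x) \<partial>M)
      \<le> (\<integral>\<^sup>+x. ennreal (a * b) * (ennreal (1 / (p * A)) * ennreal (f x powr p)
            + ennreal (1 / (q * B)) * ennreal (g x powr q)) \<partial>M)"
    using pt pq ab A(2) B(2)
    by (intro nn_integral_mono) (auto simp flip: ennreal_mult'' ennreal_plus intro!: ennreal_leI)
  also have "\<dots> = ennreal (a * b) * (ennreal (1 / (p * A)) * (\<integral>\<^sup>+x. ennreal (f x powr p) \<partial>M)
            + ennreal (1 / (q * B)) * (\<integral>\<^sup>+x. ennreal (g x powr q) \<partial>M))"
    by (simp add: nn_integral_cmult nn_integral_add)
  also have "\<dots> \<le> ennreal (a * b) * (ennreal (1 / (p * A)) * ennreal A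
            + ennreal (1 / (q * B)) * ennreal B)"
    using A(1) B(1) by (intro mult_left_mono add_mono) auto
  also have "\<dots> = ennreal (a * b * (1 / (p * A) * A + 1 / (q * B) * B))"
    using pq ab A(2) B(2) by (simp flip: ennreal_mult'' ennreal_plus)
  also have "1 / (p * A) * A + 1 / (q * B) * B = 1"
    using pq A(2) B(2) by simp
  finally show ?thesis by (simp add: a_def b_def)
qed

text \<open>The weight \<open>t powr (1 - 1/p\<^sup>2)\<close> is the one for which Hoelder loses nothing, so that the
  constant \<open>p powr p\<close> is the sharp one.\<close>
lemma Hardy_inequality_tail:
  fixes f h :: "real \<Rightarrow> real"
  assumes p: "p > 1"
    and [measurable]: "f \<in> borel_measurable borel" "h \<in> borel_measurable borel"
    and h0: "\<And>t. h t \<ge> 0" and f0: "\<And>t. f t \<ge> 0"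
    and fh: "\<And>s. s > 0 \<Longrightarrow> ennreal (f s) \<le> (\<integral>\<^sup>+t. ennreal (h t) * indicator {s..} t \<partial>lborel)"
  shows "(\<integral>\<^sup>+s. ennreal (f s powr p) * indicator {0<..} s \<partial>lborel)
     \<le> ennreal (p powr p) * (\<integral>\<^sup>+t. ennreal ((t * h t) powr p) * indicator {0<..} t \<partial>lborel)"
proof -
  define q where "q = p / (p - 1)"
  define \<alpha> where "\<alpha> = 1 - 1 / p\<^sup>2"
  have pq: "p > 1" "q > 1" "1 / p + 1 / q = 1"
    using p by (auto simp: q_def field_simps)
  have \<alpha>q: "\<alpha> * q = 1 + 1 / p"
    using p by (simp add: \<alpha>_def q_def field_simps power2_eq_square)
  have \<alpha>p: "\<alpha> * p = p - 1 / p"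
    using p by (simp add: \<alpha>_def field_simps power2_eq_square)
  have \<alpha>0: "\<alpha> > 0"
    using p by (simp add: \<alpha>_def field_simps power2_eq_square less_1_mult)
  define c where "c = p powr (p - 1)"
  have c0: "c > 0" using p by (simp add: c_def)
  define I where "I s = (\<integral>\<^sup>+t. ennreal ((t powr \<alpha> * h t) powr p * indicator {s..} t) \<partial>lborel)" for s
  \<comment> \<open>Hoelder on the tail, with \<open>h t\<close> split as
    \<open>t powr \<alpha> * h t\<close> times \<open>t powr (-\<alpha>)\<close>. The second factor
    has a finite \<open>q\<close>-norm on the tail because \<open>\<alpha> * q = 1 + 1 / p\<close>
    exceeds 1.\<close>
  have step: "ennreal (f s powr p) \<le> ennreal (c * s powr (- (1 - 1/p))) * I s" if s: "s > 0" for s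
  proof (cases "I s = \<infinity>")
    case True
    thus ?thesis using c0 s by (simp add: ennreal_mult_top)
  next
    case False
    then obtain A where A: "I s = ennreal A" "A \<ge> 0"
      by (metis ennreal_cases infinity_ennreal_def)
    have B: "(\<integral>\<^sup>+t. ennreal ((t powr (-\<alpha>) * indicator {s..} t) powr q) \<partial>lborel) = ennreal (p * s powr (-1/p))"
    proof -
      have "(\<integral>\<^sup>+t. ennreal ((t powr (-\<alpha>) * indicator {s..} t) powr q) \<partial>lborel)
          = (\<integral>\<^sup>+t. ennreal (t powr (-1 - 1/p)) * indicator {s..} t \<partial>lborel)"
        using \<alpha>q pq by (intro nn_integral_cong) (auto simp: indicator_def powr_powr)
      also have "\<dots> = ennreal (0 - (- p * s powr (-1/p)))"
      proof (rule nn_integral_FTC_atLeast)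
        fix x assume "s \<le> x"
        hence "x > 0" using s by simp
        thus "((\<lambda>x. - p * x powr (-1/p)) has_real_derivative x powr (-1 - 1/p)) (at x)"
          using p by (auto intro!: derivative_eq_intros simp: minus_diff_commute)
      next
        show "((\<lambda>x. - p * x powr (-1/p)) \<longlongrightarrow> 0) at_top"
          using p tendsto_mult_right_zero[OF tendsto_neg_powr[of "-1/p" "\<lambda>x. x" at_top], of "-p"]
          by (simp add: filterlim_ident)
      qed auto
      finally show ?thesis by simp
    qed
    \<comment> \<open>\<open>A\<close> may be 0, while the Hoelder bound asks for a positive number:
      hence \<open>A' > A\<close>, followed by a limit from the right.\<close>
    have le: "f s powr p \<le> c * s powr (- (1 - 1/p)) * A'" if A': "A' > A" for A'
    proof -
      have "A' > 0" using A' A by simp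
      have "ennreal (f s) \<le> (\<integral>\<^sup>+t. ennreal (h t) * indicator {s..} t \<partial>lborel)"
        by (rule fh[OF s])
      also have "\<dots> = (\<integral>\<^sup>+t. ennreal ((t powr \<alpha> * h t * indicator {s..} t) * (t powr (-\<alpha>) * indicator {s..} t)) \<partial>lborel)"
        using s by (intro nn_integral_cong) (auto simp: indicator_def powr_minus field_simps)
      also have "\<dots> \<le> ennreal (A' powr (1/p) * (p * s powr (-1/p)) powr (1/q))"
      proof (rule nn_integral_Holder[OF pq])
        have "(\<integral>\<^sup>+t. ennreal ((t powr \<alpha> * h t * indicator {s..} t) powr p) \<partial>lborel) = I s"
          unfolding I_def using p by (intro nn_integral_cong) (auto simp: indicator_def)
        thus "(\<integral>\<^sup>+t. ennreal ((t powr \<alpha> * h t * indicator {s..} t) powr p) \<partial>lborel) \<le> ennreal A'"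
          using A A' by simp
        show "(\<integral>\<^sup>+t. ennreal ((t powr (-\<alpha>) * indicator {s..} t) powr q) \<partial>lborel) \<le> ennreal (p * s powr (-1/p))"
          using B by simp
      qed (use h0 p s \<open>A' > 0\<close> in auto)
      finally have "f s \<le> A' powr (1/p) * (p * s powr (-1/p)) powr (1/q)"
        by (simp add: ennreal_le_iff)
      hence "f s powr p \<le> (A' powr (1/p) * (p * s powr (-1/p)) powr (1/q)) powr p"
        using f0 p by (intro powr_mono2) auto
      also have "\<dots> = A' * (p powr (p/q) * s powr (-(1/q)))"
        using p s \<open>A' > 0\<close> by (simp add: powr_mult powr_powr)
      also have "p / q = p - 1" using p by (simp add: q_def)
      also have "1 / q = 1 - 1 / p" using pq by simp
      finally show ?thesis by (simp add: c_def mult_ac)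
    qed
    have "f s powr p \<le> c * s powr (- (1 - 1/p)) * A"
    proof (rule tendsto_lowerbound)
    show "((\<lambda>A'. c * s powr (- (1 - 1/p)) * A') \<longlongrightarrow> c * s powr (- (1 - 1/p)) * A) (at_right A)"
        by (intro tendsto_intros)
      show "\<forall>\<^sub>F A' in at_right A. f s powr p \<le> c * s powr (- (1 - 1/p)) * A'"
        using eventually_at_right_less by eventually_elim (rule le)
    qed simp
    thus ?thesis using A c0 by (auto simp flip: ennreal_mult'' intro!: ennreal_leI)
  qed
  have "(\<integral>\<^sup>+s. ennreal (f s powr p) * indicator {0<..} s \<partial>lborel)
     \<le> (\<integral>\<^sup>+s. (\<integral>\<^sup>+t. ennreal (c * s powr (- (1 - 1/p))) * indicator {0<..} s *
            ennreal ((t powr \<alpha> * h t) powr p * indicator {s..} t) \<partial>lborel) \<partial>lborel)"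
    (is "_ \<le> ?R")
  proof (rule nn_integral_mono)
    fix s :: real
    show "ennreal (f s powr p) * indicator {0<..} s \<le> (\<integral>\<^sup>+t. ennreal (c * s powr (- (1 - 1/p))) * indicator {0<..} s *
            ennreal ((t powr \<alpha> * h t) powr p * indicator {s..} t) \<partial>lborel)"
      using step[of s] by (subst nn_integral_cmult) (auto simp: I_def indicator_def)
  qed
  \<comment> \<open>After Tonelli the inner integral is that of \<open>s powr (1/p - 1)\<close> over
    \<open>s \<le> t\<close>, which equals \<open>p * t powr (1/p)\<close>. The powers of
    \<open>t\<close> recombine since \<open>\<alpha> * p + 1 / p = p\<close>, and the constants
    since \<open>c * p = p powr p\<close>.\<close>
  also have "?R = (\<integral>\<^sup>+t. (\<integral>\<^sup>+s. ennreal (c * s powr (- (1 - 1/p))) * indicator {0<..} s *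
            ennreal ((t powr \<alpha> * h t) powr p * indicator {s..} t) \<partial>lborel) \<partial>lborel)"
  proof (rule lborel_pair.Fubini')
    have [measurable]: "(\<lambda>(t::real, s). indicator {s..} t :: real) \<in> borel_measurable (borel \<Otimes>\<^sub>M borel)"
    proof -
      have "(\<lambda>(t::real, s). indicator {s..} t :: real) = (\<lambda>(t, s). if s \<le> t then 1 else 0)"
        by (auto simp: fun_eq_iff indicator_def)
      thus ?thesis by simp
    qed
    show "(\<lambda>(t, s). ennreal (c * s powr (- (1 - 1/p))) * indicator {0<..} s *
            ennreal ((t powr \<alpha> * h t) powr p * indicator {s..} t)) \<in> borel_measurable (lborel \<Otimes>\<^sub>M lborel)"
      by measurable
  qed
  also have "\<dots> = (\<integral>\<^sup>+t. ennreal (p powr p) * (ennreal ((t * h t) powr p) * indicator {0<..} t) \<partial>lborel)"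
  proof (rule nn_integral_cong)
    fix t :: real
    have "(\<integral>\<^sup>+s. ennreal (c * s powr (- (1 - 1/p))) * indicator {0<..} s *
            ennreal ((t powr \<alpha> * h t) powr p * indicator {s..} t) \<partial>lborel)
       = (\<integral>\<^sup>+s. ennreal (c * (t powr \<alpha> * h t) powr p) * (ennreal (s powr (- (1 - 1/p))) * indicator {0<..t} s) \<partial>lborel)"
      using c0 by (intro nn_integral_cong) (auto simp: indicator_def ennreal_mult'' mult_ac simp flip: ennreal_mult'')
    also have "\<dots> = ennreal (c * (t powr \<alpha> * h t) powr p) * (\<integral>\<^sup>+s. (ennreal (s powr (- (1 - 1/p))) * indicator {0<..t} s) \<partial>lborel)"
      by (rule nn_integral_cmult) simp
    also have "\<dots> = ennreal (p powr p) * (ennreal ((t * h t) powr p) * indicator {0<..} t)"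
    proof (cases "t > 0")
      case True
      have "(\<integral>\<^sup>+s. (ennreal (s powr (- (1 - 1/p))) * indicator {0<..t} s) \<partial>lborel)
          = (\<integral>\<^sup>+s. (ennreal (s powr (1/p - 1)) * indicator {0..t} s) \<partial>lborel)"
        using p by (intro nn_integral_cong) (auto simp: indicator_def)
      also have "\<dots> = ennreal (t powr (1/p) * p)"
        using has_integral_powr_from_0[of "1/p - 1" t] True p
        by (intro nn_integral_has_integral_lebesgue') auto
      finally have "ennreal (c * (t powr \<alpha> * h t) powr p) * (\<integral>\<^sup>+s. (ennreal (s powr (- (1 - 1/p))) * indicator {0<..t} s) \<partial>lborel)
         = ennreal (c * (t powr \<alpha> * h t) powr p * (t powr (1/p) * p))"
        using p by (simp add: ennreal_mult'')
      also have "c * (t powr \<alpha> * h t) powr p * (t powr (1/p) * p) = (c * p) * ((t powr (\<alpha> * p) * t powr (1/p)) * h t powr p)"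
        using True h0 by (simp add: powr_mult powr_powr)
      also have "t powr (\<alpha> * p) * t powr (1/p) = t powr p"
        by (simp add: \<alpha>p flip: powr_add)
      also have "c * p = p powr p" using p by (simp add: c_def powr_diff)
      also have "t powr p * h t powr p = (t * h t) powr p" using True h0 by (simp add: powr_mult)
      finally show ?thesis using True by (simp add: ennreal_mult'')
    next
      case False thus ?thesis by simp
    qed
    finally show "(\<integral>\<^sup>+s. ennreal (c * s powr (- (1 - 1/p))) * indicator {0<..} s *
            ennreal ((t powr \<alpha> * h t) powr p * indicator {s..} t) \<partial>lborel)
        = ennreal (p powr p) * (ennreal ((t * h t) powr p) * indicator {0<..} t)" .
  qed
  also have "\<dots> = ennreal (p powr p) * (\<integral>\<^sup>+t. ennreal ((t * h t) powr p) * indicator {0<..} t \<partial>lborel)"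
    by (rule nn_integral_cmult) simp
  finally show ?thesis .
qed

section \<open>Volume and perimeter of hyperbolic balls\<close>

text \<open>For a point at Euclidean distance \<open>r\<close> from the origin of the ball, the conformal factor and
  the hyperbolic sine and cosine of its hyperbolic distance to the origin.\<close>
definition conf :: "real \<Rightarrow> real" where "conf r = 2 / (1 - r\<^sup>2)"
definition hsinh :: "real \<Rightarrow> real" where "hsinh r = 2 * r / (1 - r\<^sup>2)"
definition hcosh :: "real \<Rightarrow> real" where "hcosh r = (1 + r\<^sup>2) / (1 - r\<^sup>2)"

text \<open>Hyperbolic volume of the ball of Euclidean radius \<open>r\<close>, divided by the volume of the Euclidean
  unit ball.\<close>
definition hball :: "nat \<Rightarrow> real \<Rightarrow> real" where
  "hball n r = integral {0..r} (\<lambda>t. real n * hsinh t ^ (n - 1) * conf t)"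

section \<open>Identities and derivatives of the radial profiles\<close>

lemma one_minus_square_pos: "0 \<le> r \<Longrightarrow> r < 1 \<Longrightarrow> 0 < 1 - r\<^sup>2" for r :: real
  by (simp add: power_less_one_iff abs_square_less_1)

lemma power_powr: "(y::real) \<ge> 0 \<Longrightarrow> k > 0 \<Longrightarrow> (y ^ k) powr m = y powr (real k * m)"
proof (cases "y = 0")
  case False
  assume "y \<ge> 0"
  with False have "y > 0" by simp
  hence "(y ^ k) powr m = (y powr real k) powr m" by (simp only: powr_realpow)
  thus ?thesis by (simp only: powr_powr)
qed simp

lemma conf_ge: "0 \<le> r \<Longrightarrow> r < 1 \<Longrightarrow> conf r \<ge> 2"
  using one_minus_square_pos[of r] by (simp add: conf_def field_simps)

lemma hsinh_nonneg: "0 \<le> r \<Longrightarrow> r < 1 \<Longrightarrow> hsinh r \<ge> 0"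
  using one_minus_square_pos[of r] by (simp add: hsinh_def)

lemma hsinh_pos: "0 < r \<Longrightarrow> r < 1 \<Longrightarrow> hsinh r > 0"
  using one_minus_square_pos[of r] by (simp add: hsinh_def)

lemma hsinh_eq: "hsinh r = conf r * r"
  by (simp add: hsinh_def conf_def)

lemma hcosh_eq: "0 \<le> r \<Longrightarrow> r < 1 \<Longrightarrow> hcosh r = conf r - 1"
  using one_minus_square_pos[of r] by (simp add: hcosh_def conf_def field_simps)

lemma hcosh_ge: "0 \<le> r \<Longrightarrow> r < 1 \<Longrightarrow> hcosh r \<ge> 1"
  using hcosh_eq conf_ge by fastforce

lemma hcosh_square: "0 \<le> r \<Longrightarrow> r < 1 \<Longrightarrow> (hcosh r)\<^sup>2 = 1 + (hsinh r)\<^sup>2"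
  using one_minus_square_pos[of r] by (simp add: hcosh_def hsinh_def field_simps) algebra

lemma hsinh_le_hcosh: "0 \<le> r \<Longrightarrow> r < 1 \<Longrightarrow> hsinh r \<le> hcosh r"
  by (rule power2_le_imp_le) (use hcosh_square[of r] hcosh_ge[of r] in auto)

lemma DERIV_hsinh: "0 \<le> r \<Longrightarrow> r < 1 \<Longrightarrow> (hsinh has_real_derivative conf r * hcosh r) (at r)"
  unfolding hsinh_def[abs_def] conf_def hcosh_def using one_minus_square_pos[of r]
  by (auto intro!: derivative_eq_intros simp: field_simps power2_eq_square)

lemma DERIV_hcosh: "0 \<le> r \<Longrightarrow> r < 1 \<Longrightarrow> (hcosh has_real_derivative conf r * hsinh r) (at r)"
  unfolding hcosh_def[abs_def] conf_def hsinh_def using one_minus_square_pos[of r]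
  by (auto intro!: derivative_eq_intros simp: field_simps power2_eq_square)

lemma continuous_on_conf: "continuous_on {0..<1} conf"
  unfolding conf_def[abs_def] by (intro continuous_intros) (auto simp: power2_eq_1_iff)

lemma continuous_on_hsinh: "continuous_on {0..<1} hsinh"
  by (rule DERIV_continuous_on, rule has_field_derivative_at_within, rule DERIV_hsinh) auto

lemma continuous_on_hcosh: "continuous_on {0..<1} hcosh"
  by (rule DERIV_continuous_on, rule has_field_derivative_at_within, rule DERIV_hcosh) auto

lemma continuous_on_hball_density: "continuous_on {0..<1} (\<lambda>t. real n * hsinh t ^ (n - 1) * conf t)"
  by (intro continuous_intros continuous_on_conf continuous_on_hsinh)

lemma hball_0 [simp]: "hball n 0 = 0"
  by (simp add: hball_def)

lemma DERIV_hball: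
  assumes "0 < r" "r < 1"
  shows "(hball n has_real_derivative real n * hsinh r ^ (n - 1) * conf r) (at r)"
proof -
  let ?R = "(1 + r) / 2"
  have "continuous_on {0..?R} (\<lambda>t. real n * hsinh t ^ (n - 1) * conf t)"
    by (rule continuous_on_subset[OF continuous_on_hball_density]) (use assms in auto)
  hence "(hball n has_real_derivative real n * hsinh r ^ (n - 1) * conf r) (at r within {0..?R})"
    unfolding hball_def[abs_def] using assms by (intro integral_has_real_derivative) auto
  moreover have "r \<in> interior {0..?R}" using assms by auto
  ultimately show ?thesis using at_within_interior[of r "{0..?R}"] by simp
qed

lemma continuous_on_hball: "continuous_on {0..<1} (hball n)"
proof -
  have "continuous_on {0..R} (hball n)" if "R < 1" for R
    unfolding hball_def[abs_def]
    by (intro indefinite_integral_continuous_1 integrable_continuous_real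
        continuous_on_subset[OF continuous_on_hball_density]) (use that in auto)
  hence "continuous (at x within {0..<1}) (hball n)" if "x \<in> {0..<1}" for x
  proof -
    have "continuous_on {0..(1+x)/2} (hball n)"
      using \<open>\<And>R. R < 1 \<Longrightarrow> continuous_on {0..R} (hball n)\<close> that by auto
    hence "continuous (at x within {0..(1+x)/2}) (hball n)"
      using that by (auto simp: continuous_on_eq_continuous_within)
    moreover have "at x within {0..(1+x)/2} = at x within {0..<1}"
      by (rule at_within_nhd[of _ "{..<(1+x)/2}"]) (use that in auto)
    ultimately show ?thesis by (simp add: continuous_within)
  qed
  thus ?thesis by (simp add: continuous_on_eq_continuous_within)
qed

text \<open>The common pattern of the volume comparisons below: the difference of the two sides
  vanishes at the center and has a nonnegative derivative. Differentiability is asked only for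
  positive radii because \<open>hball\<close> is identically 0 to the left of 0, so that at the
  center only continuity on \<open>{0..<1}\<close> is used.\<close>

lemma compare_from_0:
  fixes F :: "real \<Rightarrow> real"
  assumes "0 \<le> r" "r < 1" "continuous_on {0..<1} F"
    and "\<And>x. 0 < x \<Longrightarrow> x < 1 \<Longrightarrow> \<exists>y. (F has_real_derivative y) (at x) \<and> y \<ge> 0"
  shows "F 0 \<le> F r"
proof (cases "r = 0")
  case False
  show ?thesis
  proof (rule DERIV_nonneg_imp_increasing_open[of 0 r F])
    show "0 \<le> r" by (rule assms(1))
    show "continuous_on {0..r} F"
      by (rule continuous_on_subset[OF assms(3)]) (use assms(2) in auto)
    show "\<exists>y. (F has_real_derivative y) (at x) \<and> 0 \<le> y" if "0 < x" "x < r" for x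
      by (rule assms(4)) (use that assms(2) in auto)
  qed
qed simp

text \<open>With \<open>y = hsinh r\<close> and \<open>c = hcosh r\<close>, the derivative in the
  hyperbolic radius of \<open>y ^ n / c\<close> is
  \<open>n * y ^ (n - 1) - y ^ (n + 1) / c ^ 2\<close>, and the first term is the derivative of
  \<open>hball n\<close>. The bound has the right growth both at the center and at infinity, so it
  yields positivity and unboundedness of the volume and the perimeter estimate
  \<open>hsinh_power_le\<close>.\<close>

lemma hball_ge:
  assumes "0 \<le> r" "r < 1" "n > 0"
  shows "hsinh r ^ n / hcosh r \<le> hball n r"
proof -
  let ?F = "\<lambda>r. hball n r - hsinh r ^ n / hcosh r"
  have "?F 0 \<le> ?F r"
  proof (rule compare_from_0[OF assms(1,2)])
    show "continuous_on {0..<1} ?F"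
      by (intro continuous_intros continuous_on_hball continuous_on_hsinh continuous_on_hcosh)
        (use hcosh_ge in force)
    fix x :: real assume x: "0 < x" "x < 1"
    have c: "hcosh x > 0" "hcosh x \<noteq> 0" using hcosh_ge[of x] x by auto
    have D: "(?F has_real_derivative real n * hsinh x ^ (n - 1) * conf x -
       ((real n * hsinh x ^ (n - 1) * (conf x * hcosh x)) * hcosh x - hsinh x ^ n * (conf x * hsinh x)) / (hcosh x * hcosh x)) (at x)"
      using x c
      by (auto intro!: derivative_eq_intros DERIV_hball DERIV_hsinh DERIV_hcosh)
    have eq: "real n * hsinh x ^ (n - 1) * conf x -
       ((real n * hsinh x ^ (n - 1) * (conf x * hcosh x)) * hcosh x - hsinh x ^ n * (conf x * hsinh x)) / (hcosh x * hcosh x)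
       = hsinh x ^ n * (conf x * hsinh x) / (hcosh x * hcosh x)"
      using c by (simp add: field_simps)
    have nn: "\<dots> \<ge> 0"
      using x hsinh_nonneg[of x] conf_ge[of x] by simp
    show "\<exists>y. (?F has_real_derivative y) (at x) \<and> y \<ge> 0"
      using D nn unfolding eq by blast
  qed
  moreover have "?F 0 = 0" using assms(3) by (simp add: hsinh_def power_0_left)
  ultimately show ?thesis by linarith
qed

lemma hball_nonneg: "0 \<le> r \<Longrightarrow> r < 1 \<Longrightarrow> hball n r \<ge> 0"
proof (cases "n = 0")
  case False
  assume r: "0 \<le> r" "r < 1"
  have "0 \<le> hsinh r ^ n / hcosh r"
    using hsinh_nonneg[OF r] hcosh_ge[OF r] by simp
  thus ?thesis using hball_ge[OF r, of n] False by linarith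
qed (simp add: hball_def)

lemma hball_strict_mono:
  assumes "0 \<le> r" "r < r'" "r' < 1" "n > 0"
  shows "hball n r < hball n r'"
proof (rule DERIV_pos_imp_increasing_open[OF assms(2)])
  show "\<exists>y. (hball n has_real_derivative y) (at x) \<and> y > 0" if "r < x" "x < r'" for x
  proof (intro exI conjI)
    show "(hball n has_real_derivative real n * hsinh x ^ (n - 1) * conf x) (at x)"
      using that assms by (intro DERIV_hball) auto
    show "0 < real n * hsinh x ^ (n - 1) * conf x"
      using that assms hsinh_pos[of x] conf_ge[of x] by simp
  qed
  show "continuous_on {r..r'} (hball n)"
    by (rule continuous_on_subset[OF continuous_on_hball]) (use assms in auto)
qed

lemma hball_pos: "0 < r \<Longrightarrow> r < 1 \<Longrightarrow> n > 0 \<Longrightarrow> hball n r > 0"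
  using hball_strict_mono[of 0 r n] by simp

text \<open>The linear isoperimetric inequality for balls. The derivatives in the hyperbolic radius
  differ by \<open>n * (n - 1) * hsinh r ^ (n - 2) * (hcosh r - hsinh r)\<close>, which is
  nonnegative.\<close>

lemma hball_upper:
  assumes "0 \<le> r" "r < 1" "n \<ge> 2"
  shows "(real n - 1) * hball n r \<le> real n * hsinh r ^ (n - 1)"
proof -
  let ?F = "\<lambda>r. real n * hsinh r ^ (n - 1) - (real n - 1) * hball n r"
  have "?F 0 \<le> ?F r"
  proof (rule compare_from_0[OF assms(1,2)])
    show "continuous_on {0..<1} ?F"
      by (intro continuous_intros continuous_on_hball continuous_on_hsinh)
    fix x :: real assume x: "0 < x" "x < 1"
    have D: "(?F has_real_derivative real n * (real (n - 1) * hsinh x ^ (n - 1 - 1) * (conf x * hcosh x)) -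
        (real n - 1) * (real n * hsinh x ^ (n - 1) * conf x)) (at x)"
      using x by (auto intro!: derivative_eq_intros DERIV_hball DERIV_hsinh)
    have eq: "real n * (real (n - 1) * hsinh x ^ (n - 1 - 1) * (conf x * hcosh x)) -
        (real n - 1) * (real n * hsinh x ^ (n - 1) * conf x)
        = real n * (real n - 1) * hsinh x ^ (n - 2) * conf x * (hcosh x - hsinh x)"
    proof -
      have "n - 1 = Suc (n - 2)" using assms(3) by simp
      hence "hsinh x ^ (n - 1) = hsinh x ^ (n - 2) * hsinh x" by simp
      thus ?thesis using assms(3) by (simp add: of_nat_diff algebra_simps numeral_2_eq_2)
    qed
    have nn: "\<dots> \<ge> 0"
      using x hsinh_nonneg[of x] conf_ge[of x] hsinh_le_hcosh[of x] assms(3) by simp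
    show "\<exists>y. (?F has_real_derivative y) (at x) \<and> y \<ge> 0"
      using D nn unfolding eq by blast
  qed
  moreover have "?F 0 = 0" using assms(3) by (simp add: hsinh_def power_0_left)
  ultimately show ?thesis by linarith
qed

lemma hball_2: "0 \<le> r \<Longrightarrow> r < 1 \<Longrightarrow> hball 2 r = 2 * (hcosh r - 1)"
proof -
  assume r: "0 \<le> r" "r < 1"
  have "((\<lambda>t. real 2 * hsinh t ^ (2 - 1) * conf t) has_integral (2 * hcosh r - 2 * hcosh 0)) {0..r}"
  proof (rule fundamental_theorem_of_calculus[OF r(1)])
    fix x assume "x \<in> {0..r}"
    hence "((\<lambda>r. 2 * hcosh r) has_real_derivative real 2 * hsinh x ^ (2 - 1) * conf x) (at x within {0..r})"
      using r by (auto intro!: derivative_eq_intros has_field_derivative_at_within[OF DERIV_hcosh])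
    thus "((\<lambda>r. 2 * hcosh r) has_vector_derivative real 2 * hsinh x ^ (2 - 1) * conf x) (at x within {0..r})"
      by (simp add: has_real_derivative_iff_has_vector_derivative)
  qed
  thus ?thesis unfolding hball_def by (simp add: integral_unique hcosh_def)
qed

text \<open>One integration of \<open>hball_upper\<close>: after cancelling
  \<open>hsinh r ^ (n - 1)\<close> and positive constants, the sign of the derivative of the
  difference is that of \<open>y ^ 2 - (a * q) powr (2 / (n - 1))\<close>, and raising
  \<open>a * q \<le> y ^ (n - 1)\<close> to the power \<open>2 / (n - 1)\<close> gives exactly this.
  The statement is shaped to be the derivative of \<open>hball_upper_third\<close>.\<close>

lemma hball_upper_second:
  fixes n :: nat
  assumes "0 \<le> r" "r < 1" "n \<ge> 2"
  defines "a \<equiv> (real n - 1) / real n"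
  shows "hball n r + (a * hball n r) powr ((real n + 1) / (real n - 1)) \<le> hsinh r ^ n * hcosh r"
proof -
  define m where "m = (real n + 1) / (real n - 1)"
  have n: "real n \<ge> 2" using assms(3) by simp
  have a: "a > 0" using n by (simp add: a_def)
  have m: "m > 1" "m - 1 = 2 / (real n - 1)" "m * a = (real n + 1) / real n"
    using n by (simp_all add: m_def a_def field_simps)
  let ?F = "\<lambda>r. hsinh r ^ n * hcosh r - (hball n r + (a * hball n r) powr m)"
  have "?F 0 \<le> ?F r"
  proof (rule compare_from_0[OF assms(1,2)])
    show "continuous_on {0..<1} ?F"
      by (intro continuous_intros continuous_on_hball continuous_on_hsinh continuous_on_hcosh continuous_on_powr')
        (use m a hball_nonneg in auto)
    fix x :: real assume x: "0 < x" "x < 1"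
    define y c w q where "y = hsinh x" "c = hcosh x" "w = conf x" "q = hball n x"
    have pos: "y > 0" "c \<ge> 1" "w > 0" "q > 0" "c\<^sup>2 = 1 + y\<^sup>2"
      using x hsinh_pos[of x] hcosh_ge[of x] conf_ge[of x] hball_pos[of x n] assms(3) hcosh_square[of x]
      by (auto simp: y_c_w_q_def)
    have yn: "y ^ n = y ^ (n - 1) * y" using assms(3) by (cases n) auto
    have D: "(?F has_real_derivative (real n * y ^ (n - 1) * (w * c)) * c + y ^ n * (w * y)
        - (real n * y ^ (n - 1) * w + m * (a * q) powr (m - 1) * (a * (real n * y ^ (n - 1) * w)))) (at x)"
      using x a pos unfolding y_c_w_q_def
      by (auto intro!: derivative_eq_intros DERIV_hball DERIV_hsinh DERIV_hcosh)
    have "(real n * y ^ (n - 1) * (w * c)) * c + y ^ n * (w * y)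
        - (real n * y ^ (n - 1) * w + m * (a * q) powr (m - 1) * (a * (real n * y ^ (n - 1) * w)))
        = y ^ (n - 1) * w * (real n * c\<^sup>2 + y\<^sup>2 - real n - real n * (m * a) * (a * q) powr (m - 1))"
      by (simp add: yn algebra_simps power2_eq_square)
    also have "real n * (m * a) = real n + 1"
      using n by (simp add: m(3))
    also have "y ^ (n - 1) * w * (real n * c\<^sup>2 + y\<^sup>2 - real n - (real n + 1) * (a * q) powr (m - 1))
      = y ^ (n - 1) * w * (real n + 1) * (y\<^sup>2 - (a * q) powr (m - 1))"
      by (simp add: pos(5) algebra_simps)
    finally have eq: "(real n * y ^ (n - 1) * (w * c)) * c + y ^ n * (w * y)
        - (real n * y ^ (n - 1) * w + m * (a * q) powr (m - 1) * (a * (real n * y ^ (n - 1) * w)))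
      = y ^ (n - 1) * w * (real n + 1) * (y\<^sup>2 - (a * q) powr (m - 1))" .
    have "(a * q) powr (m - 1) \<le> y\<^sup>2"
    proof -
      have "a * q \<le> y ^ (n - 1)"
        using hball_upper[of x n] x assms(3) n by (simp add: y_c_w_q_def a_def field_simps)
      hence "(a * q) powr (m - 1) \<le> (y ^ (n - 1)) powr (m - 1)"
        using m(1) a pos by (intro powr_mono2) auto
      also have "\<dots> = y powr (real (n - 1) * (2 / (real n - 1)))"
        using pos assms(3) unfolding m(2) by (intro power_powr) auto
      also have "real (n - 1) * (2 / (real n - 1)) = 2"
        using n by (simp add: of_nat_diff field_simps)
      finally show ?thesis using pos by simp
    qed
    hence nn: "y ^ (n - 1) * w * (real n + 1) * (y\<^sup>2 - (a * q) powr (m - 1)) \<ge> 0"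
      using pos by simp
    show "\<exists>y. (?F has_real_derivative y) (at x) \<and> y \<ge> 0"
      using D nn unfolding eq by blast
  qed
  moreover have "?F 0 = 0" using assms(3) by (simp add: hsinh_def power_0_left)
  ultimately show ?thesis unfolding m_def by linarith
qed

text \<open>A second integration: the derivative of the difference of both sides is a positive
  factor times the inequality \<open>hball_upper_second\<close>. Up to the factor
  \<open>n powr m\<close>, this is the comparison of perimeters at the critical exponent
  \<open>m = 2 * n / (n - 1)\<close>, where the Euclidean term has become the square of the
  volume.\<close>

lemma hball_upper_third:
  fixes n :: nat
  assumes "0 \<le> r" "r < 1" "n \<ge> 2"
  defines "a \<equiv> (real n - 1) / real n"
  shows "(hball n r)\<^sup>2 + (a * hball n r) powr (2 * real n / (real n - 1)) \<le> hsinh r ^ (2 * n)"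
proof -
  define m where "m = 2 * real n / (real n - 1)"
  have n: "real n \<ge> 2" using assms(3) by simp
  have a: "a > 0" using n by (simp add: a_def)
  have m: "m > 0" "m - 1 = (real n + 1) / (real n - 1)" "m * a = 2"
    using n by (simp_all add: m_def a_def field_simps)
  let ?F = "\<lambda>r. hsinh r ^ (2 * n) - ((hball n r)\<^sup>2 + (a * hball n r) powr m)"
  have "?F 0 \<le> ?F r"
  proof (rule compare_from_0[OF assms(1,2)])
    show "continuous_on {0..<1} ?F"
      by (intro continuous_intros continuous_on_hball continuous_on_hsinh continuous_on_hcosh continuous_on_powr')
        (use m a hball_nonneg in auto)
    fix x :: real assume x: "0 < x" "x < 1"
    define y c w q where "y = hsinh x" "c = hcosh x" "w = conf x" "q = hball n x"
    have pos: "y > 0" "c \<ge> 1" "w > 0" "q > 0"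
      using x hsinh_pos[of x] hcosh_ge[of x] conf_ge[of x] hball_pos[of x n] assms(3)
      by (auto simp: y_c_w_q_def)
    have yn: "y ^ (2 * n - 1) = y ^ (n - 1) * y ^ n" using assms(3) by (simp add: mult_2 flip: power_add)
    have D: "(?F has_real_derivative (real (2 * n) * y ^ (2 * n - 1) * (w * c))
        - (2 * q * (real n * y ^ (n - 1) * w) + m * (a * q) powr (m - 1) * (a * (real n * y ^ (n - 1) * w)))) (at x)"
      using x a pos unfolding y_c_w_q_def
      by (auto intro!: derivative_eq_intros DERIV_hball DERIV_hsinh DERIV_hcosh)
    have "(real (2 * n) * y ^ (2 * n - 1) * (w * c))
        - (2 * q * (real n * y ^ (n - 1) * w) + m * (a * q) powr (m - 1) * (a * (real n * y ^ (n - 1) * w)))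
        = real n * y ^ (n - 1) * w * (2 * y ^ n * c - 2 * q - (m * a) * (a * q) powr (m - 1))"
      unfolding yn by (simp add: algebra_simps)
    also have "\<dots> = 2 * real n * y ^ (n - 1) * w * (y ^ n * c - (q + (a * q) powr (m - 1)))"
      unfolding m(3) by (simp add: algebra_simps)
    finally have eq: "(real (2 * n) * y ^ (2 * n - 1) * (w * c))
        - (2 * q * (real n * y ^ (n - 1) * w) + m * (a * q) powr (m - 1) * (a * (real n * y ^ (n - 1) * w)))
      = 2 * real n * y ^ (n - 1) * w * (y ^ n * c - (q + (a * q) powr (m - 1)))" .
    have "q + (a * q) powr (m - 1) \<le> y ^ n * c"
      using hball_upper_second[of x n] x assms(3) by (simp add: y_c_w_q_def m(2) a_def)
    hence nn: "2 * real n * y ^ (n - 1) * w * (y ^ n * c - (q + (a * q) powr (m - 1))) \<ge> 0"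
      using pos by simp
    show "\<exists>y. (?F has_real_derivative y) (at x) \<and> y \<ge> 0"
      using D nn unfolding eq by blast
  qed
  moreover have "?F 0 = 0" using assms(3) by (simp add: hsinh_def power_0_left)
  ultimately show ?thesis unfolding m_def by linarith
qed


text \<open>Passing to a larger exponent multiplies each \<open>X powr p0\<close> by
  \<open>(X powr p0) powr t\<close> with \<open>t \<ge> 0\<close>. On the left both extra factors
  are at most the one on the right, since each summand is bounded by
  \<open>S = A powr p0\<close>.\<close>

lemma powr_superadditive_exponent:
  fixes A B C :: real
  assumes "A \<ge> 0" "B \<ge> 0" "C \<ge> 0" "0 < p0" "p0 \<le> p" "B powr p0 + C powr p0 \<le> A powr p0"
  shows "B powr p + C powr p \<le> A powr p"
proof -
  define t where "t = p / p0 - 1"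
  have t: "t \<ge> 0" "p = p0 + p0 * t" using assms by (auto simp: t_def field_simps)
  have eq: "X powr p = X powr p0 * (X powr p0) powr t" for X :: real
    by (simp add: t(2) powr_add powr_powr)
  define S where "S = A powr p0"
  have "B powr p0 * (B powr p0) powr t + C powr p0 * (C powr p0) powr t \<le> B powr p0 * S powr t + C powr p0 * S powr t"
  proof -
    have "B powr p0 \<ge> 0" "C powr p0 \<ge> 0" by simp_all
    hence "B powr p0 \<le> S" "C powr p0 \<le> S" using assms(6) unfolding S_def by linarith+
    thus ?thesis using t(1) by (intro add_mono mult_left_mono powr_mono2) simp_all
  qed
  also have "\<dots> = (B powr p0 + C powr p0) * S powr t" by (simp add: algebra_simps)
  also have "\<dots> \<le> S * S powr t" using assms by (intro mult_right_mono) (auto simp: S_def)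
  finally show ?thesis by (simp add: eq S_def)
qed

text \<open>Dividing by \<open>n powr p\<close> reduces the claim to the critical exponent. For
  \<open>n \<ge> 3\<close> this is \<open>hball_upper_third\<close>. In the plane the explicit
  volume \<open>2 * (hcosh r - 1)\<close> gives the equality \<open>q + (q / 2) ^ 2 = y ^ 2\<close>,
  so there the smaller exponent 2 is already admissible.\<close>

lemma perimeter_comparison:
  fixes n :: nat and p :: real
  assumes r: "0 \<le> r" "r < 1"
    and hp: "(n = 2 \<and> p \<ge> 2) \<or> (n \<ge> 3 \<and> p \<ge> 2 * real n / (real n - 1))"
  shows "(real n * hball n r powr ((real n - 1) / real n)) powr p + ((real n - 1) * hball n r) powr p
     \<le> (real n * hsinh r ^ (n - 1)) powr p"
proof -
  define q y where "q = hball n r" "y = hsinh r"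
  have q0: "q \<ge> 0" "y \<ge> 0" using r hball_nonneg[of r n] hsinh_nonneg[of r] by (auto simp: q_y_def)
  have n2: "n \<ge> 2" "real n \<ge> 2" using hp by auto
  define a where "a = (real n - 1) / real n"
  have a: "a > 0" using n2 by (simp add: a_def)
  have "(q powr a) powr p + (a * q) powr p \<le> (y ^ (n - 1)) powr p"
  proof (cases "n = 2")
    case True
    have "q = 2 * (hcosh r - 1)" using hball_2[OF r] True by (simp add: q_y_def)
    moreover have "a = 1 / 2" using True by (simp add: a_def)
    ultimately have "q + (a * q)\<^sup>2 = (hcosh r)\<^sup>2 - 1"
      by (simp only: power2_eq_square) (simp add: algebra_simps)
    hence "q + (a * q)\<^sup>2 = y\<^sup>2" using hcosh_square[OF r] by (simp add: q_y_def)
    hence "(q powr a) powr 2 + (a * q) powr 2 \<le> (y ^ (n - 1)) powr 2"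
      using q0 a True by (simp add: powr_powr a_def)
    moreover have "p \<ge> 2" using hp True by auto
    ultimately show ?thesis using q0 a by (rule_tac powr_superadditive_exponent[where ?p0.0 = 2]) simp_all
  next
    case False
    let ?m = "2 * real n / (real n - 1)"
    have "a * ?m = 2" using n2 by (simp add: a_def field_simps)
    hence "(q powr a) powr ?m = q\<^sup>2" using q0 by (simp only: powr_powr) simp
    moreover have "(y ^ (n - 1)) powr ?m = y ^ (2 * n)"
    proof -
      have "(y ^ (n - 1)) powr ?m = y powr (real (n - 1) * ?m)"
        using q0 n2 by (intro power_powr) auto
      also have "real (n - 1) * ?m = real (2 * n) * 1" using n2 by (simp add: of_nat_diff)
      also have "y powr \<dots> = (y ^ (2 * n)) powr 1" using q0 n2 by (subst power_powr) auto
      finally show ?thesis using q0 by simp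
    qed
    ultimately have "(q powr a) powr ?m + (a * q) powr ?m \<le> (y ^ (n - 1)) powr ?m"
      using hball_upper_third[OF r n2(1)] by (simp add: q_y_def a_def)
    moreover have "p \<ge> ?m" "?m > 0" using hp False n2 by auto
    ultimately show ?thesis using q0 a by (rule_tac powr_superadditive_exponent[where ?p0.0 = ?m]) simp_all
  qed
  hence "real n powr p * ((q powr a) powr p + (a * q) powr p) \<le> real n powr p * (y ^ (n - 1)) powr p"
    by (intro mult_left_mono) auto
  moreover have "real n powr p * (q powr a) powr p = (real n * q powr a) powr p"
    by (simp add: powr_mult)
  moreover have "real n powr p * (a * q) powr p = ((real n - 1) * q) powr p"
    using n2 q0 a by (simp add: a_def flip: powr_mult)
  moreover have "real n powr p * (y ^ (n - 1)) powr p = (real n * y ^ (n - 1)) powr p"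
    using q0 by (simp add: powr_mult)
  ultimately show ?thesis unfolding q_y_def a_def by (simp add: distrib_left)
qed

text \<open>An upper bound for the perimeter in terms of the volume, with the constant 2 only for
  convenience: it serves to show that the hyperbolic energy is finite. For \<open>y \<ge> 1\<close>
  perimeter and volume are comparable; for \<open>y < 1\<close> the factor \<open>1 + y\<close> is
  at most 2 and the Euclidean scaling between volume and perimeter takes over.\<close>

lemma hsinh_power_le:
  assumes r: "0 \<le> r" "r < 1" and n: "n \<ge> 2"
  shows "hsinh r ^ (n - 1) \<le> 2 * (hball n r + hball n r powr (1 - 1 / real n))"
proof -
  define q y where "q = hball n r" "y = hsinh r"
  have q0: "q \<ge> 0" "y \<ge> 0" using r hball_nonneg[of r n] hsinh_nonneg[of r] by (auto simp: q_y_def)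
  have "(hcosh r)\<^sup>2 \<le> (1 + y)\<^sup>2"
  proof -
    have "(1 + y)\<^sup>2 = 1 + y\<^sup>2 + 2 * y" by (simp add: power2_sum)
    thus ?thesis using hcosh_square[OF r, folded q_y_def] q0 by linarith
  qed
  hence c: "hcosh r \<le> 1 + y" "hcosh r \<ge> 1"
    using q0 hcosh_ge[OF r] by (auto intro: power2_le_imp_le)
  have ge: "y ^ n / (1 + y) \<le> q"
  proof -
    have "y ^ n / (1 + y) \<le> y ^ n / hcosh r" using c q0 by (intro divide_left_mono) auto
    thus ?thesis using hball_ge[OF r, of n] n by (simp add: q_y_def)
  qed
  have yn: "y ^ n = y ^ (n - 1) * y" using n by (cases n) auto
  show ?thesis
  proof (cases "y \<ge> 1")
    case True
    have "y ^ (n - 1) \<le> 2 * (y ^ n / (1 + y))" using True by (simp add: yn field_simps)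
    also have "\<dots> \<le> 2 * q" using ge by simp
    finally show ?thesis unfolding q_y_def by (smt (verit) powr_ge_zero)
  next
    case False
    have "y ^ n / 2 \<le> y ^ n / (1 + y)" using False q0 by (intro divide_left_mono) auto
    hence "y ^ n / 2 \<le> q" using ge by (rule order_trans)
    hence "y ^ n \<le> 2 * q" by simp
    moreover have ex: "0 \<le> 1 - 1 / real n" using n by simp
    ultimately have "(y ^ n) powr (1 - 1 / real n) \<le> (2 * q) powr (1 - 1 / real n)"
      using q0 by (intro powr_mono2) simp_all
    also have "\<dots> = 2 powr (1 - 1 / real n) * q powr (1 - 1 / real n)" by (simp add: powr_mult)
    also have "\<dots> \<le> 2 powr 1 * q powr (1 - 1 / real n)" by (intro mult_right_mono powr_mono) simp_all
    also have "(y ^ n) powr (1 - 1 / real n) = y ^ (n - 1)"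
    proof -
      have "(y ^ n) powr (1 - 1 / real n) = y powr (real n * (1 - 1 / real n))"
        using q0 n by (intro power_powr) auto
      also have "real n * (1 - 1 / real n) = real (n - 1) * 1" using n by (simp add: of_nat_diff field_simps)
      also have "y powr \<dots> = (y ^ (n - 1)) powr 1" using q0 n by (subst power_powr) auto
      finally show ?thesis using q0 by simp
    qed
    finally show ?thesis using q0 unfolding q_y_def by simp
  qed
qed

lemma hball_unbounded:
  assumes "n \<ge> 2"
  shows "\<exists>r. 0 < r \<and> r < 1 \<and> S \<le> hball n r"
proof -
  define M where "M = max 1 (2 * S)"
  \<comment> \<open>Chosen to solve \<open>r / (1 - r) = M\<close>, which forces
    \<open>hsinh r \<ge> M\<close>.\<close>
  define r where "r = M / (1 + M)"
  have M: "M \<ge> 1" "M \<ge> 2 * S" by (auto simp: M_def)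
  have r: "0 < r" "r < 1" using M by (auto simp: r_def)
  define y where "y = hsinh r"
  have y: "y \<ge> M"
  proof -
    have "M = r / (1 - r)" using M by (simp add: r_def field_simps)
    also have "\<dots> = r * (1 + r) / (1 - r\<^sup>2)"
    proof -
      have "1 - r\<^sup>2 = (1 - r) * (1 + r)" by (simp add: power2_eq_square algebra_simps)
      thus ?thesis using r by simp
    qed
    also have "\<dots> \<le> 2 * r / (1 - r\<^sup>2)"
    proof (rule divide_right_mono)
      have "r * (1 + r) \<le> r * 2" using r by (intro mult_left_mono) simp_all
      thus "r * (1 + r) \<le> 2 * r" by simp
      show "0 \<le> 1 - r\<^sup>2" using r one_minus_square_pos[of r] by simp
    qed
    finally show ?thesis by (simp add: y_def hsinh_def)
  qed
  have "1 \<le> y\<^sup>2" using y M by simp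
  hence "(hcosh r)\<^sup>2 \<le> (2 * y)\<^sup>2"
    using hcosh_square[of r] r by (simp add: y_def power_mult_distrib)
  hence "hcosh r \<le> 2 * y" using y M by (auto intro: power2_le_imp_le)
  hence "y ^ n / (2 * y) \<le> y ^ n / hcosh r"
    using y M hcosh_ge[of r] r by (intro divide_left_mono) auto
  also have "\<dots> \<le> hball n r" using hball_ge[of r n] r assms by (simp add: y_def)
  also have "y ^ n / (2 * y) = y ^ (n - 1) / 2" using assms y M by (cases n) auto
  finally have "y ^ (n - 1) / 2 \<le> hball n r" .
  moreover have "y \<le> y ^ (n - 1)" using y M assms by (simp add: self_le_power)
  ultimately have "S \<le> hball n r" using y M by linarith
  thus ?thesis using r by blast
qed

section \<open>Volume coordinates\<close>

lemma measure_eqI_lessThan_finite: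
  fixes M N :: "real measure"
  assumes sets: "sets M = sets borel" "sets N = sets borel"
    and fin: "\<And>x. emeasure M {..<x} < \<infinity>"
    and eq: "\<And>x. emeasure M {..<x} = emeasure N {..<x}"
  shows "M = N"
proof (rule measure_eqI_generator_eq[where E = "range lessThan" and \<Omega> = UNIV and A = "\<lambda>i. {..<real i}"])
  show "Int_stable (range (lessThan :: real \<Rightarrow> real set))"
  proof (rule Int_stableI, clarify)
    fix a b :: real
    have "{..<a} \<inter> {..<b} = {..<min a b}" by auto
    thus "{..<a} \<inter> {..<b} \<in> range lessThan" by blast
  qed
  show "(\<Union>i. {..<real i}) = UNIV"
    using reals_Archimedean2 by auto
  have "sets (borel :: real measure) = sigma_sets UNIV (range lessThan)"
    by (subst borel_Iio) simp
  thus "sets M = sigma_sets UNIV (range lessThan)" "sets N = sigma_sets UNIV (range lessThan)"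
    by (simp_all only: sets)
qed (use fin eq in \<open>auto simp: less_top[symmetric]\<close>)

text \<open>Polar coordinates obtained from the volumes of balls alone: the image of Lebesgue
  measure under \<open>norm\<close> and the measure with the stated density agree on all half-lines
  \<open>{..<x}\<close>, which generate the Borel sets and have finite mass.\<close>

lemma nn_integral_radial:
  fixes k :: "real \<Rightarrow> ennreal"
  assumes [measurable]: "k \<in> borel_measurable borel"
  shows "(\<integral>\<^sup>+x. k (norm (x::'a::euclidean_space)) \<partial>lborel)
     = (\<integral>\<^sup>+r. k r * ennreal (real DIM('a) * measure lborel (ball (0::'a) 1) * r ^ (DIM('a) - 1)) * indicator {0<..} r \<partial>lborel)"
proof -
  let ?d = "DIM('a)" and ?\<sigma> = "measure lborel (ball (0::'a) 1)"
  have \<sigma>: "?\<sigma> > 0" by (simp add: content_ball_pos)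
  define D where "D r = ennreal (real ?d * ?\<sigma> * r ^ (?d - 1)) * indicator {0<..} r" for r :: real
  have [measurable]: "D \<in> borel_measurable borel" unfolding D_def by measurable
  have vol: "emeasure lborel (ball (0::'a) r) = ennreal (?\<sigma> * r ^ ?d)" if "r \<ge> 0" for r
    using content_ball_conv_unit_ball[OF that, of "0::'a"] emeasure_lborel_ball_finite[of "0::'a" r]
    by (simp add: emeasure_eq_ennreal_measure less_top mult.commute)
  have "distr lborel borel (norm :: 'a \<Rightarrow> real) = density lborel D"
  proof (rule measure_eqI_lessThan_finite)
    fix x :: real
    have 1: "emeasure (distr lborel borel (norm :: 'a \<Rightarrow> real)) {..<x} = emeasure lborel (ball (0::'a) x)"
      by (subst emeasure_distr) (auto intro!: arg_cong[where f="emeasure lborel"])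
    thus "emeasure (distr lborel borel (norm :: 'a \<Rightarrow> real)) {..<x} < \<infinity>"
      using emeasure_lborel_ball_finite[of "0::'a" x] by simp
    have "emeasure (density lborel D) {..<x} = (\<integral>\<^sup>+r. D r * indicator {..<x} r \<partial>lborel)"
      by (subst emeasure_density) auto
    also have "\<dots> = emeasure lborel (ball (0::'a) x)"
    proof (cases "x > 0")
      case True
      have "AE r in lborel. r \<noteq> 0 \<and> r \<noteq> x"
        using AE_lborel_singleton[of "0::real"] AE_lborel_singleton[of x] by eventually_elim auto
      hence "(\<integral>\<^sup>+r. D r * indicator {..<x} r \<partial>lborel)
          = (\<integral>\<^sup>+r. ennreal (real ?d * ?\<sigma> * r ^ (?d - 1)) * indicator {0..x} r \<partial>lborel)"
        by (intro nn_integral_cong_AE) (auto simp: D_def indicator_def)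
      also have "\<dots> = ennreal (?\<sigma> * x ^ ?d - ?\<sigma> * 0 ^ ?d)"
        using True \<sigma>
        by (intro nn_integral_FTC_Icc) (auto intro!: derivative_eq_intros simp: mult_ac)
      finally show ?thesis using vol[of x] True by simp
    next
      case False
      hence *: "ball (0::'a) x = {}" by (simp add: ball_eq_empty)
      moreover have "(\<integral>\<^sup>+r. D r * indicator {..<x} r \<partial>lborel) = (\<integral>\<^sup>+r. 0 \<partial>(lborel :: real measure))"
        using False by (intro nn_integral_cong) (auto simp: D_def indicator_def)
      ultimately show ?thesis unfolding * by simp
    qed
    finally show "emeasure (distr lborel borel (norm :: 'a \<Rightarrow> real)) {..<x} = emeasure (density lborel D) {..<x}"
      using 1 by simp
  qed auto
  moreover have "(\<integral>\<^sup>+x. k (norm (x::'a)) \<partial>lborel) = integral\<^sup>N (distr lborel borel (norm :: 'a \<Rightarrow> real)) k"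
    by (subst nn_integral_distr) auto
  ultimately have "(\<integral>\<^sup>+x. k (norm (x::'a)) \<partial>lborel) = (\<integral>\<^sup>+r. D r * k r \<partial>lborel)"
    by (simp add: nn_integral_density)
  thus ?thesis by (simp add: D_def mult_ac)
qed

section \<open>The hyperbolic volume measure in radial and volume coordinates\<close>

lemma hyp_weight_conf: "hyp_weight (x::real^'n::finite) = conf (norm x) ^ CARD('n)"
  by (simp add: hyp_weight_def conf_def)

lemma conf_borel_measurable [measurable]: "conf \<in> borel_measurable borel"
  unfolding conf_def[abs_def] by measurable

lemma hsinh_borel_measurable [measurable]: "hsinh \<in> borel_measurable borel"
  unfolding hsinh_def[abs_def] by measurable

lemma hyp_weight_borel_measurable [measurable]: "hyp_weight \<in> borel_measurable borel"
  unfolding hyp_weight_conf[abs_def] by measurable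

lemma space_hypV [simp]: "space (hypV :: (real^'n::finite) measure) = ball 0 1"
  by (simp add: hypV_def space_restrict_space)

lemma sets_hypV: "sets (hypV :: (real^'n::finite) measure) = sets (lebesgue_on (ball 0 1))"
  by (simp add: hypV_def)

lemma borel_measurable_hypV:
  "f \<in> borel_measurable borel \<Longrightarrow> f \<in> borel_measurable (hypV :: (real^'n::finite) measure)"
  unfolding hypV_def by (simp add: measurable_completion measurable_restrict_space1)

lemma hyp_weight_borel_measurable_lebesgue_on [measurable]:
  "(\<lambda>x. ennreal (hyp_weight x)) \<in> borel_measurable (lebesgue_on (ball (0::real^'n::finite) 1))"
  by (intro measurable_restrict_space1 measurable_completion) measurable

text \<open>\<open>hypV\<close> lives on the Lebesgue measurable sets, while the computations take
  place in \<open>lborel\<close>. The transfer rests on the fact that a nonnegative integral has the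
  same value for a measure and for its completion.\<close>

lemma nn_integral_hypV:
  fixes f :: "real^'n::finite \<Rightarrow> ennreal"
  assumes "f \<in> borel_measurable hypV"
  shows "(\<integral>\<^sup>+x. f x \<partial>hypV) = (\<integral>\<^sup>+x. f x * ennreal (hyp_weight x) * indicator (ball 0 1) x \<partial>lborel)"
proof -
  have [measurable]: "f \<in> borel_measurable (lebesgue_on (ball 0 1))"
    using assms measurable_cong_sets[OF sets_hypV refl] by blast
  have "(\<integral>\<^sup>+x. f x \<partial>hypV) = (\<integral>\<^sup>+x. ennreal (hyp_weight x) * f x \<partial>lebesgue_on (ball 0 1))"
    unfolding hypV_def by (subst nn_integral_density) auto
  also have "\<dots> = (\<integral>\<^sup>+x. ennreal (hyp_weight x) * f x * indicator (ball 0 1) x \<partial>lebesgue)"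
    by (subst nn_integral_restrict_space) auto
  also have "\<dots> = (\<integral>\<^sup>+x. ennreal (hyp_weight x) * f x * indicator (ball 0 1) x \<partial>lborel)"
    by (rule nn_integral_completion)
  finally show ?thesis by (simp add: mult_ac)
qed

lemma emeasure_hypV_ball:
  assumes r: "0 \<le> r" "r < 1"
  shows "emeasure (hypV :: (real^'n::finite) measure) (ball 0 r)
     = ennreal (unit_ball_vol TYPE('n) * hball CARD('n) r)"
proof -
  let ?d = "CARD('n)" and ?\<sigma> = "unit_ball_vol TYPE('n)"
  have \<sigma>: "?\<sigma> > 0" by (simp add: unit_ball_vol_def content_ball_pos)
  have "ball 0 r \<inter> ball 0 1 = ball (0::real^'n) r" using r by auto
  hence "ball (0::real^'n) r \<in> sets hypV"
    unfolding sets_hypV sets_restrict_space by (metis (no_types, lifting) imageI inf_commute lmeasurable_ball fmeasurableD)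
  hence "emeasure (hypV :: (real^'n) measure) (ball 0 r) = (\<integral>\<^sup>+x. indicator (ball 0 r) x \<partial>(hypV :: (real^'n) measure))"
    by simp
  also have "\<dots> = (\<integral>\<^sup>+x. indicator (ball 0 r) x * ennreal (hyp_weight x) * indicator (ball 0 1) (x::real^'n) \<partial>lborel)"
    by (rule nn_integral_hypV, rule borel_measurable_hypV, rule borel_measurable_indicator) simp
  also have "\<dots> = (\<integral>\<^sup>+x. (\<lambda>t. ennreal (conf t ^ ?d) * indicator {..<r} t) (norm (x::real^'n)) \<partial>lborel)"
    using r by (intro nn_integral_cong) (auto simp: hyp_weight_conf indicator_def)
  also have "\<dots> = (\<integral>\<^sup>+t. ennreal (conf t ^ ?d) * indicator {..<r} t *
      ennreal (real ?d * ?\<sigma> * t ^ (?d - 1)) * indicator {0<..} t \<partial>lborel)"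
    by (subst nn_integral_radial) (auto simp: unit_ball_vol_def)
  also have "\<dots> = (\<integral>\<^sup>+t. ennreal (?\<sigma> * (real ?d * hsinh t ^ (?d - 1) * conf t)) * indicator {0..r} t \<partial>lborel)"
  proof (rule nn_integral_cong_AE)
    have "AE t in lborel. t \<noteq> 0 \<and> t \<noteq> r"
      using AE_lborel_singleton[of "0::real"] AE_lborel_singleton[of r] by eventually_elim auto
    thus "AE t in lborel. ennreal (conf t ^ ?d) * indicator {..<r} t *
      ennreal (real ?d * ?\<sigma> * t ^ (?d - 1)) * indicator {0<..} t
        = ennreal (?\<sigma> * (real ?d * hsinh t ^ (?d - 1) * conf t)) * indicator {0..r} t"
    proof eventually_elim
      case (elim t)
      show ?case
      proof (cases "0 < t \<and> t < r")
        case True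
        have "conf t ^ ?d = conf t ^ (?d - 1) * conf t"
          by (metis One_nat_def Suc_pred zero_less_card_finite power_Suc2)
        hence eq: "conf t ^ ?d * (real ?d * ?\<sigma> * t ^ (?d - 1)) = ?\<sigma> * (real ?d * hsinh t ^ (?d - 1) * conf t)"
          by (simp add: hsinh_eq power_mult_distrib)
        have "conf t ^ ?d \<ge> 0" using True r conf_ge[of t] by simp
        hence "ennreal (conf t ^ ?d) * ennreal (real ?d * ?\<sigma> * t ^ (?d - 1))
            = ennreal (?\<sigma> * (real ?d * hsinh t ^ (?d - 1) * conf t))"
          by (simp only: ennreal_mult'[symmetric] eq)
        thus ?thesis using True by simp
      next
        case False
        thus ?thesis using elim by (auto simp: indicator_def)
      qed
    qed
  qed
  also have "\<dots> = ennreal (?\<sigma> * hball ?d r)"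
  proof (rule nn_integral_has_integral_lebesgue')
    have "((\<lambda>t. real ?d * hsinh t ^ (?d - 1) * conf t) has_integral hball ?d r) {0..r}"
      unfolding hball_def
      by (intro integrable_integral integrable_continuous_real continuous_on_subset[OF continuous_on_hball_density])
        (use r in auto)
    thus "((\<lambda>t. ?\<sigma> * (real ?d * hsinh t ^ (?d - 1) * conf t)) has_integral ?\<sigma> * hball ?d r) {0..r}"
      by (rule has_integral_mult_right)
    show "0 \<le> ?\<sigma> * (real ?d * hsinh x ^ (?d - 1) * conf x)" if "x \<in> {0..r}" for x
      using that r \<sigma> hsinh_nonneg[of x] conf_ge[of x] by simp
  qed
  finally show ?thesis .
qed

lemma hyp_ball_vol_dist0:
  assumes "norm (x::real^'n::finite) < 1"
  shows "hyp_ball_vol TYPE('n) (hyp_dist0 x) = unit_ball_vol TYPE('n) * hball CARD('n) (norm x)"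
proof -
  have "{y \<in> ball 0 1. hyp_dist0 y < hyp_dist0 x} = ball (0::real^'n) (norm x)"
  proof -
    have "hyp_dist0 y < hyp_dist0 x \<longleftrightarrow> norm y < norm x" if "norm y < 1" for y :: "real^'n"
    proof -
      have "hyp_dist0 y < hyp_dist0 x \<longleftrightarrow> (1 + norm y) / (1 - norm y) < (1 + norm x) / (1 - norm x)"
        unfolding hyp_dist0_def using assms that by (subst ln_less_cancel_iff) (auto intro!: divide_pos_pos add_pos_nonneg)
      also have "\<dots> \<longleftrightarrow> norm y < norm x" using assms that by (simp add: divide_simps algebra_simps)
      finally show ?thesis .
    qed
    thus ?thesis using assms by auto
  qed
  hence "hyp_ball_vol TYPE('n) (hyp_dist0 x) = measure (hypV :: (real^'n) measure) (ball 0 (norm x))"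
    by (simp add: hyp_ball_vol_def)
  also have "\<dots> = unit_ball_vol TYPE('n) * hball CARD('n) (norm x)"
    unfolding measure_def using assms hball_nonneg[of "norm x" "CARD('n)"]
    by (subst emeasure_hypV_ball) (auto simp: unit_ball_vol_def)
  finally show ?thesis .
qed

text \<open>A function whose sublevel sets \<open>\<Phi> < s\<close> have volume exactly
  \<open>s\<close> transports the measure to Lebesgue measure on the positive half-line. Applied to
  the volume of the centered ball through \<open>x\<close>, it turns both model spaces into the same
  half-line, and this is what makes their energies comparable pointwise.\<close>

lemma nn_integral_volume_coordinate:
  fixes M :: "'a measure" and \<Phi> :: "'a \<Rightarrow> real" and g :: "real \<Rightarrow> ennreal"
  assumes \<Phi> [measurable]: "\<Phi> \<in> borel_measurable M"
    and vol: "\<And>s. s > 0 \<Longrightarrow> emeasure M {x \<in> space M. \<Phi> x < s} = ennreal s"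
    and nonneg: "\<And>x. x \<in> space M \<Longrightarrow> \<Phi> x \<ge> 0"
    and g: "g \<in> borel_measurable borel"
  shows "(\<integral>\<^sup>+x. g (\<Phi> x) \<partial>M) = (\<integral>\<^sup>+s. g s * indicator {0<..} s \<partial>lborel)"
proof -
  have "distr M borel \<Phi> = density lborel (indicator {0<..})"
  proof (rule measure_eqI_lessThan_finite)
    fix s :: real
    have 1: "emeasure (distr M borel \<Phi>) {..<s} = emeasure M {x \<in> space M. \<Phi> x < s}"
      by (subst emeasure_distr) (auto intro!: arg_cong[where f="emeasure M"])
    have 2: "emeasure (density lborel (indicator {0<..})) {..<s} = emeasure lborel ({0<..<s} :: real set)"
      by (subst emeasure_density)
        (auto simp: indicator_inter_arith[symmetric] greaterThanLessThan_def Int_commute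
           simp flip: nn_integral_indicator intro!: nn_integral_cong split: split_indicator)
    have "emeasure M {x \<in> space M. \<Phi> x < s} = emeasure lborel ({0<..<s} :: real set)"
    proof (cases "s > 0")
      case False
      hence "{x \<in> space M. \<Phi> x < s} = {}" using nonneg by fastforce
      hence "emeasure M {x \<in> space M. \<Phi> x < s} = 0" by (simp only: emeasure_empty)
      thus ?thesis using False by simp
    qed (simp add: vol)
    thus "emeasure (distr M borel \<Phi>) {..<s} = emeasure (density lborel (indicator {0<..})) {..<s}"
      "emeasure (distr M borel \<Phi>) {..<s} < \<infinity>" unfolding 1 2 by (cases "s > 0"; simp)+
  qed auto
  moreover have "(\<integral>\<^sup>+x. g (\<Phi> x) \<partial>M) = integral\<^sup>N (distr M borel \<Phi>) g"
    using g by (subst nn_integral_distr) auto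
  ultimately show ?thesis using g by (simp add: nn_integral_density mult.commute)
qed

lemma euc_volume_coordinate:
  fixes g :: "real \<Rightarrow> ennreal"
  assumes "g \<in> borel_measurable borel"
  shows "(\<integral>\<^sup>+x. g (unit_ball_vol TYPE('n) * norm (x::real^'n::finite) ^ CARD('n)) \<partial>lborel)
     = (\<integral>\<^sup>+s. g s * indicator {0<..} s \<partial>lborel)"
proof (rule nn_integral_volume_coordinate)
  let ?\<sigma> = "unit_ball_vol TYPE('n)" and ?d = "CARD('n)"
  have \<sigma>: "?\<sigma> > 0" by (simp add: unit_ball_vol_def content_ball_pos)
  fix s :: real assume s: "s > 0"
  define r where "r = root ?d (s / ?\<sigma>)"
  have r: "r > 0" "r ^ ?d = s / ?\<sigma>" using s \<sigma> by (auto simp: r_def)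
  have "?\<sigma> * norm x ^ ?d < s \<longleftrightarrow> norm x < r" for x :: "real^'n"
  proof -
    have "?\<sigma> * norm x ^ ?d < s \<longleftrightarrow> norm x ^ ?d < r ^ ?d" using \<sigma> by (simp add: r(2) field_simps)
    also have "\<dots> \<longleftrightarrow> norm x < r"
      using r(1) power_mono_iff[of r "norm x" ?d] by (simp flip: not_le)
    finally show ?thesis .
  qed
  hence "{x \<in> space lborel. ?\<sigma> * norm (x::real^'n) ^ ?d < s} = ball 0 r"
    by (simp add: set_eq_iff)
  moreover have "emeasure lborel (ball (0::real^'n) r) = ennreal s"
    using content_ball_conv_unit_ball[of r "0::real^'n"] emeasure_lborel_ball_finite[of "0::real^'n" r] r \<sigma>
    by (simp add: emeasure_eq_ennreal_measure less_top unit_ball_vol_def)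
  ultimately show "emeasure lborel {x \<in> space lborel. ?\<sigma> * norm (x::real^'n) ^ ?d < s} = ennreal s" by simp
qed (use assms in \<open>auto simp: unit_ball_vol_def\<close>)

lemma hball_borel_measurable_on_ball:
  "(\<lambda>x. hball n (norm x) * indicator (ball 0 1) x) \<in> borel_measurable (borel :: 'a::euclidean_space measure)"
proof -
  have "continuous_on (ball (0::'a) 1) (\<lambda>x. hball n (norm x))"
    by (rule continuous_on_compose2[OF continuous_on_hball continuous_on_norm_id]) auto
  hence "set_borel_measurable borel (ball (0::'a) 1) (\<lambda>x. hball n (norm x))"
    by (intro set_measurable_continuous_on) auto
  thus ?thesis by (simp add: set_borel_measurable_def mult.commute)
qed

lemma hball_inverse:
  assumes "n \<ge> 2" "s > 0"
  obtains r where "0 < r" "r < 1" "hball n r = s"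
proof -
  obtain R where R: "0 < R" "R < 1" "s \<le> hball n R" using hball_unbounded[OF assms(1)] by blast
  have "\<exists>r\<ge>0. r \<le> R \<and> hball n r = s"
    using R assms by (intro IVT' continuous_on_subset[OF continuous_on_hball]) auto
  then obtain r where r: "0 \<le> r" "r \<le> R" "hball n r = s" by blast
  moreover have "r \<noteq> 0" using r assms by auto
  ultimately show ?thesis using that[of r] R by auto
qed

lemma hyp_volume_coordinate:
  fixes g :: "real \<Rightarrow> ennreal"
  assumes n: "CARD('n::finite) \<ge> 2" and "g \<in> borel_measurable borel"
  shows "(\<integral>\<^sup>+x. g (unit_ball_vol TYPE('n) * hball CARD('n) (norm x)) \<partial>(hypV :: (real^'n) measure))
     = (\<integral>\<^sup>+s. g s * indicator {0<..} s \<partial>lborel)"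
proof (rule nn_integral_volume_coordinate)
  let ?\<sigma> = "unit_ball_vol TYPE('n)" and ?d = "CARD('n)"
  have \<sigma>: "?\<sigma> > 0" by (simp add: unit_ball_vol_def content_ball_pos)
  have "(\<lambda>x. ?\<sigma> * (hball ?d (norm x) * indicator (ball 0 1) x)) \<in> borel_measurable (hypV :: (real^'n) measure)"
    by (intro borel_measurable_hypV borel_measurable_times[OF borel_measurable_const hball_borel_measurable_on_ball])
  thus "(\<lambda>x. ?\<sigma> * hball ?d (norm x)) \<in> borel_measurable (hypV :: (real^'n) measure)"
    by (rule measurable_cong[THEN iffD1, rotated]) auto
  show "0 \<le> ?\<sigma> * hball ?d (norm x)" if "x \<in> space (hypV :: (real^'n) measure)" for x
    using that \<sigma> hball_nonneg[of "norm x" ?d] by simp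
  fix s :: real assume s: "s > 0"
  obtain r where r: "0 < r" "r < 1" "hball ?d r = s / ?\<sigma>"
    using hball_inverse[OF n, of "s / ?\<sigma>"] s \<sigma> by auto
  have "?\<sigma> * hball ?d (norm x) < s \<longleftrightarrow> norm x < r" if "norm x < 1" for x :: "real^'n"
  proof -
    have "?\<sigma> * hball ?d (norm x) < s \<longleftrightarrow> hball ?d (norm x) < hball ?d r"
      using \<sigma> by (simp add: r(3) field_simps)
    also have "\<dots> \<longleftrightarrow> norm x < r"
      using hball_strict_mono[of "norm x" r ?d] hball_strict_mono[of r "norm x" ?d] r that
      by (cases "norm x" r rule: linorder_cases) auto
    finally show ?thesis .
  qed
  hence "{x \<in> space hypV. ?\<sigma> * hball ?d (norm x) < s} = ball (0::real^'n) r" using r by auto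
  thus "emeasure hypV {x \<in> space hypV. ?\<sigma> * hball ?d (norm (x::real^'n)) < s} = ennreal s"
    using emeasure_hypV_ball[of r, where 'n='n] r \<sigma> by simp
qed (use assms in auto)

section \<open>Compactly supported functions of class C1\<close>

text \<open>The gradient is carried along as an explicit vector field. One continuous derivative is
  the right amount of regularity: test functions belong to the class, and it is closed under the
  truncations between two levels and under products with functions that are C1 in the open ball
  only, provided the support stays inside a smaller ball.\<close>

definition C1c :: "('a::euclidean_space \<Rightarrow> real) \<Rightarrow> ('a \<Rightarrow> 'a) \<Rightarrow> bool" where
  "C1c f D \<longleftrightarrow> (\<forall>x. (f has_derivative (\<lambda>h. D x \<bullet> h)) (at x)) \<and> continuous_on UNIV D \<and> bounded {x. f x \<noteq> 0}"

lemma C1c_derivative: "C1c f D \<Longrightarrow> (f has_derivative (\<lambda>h. D x \<bullet> h)) (at x)"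
  by (simp add: C1c_def)

lemma C1c_continuous: "C1c f D \<Longrightarrow> continuous_on S f"
  by (meson C1c_derivative has_derivative_continuous continuous_at_imp_continuous_on)

lemma C1c_continuous_grad: "C1c f D \<Longrightarrow> continuous_on S D"
  by (auto simp: C1c_def intro: continuous_on_subset)

lemma C1c_borel_measurable: "C1c f D \<Longrightarrow> f \<in> borel_measurable borel" "C1c f D \<Longrightarrow> D \<in> borel_measurable borel"
  by (auto intro: borel_measurable_continuous_onI C1c_continuous C1c_continuous_grad)

lemma grad_zero_outside:
  assumes d: "(f has_derivative (\<lambda>h. D \<bullet> h)) (at x)" and x: "x \<notin> closure {x. f x \<noteq> (0::real)}"
  shows "D = (0::'a::euclidean_space)"
proof -
  have zero: "f y = 0" if "y \<in> - closure {x. f x \<noteq> 0}" for y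
    using that closure_subset[of "{x. f x \<noteq> 0}"] by blast
  have "\<forall>\<^sub>F y in nhds x. y \<in> - closure {x. f x \<noteq> 0}"
    using x by (intro eventually_nhds_in_open) auto
  hence "\<forall>\<^sub>F y in at x. f y = 0"
    unfolding eventually_at_filter by eventually_elim (use zero in blast)
  moreover have "f x = 0" using x zero by blast
  ultimately have "((\<lambda>_. 0) has_derivative (\<lambda>h. D \<bullet> h)) (at x)"
    using has_derivative_transform_eventually[OF d, of "\<lambda>_. 0"] by simp
  hence "(\<lambda>h. D \<bullet> h) = (\<lambda>h. 0)"
    using has_derivative_unique[OF _ has_derivative_const] by blast
  hence "D \<bullet> D = 0" by metis
  thus ?thesis by simp
qed

lemma C1c_support:
  assumes "C1c f D"
  obtains b where "b > 0" "\<And>x. norm x \<ge> b \<Longrightarrow> f x = 0" "\<And>x. norm x \<ge> b \<Longrightarrow> D x = 0"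
proof -
  obtain b where b: "\<And>x. f x \<noteq> 0 \<Longrightarrow> norm x \<le> b"
    using assms by (auto simp: C1c_def bounded_iff)
  have "closure {x. f x \<noteq> 0} \<subseteq> cball 0 b"
    using b by (intro closure_minimal) auto
  hence "x \<notin> closure {x. f x \<noteq> 0}" if "norm x \<ge> \<bar>b\<bar> + 1" for x
    using that by auto
  moreover have "f x = 0" if "norm x \<ge> \<bar>b\<bar> + 1" for x using b[of x] that by fastforce
  ultimately show ?thesis
    using grad_zero_outside[OF C1c_derivative[OF assms]] by (intro that[of "\<bar>b\<bar> + 1"]) auto
qed

lemma C1c_bounded:
  assumes "C1c f D"
  obtains B where "B > 0" "\<And>x. \<bar>f x\<bar> \<le> B" "\<And>x. norm (D x) \<le> B"
proof -
  obtain b where b: "b > 0" "\<And>x. norm x \<ge> b \<Longrightarrow> f x = 0" "\<And>x. norm x \<ge> b \<Longrightarrow> D x = 0"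
    using C1c_support[OF assms] by metis
  have "bounded (f ` cball 0 b)" "bounded (D ` cball 0 b)"
    by (intro compact_imp_bounded compact_continuous_image C1c_continuous[OF assms] C1c_continuous_grad[OF assms] compact_cball)+
  then obtain B1 B2 where B: "\<And>x. x \<in> cball 0 b \<Longrightarrow> norm (f x) \<le> B1" "\<And>x. x \<in> cball 0 b \<Longrightarrow> norm (D x) \<le> B2"
    unfolding bounded_iff by blast
  have "\<bar>f x\<bar> \<le> \<bar>B1\<bar> + \<bar>B2\<bar> + 1" for x using B(1)[of x] b(2)[of x] by (cases "norm x \<le> b") auto
  moreover have "norm (D x) \<le> \<bar>B1\<bar> + \<bar>B2\<bar> + 1" for x using B(2)[of x] b(3)[of x] by (cases "norm x \<le> b") auto
  ultimately show ?thesis by (intro that[of "\<bar>B1\<bar> + \<bar>B2\<bar> + 1"]) auto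
qed

lemma integrable_bounded_support:
  fixes f :: "'a::euclidean_space \<Rightarrow> 'b::{banach, second_countable_topology}"
  assumes "f \<in> borel_measurable borel" "\<And>x. norm (f x) \<le> B" "\<And>x. norm x \<ge> b \<Longrightarrow> f x = 0"
  shows "integrable lborel f"
proof (rule Bochner_Integration.integrable_bound)
  show "integrable lborel (\<lambda>x::'a. B * indicator (ball 0 b) x)"
    using emeasure_lborel_ball_finite[of "0::'a" b] by (intro integrable_mult_right integrable_real_indicator) auto
  show "AE x in lborel. norm (f x) \<le> norm (B * indicator (ball 0 b) x)"
    using assms(2,3) order_trans[OF norm_ge_zero assms(2)] by (intro AE_I2) (auto simp: indicator_def not_less)
qed (use assms(1) in auto)

lemma C1c_integrable:
  assumes "C1c f D"
  shows "integrable lborel f" "integrable lborel D" "integrable lborel (\<lambda>x. D x \<bullet> e)"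
proof -
  obtain b where b: "b > 0" "\<And>x. norm x \<ge> b \<Longrightarrow> f x = 0" "\<And>x. norm x \<ge> b \<Longrightarrow> D x = 0"
    using C1c_support[OF assms] by metis
  obtain B where B: "B > 0" "\<And>x. \<bar>f x\<bar> \<le> B" "\<And>x. norm (D x) \<le> B"
    using C1c_bounded[OF assms] by metis
  show "integrable lborel f" "integrable lborel D"
    using b B C1c_borel_measurable[OF assms] by (auto intro!: integrable_bounded_support)
  thus "integrable lborel (\<lambda>x. D x \<bullet> e)" by simp
qed

lemma C1c_Lipschitz:
  assumes "C1c f D" "\<And>x. norm (D x) \<le> B"
  shows "\<bar>f (x + z) - f x\<bar> \<le> B * norm z"
proof -
  have "norm (f (x + z) - f x) \<le> B * norm (x + z - x)"
  proof (rule differentiable_bound[of UNIV f "\<lambda>x h. D x \<bullet> h"])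
    show "onorm (\<lambda>h. D x \<bullet> h) \<le> B" for x
    proof (rule onorm_le)
      fix h show "norm (D x \<bullet> h) \<le> B * norm h"
        using Cauchy_Schwarz_ineq2[of "D x" h] mult_right_mono[OF assms(2)[of x] norm_ge_zero[of h]] by simp
    qed
  qed (use C1c_derivative[OF assms(1)] in \<open>auto simp: has_derivative_at_withinI\<close>)
  thus ?thesis by simp
qed

text \<open>Integration by parts by translation invariance: only the differentiability of \<open>g\<close> almost
  everywhere along one sequence of increments is needed.\<close>
lemma integral_by_parts_translation:
  fixes g g' :: "'a::euclidean_space \<Rightarrow> real"
  assumes f: "C1c f D" and g: "\<And>x y. \<bar>g x - g y\<bar> \<le> L * norm (x - y)"
    and g' [measurable]: "g' \<in> borel_measurable borel"
    and lim: "AE x in lborel. (\<lambda>k. (g x - g (x - e /\<^sub>R real (Suc k))) * real (Suc k)) \<longlonglongrightarrow> g' x"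
  shows "(\<integral>x. g x * (D x \<bullet> e) \<partial>lborel) = - (\<integral>x. g' x * f x \<partial>lborel)"
proof -
  have "L-lipschitz_on UNIV g \<or> L < 0" using g by (auto simp: lipschitz_on_def dist_norm)
  hence cg: "continuous_on UNIV g"
  proof
    assume "L < 0"
    hence "g x = g y" for x y using g[of x y] mult_nonpos_nonneg[of L "norm (x - y)"] by auto
    hence "g = (\<lambda>_. g 0)" by auto
    thus ?thesis by (metis continuous_on_const)
  qed (rule lipschitz_on_continuous_on)
  hence [measurable]: "g \<in> borel_measurable borel" by (rule borel_measurable_continuous_onI)
  note [measurable] = C1c_borel_measurable[OF f]
  obtain b where b: "b > 0" "\<And>x. norm x \<ge> b \<Longrightarrow> f x = 0" "\<And>x. norm x \<ge> b \<Longrightarrow> D x = 0"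
    using C1c_support[OF f] by metis
  obtain B where B: "B > 0" "\<And>x. \<bar>f x\<bar> \<le> B" "\<And>x. norm (D x) \<le> B"
    using C1c_bounded[OF f] by metis
  \<comment> \<open>Every increment \<open>h k\<close> is at most \<open>norm e\<close> long, so
    outside this radius both \<open>f\<close> and its translates vanish; all integrals below are
    thus taken over one fixed ball, where \<open>g\<close> is bounded.\<close>
  define R where "R = b + norm e"
  have "bounded (g ` cball 0 R)"
    by (intro compact_imp_bounded compact_continuous_image continuous_on_subset[OF cg] compact_cball) auto
  then obtain G0 where G0: "\<And>x. x \<in> cball 0 R \<Longrightarrow> norm (g x) \<le> G0" unfolding bounded_iff by blast
  define G where "G = \<bar>G0\<bar>"
  have G: "\<bar>g x\<bar> \<le> G" if "norm x \<le> R" for x using G0[of x] that by (auto simp: G_def)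
  define h where "h k = e /\<^sub>R real (Suc k)" for k
  have h: "norm (h k) \<le> norm e" for k
    by (simp add: h_def divide_le_eq mult_le_cancel_left1 flip: divide_inverse_commute)
  have small: "g x * f (x + h k) = 0" "g x * f x = 0" if "norm x \<ge> R" for x k
  proof -
    have "norm x \<le> norm (x + h k) + norm (h k)" by (metis add_diff_cancel_right' norm_triangle_ineq4)
    hence "norm (x + h k) \<ge> b" using h[of k] that by (simp add: R_def)
    thus "g x * f (x + h k) = 0" using b by simp
    have "norm x \<ge> b" using that norm_ge_zero[of e] unfolding R_def by linarith
    thus "g x * f x = 0" using b by simp
  qed
  have G0': "G \<ge> 0" by (simp add: G_def)
  have int1: "integrable lborel (\<lambda>x. g x * f (x + h k))" for k
  proof (rule integrable_bounded_support[of _ "G * B" R])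
    show "norm (g x * f (x + h k)) \<le> G * B" for x
    proof (cases "norm x \<ge> R")
      case False
      thus ?thesis using G[of x] B(2)[of "x + h k"] G0' by (auto simp: abs_mult intro!: mult_mono)
    qed (use small(1)[of x k] G0' B(1) in auto)
  qed (use small in auto)
  have int2: "integrable lborel (\<lambda>x. g x * f x)"
  proof (rule integrable_bounded_support[of _ "G * B" R])
    show "norm (g x * f x) \<le> G * B" for x
    proof (cases "norm x \<ge> R")
      case False
      thus ?thesis using G[of x] B(2)[of x] G0' by (auto simp: abs_mult intro!: mult_mono)
    qed (use small(2)[of x] G0' B(1) in auto)
  qed (use small in auto)
  have shift: "(\<integral>x. g x * f (x + h k) \<partial>lborel) = (\<integral>x. g (x - h k) * f x \<partial>lborel)"
    "integrable lborel (\<lambda>x. g (x - h k) * f x)" for k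
  proof -
    have "(\<integral>x. g x * f (x + h k) \<partial>lborel) = (\<integral>x. g x * f (x + h k) \<partial>distr lborel borel ((+) (- h k)))"
      by (simp add: lborel_distr_plus)
    also have "\<dots> = (\<integral>x. g (x - h k) * f x \<partial>lborel)"
      by (subst integral_distr) (auto simp: algebra_simps)
    finally show "(\<integral>x. g x * f (x + h k) \<partial>lborel) = (\<integral>x. g (x - h k) * f x \<partial>lborel)" .
    have "integrable (distr lborel borel ((+) (- h k))) (\<lambda>x. g x * f (x + h k))"
      using int1[of k] by (simp add: lborel_distr_plus)
    thus "integrable lborel (\<lambda>x. g (x - h k) * f x)"
      by (subst (asm) integrable_distr_eq) (auto simp: algebra_simps)
  qed
  \<comment> \<open>A discrete integration by parts: translating by \<open>- h k\<close> moves the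
    difference quotient from \<open>f\<close> to \<open>g\<close>. Both sides then converge by
    dominated convergence, the left one through the Lipschitz bound of \<open>f\<close> and the
    right one through that of \<open>g\<close>.\<close>
  have eq: "(\<integral>x. g x * ((f (x + h k) - f x) * real (Suc k)) \<partial>lborel)
      = - (\<integral>x. (g x - g (x - h k)) * real (Suc k) * f x \<partial>lborel)" for k
  proof -
    have "(\<integral>x. g x * ((f (x + h k) - f x) * real (Suc k)) \<partial>lborel)
        = (\<integral>x. (g x * f (x + h k) - g x * f x) * real (Suc k) \<partial>lborel)"
      by (simp add: algebra_simps)
    also have "\<dots> = ((\<integral>x. g (x - h k) * f x \<partial>lborel) - (\<integral>x. g x * f x \<partial>lborel)) * real (Suc k)"
      using int1 int2 shift by simp
    also have "\<dots> = - ((\<integral>x. g x * f x - g (x - h k) * f x \<partial>lborel) * real (Suc k))"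
      using int2 shift(2)[of k] by (simp add: algebra_simps)
    also have "\<dots> = - (\<integral>x. (g x * f x - g (x - h k) * f x) * real (Suc k) \<partial>lborel)"
      by simp
    finally show ?thesis by (simp add: algebra_simps)
  qed
  have "(\<lambda>k. \<integral>x. g x * ((f (x + h k) - f x) * real (Suc k)) \<partial>lborel) \<longlonglongrightarrow> (\<integral>x. g x * (D x \<bullet> e) \<partial>lborel)"
  proof (rule integral_dominated_convergence[where w = "\<lambda>x. G * (B * norm e) * indicator (ball 0 R) x"])
    show "integrable lborel (\<lambda>x::'a. G * (B * norm e) * indicator (ball 0 R) x)"
      using emeasure_lborel_ball_finite[of "0::'a" R] by (intro integrable_mult_right integrable_real_indicator) auto
    show "AE x in lborel. (\<lambda>k. g x * ((f (x + h k) - f x) * real (Suc k))) \<longlonglongrightarrow> g x * (D x \<bullet> e)"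
    proof (intro AE_I2 tendsto_mult_left)
      fix x
      have "((\<lambda>t. f (x + t *\<^sub>R e)) has_derivative (\<lambda>t. D (x + 0 *\<^sub>R e) \<bullet> (t *\<^sub>R e))) (at 0)"
        by (rule has_derivative_compose[of _ "\<lambda>t. t *\<^sub>R e" _ _ f])
          (use C1c_derivative[OF f] in \<open>auto intro!: derivative_eq_intros\<close>)
      hence "((\<lambda>t. f (x + t *\<^sub>R e)) has_real_derivative (D x \<bullet> e)) (at 0)"
        by (simp add: has_field_derivative_def mult_commute_abs)
      hence lim0: "((\<lambda>t. (f (x + t *\<^sub>R e) - f x) / t) \<longlongrightarrow> D x \<bullet> e) (at 0)"
        by (simp add: DERIV_def)
      have "filterlim (\<lambda>k. inverse (real (Suc k))) (at 0) sequentially"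
        unfolding filterlim_at using LIMSEQ_inverse_real_of_nat by (auto intro!: always_eventually)
      from filterlim_compose[OF lim0 this]
      show "(\<lambda>k. (f (x + h k) - f x) * real (Suc k)) \<longlonglongrightarrow> D x \<bullet> e"
        by (simp add: h_def divide_inverse)
    qed
    fix k
    show "AE x in lborel. norm (g x * ((f (x + h k) - f x) * real (Suc k))) \<le> G * (B * norm e) * indicator (ball 0 R) x"
    proof (rule AE_I2)
      fix x
      show "norm (g x * ((f (x + h k) - f x) * real (Suc k))) \<le> G * (B * norm e) * indicator (ball 0 R) x"
      proof (cases "norm x < R")
        case True
        have "\<bar>f (x + h k) - f x\<bar> * real (Suc k) \<le> B * norm (h k) * real (Suc k)"
          using C1c_Lipschitz[OF f B(3)] by (intro mult_right_mono) auto
        also have "\<dots> = B * norm e" by (simp add: h_def)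
        finally have "\<bar>g x\<bar> * (\<bar>f (x + h k) - f x\<bar> * real (Suc k)) \<le> G * (B * norm e)"
          using G[of x] True G0' by (rule_tac mult_mono) auto
        thus ?thesis using True by (simp add: abs_mult)
      next
        case False
        hence "g x * (f (x + h k) - f x) = 0" using small(1)[of x k] small(2)[of x] by auto
        thus ?thesis using False by (auto simp flip: mult.assoc)
      qed
    qed
  qed auto
  moreover have "(\<lambda>k. - (\<integral>x. (g x - g (x - h k)) * real (Suc k) * f x \<partial>lborel)) \<longlonglongrightarrow> - (\<integral>x. g' x * f x \<partial>lborel)"
  proof (intro tendsto_minus integral_dominated_convergence[where w = "\<lambda>x. L * norm e * \<bar>f x\<bar>"])
    show "integrable lborel (\<lambda>x. L * norm e * \<bar>f x\<bar>)" using C1c_integrable[OF f] by simp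
    show "AE x in lborel. (\<lambda>k. (g x - g (x - h k)) * real (Suc k) * f x) \<longlonglongrightarrow> g' x * f x"
      using lim unfolding h_def by eventually_elim (intro tendsto_mult_right)
    fix k
    have "\<bar>g x - g (x - h k)\<bar> * real (Suc k) \<le> L * norm e" for x
    proof -
      have "\<bar>g x - g (x - h k)\<bar> * real (Suc k) \<le> L * norm (h k) * real (Suc k)"
        using g[of x "x - h k"] by (intro mult_right_mono) auto
      also have "\<dots> = L * norm e" by (simp add: h_def)
      finally show ?thesis .
    qed
    thus "AE x in lborel. norm ((g x - g (x - h k)) * real (Suc k) * f x) \<le> L * norm e * \<bar>f x\<bar>"
      by (intro AE_I2) (auto simp: abs_mult intro!: mult_right_mono)
  qed auto
  ultimately show ?thesis
    unfolding eq by (rule LIMSEQ_unique)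
qed

lemma C1c_integral_grad:
  assumes "C1c f D"
  shows "(\<integral>x. D x \<bullet> e \<partial>lborel) = 0"
  using integral_by_parts_translation[OF assms, of "\<lambda>_. 1" 0 "\<lambda>_. 0" e] by simp

lemma C1c_test_fun:
  assumes "test_fun U \<phi>"
  shows "C1c \<phi> (egrad \<phi>)" "partial_deriv i \<phi> x = egrad \<phi> x \<bullet> axis i 1"
proof -
  have sm: "\<phi> differentiable (at x)" "continuous_on UNIV (partial_deriv i \<phi>)" for x i
    using assms unfolding test_fun_def smooth_fun_def
    by (metis iter_partial.simps(1)) (metis assms iter_partial.simps smooth_fun_def test_fun_def)
  have "frechet_derivative \<phi> (at x) h = egrad \<phi> x \<bullet> h" for x h
  proof -
    interpret linear "frechet_derivative \<phi> (at x)"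
      by (rule linear_frechet_derivative[OF sm(1)])
    have "frechet_derivative \<phi> (at x) h = frechet_derivative \<phi> (at x) (\<Sum>i\<in>UNIV. (h $ i) *\<^sub>R axis i 1)"
      by (simp add: basis_expansion flip: scalar_mult_eq_scaleR)
    also have "\<dots> = (\<Sum>i\<in>UNIV. (h $ i) * frechet_derivative \<phi> (at x) (axis i 1))"
      by (simp add: sum scale)
    also have "\<dots> = egrad \<phi> x \<bullet> h" by (simp add: egrad_def partial_deriv_def inner_vec_def mult.commute)
    finally show ?thesis .
  qed
  hence "(\<phi> has_derivative (\<lambda>h. egrad \<phi> x \<bullet> h)) (at x)" for x
    using frechet_derivative_works[THEN iffD1, OF sm(1)[of x]] by presburger
  moreover have "continuous_on UNIV (egrad \<phi>)"
    unfolding egrad_def[abs_def] using sm(2) by (intro continuous_on_vec_lambda) auto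
  moreover have "bounded {x. \<phi> x \<noteq> 0}"
    using assms unfolding test_fun_def by (meson bounded_subset closure_subset compact_imp_bounded)
  ultimately show "C1c \<phi> (egrad \<phi>)" by (auto simp: C1c_def)
  show "partial_deriv i \<phi> x = egrad \<phi> x \<bullet> axis i 1" by (simp add: egrad_def inner_axis)
qed

section \<open>Weak gradients of radial functions\<close>

lemma integral_radial:
  fixes k :: "real \<Rightarrow> real"
  assumes [measurable]: "k \<in> borel_measurable borel" and k: "\<And>r. k r \<ge> 0"
  defines "c \<equiv> \<lambda>r. real DIM('a::euclidean_space) * measure lborel (ball (0::'a) 1) * r ^ (DIM('a) - 1)"
  shows "integrable lborel (\<lambda>x::'a. k (norm x)) \<longleftrightarrow> integrable lborel (\<lambda>r. k r * c r * indicator {0<..} r)"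
    and "(\<integral>x. k (norm (x::'a)) \<partial>lborel) = (\<integral>r. k r * c r * indicator {0<..} r \<partial>lborel)"
proof -
  have [measurable]: "c \<in> borel_measurable borel" unfolding c_def by measurable
  have c0: "c r \<ge> 0" if "r > 0" for r using that by (simp add: c_def)
  have nn: "k r * c r * indicator {0<..} r \<ge> 0" for r using k c0 by (simp add: indicator_def)
  have eq: "(\<integral>\<^sup>+x. ennreal (k (norm (x::'a))) \<partial>lborel) = (\<integral>\<^sup>+r. ennreal (k r * c r * indicator {0<..} r) \<partial>lborel)"
    by (subst nn_integral_radial[of "\<lambda>r. ennreal (k r)"])
      (auto intro!: nn_integral_cong simp: c_def ennreal_mult' k indicator_def)
  show "integrable lborel (\<lambda>x::'a. k (norm x)) \<longleftrightarrow> integrable lborel (\<lambda>r. k r * c r * indicator {0<..} r)"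
    using eq k nn by (simp add: integrable_iff_bounded)
  show "(\<integral>x. k (norm (x::'a)) \<partial>lborel) = (\<integral>r. k r * c r * indicator {0<..} r \<partial>lborel)"
    using eq k nn by (simp add: integral_eq_nn_integral)
qed

text \<open>The cone \<open>max 0 (\<beta> - norm x)\<close> is 1-Lipschitz with gradient
  \<open>- x / norm x\<close> inside the ball and 0 outside. Testing against it yields the
  divergence theorem on balls in a form already integrated over the radius.\<close>

lemma integral_distance_weight:
  fixes f :: "'a::euclidean_space \<Rightarrow> real"
  assumes f: "C1c f D" and \<beta>: "\<beta> > 0"
  shows "(\<integral>x. max 0 (\<beta> - norm x) * (D x \<bullet> e) \<partial>lborel) = (\<integral>x. (x \<bullet> e / norm x) * f x * indicator (ball 0 \<beta>) x \<partial>lborel)"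
proof -
  let ?g = "\<lambda>x::'a. max 0 (\<beta> - norm x)"
  let ?g' = "\<lambda>x::'a. - ((x \<bullet> e / norm x) * indicator (ball 0 \<beta>) x)"
  have "(\<integral>x. ?g x * (D x \<bullet> e) \<partial>lborel) = - (\<integral>x. ?g' x * f x \<partial>lborel)"
  proof (rule integral_by_parts_translation[OF f])
    show "\<bar>?g x - ?g y\<bar> \<le> 1 * norm (x - y)" for x y
      using norm_triangle_ineq3[of x y] by (auto simp: max_def)
    show "?g' \<in> borel_measurable borel"
      by (intro borel_measurable_uminus borel_measurable_times borel_measurable_indicator borel_measurable_divide) auto
    \<comment> \<open>The cone fails to be differentiable only at its apex and on the sphere of
      radius \<open>\<beta>\<close>, two null sets.\<close>
    have "AE x in lborel. x \<noteq> (0::'a)" using AE_lborel_singleton[of "0::'a"] .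
    moreover have "AE x in lborel. x \<notin> sphere (0::'a) \<beta>"
      using negligible_sphere[of "0::'a" \<beta>] unfolding negligible_iff_null_sets
      by (metis AE_not_in completion.AE_iff_null_sets null_sets_completion_iff2 null_sets_completionI AE_not_in borel_closed closed_sphere sets_lborel null_sets_completion_iff)
    ultimately show "AE x in lborel. (\<lambda>k. (?g x - ?g (x - e /\<^sub>R real (Suc k))) * real (Suc k)) \<longlonglongrightarrow> ?g' x"
    proof eventually_elim
      case (elim x)
      define y where "y t = x - t *\<^sub>R e" for t
      have lim_y: "((\<lambda>t. norm (y t)) \<longlongrightarrow> norm x) (at 0)"
        unfolding y_def by (auto intro!: tendsto_eq_intros)
      have "((\<lambda>t. norm (y t)) has_derivative (\<lambda>t. inner (sgn x) (- (t *\<^sub>R e)))) (at 0)"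
      proof -
        have "((\<lambda>t. x - t *\<^sub>R e) has_derivative (\<lambda>t. - (t *\<^sub>R e))) (at 0)"
          by (auto intro!: derivative_eq_intros)
        moreover have "(norm has_derivative (\<lambda>h. sgn x \<bullet> h)) (at (x - 0 *\<^sub>R e))"
          using has_derivative_norm[of x] elim by (simp add: inner_commute)
        ultimately show ?thesis unfolding y_def by (rule has_derivative_compose)
      qed
      hence "((\<lambda>t. norm (y t)) has_real_derivative (- (sgn x \<bullet> e))) (at 0)"
        unfolding has_field_derivative_def by (rule has_derivative_eq_rhs) (auto simp: fun_eq_iff)
      hence d: "((\<lambda>t. (norm (y t) - norm x) / t) \<longlongrightarrow> - (sgn x \<bullet> e)) (at 0)"
        by (simp add: DERIV_def y_def)
      have "((\<lambda>t. (?g x - ?g (y t)) / t) \<longlongrightarrow> ?g' x) (at 0)"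
      proof (cases "norm x < \<beta>")
        case True
        have "\<forall>\<^sub>F t in at 0. norm (y t) < \<beta>" using order_tendstoD(2)[OF lim_y True] .
        hence "\<forall>\<^sub>F t in at 0. (norm (y t) - norm x) / t = (?g x - ?g (y t)) / t"
          by eventually_elim (use True in auto)
        from Lim_transform_eventually[OF d this] show ?thesis
          using True by (simp add: sgn_div_norm inverse_eq_divide)
      next
        case False
        hence F: "norm x > \<beta>" using elim by auto
        have "\<forall>\<^sub>F t in at 0. norm (y t) > \<beta>" using order_tendstoD(1)[OF lim_y F] .
        hence "\<forall>\<^sub>F t in at 0. 0 = (?g x - ?g (y t)) / t"
          by eventually_elim (use F in auto)
        from Lim_transform_eventually[OF tendsto_const this] show ?thesis using F by simp
      qed
      moreover have "filterlim (\<lambda>k. inverse (real (Suc k))) (at 0) sequentially"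
        unfolding filterlim_at using LIMSEQ_inverse_real_of_nat by (auto intro!: always_eventually)
      ultimately have "(\<lambda>k. (?g x - ?g (y (inverse (real (Suc k))))) / inverse (real (Suc k))) \<longlonglongrightarrow> ?g' x"
        by (rule filterlim_compose)
      thus ?case by (simp add: y_def divide_inverse)
    qed
  qed
  thus ?thesis by (simp add: mult_ac)
qed

text \<open>\<open>A r\<close> is the integral of a directional derivative over the ball of radius
  \<open>r\<close>, that is, the flux of \<open>f\<close> through the sphere in direction
  \<open>e\<close>. Writing the cone as the integral of 1 over the radii between
  \<open>norm x\<close> and \<open>\<beta>\<close> and applying Fubini turns the preceding identity
  into one for fluxes integrated over an interval.\<close>

lemma integral_flux_interval:
  fixes f :: "'a::euclidean_space \<Rightarrow> real" and e :: 'a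
  assumes f: "C1c f D" and \<beta>: "\<beta> > 0"
  defines "A \<equiv> \<lambda>r. (\<integral>x. (D x \<bullet> e) * indicator (ball 0 r) x \<partial>lborel)"
  shows "integrable lborel (\<lambda>r. A r * indicator {0<..<\<beta>} r)"
    "(\<integral>r. A r * indicator {0<..<\<beta>} r \<partial>lborel) = (\<integral>x. (x \<bullet> e / norm x) * f x * indicator (ball 0 \<beta>) x \<partial>lborel)"
proof -
  note [measurable] = C1c_borel_measurable[OF f]
  let ?H = "\<lambda>x r. (D x \<bullet> e) * (if norm x < r \<and> 0 < r \<and> r < \<beta> then 1 else 0 :: real)"
  have H [measurable]: "case_prod ?H \<in> borel_measurable (lborel \<Otimes>\<^sub>M lborel)"
    by measurable
  have inner: "(\<lambda>r. ?H x r) = (\<lambda>r. (D x \<bullet> e) * indicator {norm x<..<\<beta>} r)" for x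
    by (auto simp: fun_eq_iff indicator_def intro: le_less_trans[OF norm_ge_zero])
  have w: "measure lborel {norm x<..<\<beta>} = max 0 (\<beta> - norm x)" for x :: 'a
    by (cases "norm x \<le> \<beta>") auto
  have ii: "(\<integral>r. ?H x r \<partial>lborel) = max 0 (\<beta> - norm x) * (D x \<bullet> e)" for x
    unfolding inner by (simp add: w)
  have int: "integrable (lborel \<Otimes>\<^sub>M lborel) (case_prod ?H)"
  proof (rule lborel_pair.Fubini_integrable[OF H])
    have "integrable lborel (\<lambda>x. max 0 (\<beta> - norm x) * \<bar>D x \<bullet> e\<bar>)"
    proof (rule Bochner_Integration.integrable_bound)
      show "integrable lborel (\<lambda>x. \<beta> * \<bar>D x \<bullet> e\<bar>)" using C1c_integrable(3)[OF f, of e] by simp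
      show "AE x in lborel. norm (max 0 (\<beta> - norm x) * \<bar>D x \<bullet> e\<bar>) \<le> norm (\<beta> * \<bar>D x \<bullet> e\<bar>)"
        using \<beta> by (intro AE_I2) (auto simp: abs_mult intro!: mult_right_mono)
    qed measurable
    moreover have "(\<integral>r. norm (?H x r) \<partial>lborel) = max 0 (\<beta> - norm x) * \<bar>D x \<bullet> e\<bar>" for x
    proof -
      have "(\<lambda>r. norm (?H x r)) = (\<lambda>r. \<bar>D x \<bullet> e\<bar> * indicator {norm x<..<\<beta>} r)"
        by (auto simp: fun_eq_iff indicator_def intro: le_less_trans[OF norm_ge_zero])
      thus ?thesis by (simp add: w)
    qed
    ultimately show "integrable lborel (\<lambda>x. \<integral>r. norm (case_prod ?H (x, r)) \<partial>lborel)" by simp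
    show "AE x in lborel. integrable lborel (\<lambda>r. case_prod ?H (x, r))"
    proof (intro AE_I2)
      fix x :: 'a
      have "emeasure lborel {norm x<..<\<beta>} < \<infinity>" by (rule emeasure_bounded_finite) simp
      hence "integrable lborel (indicator {norm x<..<\<beta>} :: real \<Rightarrow> real)"
        by (intro integrable_real_indicator) auto
      thus "integrable lborel (\<lambda>r. case_prod ?H (x, r))" by (simp add: inner)
    qed
  qed
  have A: "(\<integral>x. ?H x r \<partial>lborel) = A r * indicator {0<..<\<beta>} r" for r
  proof (cases "0 < r \<and> r < \<beta>")
    case True
    hence "(\<lambda>x. ?H x r) = (\<lambda>x. (D x \<bullet> e) * indicator (ball 0 r) x)" by (auto simp: fun_eq_iff indicator_def)
    thus ?thesis using True by (simp add: A_def)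
  next
    case False
    hence "(\<lambda>x. ?H x r) = (\<lambda>x. 0)" by auto
    thus ?thesis using False by (auto simp: indicator_def)
  qed
  show "integrable lborel (\<lambda>r. A r * indicator {0<..<\<beta>} r)"
    using lborel_pair.integrable_snd[OF int] unfolding A .
  have "(\<integral>r. A r * indicator {0<..<\<beta>} r \<partial>lborel) = (\<integral>x. max 0 (\<beta> - norm x) * (D x \<bullet> e) \<partial>lborel)"
    using lborel_pair.Fubini_integral[OF int] unfolding A ii .
  thus "(\<integral>r. A r * indicator {0<..<\<beta>} r \<partial>lborel) = (\<integral>x. (x \<bullet> e / norm x) * f x * indicator (ball 0 \<beta>) x \<partial>lborel)"
    by (simp add: integral_distance_weight[OF f \<beta>])
qed

text \<open>The identity for indicators of intervals extends to all weights \<open>k\<close> by uniqueness of measures,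
  after adding a multiple of the sphere area that makes both densities nonnegative.\<close>
lemma integral_flux:
  fixes f :: "'a::euclidean_space \<Rightarrow> real" and k :: "real \<Rightarrow> real"
  assumes f: "C1c f D" and b: "b > 0" and e: "norm e = 1"
    and k [measurable]: "k \<in> borel_measurable borel" and k0: "\<And>r. k r \<ge> 0"
    and kint: "integrable lborel (\<lambda>x::'a. k (norm x) * indicator (ball 0 b) x)"
  defines "A \<equiv> \<lambda>r. (\<integral>x. (D x \<bullet> e) * indicator (ball 0 r) x \<partial>lborel)"
  shows "(\<integral>r. k r * A r * indicator {0<..<b} r \<partial>lborel)
    = (\<integral>x. k (norm x) * (x \<bullet> e / norm x) * f x * indicator (ball 0 b) x \<partial>lborel)"
proof -
  note [measurable] = C1c_borel_measurable[OF f]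
  let ?d = "DIM('a)" and ?\<sigma> = "measure lborel (ball (0::'a) 1)"
  obtain B0 where B0: "B0 > 0" "\<And>x. \<bar>f x\<bar> \<le> B0" "\<And>x. norm (D x) \<le> B0"
    using C1c_bounded[OF f] by metis
  \<comment> \<open>Large enough for both densities: a ball of radius \<open>r < b\<close>
    contributes at most \<open>B0\<close> times its volume to the flux, which the factor
    \<open>1 + b\<close> converts into a multiple of the sphere area \<open>c r\<close>; and
    \<open>B \<ge> B0\<close> bounds the radial component \<open>Q\<close>.\<close>
  define B where "B = B0 * (1 + b)"
  define c where "c r = real ?d * ?\<sigma> * r ^ (?d - 1)" for r :: real
  define Q where "Q x = (x \<bullet> e / norm x) * f x" for x
  have \<sigma>: "?\<sigma> > 0" by (simp add: content_ball_pos)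
  have [measurable]: "c \<in> borel_measurable borel" unfolding c_def by measurable
  have [measurable]: "Q \<in> borel_measurable borel" unfolding Q_def by measurable
  have ballm [measurable]: "ball (0::'a) r \<in> sets borel" for r by simp
  have B: "B > 0" "B \<ge> B0" using B0 b by (auto simp: B_def)
  have Qb: "\<bar>Q x\<bar> \<le> B0" for x
  proof -
    have "\<bar>x \<bullet> e / norm x\<bar> \<le> 1" using Cauchy_Schwarz_ineq2[of x e] e by (cases "x = 0") auto
    hence "\<bar>x \<bullet> e / norm x\<bar> * \<bar>f x\<bar> \<le> 1 * B0" using B0 by (intro mult_mono) auto
    thus ?thesis by (simp add: Q_def abs_mult)
  qed
  have [measurable]: "A \<in> borel_measurable borel"
  proof -
    have "(\<lambda>r. \<integral>x. (D x \<bullet> e) * (if norm x < r then 1 else 0) \<partial>lborel) \<in> borel_measurable borel"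
      by measurable
    moreover have "(\<lambda>r. \<integral>x. (D x \<bullet> e) * (if norm x < r then 1 else 0) \<partial>lborel) = A"
      unfolding A_def by (intro ext Bochner_Integration.integral_cong) (auto simp: indicator_def)
    ultimately show ?thesis by simp
  qed
  have Ab: "\<bar>A r\<bar> \<le> B * c r" if r: "0 < r" "r < b" for r
  proof -
    have "\<bar>A r\<bar> \<le> (\<integral>x. \<bar>(D x \<bullet> e) * indicator (ball 0 r) x\<bar> \<partial>lborel)"
      unfolding A_def by (rule integral_abs_bound)
    also have "\<dots> \<le> (\<integral>x. B0 * indicator (ball (0::'a) r) x \<partial>lborel)"
    proof (rule integral_mono)
      show "integrable lborel (\<lambda>x::'a. B0 * indicator (ball 0 r) x)"
        using emeasure_lborel_ball_finite[of "0::'a" r] by (intro integrable_mult_right integrable_real_indicator) auto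
      show "integrable lborel (\<lambda>x. \<bar>(D x \<bullet> e) * indicator (ball 0 r) x\<bar>)"
        using integrable_mult_indicator[OF _ C1c_integrable(3)[OF f, of e], of "ball 0 r"]
        by (intro integrable_abs) (simp add: mult.commute)
      fix x
      have "\<bar>D x \<bullet> e\<bar> \<le> B0" using Cauchy_Schwarz_ineq2[of "D x" e] B0(3)[of x] e by simp
      thus "\<bar>(D x \<bullet> e) * indicator (ball 0 r) x\<bar> \<le> B0 * indicator (ball 0 r) x"
        by (simp add: indicator_def)
    qed
    also have "\<dots> = B0 * (r ^ ?d * ?\<sigma>)"
      using content_ball_conv_unit_ball[of r "0::'a"] r by simp
    also have "r ^ ?d = r ^ (?d - 1) * r" by (metis DIM_positive Suc_pred power_Suc2 One_nat_def)
    also have "B0 * (r ^ (?d - 1) * r * ?\<sigma>) \<le> B * (real ?d * ?\<sigma> * r ^ (?d - 1))"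
    proof -
      have "B0 * r \<le> B * real ?d"
      proof -
        have "B0 * r \<le> B" using r B0 b by (simp add: B_def)
        also have "\<dots> \<le> B * real ?d" using B DIM_positive[where 'a='a] by simp
        finally show ?thesis .
      qed
      hence "(B0 * r) * (r ^ (?d - 1) * ?\<sigma>) \<le> (B * real ?d) * (r ^ (?d - 1) * ?\<sigma>)"
        using r \<sigma> by (intro mult_right_mono) auto
      thus ?thesis by (simp add: mult_ac)
    qed
    finally show ?thesis by (simp add: c_def)
  qed
  have ball_int: "integrable lborel (\<lambda>x::'a. indicator (ball 0 \<beta>) x :: real)" for \<beta>
    using emeasure_lborel_ball_finite[of "0::'a" \<beta>] by (intro integrable_real_indicator) auto
  define M1 where "M1 = density lborel (\<lambda>r. ennreal ((A r + B * c r) * indicator {0<..<b} r))"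
  define M2 where "M2 = distr (density lborel (\<lambda>x::'a. ennreal ((Q x + B) * indicator (ball 0 b) x))) borel norm"
  have M2_ball: "emeasure M2 {..<\<beta>} = (\<integral>\<^sup>+x. ennreal ((Q x + B) * indicator (ball 0 b) x) * indicator (ball 0 \<beta>) x \<partial>(lborel :: 'a measure))" for \<beta>
  proof -
    have "norm -` {..<\<beta>} = ball (0::'a) \<beta>" by auto
    thus ?thesis unfolding M2_def by (simp add: emeasure_distr emeasure_density)
  qed
  have M1_eq: "emeasure M1 {..<\<beta>} = ennreal ((\<integral>x. Q x * indicator (ball 0 \<beta>) x \<partial>lborel) + B * measure lborel (ball (0::'a) \<beta>))"
    if \<beta>: "0 < \<beta>" "\<beta> \<le> b" for \<beta>
  proof -
    have cint: "integrable lborel (\<lambda>r. c r * indicator {0<..<\<beta>} r)"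
      "(\<integral>r. c r * indicator {0<..<\<beta>} r \<partial>lborel) = measure lborel (ball (0::'a) \<beta>)"
    proof -
      have e1: "(\<lambda>r. indicator {..<\<beta>} r * (real ?d * ?\<sigma> * r ^ (?d - 1)) * indicator {0<..} r) = (\<lambda>r. c r * indicator {0<..<\<beta>} r)"
        by (auto simp: fun_eq_iff indicator_def c_def)
      have e2: "(\<lambda>x::'a. indicator {..<\<beta>} (norm x) :: real) = indicator (ball 0 \<beta>)"
        by (auto simp: fun_eq_iff indicator_def)
      show "integrable lborel (\<lambda>r. c r * indicator {0<..<\<beta>} r)"
        using integral_radial(1)[of "indicator {..<\<beta>}", where 'a='a] ball_int[of \<beta>] unfolding e1 e2 by simp
      show "(\<integral>r. c r * indicator {0<..<\<beta>} r \<partial>lborel) = measure lborel (ball (0::'a) \<beta>)"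
        using integral_radial(2)[of "indicator {..<\<beta>}", where 'a='a] unfolding e1 e2 by simp
    qed
    have "emeasure M1 {..<\<beta>} = (\<integral>\<^sup>+r. ennreal (A r * indicator {0<..<\<beta>} r + B * (c r * indicator {0<..<\<beta>} r)) \<partial>lborel)"
      unfolding M1_def using \<beta>
      by (subst emeasure_density) (auto intro!: nn_integral_cong simp: indicator_def)
    also have "\<dots> = ennreal (\<integral>r. A r * indicator {0<..<\<beta>} r + B * (c r * indicator {0<..<\<beta>} r) \<partial>lborel)"
    proof (rule nn_integral_eq_integral)
      show "integrable lborel (\<lambda>r. A r * indicator {0<..<\<beta>} r + B * (c r * indicator {0<..<\<beta>} r))"
        using cint integral_flux_interval(1)[OF f \<beta>(1), of e] by (simp add: A_def)
      show "AE r in lborel. 0 \<le> A r * indicator {0<..<\<beta>} r + B * (c r * indicator {0<..<\<beta>} r)"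
      proof (intro AE_I2)
        fix r
        show "0 \<le> A r * indicator {0<..<\<beta>} r + B * (c r * indicator {0<..<\<beta>} r)"
          using Ab[of r] \<beta> by (cases "0 < r \<and> r < \<beta>") auto
      qed
    qed
    also have "(\<integral>r. A r * indicator {0<..<\<beta>} r + B * (c r * indicator {0<..<\<beta>} r) \<partial>lborel)
        = (\<integral>x. Q x * indicator (ball 0 \<beta>) x \<partial>lborel) + B * measure lborel (ball (0::'a) \<beta>)"
      using cint integral_flux_interval[OF f \<beta>(1), of e] by (simp add: A_def Q_def)
    finally show ?thesis .
  qed
  have M2_eq: "emeasure M2 {..<\<beta>} = ennreal ((\<integral>x. Q x * indicator (ball 0 \<beta>) x \<partial>lborel) + B * measure lborel (ball (0::'a) \<beta>))"
    if \<beta>: "0 < \<beta>" "\<beta> \<le> b" for \<beta>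
  proof -
    have Qint: "integrable lborel (\<lambda>x::'a. Q x * indicator (ball 0 \<beta>) x)"
      using Qb B0(1) by (intro integrable_bounded_support[of _ B0 \<beta>]) (auto simp: indicator_def)
    have "emeasure M2 {..<\<beta>} = (\<integral>\<^sup>+x. ennreal (Q x * indicator (ball 0 \<beta>) x + B * indicator (ball 0 \<beta>) x) \<partial>(lborel :: 'a measure))"
      unfolding M2_ball using \<beta>
      by (auto intro!: nn_integral_cong simp: indicator_def algebra_simps)
    also have "\<dots> = ennreal (\<integral>x. Q x * indicator (ball 0 \<beta>) x + B * indicator (ball 0 \<beta>) x \<partial>(lborel :: 'a measure))"
    proof (rule nn_integral_eq_integral)
      show "integrable lborel (\<lambda>x::'a. Q x * indicator (ball 0 \<beta>) x + B * indicator (ball 0 \<beta>) x)"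
        using Qint ball_int by simp
      show "AE x::'a in lborel. 0 \<le> Q x * indicator (ball 0 \<beta>) x + B * indicator (ball 0 \<beta>) x"
      proof (intro AE_I2)
        fix x :: 'a
        have "0 \<le> Q x + B" using Qb[of x] B by (simp add: abs_le_iff)
        thus "0 \<le> Q x * indicator (ball 0 \<beta>) x + B * indicator (ball 0 \<beta>) x" by (simp add: indicator_def)
      qed
    qed
    also have "(\<integral>x. Q x * indicator (ball 0 \<beta>) x + B * indicator (ball 0 \<beta>) x \<partial>(lborel :: 'a measure))
        = (\<integral>x. Q x * indicator (ball 0 \<beta>) x \<partial>lborel) + B * measure lborel (ball (0::'a) \<beta>)"
      using Qint ball_int[of \<beta>] by simp
    finally show ?thesis .
  qed
  have "M1 = M2"
  proof (rule measure_eqI_lessThan_finite)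
    fix \<beta> :: real
    have min1: "emeasure M1 {..<\<beta>} = emeasure M1 {..<min \<beta> b}"
      unfolding M1_def
      by (simp add: emeasure_density) (auto intro!: nn_integral_cong simp: indicator_def)
    have min2: "emeasure M2 {..<\<beta>} = emeasure M2 {..<min \<beta> b}"
      unfolding M2_ball by (auto intro!: nn_integral_cong simp: indicator_def)
    have "emeasure M1 {..<min \<beta> b} = emeasure M2 {..<min \<beta> b} \<and> emeasure M1 {..<min \<beta> b} < \<infinity>"
    proof (cases "\<beta> > 0")
      case True
      thus ?thesis using M1_eq[of "min \<beta> b"] M2_eq[of "min \<beta> b"] b by simp
    next
      case False
      have "emeasure M1 {..<min \<beta> b} = (\<integral>\<^sup>+r. 0 \<partial>(lborel::real measure))"
        unfolding M1_def using False
        by (subst emeasure_density) (auto intro!: nn_integral_cong simp: indicator_def simp del: nn_integral_const)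
      moreover have "emeasure M2 {..<min \<beta> b} = 0"
      proof -
        have *: "ball (0::'a) (min \<beta> b) = {}" using False by (simp add: ball_eq_empty)
        show ?thesis unfolding M2_ball * by simp
      qed
      ultimately show ?thesis by simp
    qed
    thus "emeasure M1 {..<\<beta>} = emeasure M2 {..<\<beta>}" "emeasure M1 {..<\<beta>} < \<infinity>"
      using min1 min2 by auto
  qed (auto simp: M1_def M2_def)
  hence "(\<integral>\<^sup>+r. ennreal (k r) \<partial>M1) = (\<integral>\<^sup>+r. ennreal (k r) \<partial>M2)" by simp
  hence nn: "(\<integral>\<^sup>+r. ennreal (k r * (A r + B * c r) * indicator {0<..<b} r) \<partial>lborel)
       = (\<integral>\<^sup>+x. ennreal (k (norm x) * (Q x + B) * indicator (ball 0 b) x) \<partial>(lborel :: 'a measure))"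
    unfolding M1_def M2_def using k0
    by (simp add: nn_integral_density nn_integral_distr ennreal_mult'[symmetric] mult_ac flip: ennreal_mult'')
  have Qint: "integrable lborel (\<lambda>x::'a. k (norm x) * Q x * indicator (ball 0 b) x)"
  proof (rule Bochner_Integration.integrable_bound)
    show "integrable lborel (\<lambda>x::'a. B * (k (norm x) * indicator (ball 0 b) x))" using kint by simp
    show "AE x::'a in lborel. norm (k (norm x) * Q x * indicator (ball 0 b) x) \<le> norm (B * (k (norm x) * indicator (ball 0 b) x))"
      using Qb B k0 order_trans[OF Qb B(2)] by (intro AE_I2) (auto simp: abs_mult indicator_def mult.commute intro!: mult_right_mono)
  qed measurable
  have kc: "integrable lborel (\<lambda>r. k r * c r * indicator {0<..<b} r)"
    "(\<integral>r. k r * c r * indicator {0<..<b} r \<partial>lborel) = (\<integral>x. k (norm x) * indicator (ball 0 b) x \<partial>(lborel :: 'a measure))"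
  proof -
    have e1: "(\<lambda>r. (k r * indicator {..<b} r) * (real ?d * ?\<sigma> * r ^ (?d - 1)) * indicator {0<..} r) = (\<lambda>r. k r * c r * indicator {0<..<b} r)"
      by (auto simp: fun_eq_iff indicator_def c_def)
    have e2: "(\<lambda>x::'a. k (norm x) * indicator {..<b} (norm x)) = (\<lambda>x. k (norm x) * indicator (ball 0 b) x)"
      by (auto simp: fun_eq_iff indicator_def)
    show "integrable lborel (\<lambda>r. k r * c r * indicator {0<..<b} r)"
      using integral_radial(1)[of "\<lambda>r. k r * indicator {..<b} r", where 'a='a] kint k0 unfolding e1 e2 by simp
    show "(\<integral>r. k r * c r * indicator {0<..<b} r \<partial>lborel) = (\<integral>x. k (norm x) * indicator (ball 0 b) x \<partial>(lborel :: 'a measure))"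
      using integral_radial(2)[of "\<lambda>r. k r * indicator {..<b} r", where 'a='a] k0 unfolding e1 e2 by simp
  qed
  have kA: "integrable lborel (\<lambda>r. k r * A r * indicator {0<..<b} r)"
  proof (rule Bochner_Integration.integrable_bound)
    show "integrable lborel (\<lambda>r. B * (k r * c r * indicator {0<..<b} r))" using kc by simp
    show "AE r in lborel. norm (k r * A r * indicator {0<..<b} r) \<le> norm (B * (k r * c r * indicator {0<..<b} r))"
    proof (intro AE_I2)
      fix r
      show "norm (k r * A r * indicator {0<..<b} r) \<le> norm (B * (k r * c r * indicator {0<..<b} r))"
      proof (cases "0 < r \<and> r < b")
        case True
        hence "k r * \<bar>A r\<bar> \<le> k r * (B * c r)" using Ab k0 by (intro mult_left_mono) auto
        also have "\<dots> \<le> \<bar>B * (k r * c r)\<bar>" by (simp add: mult_ac)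
        finally show ?thesis using True k0 by (simp add: abs_mult)
      qed auto
    qed
  qed measurable
  \<comment> \<open>The equality of the measures holds for the shifted densities. The contribution
    of \<open>B\<close> is the same finite integral of \<open>k\<close> on both sides and can be
    subtracted again.\<close>
  have "(\<integral>r. k r * A r * indicator {0<..<b} r \<partial>lborel) + B * (\<integral>r. k r * c r * indicator {0<..<b} r \<partial>lborel)
      = (\<integral>r. k r * (A r + B * c r) * indicator {0<..<b} r \<partial>lborel)"
    using kA kc by (simp add: algebra_simps)
  also have "\<dots> = (\<integral>x. k (norm x) * (Q x + B) * indicator (ball 0 b) x \<partial>(lborel :: 'a measure))"
  proof -
    have "0 \<le> k r * (A r + B * c r) * indicator {0<..<b} r" for r
      using k0 Ab[of r] by (auto simp: indicator_def abs_le_iff)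
    moreover have "0 \<le> k (norm x) * (Q x + B) * indicator (ball 0 b) x" for x :: 'a
      using k0 Qb[of x] B by (auto simp: indicator_def abs_le_iff)
    ultimately show ?thesis using nn by (simp add: integral_eq_nn_integral)
  qed
  also have "\<dots> = (\<integral>x. k (norm x) * Q x * indicator (ball 0 b) x \<partial>(lborel :: 'a measure)) + B * (\<integral>x. k (norm x) * indicator (ball 0 b) x \<partial>(lborel :: 'a measure))"
    using Qint kint by (simp add: algebra_simps)
  finally show ?thesis using kc(2) by (simp add: Q_def mult_ac)
qed


lemma integrable_lborelI_nn:
  fixes f :: "'a::euclidean_space \<Rightarrow> real"
  assumes "f \<in> borel_measurable borel" "(\<integral>\<^sup>+x. ennreal \<bar>f x\<bar> \<partial>lborel) < \<infinity>"
  shows "integrable lborel f"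
  using assms by (simp add: integrable_iff_bounded)

text \<open>The difference \<open>F (norm x) - F b\<close> is the integral of \<open>k\<close> over
  the radii from \<open>norm x\<close> to \<open>b\<close>, so Fubini reduces the weak derivative to
  the fluxes of the test function, which \<open>integral_flux\<close> evaluates. The set
  \<open>radii\<close> lists the balls that exhaust \<open>U\<close>, so that the unit ball and the
  whole space are both instances. Only integrability of \<open>F\<close> and \<open>k\<close> on
  balls is assumed, which leaves room for profiles that are unbounded at the origin.\<close>

lemma weak_grad_radial:
  fixes U :: "(real^'n::finite) set" and F k :: "real \<Rightarrow> real" and f :: "real^'n \<Rightarrow> real" and radii :: "real set"
  assumes U: "\<And>K. compact K \<Longrightarrow> K \<subseteq> U \<Longrightarrow> \<exists>b\<in>radii. K \<subseteq> ball 0 b"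
    and radii: "\<And>b. b \<in> radii \<Longrightarrow> b > 0 \<and> ball 0 b \<subseteq> U"
    and [measurable]: "F \<in> borel_measurable borel" "k \<in> borel_measurable borel"
    and k0: "\<And>r. k r \<ge> 0"
    and f: "\<And>x. x \<in> U \<Longrightarrow> x \<noteq> 0 \<Longrightarrow> f x = F (norm x)"
    and Fint: "\<And>b. b \<in> radii \<Longrightarrow> (\<integral>\<^sup>+x. ennreal (\<bar>F (norm x)\<bar> * indicator (ball 0 b) (x::real^'n)) \<partial>lborel) < \<infinity>"
    and kint: "\<And>b. b \<in> radii \<Longrightarrow> (\<integral>\<^sup>+x. ennreal (k (norm x) * indicator (ball 0 b) (x::real^'n)) \<partial>lborel) < \<infinity>"
    and Fk: "\<And>b r. b \<in> radii \<Longrightarrow> 0 < r \<Longrightarrow> r < b \<Longrightarrow>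
        F b \<le> F r \<and> ennreal (F r - F b) = (\<integral>\<^sup>+t. ennreal (k t) * indicator {r<..<b} t \<partial>lborel)"
  shows "weak_grad U f (\<lambda>x. (- k (norm x) / norm x) *\<^sub>R x)"
proof -
  define f0 where "f0 b x = F (norm x) * indicator (ball 0 b) x" for b and x :: "real^'n"
  have ballm [measurable]: "ball (0::real^'n) r \<in> sets borel" for r by simp
  have [measurable]: "f0 b \<in> borel_measurable borel" for b unfolding f0_def by measurable
  have [measurable]: "(\<lambda>x::real^'n. x $ i) \<in> borel_measurable borel" for i
    by (intro borel_measurable_continuous_onI continuous_intros)
  have [measurable]: "(\<lambda>x::real^'n. ((- k (norm x) / norm x) *\<^sub>R x) $ i) \<in> borel_measurable borel" for i
    unfolding vector_scaleR_component by measurable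
  have f0_int: "integrable lborel (f0 b)" if "b \<in> radii" for b
    using Fint[OF that] by (intro integrable_lborelI_nn) (auto simp: f0_def abs_mult)
  have k_int: "integrable lborel (\<lambda>x::real^'n. k (norm x) * indicator (ball 0 b) x)" if "b \<in> radii" for b
    using kint[OF that] k0 by (intro integrable_lborelI_nn) (auto simp: abs_mult)
  have ne0: "AE x in lborel. x \<noteq> (0::real^'n)" using AE_lborel_singleton[of "0::real^'n"] .
  show ?thesis
    unfolding weak_grad_def
  proof (intro conjI allI impI)
    fix K :: "(real^'n) set" assume K: "compact K \<and> K \<subseteq> U"
    then obtain b where b: "b \<in> radii" "K \<subseteq> ball 0 b" using U by blast
    have [measurable]: "K \<in> sets borel" using K by (simp add: compact_imp_closed borel_closed)
    show "set_integrable lebesgue K f"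
    proof -
      let ?h = "\<lambda>x. if x = 0 then indicator K 0 * f 0 else indicator K x * f0 b x"
      have "(\<lambda>x. indicator K x *\<^sub>R f x) = ?h"
        using K b f by (auto simp: fun_eq_iff indicator_def f0_def)
      moreover have "integrable lborel ?h"
      proof (rule integrable_cong_AE_imp)
        show "integrable lborel (\<lambda>x. indicator K x *\<^sub>R f0 b x)"
          using f0_int[OF b(1)] by (intro integrable_mult_indicator) auto
        show "AE x in lborel. indicator K x *\<^sub>R f0 b x = ?h x" using ne0 by eventually_elim simp
      qed measurable
      ultimately show ?thesis
        unfolding set_integrable_def by (simp add: integrable_completion)
    qed
    show "set_integrable lebesgue K (\<lambda>x. ((- k (norm x) / norm x) *\<^sub>R x) $ i)" for i
    proof -
      have "integrable lborel (\<lambda>x. indicator K x *\<^sub>R (((- k (norm x) / norm x) *\<^sub>R x) $ i))"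
      proof (rule Bochner_Integration.integrable_bound[OF k_int[OF b(1)]])
        show "AE x in lborel. norm (indicator K x *\<^sub>R (((- k (norm x) / norm x) *\<^sub>R x) $ i)) \<le> norm (k (norm x) * indicator (ball 0 b) x)"
        proof (intro AE_I2)
          fix x :: "real^'n"
          have "\<bar>x $ i\<bar> / norm x \<le> 1" using component_le_norm_cart[of x i] by (cases "x = 0") auto
          hence "k (norm x) * (\<bar>x $ i\<bar> / norm x) \<le> k (norm x) * 1" using k0 by (intro mult_left_mono)
          thus "norm (indicator K x *\<^sub>R (((- k (norm x) / norm x) *\<^sub>R x) $ i)) \<le> norm (k (norm x) * indicator (ball 0 b) x)"
            using b k0 by (auto simp: indicator_def abs_mult)
        qed
      qed measurable
      thus ?thesis unfolding set_integrable_def by (subst integrable_completion) auto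
    qed
  next
    fix \<phi> :: "real^'n \<Rightarrow> real" and i assume \<phi>: "test_fun U \<phi>"
    define K where "K = closure {x. \<phi> x \<noteq> 0}"
    have "compact K \<and> K \<subseteq> U" using \<phi> by (simp add: test_fun_def K_def)
    then obtain b where b: "b \<in> radii" "K \<subseteq> ball 0 b" using U by blast
    have b0: "b > 0" "ball 0 b \<subseteq> U" using radii[OF b(1)] by auto
    define D where "D = egrad \<phi>"
    define e :: "real^'n" where "e = axis i 1"
    have \<phi>c: "C1c \<phi> D" and pd: "\<And>x. partial_deriv i \<phi> x = D x \<bullet> e"
      using C1c_test_fun[OF \<phi>] by (auto simp: D_def e_def)
    have e: "norm e = 1" by (simp add: e_def)
    note [measurable] = C1c_borel_measurable[OF \<phi>c]
    have D0: "D x = 0" if "x \<notin> ball 0 b" for x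
    proof -
      have "x \<notin> closure {x. \<phi> x \<noteq> 0}" using that b(2) unfolding K_def by blast
      thus ?thesis by (rule grad_zero_outside[OF C1c_derivative[OF \<phi>c]])
    qed
    have \<phi>0: "\<phi> x = 0" if "x \<notin> ball 0 b" for x
      using that b closure_subset[of "{x. \<phi> x \<noteq> 0}"] by (auto simp: K_def)
    define A where "A = (\<lambda>r. \<integral>x. (D x \<bullet> e) * indicator (ball 0 r) x \<partial>lborel)"
    let ?H = "\<lambda>x r. (D x \<bullet> e) * (k r * (if norm x < r \<and> r < b then 1 else 0))"
    have H [measurable]: "case_prod ?H \<in> borel_measurable (lborel \<Otimes>\<^sub>M lborel)"
      by measurable
    have kr: "has_bochner_integral lborel (\<lambda>r. k r * (if norm x < r \<and> r < b then 1 else 0)) (F (norm x) - F b)"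
      if "x \<noteq> 0" "x \<in> ball 0 b" for x :: "real^'n"
    proof (rule has_bochner_integral_nn_integral)
      have "(\<integral>\<^sup>+r. ennreal (k r * (if norm x < r \<and> r < b then 1 else 0)) \<partial>lborel) = (\<integral>\<^sup>+t. ennreal (k t) * indicator {norm x<..<b} t \<partial>lborel)"
        by (intro nn_integral_cong) (auto simp: indicator_def)
      thus "(\<integral>\<^sup>+r. ennreal (k r * (if norm x < r \<and> r < b then 1 else 0)) \<partial>lborel) = ennreal (F (norm x) - F b)"
        using Fk[OF b(1), of "norm x"] that by simp
      show "0 \<le> F (norm x) - F b" using Fk[OF b(1), of "norm x"] that by simp
    qed (use k0 in \<open>auto simp: indicator_def\<close>)
    have inner: "integrable lborel (\<lambda>r. ?H x r) \<and> (\<integral>r. ?H x r \<partial>lborel) = (f0 b x - F b) * (D x \<bullet> e)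
        \<and> (\<integral>r. norm (?H x r) \<partial>lborel) = (f0 b x - F b) * \<bar>D x \<bullet> e\<bar>" if "x \<noteq> 0" for x
    proof (cases "x \<in> ball 0 b")
      case True
      have I: "integrable lborel (\<lambda>r. k r * (if norm x < r \<and> r < b then 1 else 0))"
        "(\<integral>r. k r * (if norm x < r \<and> r < b then 1 else 0) \<partial>lborel) = F (norm x) - F b"
        using kr[OF that True] by (auto simp: has_bochner_integral_iff)
      have "(\<lambda>r. norm (?H x r)) = (\<lambda>r. \<bar>D x \<bullet> e\<bar> * (k r * (if norm x < r \<and> r < b then 1 else 0)))"
        using k0 by (auto simp: fun_eq_iff abs_mult)
      thus ?thesis using True I by (auto simp: f0_def mult.commute)
    next
      case False
      thus ?thesis using D0[OF False] by simp
    qed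
    have Dint: "integrable lborel (\<lambda>x. D x \<bullet> e)" by (rule C1c_integrable[OF \<phi>c])
    obtain B where B: "B > 0" "\<And>x. norm (D x) \<le> B" using C1c_bounded[OF \<phi>c] by metis
    have Db: "\<bar>D x \<bullet> e\<bar> \<le> B" for x using Cauchy_Schwarz_ineq2[of "D x" e] B(2)[of x] e by simp
    have f0D: "integrable lborel (\<lambda>x. f0 b x * (D x \<bullet> e))"
    proof (rule Bochner_Integration.integrable_bound)
      show "integrable lborel (\<lambda>x. B * f0 b x)" using f0_int[OF b(1)] by simp
      show "AE x in lborel. norm (f0 b x * (D x \<bullet> e)) \<le> norm (B * f0 b x)"
      proof (intro AE_I2)
        fix x
        have "\<bar>f0 b x\<bar> * \<bar>D x \<bullet> e\<bar> \<le> \<bar>f0 b x\<bar> * B" using Db by (intro mult_left_mono) auto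
        thus "norm (f0 b x * (D x \<bullet> e)) \<le> norm (B * f0 b x)" using B(1) by (simp add: abs_mult mult.commute)
      qed
    qed measurable
    have int: "integrable (lborel \<Otimes>\<^sub>M lborel) (case_prod ?H)"
    proof (rule lborel_pair.Fubini_integrable[OF H])
      show "AE x in lborel. integrable lborel (\<lambda>r. case_prod ?H (x, r))"
        using ne0 by eventually_elim (use inner in simp)
      have I1: "integrable lborel (\<lambda>x. \<bar>(f0 b x - F b) * (D x \<bullet> e)\<bar>)"
        using f0D Dint by (simp add: left_diff_distrib)
      have I2: "AE x in lborel. \<bar>(f0 b x - F b) * (D x \<bullet> e)\<bar> = (\<integral>r. norm (case_prod ?H (x, r)) \<partial>lborel)"
        using ne0
      proof eventually_elim
        case (elim x)
        have "(\<integral>r. norm (?H x r) \<partial>lborel) = (f0 b x - F b) * \<bar>D x \<bullet> e\<bar>" using inner[OF elim] by blast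
        moreover have "(\<integral>r. norm (?H x r) \<partial>lborel) \<ge> 0" by (rule Bochner_Integration.integral_nonneg) simp
        ultimately have "(\<integral>r. norm (?H x r) \<partial>lborel) = \<bar>(f0 b x - F b) * \<bar>D x \<bullet> e\<bar>\<bar>" by simp
        thus ?case by (auto simp: abs_mult)
      qed
      show "integrable lborel (\<lambda>x. \<integral>r. norm (case_prod ?H (x, r)) \<partial>lborel)"
        by (rule integrable_cong_AE_imp[OF I1 _ I2]) measurable
    qed
    have outer: "(\<integral>x. ?H x r \<partial>lborel) = k r * A r * indicator {0<..<b} r" for r
    proof (cases "0 < r \<and> r < b")
      case True
      hence "(\<lambda>x. ?H x r) = (\<lambda>x. k r * ((D x \<bullet> e) * indicator (ball 0 r) x))" by (auto simp: fun_eq_iff indicator_def)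
      thus ?thesis using True by (simp add: A_def)
    next
      case False
      hence "(\<lambda>x. ?H x r) = (\<lambda>x. 0)" by (auto simp: fun_eq_iff intro: le_less_trans[OF norm_ge_zero])
      thus ?thesis using False by (auto simp: indicator_def)
    qed
    have "(\<integral>x. f x * partial_deriv i \<phi> x \<partial>lebesgue) = (\<integral>x. (if x = 0 then f 0 * (D 0 \<bullet> e) else f0 b x * (D x \<bullet> e)) \<partial>lebesgue)"
      using f b0 D0 by (intro Bochner_Integration.integral_cong) (auto simp: pd f0_def indicator_def)
    also have "\<dots> = (\<integral>x. (if x = 0 then f 0 * (D 0 \<bullet> e) else f0 b x * (D x \<bullet> e)) \<partial>lborel)"
      by (rule integral_completion) measurable
    also have "\<dots> = (\<integral>x. f0 b x * (D x \<bullet> e) \<partial>lborel)"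
    proof (rule integral_cong_AE)
      show "AE x in lborel. (if x = 0 then f 0 * (D 0 \<bullet> e) else f0 b x * (D x \<bullet> e)) = f0 b x * (D x \<bullet> e)"
        using ne0 by eventually_elim simp
    qed measurable
    \<comment> \<open>A constant may be subtracted because a partial derivative of a test function
      has integral 0; it makes the profile vanish at the outer radius \<open>b\<close>.\<close>
    also have "\<dots> = (\<integral>x. (f0 b x - F b) * (D x \<bullet> e) \<partial>lborel)"
      using f0D Dint C1c_integral_grad[OF \<phi>c, of e] by (simp add: left_diff_distrib)
    also have "\<dots> = (\<integral>x. (\<integral>r. ?H x r \<partial>lborel) \<partial>lborel)"
    proof (rule integral_cong_AE)
      show "AE x in lborel. (f0 b x - F b) * (D x \<bullet> e) = (\<integral>r. ?H x r \<partial>lborel)"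
        using ne0 by eventually_elim (rule sym, use inner in blast)
    qed measurable
    also have "\<dots> = (\<integral>r. (\<integral>x. ?H x r \<partial>lborel) \<partial>lborel)"
      using lborel_pair.Fubini_integral[OF int] by simp
    also have "\<dots> = (\<integral>x. k (norm x) * (x \<bullet> e / norm x) * \<phi> x * indicator (ball 0 b) x \<partial>lborel)"
      unfolding outer A_def by (rule integral_flux[OF \<phi>c b0(1) e _ k0 k_int[OF b(1)]]) measurable
    also have "\<dots> = (\<integral>x. - (((- k (norm x) / norm x) *\<^sub>R x) $ i * \<phi> x) \<partial>lborel)"
      using \<phi>0 by (intro Bochner_Integration.integral_cong) (auto simp: e_def inner_axis indicator_def)
    also have "\<dots> = (\<integral>x. - (((- k (norm x) / norm x) *\<^sub>R x) $ i * \<phi> x) \<partial>lebesgue)"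
      by (rule integral_completion[symmetric]) measurable
    also have "\<dots> = - (\<integral>x. ((- k (norm x) / norm x) *\<^sub>R x) $ i * \<phi> x \<partial>lebesgue)"
      by simp
    finally show "(\<integral>x. f x * partial_deriv i \<phi> x \<partial>lebesgue) = - (\<integral>x. ((- k (norm x) / norm x) *\<^sub>R x) $ i * \<phi> x \<partial>lebesgue)" .
  qed
qed

section \<open>Isoperimetric estimates in the ball model\<close>

text \<open>The increment is the integral of the directional derivative along the segment from
  \<open>x\<close> to \<open>x + z\<close>. Integrating over \<open>x\<close> first, each point of
  the segment contributes the same amount by translation invariance.\<close>

lemma C1c_translation:
  fixes f :: "'a::euclidean_space \<Rightarrow> real"
  assumes f: "C1c f D"
  shows "(\<integral>\<^sup>+x. ennreal \<bar>f (x + z) - f x\<bar> \<partial>lborel) \<le> ennreal (norm z) * (\<integral>\<^sup>+x. ennreal (norm (D x)) \<partial>lborel)"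
proof -
  note [measurable] = C1c_borel_measurable[OF f]
  have pt: "ennreal \<bar>f (x + z) - f x\<bar> \<le> (\<integral>\<^sup>+t. ennreal (norm z * norm (D (x + t *\<^sub>R z))) * indicator {0..1} t \<partial>lborel)" for x
  proof -
    have c: "continuous_on {0..1} (\<lambda>t. D (x + t *\<^sub>R z))"
      by (rule continuous_on_compose2[OF C1c_continuous_grad[OF f, of UNIV]]) (auto intro!: continuous_intros)
    have "((\<lambda>t. D (x + t *\<^sub>R z) \<bullet> z) has_integral (f (x + 1 *\<^sub>R z) - f (x + 0 *\<^sub>R z))) {0..1}"
    proof (rule fundamental_theorem_of_calculus)
      fix t :: real
      have "((\<lambda>t. x + t *\<^sub>R z) has_derivative (\<lambda>s. s *\<^sub>R z)) (at t within {0..1})"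
        by (auto intro!: derivative_eq_intros)
      from has_derivative_compose[OF this C1c_derivative[OF f]]
      have "((\<lambda>t. f (x + t *\<^sub>R z)) has_derivative (\<lambda>s. D (x + t *\<^sub>R z) \<bullet> (s *\<^sub>R z))) (at t within {0..1})" .
      thus "((\<lambda>t. f (x + t *\<^sub>R z)) has_vector_derivative (D (x + t *\<^sub>R z) \<bullet> z)) (at t within {0..1})"
        by (simp add: has_vector_derivative_def)
    qed simp
    hence I: "integral {0..1} (\<lambda>t. D (x + t *\<^sub>R z) \<bullet> z) = f (x + z) - f x"
      "(\<lambda>t. D (x + t *\<^sub>R z) \<bullet> z) integrable_on {0..1}"
      by (auto simp: has_integral_iff)
    have J: "(\<lambda>t. norm z * norm (D (x + t *\<^sub>R z))) integrable_on {0..1}"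
      by (intro integrable_continuous_real continuous_intros c)
    have "\<bar>f (x + z) - f x\<bar> \<le> integral {0..1} (\<lambda>t. norm z * norm (D (x + t *\<^sub>R z)))"
      unfolding I(1)[symmetric] real_norm_def[symmetric]
      by (rule integral_norm_bound_integral[OF I(2) J])
        (simp add: mult.commute[of "norm z"] Cauchy_Schwarz_ineq2)
    also have "ennreal \<dots> = (\<integral>\<^sup>+t. ennreal (norm z * norm (D (x + t *\<^sub>R z))) * indicator {0..1} t \<partial>lborel)"
      by (rule nn_integral_has_integral_lebesgue'[OF _ integrable_integral[OF J], symmetric]) simp
    finally show ?thesis by (simp add: ennreal_leI)
  qed
  have "(\<integral>\<^sup>+x. ennreal \<bar>f (x + z) - f x\<bar> \<partial>lborel)
     \<le> (\<integral>\<^sup>+x. (\<integral>\<^sup>+t. ennreal (norm z * norm (D (x + t *\<^sub>R z))) * indicator {0..1} t \<partial>lborel) \<partial>lborel)"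
    by (intro nn_integral_mono pt)
  also have "\<dots> = (\<integral>\<^sup>+t. (\<integral>\<^sup>+x. ennreal (norm z * norm (D (x + t *\<^sub>R z))) * indicator {0..1} t \<partial>lborel) \<partial>lborel)"
    by (rule lborel_pair.Fubini') measurable
  also have "\<dots> = (\<integral>\<^sup>+t. ennreal (norm z) * (\<integral>\<^sup>+x. ennreal (norm (D x)) \<partial>lborel) * indicator {0..1::real} t \<partial>lborel)"
  proof (rule nn_integral_cong)
    fix t :: real
    have "(\<integral>\<^sup>+x. ennreal (norm (D x)) \<partial>lborel) = (\<integral>\<^sup>+x. ennreal (norm (D x)) \<partial>distr lborel borel ((+) (t *\<^sub>R z)))"
      by (simp add: lborel_distr_plus)
    also have "\<dots> = (\<integral>\<^sup>+x. ennreal (norm (D (x + t *\<^sub>R z))) \<partial>lborel)"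
      by (subst nn_integral_distr) (auto simp: add.commute)
    finally show "(\<integral>\<^sup>+x. ennreal (norm z * norm (D (x + t *\<^sub>R z))) * indicator {0..1} t \<partial>lborel)
        = ennreal (norm z) * (\<integral>\<^sup>+x. ennreal (norm (D x)) \<partial>lborel) * indicator {0..1} t"
      by (simp add: ennreal_mult' nn_integral_cmult nn_integral_multc)
  qed
  also have "\<dots> = ennreal (norm z) * (\<integral>\<^sup>+x. ennreal (norm (D x)) \<partial>lborel)"
    by (simp add: nn_integral_cmult)
  finally show ?thesis .
qed

lemma C1c_grad_zero:
  assumes v: "C1c v Dv" and supp: "\<And>x. norm x \<ge> \<rho> \<Longrightarrow> v x = 0" and x: "norm x > \<rho>"
  shows "Dv x = 0"
proof -
  have "{x. v x \<noteq> 0} \<subseteq> cball 0 \<rho>" using supp by (force simp: not_le[symmetric])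
  hence "closure {x. v x \<noteq> 0} \<subseteq> cball 0 \<rho>" by (intro closure_minimal) auto
  thus ?thesis using x by (intro grad_zero_outside[OF C1c_derivative[OF v]]) auto
qed

text \<open>The factor \<open>h\<close> is typically a function of the conformal factor, which blows
  up at the unit sphere. Since \<open>v\<close> vanishes beyond \<open>\<rho> < 1\<close>, the
  product is glued from its values on the unit ball and from zero on the open set beyond
  \<open>\<rho>\<close>, two open sets that cover the space.\<close>

lemma C1c_mult:
  fixes v h :: "'a::euclidean_space \<Rightarrow> real"
  assumes v: "C1c v Dv" and supp: "\<And>x. norm x \<ge> \<rho> \<Longrightarrow> v x = 0" and \<rho>: "\<rho> < 1"
    and h: "\<And>x. norm x < 1 \<Longrightarrow> (h has_derivative (\<lambda>t. Dh x \<bullet> t)) (at x)"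
    and Dh: "continuous_on (ball 0 1) Dh"
  shows "C1c (\<lambda>x. v x * h x) (\<lambda>x. v x *\<^sub>R Dh x + h x *\<^sub>R Dv x)"
proof -
  let ?G = "\<lambda>x. v x *\<^sub>R Dh x + h x *\<^sub>R Dv x"
  have op: "open {x::'a. \<rho> < norm x}" by (intro open_Collect_less continuous_intros)
  have Dv0: "Dv x = 0" if "norm x > \<rho>" for x
    by (rule C1c_grad_zero[OF v _ that]) (rule supp)
  have "((\<lambda>x. v x * h x) has_derivative (\<lambda>t. ?G x \<bullet> t)) (at x)" for x
  proof (cases "norm x < 1")
    case True
    show ?thesis
      by (rule has_derivative_eq_rhs[OF has_derivative_mult[OF C1c_derivative[OF v] h[OF True]]])
        (auto simp: fun_eq_iff inner_add_left)
  next
    case False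
    hence x: "x \<in> {x. \<rho> < norm x}" using \<rho> by simp
    have "((\<lambda>_. 0) has_derivative (\<lambda>t. ?G x \<bullet> t)) (at x)"
      using supp[of x] Dv0[of x] x by simp
    thus ?thesis
      by (rule has_derivative_transform_within_open[OF _ op x]) (use supp in auto)
  qed
  moreover have "continuous_on UNIV ?G"
  proof -
    have hc: "continuous_on (ball 0 1) h"
      using h by (auto intro!: continuous_at_imp_continuous_on has_derivative_continuous)
    have "continuous_on (ball 0 1) ?G"
      by (intro continuous_intros Dh hc C1c_continuous[OF v] C1c_continuous_grad[OF v])
    moreover have "continuous_on {x. \<rho> < norm x} ?G"
      by (rule continuous_on_eq[OF continuous_on_const[of _ 0]]) (use supp Dv0 in auto)
    ultimately have "continuous_on (ball 0 1 \<union> {x. \<rho> < norm x}) ?G"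
      by (intro continuous_on_open_Un op) auto
    moreover have "ball 0 1 \<union> {x. \<rho> < norm x} = (UNIV :: 'a set)" using \<rho> by auto
    ultimately show ?thesis by simp
  qed
  moreover have "bounded {x. v x * h x \<noteq> 0}"
    using v by (auto simp: C1c_def intro: bounded_subset)
  ultimately show ?thesis by (simp add: C1c_def)
qed

lemma has_derivative_conf_norm:
  fixes x :: "'a::euclidean_space"
  assumes "norm x < 1"
  shows "((\<lambda>x. conf (norm x)) has_derivative (\<lambda>t. ((conf (norm x))\<^sup>2 *\<^sub>R x) \<bullet> t)) (at x)"
proof -
  have "1 - x \<bullet> x > 0" using one_minus_square_pos[of "norm x"] assms by (simp add: power2_norm_eq_inner)
  hence "((\<lambda>x. 2 / (1 - x \<bullet> x)) has_derivative (\<lambda>t. ((2 / (1 - x \<bullet> x))\<^sup>2 *\<^sub>R x) \<bullet> t)) (at x)"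
    by (auto intro!: derivative_eq_intros simp: fun_eq_iff field_simps inner_commute power2_eq_square)
  thus ?thesis by (simp add: conf_def power2_norm_eq_inner)
qed

lemma continuous_on_conf_norm: "continuous_on (ball 0 1) (\<lambda>x::'a::euclidean_space. conf (norm x))"
  by (rule continuous_on_compose2[OF continuous_on_conf continuous_on_norm_id]) auto

text \<open>The divergence of \<open>conf ^ (n - 1) x\<close> dominates half the dimension times the volume density.\<close>
lemma hyperbolic_Cheeger:
  fixes v :: "'a::euclidean_space \<Rightarrow> real"
  assumes v: "C1c v Dv" and supp: "\<And>x. norm x \<ge> \<rho> \<Longrightarrow> v x = 0" and \<rho>: "\<rho> < 1" and v0: "\<And>x. v x \<ge> 0"
    and n: "DIM('a) \<ge> 2"
  shows "ennreal (real DIM('a)) * (\<integral>\<^sup>+x. ennreal (v x * conf (norm x) ^ DIM('a)) * indicator (ball 0 1) x \<partial>lborel)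
     \<le> 2 * (\<integral>\<^sup>+x. ennreal (norm (Dv x) * conf (norm x) ^ (DIM('a) - 1)) * indicator (ball 0 1) x \<partial>lborel)"
proof -
  let ?d = "DIM('a)"
  define w where "w x = conf (norm x)" for x :: 'a
  define c where "c = (\<lambda>x::'a. w x ^ (?d - 1))"
  define Dc where "Dc = (\<lambda>x::'a. (real (?d - 1) * w x ^ (?d - 2) * (w x)\<^sup>2) *\<^sub>R x)"
  have w2: "w x \<ge> 2" if "norm x < 1" for x using conf_ge[of "norm x"] that by (simp add: w_def)
  have dc: "(c has_derivative (\<lambda>t. Dc x \<bullet> t)) (at x)" if "norm x < 1" for x
  proof -
    have "?d - 1 - 1 = ?d - 2" by simp
    thus ?thesis unfolding c_def
      by (intro has_derivative_eq_rhs[OF has_derivative_power[OF has_derivative_conf_norm[OF that, folded w_def]]])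
        (auto simp: fun_eq_iff Dc_def mult_ac)
  qed
  have wc: "continuous_on (ball 0 1) w" unfolding w_def by (rule continuous_on_conf_norm)
  \<comment> \<open>The gradient of \<open>v\<close> times the component along \<open>b\<close> of
    the field \<open>c x * x\<close>. Summing the \<open>b\<close>-derivatives over the basis gives
    the divergence, whose integral is 0.\<close>
  define D where "D b x = v x *\<^sub>R ((x \<bullet> b) *\<^sub>R Dc x + c x *\<^sub>R b) + (c x * (x \<bullet> b)) *\<^sub>R Dv x" for b x
  have D: "C1c (\<lambda>x. v x * (c x * (x \<bullet> b))) (D b)" for b
    unfolding D_def
  proof (rule C1c_mult[OF v supp \<rho>])
    show "((\<lambda>x. c x * (x \<bullet> b)) has_derivative (\<lambda>t. ((x \<bullet> b) *\<^sub>R Dc x + c x *\<^sub>R b) \<bullet> t)) (at x)" if "norm x < 1" for x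
      by (rule has_derivative_eq_rhs[OF has_derivative_mult[OF dc[OF that] has_derivative_inner_left[OF has_derivative_ident]]])
        (simp add: fun_eq_iff inner_add_left inner_commute[of b] mult.commute)
    show "continuous_on (ball 0 1) (\<lambda>x. (x \<bullet> b) *\<^sub>R Dc x + c x *\<^sub>R b)"
      unfolding Dc_def c_def by (intro continuous_intros wc)
  qed auto
  have sum0: "(\<integral>x. (\<Sum>b\<in>Basis. D b x \<bullet> b) \<partial>lborel) = 0"
    using C1c_integral_grad[OF D] C1c_integrable(3)[OF D] by (subst Bochner_Integration.integral_sum) auto
  have sumint: "integrable lborel (\<lambda>x. \<Sum>b\<in>Basis. D b x \<bullet> b)"
    using C1c_integrable(3)[OF D] by auto
  have sumD: "(\<Sum>b\<in>Basis. D b x \<bullet> b) = v x * (Dc x \<bullet> x + c x * real ?d) + c x * (Dv x \<bullet> x)" for x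
  proof -
    have "(\<Sum>b\<in>Basis. D b x \<bullet> b) = v x * ((\<Sum>b\<in>Basis. (Dc x \<bullet> b) * (x \<bullet> b)) + c x * (\<Sum>b\<in>(Basis::'a set). b \<bullet> b)) + c x * (\<Sum>b\<in>Basis. (Dv x \<bullet> b) * (x \<bullet> b))"
      by (simp add: D_def inner_add_left sum.distrib sum_distrib_left algebra_simps)
    also have "(\<Sum>b\<in>(Basis::'a set). b \<bullet> b) = real ?d" by simp
    finally show ?thesis by (simp add: euclidean_inner[symmetric])
  qed
  define P where "P x = norm (Dv x) * w x ^ (?d - 1) * indicator (ball 0 1) x" for x
  define Q where "Q x = v x * w x ^ ?d * indicator (ball 0 1) x" for x
  have Dv0: "Dv x = 0" if "norm x > \<rho>" for x
    by (rule C1c_grad_zero[OF v _ that]) (rule supp)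
  have pt: "real ?d / 2 * Q x \<le> (\<Sum>b\<in>Basis. D b x \<bullet> b) + P x" for x
  proof (cases "norm x < 1")
    case True
    have w0: "w x \<ge> 2" using w2 True by simp
    have "(norm x)\<^sup>2 = 1 - 2 / w x"
      using one_minus_square_pos[of "norm x"] True by (simp add: w_def conf_def diff_divide_distrib)
    hence nx: "w x * (norm x)\<^sup>2 = w x - 2" using w0 by (simp add: field_simps)
    have wd: "w x ^ ?d = w x ^ (?d - 2) * (w x)\<^sup>2" "w x ^ (?d - 1) = w x ^ (?d - 2) * w x"
    proof -
      have "?d - 2 + 2 = ?d" "?d - 2 + 1 = ?d - 1" using n by simp_all
      thus "w x ^ ?d = w x ^ (?d - 2) * (w x)\<^sup>2" "w x ^ (?d - 1) = w x ^ (?d - 2) * w x"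
        by (metis power_add, metis power_add power_one_right)
    qed
    have "Dc x \<bullet> x + c x * real ?d = real (?d - 1) * w x ^ (?d - 2) * w x * (w x * (norm x)\<^sup>2) + w x ^ (?d - 1) * real ?d"
      unfolding power2_norm_eq_inner by (simp add: Dc_def c_def power2_eq_square)
    also have "\<dots> = w x ^ (?d - 2) * w x * ((real ?d - 1) * (w x - 2) + real ?d)"
      using n unfolding nx wd by (simp add: of_nat_diff algebra_simps)
    \<comment> \<open>Since \<open>w * (norm x) ^ 2 = w - 2\<close>, the divergence is explicit in
      \<open>w\<close>; it exceeds the claimed bound by a positive multiple of
      \<open>(?d / 2 - 1) * (w - 2)\<close>, and \<open>w \<ge> 2\<close> in the ball.\<close>
    also have "\<dots> \<ge> w x ^ (?d - 2) * w x * (real ?d / 2 * w x)"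
    proof (rule mult_left_mono)
      have "real ?d / 2 * w x \<le> (real ?d - 1) * (w x - 2) + real ?d \<longleftrightarrow> 0 \<le> (real ?d / 2 - 1) * (w x - 2)"
        by (simp add: field_simps)
      also have "\<dots>" using n w0 by simp
      finally show "real ?d / 2 * w x \<le> (real ?d - 1) * (w x - 2) + real ?d" .
    qed (use w0 in simp)
    also have "w x ^ (?d - 2) * w x * (real ?d / 2 * w x) = real ?d / 2 * w x ^ ?d"
      unfolding wd by (simp add: power2_eq_square)
    finally have "v x * (real ?d / 2 * w x ^ ?d) \<le> v x * (Dc x \<bullet> x + c x * real ?d)"
      using v0 by (intro mult_left_mono) auto
    moreover have "- (c x * (Dv x \<bullet> x)) \<le> P x"
    proof -
      have "- (Dv x \<bullet> x) \<le> norm (Dv x) * norm x" using Cauchy_Schwarz_ineq2[of "Dv x" x] by linarith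
      also have "\<dots> \<le> norm (Dv x) * 1" using True by (intro mult_left_mono) auto
      finally have "c x * (- (Dv x \<bullet> x)) \<le> c x * norm (Dv x)"
        using w0 by (intro mult_left_mono) (auto simp: c_def)
      thus ?thesis using True by (simp add: P_def c_def mult.commute)
    qed
    ultimately show ?thesis using True by (simp add: sumD Q_def algebra_simps)
  next
    case False
    thus ?thesis using supp[of x] Dv0[of x] \<rho> by (simp add: sumD P_def Q_def)
  qed
  have [measurable]: "w \<in> borel_measurable borel" unfolding w_def by measurable
  note [measurable] = C1c_borel_measurable[OF v]
  have ballm [measurable]: "ball (0::'a) 1 \<in> sets borel" by simp
  have [measurable]: "P \<in> borel_measurable borel" "Q \<in> borel_measurable borel"
    unfolding P_def Q_def by measurable
  have P0: "P x \<ge> 0" "Q x \<ge> 0" for x using w2[of x] v0[of x] by (auto simp: P_def Q_def indicator_def)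
  have nnP: "(\<integral>\<^sup>+x. ennreal (norm (Dv x) * conf (norm x) ^ (?d - 1)) * indicator (ball 0 1) x \<partial>lborel) = (\<integral>\<^sup>+x. ennreal (P x) \<partial>lborel)"
    by (intro nn_integral_cong) (auto simp: P_def w_def indicator_def)
  have nnQ: "(\<integral>\<^sup>+x. ennreal (v x * conf (norm x) ^ ?d) * indicator (ball 0 1) x \<partial>lborel) = (\<integral>\<^sup>+x. ennreal (Q x) \<partial>lborel)"
    by (intro nn_integral_cong) (auto simp: Q_def w_def indicator_def)
  show ?thesis
  proof (cases "(\<integral>\<^sup>+x. ennreal (P x) \<partial>lborel) = \<infinity>")
    case True
    thus ?thesis unfolding nnP by (simp add: ennreal_mult_top)
  next
    case False
    hence iP: "integrable lborel P" using P0 by (simp add: integrable_iff_bounded less_top)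
    have iQ: "integrable lborel (\<lambda>x. real ?d / 2 * Q x)"
    proof (rule Bochner_Integration.integrable_bound[OF Bochner_Integration.integrable_add[OF sumint iP]])
      show "AE x in lborel. norm (real ?d / 2 * Q x) \<le> norm ((\<Sum>b\<in>Basis. D b x \<bullet> b) + P x)"
      proof (intro AE_I2)
        fix x
        have "0 \<le> real ?d / 2 * Q x" using P0[of x] by simp
        thus "norm (real ?d / 2 * Q x) \<le> norm ((\<Sum>b\<in>Basis. D b x \<bullet> b) + P x)" using pt[of x] by simp
      qed
    qed measurable
    have "real ?d / 2 * (\<integral>x. Q x \<partial>lborel) = (\<integral>x. real ?d / 2 * Q x \<partial>lborel)" by simp
    also have "\<dots> \<le> (\<integral>x. (\<Sum>b\<in>Basis. D b x \<bullet> b) + P x \<partial>lborel)"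
      using iQ sumint iP pt by (intro integral_mono) auto
    also have "\<dots> = (\<integral>x. P x \<partial>lborel)" using sum0 sumint iP by simp
    finally have le: "real ?d * (\<integral>x. Q x \<partial>lborel) \<le> 2 * (\<integral>x. P x \<partial>lborel)" by simp
    have "integrable lborel (\<lambda>x. 2 / real ?d * (real ?d / 2 * Q x))" by (intro integrable_mult_right iQ)
    hence iQ': "integrable lborel Q" by simp
    have "(\<integral>\<^sup>+x. ennreal (Q x) \<partial>lborel) = ennreal (\<integral>x. Q x \<partial>lborel)" "(\<integral>\<^sup>+x. ennreal (P x) \<partial>lborel) = ennreal (\<integral>x. P x \<partial>lborel)"
      using iP iQ' P0 by (auto intro!: nn_integral_eq_integral)
    hence "ennreal (real ?d) * (\<integral>\<^sup>+x. ennreal (Q x) \<partial>lborel) = ennreal (real ?d * (\<integral>x. Q x \<partial>lborel))"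
      "2 * (\<integral>\<^sup>+x. ennreal (P x) \<partial>lborel) = ennreal (2 * (\<integral>x. P x \<partial>lborel))"
      using P0 by (auto simp: ennreal_mult' ennreal_mult'')
    thus ?thesis unfolding nnP nnQ using le by (simp add: ennreal_leI)
  qed
qed


text \<open>With \<open>w\<close> the conformal factor, compare \<open>v * w ^ n / (l ^ n + w ^ n)\<close> with its averages over balls of radius
  proportional to \<open>1 / l\<close>, integrated over all scales \<open>l\<close>.\<close>
lemma hyperbolic_isoperimetric:
  fixes v :: "'a::euclidean_space \<Rightarrow> real"
  assumes v: "C1c v Dv" and supp: "\<And>x. norm x \<ge> \<rho> \<Longrightarrow> v x = 0" and \<rho>: "\<rho> < 1"
    and v0: "\<And>x. v x \<ge> 0" and vT: "\<And>x. v x \<le> T" and T: "T \<ge> 0"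
    and n: "DIM('a) \<ge> 2"
    and E [measurable]: "E \<in> sets borel" and EB: "\<And>x. x \<in> E \<Longrightarrow> norm x < 1 \<and> v x = T"
    and M: "M > 0" "(\<integral>\<^sup>+x. ennreal (conf (norm x) ^ DIM('a)) * indicator {x \<in> ball 0 1. v x > 0} x \<partial>lborel) \<le> ennreal M"
  shows "ennreal T * (\<integral>\<^sup>+x. ennreal (conf (norm x) ^ DIM('a)) * indicator E x \<partial>lborel)
     \<le> ennreal (24 * real DIM('a) * (4 * M / measure lborel (ball (0::'a) 1)) powr (1 / real DIM('a)))
        * (\<integral>\<^sup>+x. ennreal (norm (Dv x) * conf (norm x) ^ (DIM('a) - 1)) * indicator (ball 0 1) x \<partial>lborel)"
proof -
  let ?d = "DIM('a)" and ?\<sigma> = "measure lborel (ball (0::'a) 1)"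
  define w where "w x = conf (norm x)" for x :: 'a
  have \<sigma>: "?\<sigma> > 0" by (simp add: content_ball_pos)
  have w2: "w x \<ge> 2" if "norm x < 1" for x using conf_ge[of "norm x"] that by (simp add: w_def)
  have [measurable]: "w \<in> borel_measurable borel" unfolding w_def by measurable
  note [measurable] = C1c_borel_measurable[OF v]
  have ballm [measurable]: "ball (0::'a) r \<in> sets borel" for r by simp
  have Dv0: "Dv x = 0" if "norm x > \<rho>" for x
    by (rule C1c_grad_zero[OF v _ that]) (rule supp)
  \<comment> \<open>With this \<open>R\<close> the Euclidean ball of radius \<open>R / l\<close> has
    volume \<open>4 * M / l ^ ?d\<close>. Where \<open>w\<close> is about \<open>l\<close> the
    metric is about \<open>l\<close> times the Euclidean one, so these balls have hyperbolic volume
    comparable to the bound \<open>M\<close> on the support.\<close>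
  define R where "R = (4 * M / ?\<sigma>) powr (1 / real ?d)"
  have R0: "R > 0" using M \<sigma> by (simp add: R_def)
  have Rd: "R ^ ?d = 4 * M / ?\<sigma>"
  proof -
    have "R ^ ?d = R powr real ?d" using R0 by (simp add: powr_realpow)
    also have "\<dots> = (4 * M / ?\<sigma>) powr 1" unfolding R_def powr_powr using n by simp
    finally show ?thesis using M \<sigma> by simp
  qed
  define \<eta> where "\<eta> l x = w x ^ ?d / (l ^ ?d + w x ^ ?d)" for l x
  \<comment> \<open>The derivative of the cutoff satisfies
    \<open>norm (D\<eta> x) \<le> ?d * w x * \<eta> l x\<close>, so \<open>\<eta> l x * Z x\<close>
    bounds the gradient of the localized function. The second summand is the price of the
    localization and is absorbed at the end.\<close>
  define Z where "Z x = norm (Dv x) + real ?d * w x * v x" for x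
  have [measurable]: "Z \<in> borel_measurable borel" unfolding Z_def by measurable
  have [measurable]: "(\<lambda>(l, x). \<eta> l x) \<in> borel_measurable (borel \<Otimes>\<^sub>M borel)" unfolding \<eta>_def by measurable
  have Z0: "Z x \<ge> 0" if "norm x < 1" for x using w2[OF that] v0[of x] by (simp add: Z_def)
  have \<eta>01: "0 \<le> \<eta> l x" "\<eta> l x \<le> 1" "\<eta> l x \<le> w x ^ ?d / l ^ ?d" if "norm x < 1" "l > 0" for l x
  proof -
    have pos: "l ^ ?d > 0" "w x ^ ?d > 0" using that w2[OF that(1)] by simp_all
    show "0 \<le> \<eta> l x" "\<eta> l x \<le> 1" unfolding \<eta>_def using pos by simp_all
    show "\<eta> l x \<le> w x ^ ?d / l ^ ?d" unfolding \<eta>_def using pos by (intro divide_left_mono) simp_all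
  qed
  \<comment> \<open>At a point of \<open>E\<close> with \<open>w \<ge> l\<close> the localized
    function is at least \<open>T / 2\<close>, since there the cutoff is at least
    \<open>1 / 2\<close>. Its total integral is at most \<open>T * M / l ^ ?d\<close>, a quarter of
    \<open>T\<close> times the volume of the ball, so its average over the ball is at most
    \<open>T / 4\<close>. The mean oscillation is therefore at least \<open>T / 4\<close>, and
    translation estimates bound it by the radius times the integral of the gradient.\<close>
  have scale: "ennreal (T / 4) * emeasure lborel {x \<in> E. l \<le> w x}
      \<le> ennreal (R / l) * (\<integral>\<^sup>+x. ennreal (\<eta> l x * Z x) * indicator (ball 0 1) x \<partial>lborel)" if l: "l > 0" for l
  proof -
    define D\<eta> where "D\<eta> x = (real ?d * w x ^ (?d - 1) * l ^ ?d / (l ^ ?d + w x ^ ?d)\<^sup>2 * (w x)\<^sup>2) *\<^sub>R x" for x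
    have pos: "l ^ ?d + w x ^ ?d > 0" if "norm x < 1" for x
      using w2[OF that] l by (intro add_pos_pos) auto
    have d\<eta>: "(\<eta> l has_derivative (\<lambda>t. D\<eta> x \<bullet> t)) (at x)" if x: "norm x < 1" for x
    proof -
      have "((\<lambda>t. t ^ ?d / (l ^ ?d + t ^ ?d)) has_real_derivative
          ((real ?d * w x ^ (?d - 1)) * (l ^ ?d + w x ^ ?d) - w x ^ ?d * (real ?d * w x ^ (?d - 1))) / ((l ^ ?d + w x ^ ?d) * (l ^ ?d + w x ^ ?d))) (at (w x))"
        using pos[OF x] by (auto intro!: derivative_eq_intros)
      note dd = this
      have "((\<lambda>t. t ^ ?d / (l ^ ?d + t ^ ?d)) has_derivative (\<lambda>t. (real ?d * w x ^ (?d - 1) * l ^ ?d / (l ^ ?d + w x ^ ?d)\<^sup>2) * t)) (at (w x))"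
      proof -
        have "((real ?d * w x ^ (?d - 1)) * (l ^ ?d + w x ^ ?d) - w x ^ ?d * (real ?d * w x ^ (?d - 1))) / ((l ^ ?d + w x ^ ?d) * (l ^ ?d + w x ^ ?d))
            = real ?d * w x ^ (?d - 1) * l ^ ?d / (l ^ ?d + w x ^ ?d)\<^sup>2"
          unfolding power2_eq_square by (rule arg_cong2[where f = "(/)"]) (simp_all add: algebra_simps)
        thus ?thesis using dd by (simp only: has_field_derivative_def)
      qed
      from has_derivative_compose[OF has_derivative_conf_norm[OF x, folded w_def] this]
      show ?thesis unfolding \<eta>_def
        by (rule has_derivative_eq_rhs) (auto simp: fun_eq_iff D\<eta>_def)
    qed
    have wc: "continuous_on (ball 0 1) w" unfolding w_def by (rule continuous_on_conf_norm)
    define \<psi> where "\<psi> x = v x * \<eta> l x" for x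
    define D\<psi> where "D\<psi> x = v x *\<^sub>R D\<eta> x + \<eta> l x *\<^sub>R Dv x" for x
    have \<psi>: "C1c \<psi> D\<psi>" unfolding \<psi>_def D\<psi>_def
    proof (rule C1c_mult[OF v supp \<rho> d\<eta>])
      have "l ^ ?d + w x ^ ?d \<noteq> 0" if "x \<in> ball 0 1" for x using pos[of x] that by simp
      thus "continuous_on (ball 0 1) D\<eta>"
        unfolding D\<eta>_def by (intro continuous_intros wc) auto
    qed auto
    note [measurable] = C1c_borel_measurable[OF \<psi>]
    have D\<psi>_le: "ennreal (norm (D\<psi> x)) \<le> ennreal (\<eta> l x * Z x) * indicator (ball 0 1) x" for x
    proof (cases "norm x < 1")
      case True
      define A where "A = l ^ ?d + w x ^ ?d"
      have A: "A > 0" "l ^ ?d \<le> A" using pos[OF True] w2[OF True] by (auto simp: A_def)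
      have "norm (D\<eta> x) = real ?d * w x ^ (?d - 1) * l ^ ?d / A\<^sup>2 * (w x)\<^sup>2 * norm x"
        using w2[OF True] l by (simp add: D\<eta>_def A_def abs_mult)
      also have "\<dots> = (real ?d * w x * (w x ^ ?d / A)) * ((l ^ ?d / A) * norm x)"
      proof -
        have "w x ^ ?d = w x ^ (?d - 1) * w x" by (metis DIM_positive Suc_pred power_Suc2 One_nat_def)
        thus ?thesis using A by (simp add: power2_eq_square)
      qed
      also have "\<dots> \<le> (real ?d * w x * (w x ^ ?d / A)) * (1 * 1)"
        using A w2[OF True] l True by (intro mult_left_mono mult_mono) auto
      finally have "norm (D\<eta> x) \<le> real ?d * w x * \<eta> l x" by (simp add: \<eta>_def A_def)
      hence "v x * norm (D\<eta> x) \<le> v x * (real ?d * w x * \<eta> l x)" using v0 by (intro mult_left_mono)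
      moreover have "norm (D\<psi> x) \<le> v x * norm (D\<eta> x) + \<eta> l x * norm (Dv x)"
        unfolding D\<psi>_def using norm_triangle_ineq[of "v x *\<^sub>R D\<eta> x" "\<eta> l x *\<^sub>R Dv x"] v0[of x] \<eta>01[OF True l] by simp
      ultimately have "norm (D\<psi> x) \<le> \<eta> l x * Z x" by (simp add: Z_def algebra_simps)
      thus ?thesis using True by (simp add: ennreal_leI)
    next
      case False
      thus ?thesis using supp[of x] Dv0[of x] \<rho> by (simp add: D\<psi>_def)
    qed
    have \<psi>0: "\<psi> x \<ge> 0" for x using v0[of x] \<eta>01[of x l] l supp[of x] \<rho> by (cases "norm x < 1") (auto simp: \<psi>_def)
    have \<psi>_int: "(\<integral>\<^sup>+x. ennreal (\<psi> x) \<partial>lborel) \<le> ennreal (T * M / l ^ ?d)"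
    proof -
      have "(\<integral>\<^sup>+x. ennreal (\<psi> x) \<partial>lborel) \<le> (\<integral>\<^sup>+x. ennreal (T / l ^ ?d) * (ennreal (w x ^ ?d) * indicator {x \<in> ball 0 1. v x > 0} x) \<partial>lborel)"
      proof (rule nn_integral_mono)
        fix x
        show "ennreal (\<psi> x) \<le> ennreal (T / l ^ ?d) * (ennreal (w x ^ ?d) * indicator {x \<in> ball 0 1. v x > 0} x)"
        proof (cases "norm x < 1 \<and> v x > 0")
          case True
          have "v x * \<eta> l x \<le> T * (w x ^ ?d / l ^ ?d)"
            using True vT[of x] v0[of x] \<eta>01[of x l] l T by (intro mult_mono) auto
          thus ?thesis using True T l w2[of x] by (auto simp: \<psi>_def simp flip: ennreal_mult' intro!: ennreal_leI)
        next
          case False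
          thus ?thesis using v0[of x] supp[of x] \<rho> by (auto simp: \<psi>_def not_less)
        qed
      qed
      also have "\<dots> = ennreal (T / l ^ ?d) * (\<integral>\<^sup>+x. ennreal (w x ^ ?d) * indicator {x \<in> ball 0 1. v x > 0} x \<partial>lborel)"
        by (intro nn_integral_cmult) measurable
      also have "\<dots> \<le> ennreal (T / l ^ ?d) * ennreal M"
        using M(2) unfolding w_def by (intro mult_left_mono) auto
      also have "\<dots> = ennreal (T * M / l ^ ?d)" using T l M by (simp flip: ennreal_mult')
      finally show ?thesis .
    qed
    define r where "r = R / l"
    define \<beta> where "\<beta> = 4 * M / l ^ ?d"
    have r0: "r > 0" and \<beta>0: "\<beta> > 0" using R0 l M by (auto simp: r_def \<beta>_def)
    have vol: "emeasure lborel (ball (0::'a) r) = ennreal \<beta>"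
    proof -
      have "measure lborel (ball (0::'a) r) = \<beta>"
        using content_ball_conv_unit_ball[of r "0::'a"] r0 \<sigma> by (simp add: r_def \<beta>_def power_divide Rd)
      thus ?thesis using emeasure_lborel_ball_finite[of "0::'a" r] by (simp add: emeasure_eq_ennreal_measure less_top)
    qed
    define J where "J x = (\<integral>\<^sup>+z. ennreal \<bar>\<psi> (x + z) - \<psi> x\<bar> * indicator (ball 0 r) z \<partial>lborel)" for x
    have J: "ennreal (T / 4 * \<beta>) \<le> J x" if x: "x \<in> E" "l \<le> w x" for x
    proof -
      have nx: "norm x < 1" "v x = T" using EB x by auto
      have "l ^ ?d \<le> w x ^ ?d" using x l by (intro power_mono) auto
      hence "1 / 2 \<le> \<eta> l x" using pos[OF nx(1)] by (simp add: \<eta>_def field_simps)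
      hence \<psi>x: "T / 2 \<le> \<psi> x" using T mult_left_mono[of "1/2" "\<eta> l x" T] by (simp add: \<psi>_def nx)
      have "ennreal (T / 4 * \<beta>) + ennreal (T / 4 * \<beta>) = (\<integral>\<^sup>+z. ennreal (T / 2) * indicator (ball (0::'a) r) z \<partial>lborel)"
        using T \<beta>0 by (simp add: nn_integral_cmult_indicator vol flip: ennreal_plus ennreal_mult')
      also have "\<dots> \<le> (\<integral>\<^sup>+z. ennreal \<bar>\<psi> (x + z) - \<psi> x\<bar> * indicator (ball 0 r) z + ennreal (\<psi> (x + z)) \<partial>lborel)"
      proof (rule nn_integral_mono)
        fix z :: 'a
        have "T / 2 \<le> \<bar>\<psi> (x + z) - \<psi> x\<bar> + \<psi> (x + z)" using \<psi>x by linarith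
        hence "ennreal (T / 2) \<le> ennreal \<bar>\<psi> (x + z) - \<psi> x\<bar> + ennreal (\<psi> (x + z))"
          using \<psi>0 by (simp add: ennreal_leI flip: ennreal_plus)
        thus "ennreal (T / 2) * indicator (ball 0 r) z \<le> ennreal \<bar>\<psi> (x + z) - \<psi> x\<bar> * indicator (ball 0 r) z + ennreal (\<psi> (x + z))"
          by (simp add: indicator_def)
      qed
      also have "\<dots> = J x + (\<integral>\<^sup>+z. ennreal (\<psi> (x + z)) \<partial>lborel)"
        unfolding J_def by (intro nn_integral_add) measurable
      also have "(\<integral>\<^sup>+z. ennreal (\<psi> (x + z)) \<partial>lborel) = (\<integral>\<^sup>+z. ennreal (\<psi> z) \<partial>distr lborel borel ((+) x))"
        by (subst nn_integral_distr) auto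
      also have "\<dots> = (\<integral>\<^sup>+z. ennreal (\<psi> z) \<partial>lborel)" by (simp add: lborel_distr_plus)
      also have "\<dots> \<le> ennreal (T / 4 * \<beta>)" using \<psi>_int by (simp add: \<beta>_def mult.commute)
      finally have "ennreal (T / 4 * \<beta>) + ennreal (T / 4 * \<beta>) \<le> J x + ennreal (T / 4 * \<beta>)" by (simp add: add_left_mono)
      thus ?thesis by (simp add: add.commute[of "J x"] ennreal_add_left_cancel_le)
    qed
    have "ennreal (T / 4 * \<beta>) * emeasure lborel {x \<in> E. l \<le> w x} = (\<integral>\<^sup>+x. ennreal (T / 4 * \<beta>) * indicator {x \<in> E. l \<le> w x} x \<partial>lborel)"
      by (subst nn_integral_cmult_indicator) auto
    also have "\<dots> \<le> (\<integral>\<^sup>+x. J x \<partial>lborel)"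
      using J by (intro nn_integral_mono) (auto simp: indicator_def)
    also have "\<dots> = (\<integral>\<^sup>+z. (\<integral>\<^sup>+x. ennreal \<bar>\<psi> (x + z) - \<psi> x\<bar> * indicator (ball 0 r) z \<partial>lborel) \<partial>lborel)"
      unfolding J_def by (rule lborel_pair.Fubini') measurable
    also have "\<dots> \<le> (\<integral>\<^sup>+z. (ennreal r * (\<integral>\<^sup>+x. ennreal (norm (D\<psi> x)) \<partial>lborel)) * indicator (ball (0::'a) r) z \<partial>lborel)"
    proof (rule nn_integral_mono)
      fix z :: 'a
      show "(\<integral>\<^sup>+x. ennreal \<bar>\<psi> (x + z) - \<psi> x\<bar> * indicator (ball 0 r) z \<partial>lborel) \<le> ennreal r * (\<integral>\<^sup>+x. ennreal (norm (D\<psi> x)) \<partial>lborel) * indicator (ball 0 r) z"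
      proof (cases "z \<in> ball 0 r")
        case True
        have "(\<integral>\<^sup>+x. ennreal \<bar>\<psi> (x + z) - \<psi> x\<bar> \<partial>lborel) \<le> ennreal (norm z) * (\<integral>\<^sup>+x. ennreal (norm (D\<psi> x)) \<partial>lborel)"
          by (rule C1c_translation[OF \<psi>])
        also have "\<dots> \<le> ennreal r * (\<integral>\<^sup>+x. ennreal (norm (D\<psi> x)) \<partial>lborel)"
          using True by (intro mult_right_mono ennreal_leI) auto
        finally show ?thesis using True by simp
      qed simp
    qed
    also have "\<dots> = ennreal r * (\<integral>\<^sup>+x. ennreal (norm (D\<psi> x)) \<partial>lborel) * ennreal \<beta>"
      by (simp add: nn_integral_cmult_indicator vol)
    finally have fin: "ennreal (T / 4 * \<beta>) * emeasure lborel {x \<in> E. l \<le> w x} \<le> ennreal r * (\<integral>\<^sup>+x. ennreal (norm (D\<psi> x)) \<partial>lborel) * ennreal \<beta>" .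
    have "ennreal (T / 4) * emeasure lborel {x \<in> E. l \<le> w x} = ennreal (1 / \<beta>) * (ennreal (T / 4 * \<beta>) * emeasure lborel {x \<in> E. l \<le> w x})"
      using \<beta>0 T by (simp add: mult.assoc[symmetric] flip: ennreal_mult')
    also have "\<dots> \<le> ennreal (1 / \<beta>) * (ennreal r * (\<integral>\<^sup>+x. ennreal (norm (D\<psi> x)) \<partial>lborel) * ennreal \<beta>)"
      by (intro mult_left_mono fin) auto
    also have "\<dots> = (ennreal (1 / \<beta>) * ennreal \<beta>) * (ennreal r * (\<integral>\<^sup>+x. ennreal (norm (D\<psi> x)) \<partial>lborel))"
      by (simp add: mult_ac)
    also have "ennreal (1 / \<beta>) * ennreal \<beta> = 1" using \<beta>0 by (simp flip: ennreal_mult')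
    also have "1 * (ennreal r * (\<integral>\<^sup>+x. ennreal (norm (D\<psi> x)) \<partial>lborel)) \<le> ennreal r * (\<integral>\<^sup>+x. ennreal (\<eta> l x * Z x) * indicator (ball 0 1) x \<partial>lborel)"
      unfolding mult_1_left by (intro mult_left_mono nn_integral_mono D\<psi>_le) auto
    finally show ?thesis by (simp add: r_def)
  qed
  define m where "m = (\<integral>\<^sup>+x. ennreal (w x ^ ?d) * indicator E x \<partial>lborel)"
  define P where "P = (\<integral>\<^sup>+x. ennreal (norm (Dv x) * w x ^ (?d - 1)) * indicator (ball 0 1) x \<partial>lborel)"
  \<comment> \<open>The estimates at the scales \<open>l\<close> are summed with the weight
    \<open>l ^ (?d - 1)\<close>, because its integral over \<open>l \<le> w x\<close> is
    \<open>w x ^ ?d / ?d\<close> and so restores the hyperbolic volume density.\<close>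
  have "ennreal (T / (4 * real ?d)) * m = (\<integral>\<^sup>+x. (\<integral>\<^sup>+l. ennreal (l ^ (?d - 1)) * ennreal (T / 4) * (indicator E x * (if 0 < l \<and> l \<le> w x then 1 else 0)) \<partial>lborel) \<partial>lborel)"
  proof -
    have "(\<integral>\<^sup>+l. ennreal (l ^ (?d - 1)) * ennreal (T / 4) * (indicator E x * (if 0 < l \<and> l \<le> w x then 1 else 0)) \<partial>lborel)
        = ennreal (T / (4 * real ?d)) * (ennreal (w x ^ ?d) * indicator E x)" for x
    proof (cases "x \<in> E")
      case True
      have w0: "w x > 0" using w2[of x] EB[OF True] by simp
      have "(\<integral>\<^sup>+l. ennreal (l ^ (?d - 1)) * ennreal (T / 4) * (indicator E x * (if 0 < l \<and> l \<le> w x then 1 else 0)) \<partial>lborel)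
        = (\<integral>\<^sup>+l. ennreal (T / 4 * l ^ (?d - 1)) * indicator {0..w x} l \<partial>lborel)"
      proof (rule nn_integral_cong_AE)
        show "AE l in lborel. ennreal (l ^ (?d - 1)) * ennreal (T / 4) * (indicator E x * (if 0 < l \<and> l \<le> w x then 1 else 0))
            = ennreal (T / 4 * l ^ (?d - 1)) * indicator {0..w x} l"
          using AE_lborel_singleton[of "0::real"]
        proof eventually_elim
          case (elim l)
          have "ennreal (T / 4 * l ^ (?d - 1)) = ennreal (T / 4) * ennreal (l ^ (?d - 1))"
            using T by (intro ennreal_mult') simp
          thus ?case using True elim by (auto simp: indicator_def mult.commute)
        qed
      qed
      also have "\<dots> = ennreal (T / (4 * real ?d) * w x ^ ?d - T / (4 * real ?d) * 0 ^ ?d)"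
        using w0 T n by (intro nn_integral_FTC_Icc) (auto intro!: derivative_eq_intros simp: field_simps)
      also have "\<dots> = ennreal (T / (4 * real ?d)) * ennreal (w x ^ ?d)"
        using T by (subst ennreal_mult'[symmetric]) (auto simp: zero_power)
      finally show ?thesis using True by simp
    qed simp
    thus ?thesis unfolding m_def by (simp add: nn_integral_cmult)
  qed
  also have "\<dots> = (\<integral>\<^sup>+l. (\<integral>\<^sup>+x. ennreal (l ^ (?d - 1)) * ennreal (T / 4) * (indicator E x * (if 0 < l \<and> l \<le> w x then 1 else 0)) \<partial>lborel) \<partial>lborel)"
    by (rule lborel_pair.Fubini') measurable
  also have "\<dots> \<le> (\<integral>\<^sup>+l. (\<integral>\<^sup>+x. ennreal (R * l ^ (?d - 2)) * indicator {0<..} l * (ennreal (\<eta> l x * Z x) * indicator (ball 0 1) x) \<partial>lborel) \<partial>lborel)"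
  proof (rule nn_integral_mono)
    fix l :: real
    show "(\<integral>\<^sup>+x. ennreal (l ^ (?d - 1)) * ennreal (T / 4) * (indicator E x * (if 0 < l \<and> l \<le> w x then 1 else 0)) \<partial>lborel)
       \<le> (\<integral>\<^sup>+x. ennreal (R * l ^ (?d - 2)) * indicator {0<..} l * (ennreal (\<eta> l x * Z x) * indicator (ball 0 1) x) \<partial>lborel)"
    proof (cases "l > 0")
      case True
      have [measurable]: "(\<lambda>x. \<eta> l x) \<in> borel_measurable borel" unfolding \<eta>_def by measurable
      have "(\<integral>\<^sup>+x. ennreal (l ^ (?d - 1)) * ennreal (T / 4) * (indicator E x * (if 0 < l \<and> l \<le> w x then 1 else 0)) \<partial>lborel)
          = (\<integral>\<^sup>+x. (ennreal (l ^ (?d - 1)) * ennreal (T / 4)) * indicator {x \<in> E. l \<le> w x} x \<partial>lborel)"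
        using True by (intro nn_integral_cong) (auto simp: indicator_def)
      also have "\<dots> = ennreal (l ^ (?d - 1)) * (ennreal (T / 4) * emeasure lborel {x \<in> E. l \<le> w x})"
        by (subst nn_integral_cmult_indicator) (auto simp: mult.assoc)
      also have "\<dots> \<le> ennreal (l ^ (?d - 1)) * (ennreal (R / l) * (\<integral>\<^sup>+x. ennreal (\<eta> l x * Z x) * indicator (ball 0 1) x \<partial>lborel))"
        by (intro mult_left_mono scale True) auto
      also have "\<dots> = ennreal (R * l ^ (?d - 2)) * (\<integral>\<^sup>+x. ennreal (\<eta> l x * Z x) * indicator (ball 0 1) x \<partial>lborel)"
      proof -
        have "?d - 1 = Suc (?d - 2)" using n by simp
        hence "l ^ (?d - 1) * (R / l) = R * l ^ (?d - 2)" using True by simp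
        thus ?thesis using True R0 by (simp add: mult.assoc[symmetric] flip: ennreal_mult')
      qed
      also have "\<dots> = (\<integral>\<^sup>+x. ennreal (R * l ^ (?d - 2)) * indicator {0<..} l * (ennreal (\<eta> l x * Z x) * indicator (ball 0 1) x) \<partial>lborel)"
        using True by (subst nn_integral_cmult) auto
      finally show ?thesis .
    qed simp
  qed
  also have "\<dots> = (\<integral>\<^sup>+x. (\<integral>\<^sup>+l. ennreal (R * l ^ (?d - 2)) * indicator {0<..} l * (ennreal (\<eta> l x * Z x) * indicator (ball 0 1) x) \<partial>lborel) \<partial>lborel)"
    by (rule lborel_pair.Fubini') measurable
  also have "\<dots> \<le> (\<integral>\<^sup>+x. ennreal (2 * R) * (ennreal (Z x * w x ^ (?d - 1)) * indicator (ball 0 1) x) \<partial>lborel)"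
  proof (rule nn_integral_mono)
    fix x :: 'a
    show "(\<integral>\<^sup>+l. ennreal (R * l ^ (?d - 2)) * indicator {0<..} l * (ennreal (\<eta> l x * Z x) * indicator (ball 0 1) x) \<partial>lborel)
       \<le> ennreal (2 * R) * (ennreal (Z x * w x ^ (?d - 1)) * indicator (ball 0 1) x)"
    proof (cases "norm x < 1")
      case True
      have w0: "w x > 0" using w2[OF True] by simp
      have "(\<integral>\<^sup>+l. ennreal (R * l ^ (?d - 2)) * indicator {0<..} l * (ennreal (\<eta> l x * Z x) * indicator (ball 0 1) x) \<partial>lborel)
         \<le> (\<integral>\<^sup>+l. ennreal (R * Z x) * (ennreal (l ^ (?d - 2)) * indicator {0..w x} l + ennreal (w x ^ ?d * (1 / l\<^sup>2)) * indicator {w x..} l) \<partial>lborel)"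
      proof (rule nn_integral_mono)
        fix l :: real
        show "ennreal (R * l ^ (?d - 2)) * indicator {0<..} l * (ennreal (\<eta> l x * Z x) * indicator (ball 0 1) x)
            \<le> ennreal (R * Z x) * (ennreal (l ^ (?d - 2)) * indicator {0..w x} l + ennreal (w x ^ ?d * (1 / l\<^sup>2)) * indicator {w x..} l)"
        proof (cases "l > 0")
          case l: True
          \<comment> \<open>Two bounds for the cutoff, split at \<open>l = w x\<close>: 1 below and
            \<open>(w x / l) ^ ?d\<close> above. Both parts integrate to at most
            \<open>w x ^ (?d - 1)\<close>, which accounts for the factor 2 in
            \<open>2 * R\<close>.\<close>
          have "l ^ (?d - 2) * \<eta> l x \<le> l ^ (?d - 2) * 1" using \<eta>01(2)[OF True l] l by (intro mult_left_mono) auto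
          moreover have "l ^ (?d - 2) * \<eta> l x \<le> w x ^ ?d * (1 / l\<^sup>2)"
          proof -
            have "?d - 2 + 2 = ?d" using n by simp
            hence "l ^ ?d = l ^ (?d - 2) * l\<^sup>2" by (metis power_add)
            moreover have "l ^ (?d - 2) * \<eta> l x \<le> l ^ (?d - 2) * (w x ^ ?d / l ^ ?d)"
              using \<eta>01(3)[OF True l] l by (intro mult_left_mono) auto
            ultimately show ?thesis using l by simp
          qed
          ultimately have "ennreal (l ^ (?d - 2) * \<eta> l x) \<le> ennreal (l ^ (?d - 2)) * indicator {0..w x} l + ennreal (w x ^ ?d * (1 / l\<^sup>2)) * indicator {w x..} l"
            using l by (auto simp: indicator_def intro: ennreal_leI order_trans[OF ennreal_leI])
          hence "ennreal (R * Z x) * ennreal (l ^ (?d - 2) * \<eta> l x) \<le> ennreal (R * Z x) * (ennreal (l ^ (?d - 2)) * indicator {0..w x} l + ennreal (w x ^ ?d * (1 / l\<^sup>2)) * indicator {w x..} l)"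
            by (rule mult_left_mono) simp
          moreover have "ennreal (R * l ^ (?d - 2)) * ennreal (\<eta> l x * Z x) = ennreal (R * Z x) * ennreal (l ^ (?d - 2) * \<eta> l x)"
            using R0 l Z0[OF True] \<eta>01(1)[OF True l] by (simp add: mult_ac flip: ennreal_mult')
          ultimately show ?thesis using True l by simp
        qed simp
      qed
      also have "\<dots> = ennreal (R * Z x) * ((\<integral>\<^sup>+l. ennreal (l ^ (?d - 2)) * indicator {0..w x} l \<partial>lborel) + (\<integral>\<^sup>+l. ennreal (w x ^ ?d * (1 / l\<^sup>2)) * indicator {w x..} l \<partial>lborel))"
        by (simp add: nn_integral_cmult nn_integral_add)
      also have "(\<integral>\<^sup>+l. ennreal (l ^ (?d - 2)) * indicator {0..w x} l \<partial>lborel) = ennreal (w x ^ (?d - 1) / real (?d - 1) - 0 ^ (?d - 1) / real (?d - 1))"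
      proof (rule nn_integral_FTC_Icc)
        have e: "?d - 1 - 1 = ?d - 2" by simp
        show "((\<lambda>l. l ^ (?d - 1) / real (?d - 1)) has_real_derivative l ^ (?d - 2)) (at l)" for l :: real
          using n e by (auto intro!: derivative_eq_intros)
      qed (use w0 in auto)
      also have "(\<integral>\<^sup>+l. ennreal (w x ^ ?d * (1 / l\<^sup>2)) * indicator {w x..} l \<partial>lborel) = ennreal (0 - (- (w x ^ ?d / w x)))"
      proof (rule nn_integral_FTC_atLeast[where F = "\<lambda>l. - (w x ^ ?d / l)" and T = 0])
        show "((\<lambda>l. - (w x ^ ?d / l)) has_real_derivative w x ^ ?d * (1 / l\<^sup>2)) (at l)" if "w x \<le> l" for l
          using that w0 by (auto intro!: derivative_eq_intros simp: power2_eq_square)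
        show "((\<lambda>l. - (w x ^ ?d / l)) \<longlongrightarrow> 0) at_top"
          using tendsto_minus[OF tendsto_divide_0[OF tendsto_const[of "w x ^ ?d"] filterlim_at_top_imp_at_infinity[OF filterlim_ident]]] by simp
      qed (use w0 in auto)
      also have "0 - - (w x ^ ?d / w x) = w x ^ (?d - 1)"
      proof -
        have "w x ^ ?d = w x ^ (?d - 1) * w x" by (metis DIM_positive Suc_pred power_Suc2 One_nat_def)
        thus ?thesis using w0 by simp
      qed
      also have "ennreal (R * Z x) * (ennreal (w x ^ (?d - 1) / real (?d - 1) - 0 ^ (?d - 1) / real (?d - 1)) + ennreal (w x ^ (?d - 1)))
          \<le> ennreal (R * Z x) * (ennreal (w x ^ (?d - 1)) + ennreal (w x ^ (?d - 1)))"
      proof (intro mult_left_mono add_right_mono ennreal_leI)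
        have "w x ^ (?d - 1) * 1 \<le> w x ^ (?d - 1) * real (?d - 1)" using n w0 by (intro mult_left_mono) auto
        thus "w x ^ (?d - 1) / real (?d - 1) - 0 ^ (?d - 1) / real (?d - 1) \<le> w x ^ (?d - 1)"
          using n by (simp add: power_0_left divide_le_eq)
      qed simp
      also have "\<dots> = ennreal (2 * R) * (ennreal (Z x * w x ^ (?d - 1)) * indicator (ball 0 1) x)"
        using True R0 Z0[OF True] w0 by (simp add: algebra_simps flip: ennreal_plus ennreal_mult')
      finally show ?thesis .
    qed simp
  qed
  also have "\<dots> = ennreal (2 * R) * (\<integral>\<^sup>+x. ennreal (Z x * w x ^ (?d - 1)) * indicator (ball 0 1) x \<partial>lborel)"
    by (intro nn_integral_cmult) measurable
  also have "(\<integral>\<^sup>+x. ennreal (Z x * w x ^ (?d - 1)) * indicator (ball 0 1) x \<partial>lborel)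
     = P + ennreal (real ?d) * (\<integral>\<^sup>+x. ennreal (v x * w x ^ ?d) * indicator (ball 0 1) x \<partial>lborel)"
  proof -
    have "(\<integral>\<^sup>+x. ennreal (Z x * w x ^ (?d - 1)) * indicator (ball 0 1) x \<partial>lborel)
       = (\<integral>\<^sup>+x. ennreal (norm (Dv x) * w x ^ (?d - 1)) * indicator (ball 0 1) x + ennreal (real ?d) * (ennreal (v x * w x ^ ?d) * indicator (ball 0 1) x) \<partial>lborel)"
    proof (rule nn_integral_cong)
      fix x :: 'a
      have wd: "w x ^ ?d = w x ^ (?d - 1) * w x" by (metis DIM_positive Suc_pred power_Suc2 One_nat_def)
      show "ennreal (Z x * w x ^ (?d - 1)) * indicator (ball 0 1) x = ennreal (norm (Dv x) * w x ^ (?d - 1)) * indicator (ball 0 1) x + ennreal (real ?d) * (ennreal (v x * w x ^ ?d) * indicator (ball 0 1) x)"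
      proof (cases "norm x < 1")
        case True
        have "ennreal (norm (Dv x) * w x ^ (?d - 1)) + ennreal (real ?d) * ennreal (v x * w x ^ ?d) = ennreal (norm (Dv x) * w x ^ (?d - 1) + real ?d * (v x * w x ^ ?d))"
          using v0[of x] w2[OF True] by (simp add: ennreal_mult' ennreal_plus)
        also have "norm (Dv x) * w x ^ (?d - 1) + real ?d * (v x * w x ^ ?d) = Z x * w x ^ (?d - 1)"
          unfolding wd by (simp add: Z_def algebra_simps)
        finally show ?thesis using True by simp
      qed simp
    qed
    also have "\<dots> = P + ennreal (real ?d) * (\<integral>\<^sup>+x. ennreal (v x * w x ^ ?d) * indicator (ball 0 1) x \<partial>lborel)"
      unfolding P_def by (subst nn_integral_add) (auto simp: nn_integral_cmult)
    finally show ?thesis .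
  qed
  \<comment> \<open>The localization term is absorbed by \<open>hyperbolic_Cheeger\<close>. The
    final constant collects \<open>2 * 3\<close> from here and \<open>4 * ?d\<close> from the left
    side, that is \<open>24 * ?d\<close>.\<close>
  also have "ennreal (2 * R) * (P + ennreal (real ?d) * (\<integral>\<^sup>+x. ennreal (v x * w x ^ ?d) * indicator (ball 0 1) x \<partial>lborel)) \<le> ennreal (2 * R) * (P + 2 * P)"
  proof (intro mult_left_mono add_left_mono)
    show "ennreal (real ?d) * (\<integral>\<^sup>+x. ennreal (v x * w x ^ ?d) * indicator (ball 0 1) x \<partial>lborel) \<le> 2 * P"
      unfolding P_def w_def by (rule hyperbolic_Cheeger[OF v _ \<rho> v0 n]) (rule supp)
  qed auto
  also have "P + 2 * P = 3 * P"
    by (metis distrib_right mult_1 one_add_one add.assoc numeral_plus_one one_plus_numeral semiring_norm(3) semiring_norm(4) semiring_norm(2))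
  also have "ennreal (2 * R) * (3 * P) = ennreal (6 * R) * P"
    using R0 by (simp add: ennreal_mult' mult_ac)
  finally have main: "ennreal (T / (4 * real ?d)) * m \<le> ennreal (6 * R) * P" .
  have "ennreal T * m = ennreal (4 * real ?d) * (ennreal (T / (4 * real ?d)) * m)"
    using T n by (simp add: mult.assoc[symmetric] flip: ennreal_mult')
  also have "\<dots> \<le> ennreal (4 * real ?d) * (ennreal (6 * R) * P)"
    by (intro mult_left_mono main) auto
  also have "\<dots> = ennreal (24 * real ?d * R) * P"
    using R0 by (simp add: mult.assoc[symmetric] flip: ennreal_mult')
  finally show ?thesis by (simp add: m_def P_def R_def w_def)
qed

section \<open>Decreasing rearrangement\<close>

text \<open>The middle condition makes the set in \<open>decr_rearr u s\<close> bounded above for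
  every \<open>s > 0\<close>, so that its supremum is the intended one. Finite superlevel volumes
  give decay of the rearrangement at infinity.\<close>

definition rearrangeable :: "(real^'n::finite \<Rightarrow> real) \<Rightarrow> bool" where
  "rearrangeable u \<longleftrightarrow> u \<in> borel_measurable hypV \<and> (\<forall>s>0. \<exists>t>0. distr_hyp u t \<le> ennreal s)
     \<and> (\<forall>t>0. distr_hyp u t < \<infinity>)"

lemma distr_hyp_antimono:
  assumes [measurable]: "u \<in> borel_measurable hypV" and "t \<le> t'"
  shows "distr_hyp u t' \<le> distr_hyp u t"
  unfolding distr_hyp_def using assms(2) by (intro emeasure_mono) (auto simp del: space_hypV)

lemma distr_hyp_Markov:
  fixes u :: "real^'n::finite \<Rightarrow> real"
  assumes [measurable]: "u \<in> borel_measurable hypV" and t: "t > 0" and p: "p > 0"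
  shows "distr_hyp u t \<le> ennreal (1 / t powr p) * (\<integral>\<^sup>+x. ennreal (\<bar>u x\<bar> powr p) \<partial>hypV)"
proof -
  have "distr_hyp u t = (\<integral>\<^sup>+x. indicator {x \<in> space hypV. \<bar>u x\<bar> > t} x \<partial>hypV)"
    unfolding distr_hyp_def by (subst nn_integral_indicator) (auto simp del: space_hypV)
  also have "\<dots> \<le> (\<integral>\<^sup>+x. ennreal (1 / t powr p) * ennreal (\<bar>u x\<bar> powr p) \<partial>hypV)"
  proof (rule nn_integral_mono)
    fix x assume x: "x \<in> space (hypV :: (real^'n) measure)"
    show "indicator {x \<in> space hypV. \<bar>u x\<bar> > t} x \<le> ennreal (1 / t powr p) * ennreal (\<bar>u x\<bar> powr p)"
    proof (cases "\<bar>u x\<bar> > t")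
      case True
      have "t powr p \<le> \<bar>u x\<bar> powr p" using True t p by (intro powr_mono2) auto
      hence "1 \<le> 1 / t powr p * \<bar>u x\<bar> powr p" using t by (simp add: field_simps)
      hence "1 \<le> ennreal (1 / t powr p * \<bar>u x\<bar> powr p)" by (simp add: ennreal_ge_1)
      also have "\<dots> = ennreal (1 / t powr p) * ennreal (\<bar>u x\<bar> powr p)" by (rule ennreal_mult') simp
      finally show ?thesis using True x by simp
    qed simp
  qed
  also have "\<dots> = ennreal (1 / t powr p) * (\<integral>\<^sup>+x. ennreal (\<bar>u x\<bar> powr p) \<partial>hypV)"
    by (rule nn_integral_cmult) measurable
  finally show ?thesis .
qed

lemma rearrangeable_Lp:
  fixes u :: "real^'n::finite \<Rightarrow> real"
  assumes u: "u \<in> borel_measurable hypV" and p: "p > 0"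
    and fin: "(\<integral>\<^sup>+x. ennreal (\<bar>u x\<bar> powr p) \<partial>hypV) < \<infinity>"
  shows "rearrangeable u"
proof -
  obtain A where A: "(\<integral>\<^sup>+x. ennreal (\<bar>u x\<bar> powr p) \<partial>hypV) = ennreal A" "A \<ge> 0"
    using fin by (cases "\<integral>\<^sup>+x. ennreal (\<bar>u x\<bar> powr p) \<partial>hypV") auto
  have M: "distr_hyp u t \<le> ennreal (A / t powr p)" if "t > 0" for t
    using distr_hyp_Markov[OF u that p] A by (simp flip: ennreal_mult')
  have "\<exists>t>0. distr_hyp u t \<le> ennreal s" if s: "s > 0" for s
  proof (intro exI conjI)
    define t where "t = ((A + 1) / s) powr (1 / p)"
    show t: "t > 0" using A s by (simp add: t_def)
    have "t powr p = (A + 1) / s" using A s p by (simp add: t_def powr_powr)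
    hence "A / t powr p = s * (A / (A + 1))" using A s by simp
    also have "\<dots> \<le> s * 1" using A s by (intro mult_left_mono) auto
    finally have "A / t powr p \<le> s" by simp
    thus "distr_hyp u t \<le> ennreal s" using M[OF t] by (meson ennreal_leI order_trans)
  qed
  moreover have "distr_hyp u t < \<infinity>" if "t > 0" for t using M[OF that] by (simp add: le_less_trans)
  ultimately show ?thesis using u by (simp add: rearrangeable_def)
qed

text \<open>The rearrangement and the distribution function are generalized inverses of each other.
  With strict inequalities on both sides the equivalence is exact, because the superlevel sets of
  \<open>t + 1 / k\<close> increase to that of \<open>t\<close> and the measure is continuous from
  below. Monotonicity, right continuity, measurability and equimeasurability all follow from
  it.\<close>

lemma decr_rearr_gt_iff:
  fixes u :: "real^'n::finite \<Rightarrow> real"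
  assumes u: "rearrangeable u" and s: "s > 0" and t: "t \<ge> 0"
  shows "decr_rearr u s > t \<longleftrightarrow> distr_hyp u t > ennreal s"
proof -
  have um [measurable]: "u \<in> borel_measurable hypV" using u by (simp add: rearrangeable_def)
  let ?S = "insert 0 {y. y > 0 \<and> distr_hyp u y > ennreal s}"
  obtain t0 where t0: "t0 > 0" "distr_hyp u t0 \<le> ennreal s" using u s by (auto simp: rearrangeable_def)
  have "y \<le> t0" if "y \<in> ?S" for y
  proof (rule ccontr)
    assume "\<not> y \<le> t0"
    hence "distr_hyp u y \<le> distr_hyp u t0" by (intro distr_hyp_antimono[OF um]) auto
    thus False using that t0 \<open>\<not> y \<le> t0\<close> by auto
  qed
  hence bdd: "bdd_above ?S" by (auto intro!: bdd_aboveI)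
  have "decr_rearr u s > t \<longleftrightarrow> (\<exists>y\<in>?S. t < y)"
    unfolding decr_rearr_def by (rule less_cSup_iff[OF _ bdd]) auto
  also have "\<dots> \<longleftrightarrow> distr_hyp u t > ennreal s"
  proof
    assume "\<exists>y\<in>?S. t < y"
    then obtain y where y: "y > t" "distr_hyp u y > ennreal s" using t by auto
    have "distr_hyp u y \<le> distr_hyp u t" by (rule distr_hyp_antimono[OF um]) (use y in auto)
    thus "distr_hyp u t > ennreal s" using y by simp
  next
    assume gt: "distr_hyp u t > ennreal s"
    let ?A = "\<lambda>k. {x \<in> space hypV. \<bar>u x\<bar> > t + inverse (real (Suc k))}"
    have "incseq ?A"
    proof (intro incseq_SucI subsetI)
      fix k x assume "x \<in> ?A k"
      moreover have "inverse (real (Suc (Suc k))) \<le> inverse (real (Suc k))" by (simp add: field_simps)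
      ultimately show "x \<in> ?A (Suc k)" by (auto intro: le_less_trans[rotated])
    qed
    have "(SUP k. emeasure hypV (?A k)) = emeasure hypV (\<Union>k. ?A k)"
      by (rule SUP_emeasure_incseq[OF _ \<open>incseq ?A\<close>]) (auto simp del: space_hypV)
    also have "(\<Union>k. ?A k) = {x \<in> space hypV. \<bar>u x\<bar> > t}"
    proof (intro equalityI subsetI)
      fix x assume x: "x \<in> {x \<in> space hypV. \<bar>u x\<bar> > t}"
      hence "\<bar>u x\<bar> - t > 0" by simp
      then obtain k where "inverse (real (Suc k)) < \<bar>u x\<bar> - t" using reals_Archimedean by blast
      hence "t + inverse (real (Suc k)) < \<bar>u x\<bar>" by linarith
      thus "x \<in> (\<Union>k. ?A k)" using x by blast
    next
      fix x assume "x \<in> (\<Union>k. ?A k)"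
      then obtain k where k: "x \<in> space hypV" "\<bar>u x\<bar> > t + inverse (real (Suc k))" by blast
      moreover have "inverse (real (Suc k)) > 0" by simp
      ultimately have "\<bar>u x\<bar> > t" by linarith
      thus "x \<in> {x \<in> space hypV. \<bar>u x\<bar> > t}" using k by simp
    qed
    finally have "ennreal s < (SUP k. emeasure hypV (?A k))" using gt by (simp add: distr_hyp_def)
    then obtain k where k: "ennreal s < emeasure hypV (?A k)" by (auto simp: less_SUP_iff)
    have "t + inverse (real (Suc k)) \<in> ?S" using k t by (auto simp: distr_hyp_def add_nonneg_pos)
    thus "\<exists>y\<in>?S. t < y" by (rule bexI[rotated]) simp
  qed
  finally show ?thesis .
qed

lemma decr_rearr_nonneg:
  assumes u: "rearrangeable u" and s: "s > 0"
  shows "decr_rearr u s \<ge> 0"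
proof (rule ccontr)
  assume "\<not> 0 \<le> decr_rearr u s"
  have um: "u \<in> borel_measurable hypV" using u by (simp add: rearrangeable_def)
  obtain t0 where t0: "t0 > 0" "distr_hyp u t0 \<le> ennreal s" using u s by (auto simp: rearrangeable_def)
  have "y \<le> t0" if "y \<in> insert 0 {y. y > 0 \<and> distr_hyp u y > ennreal s}" for y
  proof (rule ccontr)
    assume "\<not> y \<le> t0"
    hence "distr_hyp u y \<le> distr_hyp u t0" by (intro distr_hyp_antimono[OF um]) auto
    thus False using that t0 \<open>\<not> y \<le> t0\<close> by auto
  qed
  hence "0 \<le> decr_rearr u s" unfolding decr_rearr_def by (intro cSup_upper bdd_aboveI[of _ t0]) blast+
  thus False using \<open>\<not> 0 \<le> decr_rearr u s\<close> by simp
qed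

lemma decr_rearr_antimono:
  assumes u: "rearrangeable u" and s: "0 < s" "s \<le> t"
  shows "decr_rearr u t \<le> decr_rearr u s"
proof (rule ccontr)
  assume "\<not> decr_rearr u t \<le> decr_rearr u s"
  hence "distr_hyp u (decr_rearr u s) > ennreal t"
    using decr_rearr_gt_iff[OF u, of t "decr_rearr u s"] decr_rearr_nonneg[OF u s(1)] s by simp
  moreover have "ennreal s \<le> ennreal t" using s by (intro ennreal_leI) auto
  ultimately have "distr_hyp u (decr_rearr u s) > ennreal s" by simp
  thus False using decr_rearr_gt_iff[OF u s(1) decr_rearr_nonneg[OF u s(1)]] by simp
qed

lemma distr_hyp_decr_rearr_le:
  assumes u: "rearrangeable u" and s: "s > 0"
  shows "distr_hyp u (decr_rearr u s) \<le> ennreal s"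
  using decr_rearr_gt_iff[OF u s decr_rearr_nonneg[OF u s]] by simp

text \<open>Strictness again: a strict inequality \<open>s < distr_hyp u y\<close> persists for
  slightly larger \<open>s\<close>, which gives the lower bound, and monotonicity gives the upper
  one. Right continuity is what the construction of a Stieltjes measure from the rearrangement
  requires.\<close>

lemma decr_rearr_right_continuous:
  assumes u: "rearrangeable u" and s: "s > 0"
  shows "(decr_rearr u \<longlongrightarrow> decr_rearr u s) (at_right s)"
proof (rule order_tendstoI)
  fix y assume y: "y < decr_rearr u s"
  show "\<forall>\<^sub>F t in at_right s. y < decr_rearr u t"
  proof (cases "y \<ge> 0")
    case True
    hence "ennreal s < distr_hyp u y" using decr_rearr_gt_iff[OF u s True] y by simp
    then obtain s' where s': "s < s'" "ennreal s' < distr_hyp u y"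
    proof (cases "distr_hyp u y")
      case (real z)
      hence "s < z" using \<open>ennreal s < distr_hyp u y\<close> s by (simp add: ennreal_less_iff)
      hence "s < (s + z) / 2" "ennreal ((s + z) / 2) < distr_hyp u y" using real s by (auto simp: ennreal_less_iff)
      thus ?thesis using that by blast
    qed (use that[of "s + 1"] in auto)
    show ?thesis
      using eventually_at_right_real[OF s'(1)]
    proof eventually_elim
      case (elim t)
      hence "ennreal t < distr_hyp u y" using s' by (meson ennreal_leI greaterThanLessThan_iff le_less_trans less_imp_le)
      thus ?case using decr_rearr_gt_iff[OF u _ True, of t] elim s by auto
    qed
  next
    case False
    show ?thesis
      using eventually_at_right_less[of s]
    proof eventually_elim
      case (elim t)
      thus ?case using decr_rearr_nonneg[OF u, of t] s False by linarith
    qed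
  qed
next
  fix y assume y: "y > decr_rearr u s"
  show "\<forall>\<^sub>F t in at_right s. y > decr_rearr u t"
    using eventually_at_right_less[of s]
  proof eventually_elim
    case (elim t)
    thus ?case using decr_rearr_antimono[OF u s, of t] y by linarith
  qed
qed

lemma decr_rearr_borel_measurable:
  assumes u: "rearrangeable u"
  shows "(\<lambda>s. decr_rearr u s * indicator {0<..} s) \<in> borel_measurable borel"
proof (rule borel_measurableI_greater)
  fix y :: real
  show "{s \<in> space borel. y < decr_rearr u s * indicator {0<..} s} \<in> sets borel"
  proof (cases "y \<ge> 0")
    case True
    have "{s \<in> space borel. y < decr_rearr u s * indicator {0<..} s} = {s. 0 < s \<and> ennreal s < distr_hyp u y}"
      using True decr_rearr_gt_iff[OF u _ True] by (auto simp: indicator_def)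
    also have "\<dots> \<in> sets borel" by measurable
    finally show ?thesis .
  next
    case False
    have "{s \<in> space borel. y < decr_rearr u s * indicator {0<..} s} = UNIV"
      using False decr_rearr_nonneg[OF u] by (auto simp: indicator_def not_le intro: less_le_trans)
    thus ?thesis by simp
  qed
qed

section \<open>Equimeasurability and stability under convergence in measure\<close>

lemma sigma_finite_hypV: "sigma_finite_measure (hypV :: (real^'n::finite) measure)"
proof
  let ?A = "range (\<lambda>k::nat. ball (0::real^'n) (1 - 1 / real (Suc k)))"
  show "\<exists>A. countable A \<and> A \<subseteq> sets (hypV :: (real^'n) measure) \<and> \<Union>A = space hypV \<and> (\<forall>a\<in>A. emeasure hypV a \<noteq> \<infinity>)"
  proof (intro exI[of _ ?A] conjI)
    show "\<Union>?A = space hypV"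
    proof (intro equalityI subsetI)
      fix x :: "real^'n" assume "x \<in> space hypV"
      hence "1 - norm x > 0" by simp
      then obtain k where "inverse (real (Suc k)) < 1 - norm x" using reals_Archimedean by blast
      hence "x \<in> ball 0 (1 - 1 / real (Suc k))" by (simp add: inverse_eq_divide)
      thus "x \<in> \<Union>?A" by blast
    next
      fix x :: "real^'n" assume "x \<in> \<Union>?A"
      then obtain k :: nat where "norm x < 1 - 1 / real (Suc k)" by auto
      moreover have "1 / real (Suc k) > 0" by simp
      ultimately have "norm x < 1" by linarith
      thus "x \<in> space hypV" by simp
    qed
    have "emeasure (hypV :: (real^'n) measure) (ball 0 (1 - 1 / real (Suc k))) \<noteq> \<infinity>" for k
      by (subst emeasure_hypV_ball) auto
    thus "\<forall>a\<in>?A. emeasure hypV a \<noteq> \<infinity>" by blast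
    have "ball (0::real^'n) (1 - 1 / real (Suc k)) \<in> sets hypV" for k
    proof -
      have "ball 0 1 \<inter> ball (0::real^'n) (1 - 1 / real (Suc k)) = ball 0 (1 - 1 / real (Suc k))"
        using subset_ball[of "1 - 1 / real (Suc k)" 1 "0::real^'n"] by auto
      thus ?thesis unfolding sets_hypV sets_restrict_space
        by (metis (no_types, lifting) imageI lmeasurable_ball fmeasurableD)
    qed
    thus "?A \<subseteq> sets hypV" by blast
  qed auto
qed

lemma nn_integral_layer_cake:
  fixes g :: "'a \<Rightarrow> real"
  assumes "sigma_finite_measure M" and [measurable]: "g \<in> borel_measurable M" and g0: "\<And>x. x \<in> space M \<Longrightarrow> g x \<ge> 0"
  shows "(\<integral>\<^sup>+x. ennreal (g x) \<partial>M) = (\<integral>\<^sup>+t. emeasure M {x \<in> space M. g x > t} * indicator {0<..} t \<partial>lborel)"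
proof -
  interpret M: sigma_finite_measure M by fact
  interpret P: pair_sigma_finite lborel M ..
  have "(\<integral>\<^sup>+x. ennreal (g x) \<partial>M) = (\<integral>\<^sup>+x. (\<integral>\<^sup>+t. (if 0 < t \<and> t < g x then 1 else 0) \<partial>lborel) \<partial>M)"
  proof (rule nn_integral_cong)
    fix x assume "x \<in> space M"
    have "(\<integral>\<^sup>+t. (if 0 < t \<and> t < g x then 1 else 0) \<partial>lborel) = (\<integral>\<^sup>+t. indicator {0<..<g x} t \<partial>lborel)"
      by (intro nn_integral_cong) auto
    thus "ennreal (g x) = (\<integral>\<^sup>+t. (if 0 < t \<and> t < g x then 1 else 0) \<partial>lborel)" using g0[OF \<open>x \<in> space M\<close>] by simp
  qed
  also have "\<dots> = (\<integral>\<^sup>+t. (\<integral>\<^sup>+x. (if 0 < t \<and> t < g x then 1 else 0) \<partial>M) \<partial>lborel)"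
    by (rule P.Fubini') measurable
  also have "\<dots> = (\<integral>\<^sup>+t. emeasure M {x \<in> space M. g x > t} * indicator {0<..} t \<partial>lborel)"
  proof (rule nn_integral_cong)
    fix t :: real
    have "(\<integral>\<^sup>+x. (if 0 < t \<and> t < g x then 1 else 0) \<partial>M) = (\<integral>\<^sup>+x. indicator {0<..} t * indicator {x \<in> space M. g x > t} x \<partial>M)"
      by (intro nn_integral_cong) (auto simp: indicator_def)
    thus "(\<integral>\<^sup>+x. (if 0 < t \<and> t < g x then 1 else 0) \<partial>M) = emeasure M {x \<in> space M. g x > t} * indicator {0<..} t"
      by (subst (asm) nn_integral_cmult_indicator) (auto simp: mult.commute)
  qed
  finally show ?thesis .
qed

text \<open>Layer cake on both sides: the points where the rearrangement exceeds \<open>y\<close>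
  form the interval of those \<open>s\<close> below \<open>distr_hyp u y\<close>, whose length is
  the volume of the superlevel set of \<open>u\<close>.\<close>

lemma nn_integral_decr_rearr_powr:
  fixes u :: "real^'n::finite \<Rightarrow> real"
  assumes u: "rearrangeable u" and p: "p > 0"
  shows "(\<integral>\<^sup>+s. ennreal (decr_rearr u s powr p) * indicator {0<..} s \<partial>lborel) = (\<integral>\<^sup>+x. ennreal (\<bar>u x\<bar> powr p) \<partial>hypV)"
proof -
  have um [measurable]: "u \<in> borel_measurable hypV" using u by (simp add: rearrangeable_def)
  note [measurable] = decr_rearr_borel_measurable[OF u]
  let ?f = "\<lambda>s. decr_rearr u s * indicator {0<..} s"
  have root: "y < z powr p \<longleftrightarrow> y powr (1 / p) < z" if "y > 0" "z \<ge> 0" for y z :: real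
  proof -
    have "y < z powr p \<longleftrightarrow> (y powr (1 / p)) powr p < z powr p" using that p by (simp add: powr_powr)
    also have "\<dots> \<longleftrightarrow> y powr (1 / p) < z"
      using that p by (smt (verit) powr_ge_zero powr_less_mono2 powr_mono2)
    finally show ?thesis .
  qed
  have "(\<integral>\<^sup>+s. ennreal (decr_rearr u s powr p) * indicator {0<..} s \<partial>lborel) = (\<integral>\<^sup>+s. ennreal (?f s powr p) \<partial>lborel)"
    using p by (intro nn_integral_cong) (auto simp: indicator_def)
  also have "\<dots> = (\<integral>\<^sup>+t. emeasure lborel {s \<in> space lborel. ?f s powr p > t} * indicator {0<..} t \<partial>lborel)"
    by (rule nn_integral_layer_cake) (auto intro: lborel.sigma_finite_measure_axioms)
  also have "\<dots> = (\<integral>\<^sup>+t. emeasure hypV {x \<in> space (hypV :: (real^'n) measure). \<bar>u x\<bar> powr p > t} * indicator {0<..} t \<partial>lborel)"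
  proof (rule nn_integral_cong)
    fix t :: real
    show "emeasure lborel {s \<in> space lborel. ?f s powr p > t} * indicator {0<..} t = emeasure hypV {x \<in> space (hypV :: (real^'n) measure). \<bar>u x\<bar> powr p > t} * indicator {0<..} t"
    proof (cases "t > 0")
      case True
      define y where "y = t powr (1 / p)"
      have y: "y > 0" using True by (simp add: y_def)
      have f0: "?f s \<ge> 0" for s using decr_rearr_nonneg[OF u] by (simp add: indicator_def)
      have "{s \<in> space lborel. ?f s powr p > t} = {s. 0 < s \<and> ennreal s < distr_hyp u y}"
        using root[OF True f0] decr_rearr_gt_iff[OF u, of _ y] y by (auto simp: y_def indicator_def split: if_splits)
      also have "emeasure lborel \<dots> = distr_hyp u y"
      proof (cases "distr_hyp u y")
        case (real r)
        hence "{s. 0 < s \<and> ennreal s < distr_hyp u y} = {0<..<r}" by (auto simp: ennreal_less_iff)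
        thus ?thesis using real by simp
      next
        case top
        moreover have "distr_hyp u y < \<infinity>" using u y by (simp add: rearrangeable_def)
        ultimately show ?thesis by simp
      qed
      also have "distr_hyp u y = emeasure hypV {x \<in> space (hypV :: (real^'n) measure). \<bar>u x\<bar> powr p > t}"
        unfolding distr_hyp_def using root[OF True] by (intro arg_cong[where f = "emeasure hypV"]) (auto simp: y_def)
      finally show ?thesis by simp
    qed simp
  qed
  also have "\<dots> = (\<integral>\<^sup>+x. ennreal (\<bar>u x\<bar> powr p) \<partial>hypV)"
    by (rule nn_integral_layer_cake[symmetric, OF sigma_finite_hypV]) auto
  finally show ?thesis .
qed

text \<open>If \<open>a\<close> exceeds \<open>t + \<epsilon>\<close> in absolute value, then either
  \<open>b\<close> exceeds \<open>t\<close> or \<open>a - b\<close> exceeds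
  \<open>\<epsilon>\<close>. Closeness in measure thus costs \<open>\<epsilon>\<close> in height and
  \<open>\<eta>\<close> in volume.\<close>

lemma decr_rearr_shift:
  fixes a b :: "real^'n::finite \<Rightarrow> real"
  assumes a: "rearrangeable a" and b: "rearrangeable b" and s: "s > 0" and \<eta>: "\<eta> > 0" and \<epsilon>: "\<epsilon> > 0"
    and le: "distr_hyp (\<lambda>x. a x - b x) \<epsilon> \<le> ennreal \<eta>"
  shows "decr_rearr a (s + \<eta>) \<le> decr_rearr b s + \<epsilon>"
proof (rule ccontr)
  have [measurable]: "a \<in> borel_measurable hypV" "b \<in> borel_measurable hypV" using a b by (simp_all add: rearrangeable_def)
  define t where "t = decr_rearr b s"
  have t: "t \<ge> 0" using decr_rearr_nonneg[OF b s] by (simp add: t_def)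
  assume "\<not> decr_rearr a (s + \<eta>) \<le> decr_rearr b s + \<epsilon>"
  hence "ennreal (s + \<eta>) < distr_hyp a (t + \<epsilon>)"
    using decr_rearr_gt_iff[OF a, of "s + \<eta>" "t + \<epsilon>"] s \<eta> \<epsilon> t by (simp add: t_def)
  also have "\<dots> \<le> emeasure hypV ({x \<in> space hypV. \<bar>b x\<bar> > t} \<union> {x \<in> space hypV. \<bar>a x - b x\<bar> > \<epsilon>})"
    unfolding distr_hyp_def by (intro emeasure_mono) (auto simp del: space_hypV)
  also have "\<dots> \<le> distr_hyp b t + distr_hyp (\<lambda>x. a x - b x) \<epsilon>"
    unfolding distr_hyp_def by (intro emeasure_subadditive) (auto simp del: space_hypV)
  also have "\<dots> \<le> ennreal s + ennreal \<eta>"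
    using distr_hyp_decr_rearr_le[OF b s] le by (intro add_mono) (auto simp: t_def)
  finally show False using s \<eta> by (simp flip: ennreal_plus)
qed

text \<open>The shift by \<open>\<eta>\<close> in the volume variable, applied in both directions,
  sandwiches the approximating value between values of the limit at \<open>s - \<eta>\<close> and
  \<open>s + \<eta>\<close>; continuity at \<open>s\<close> closes the gap. A monotone function has
  only countably many discontinuities, so convergence holds almost everywhere.\<close>

lemma decr_rearr_tendsto:
  fixes u :: "real^'n::finite \<Rightarrow> real" and \<phi> :: "nat \<Rightarrow> real^'n \<Rightarrow> real"
  assumes u: "rearrangeable u" and \<phi>: "\<And>k. rearrangeable (\<phi> k)"
    and conv: "\<And>\<epsilon>. \<epsilon> > 0 \<Longrightarrow> (\<lambda>k. distr_hyp (\<lambda>x. \<phi> k x - u x) \<epsilon>) \<longlonglongrightarrow> 0"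
    and s: "s > 0" and cont: "isCont (decr_rearr u) s"
  shows "(\<lambda>k. decr_rearr (\<phi> k) s) \<longlonglongrightarrow> decr_rearr u s"
proof (rule LIMSEQ_I)
  fix e :: real assume e: "e > 0"
  obtain d where d: "d > 0" "\<And>t. dist t s < d \<Longrightarrow> dist (decr_rearr u t) (decr_rearr u s) < e / 2"
    using cont e unfolding continuous_at_eps_delta dist_real_def by (metis half_gt_zero)
  define \<eta> where "\<eta> = min (d / 2) (s / 2)"
  have \<eta>: "\<eta> > 0" "\<eta> < d" "\<eta> < s" using d s by (auto simp: \<eta>_def)
  have near: "\<bar>decr_rearr u (s + \<eta>) - decr_rearr u s\<bar> < e / 2" "\<bar>decr_rearr u (s - \<eta>) - decr_rearr u s\<bar> < e / 2"
    using d(2)[of "s + \<eta>"] d(2)[of "s - \<eta>"] \<eta> by (auto simp: dist_real_def)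
  have "\<forall>\<^sub>F k in sequentially. distr_hyp (\<lambda>x. \<phi> k x - u x) (e / 2) < ennreal \<eta>"
    using conv[of "e / 2"] e \<eta> by (intro order_tendstoD(2)) auto
  hence "\<forall>\<^sub>F k in sequentially. norm (decr_rearr (\<phi> k) s - decr_rearr u s) < e"
  proof eventually_elim
    case (elim k)
    have "decr_rearr (\<phi> k) (s - \<eta> + \<eta>) \<le> decr_rearr u (s - \<eta>) + e / 2"
      by (rule decr_rearr_shift[OF \<phi> u]) (use elim \<eta> e in auto)
    moreover have "distr_hyp (\<lambda>x. u x - \<phi> k x) (e / 2) = distr_hyp (\<lambda>x. \<phi> k x - u x) (e / 2)"
      by (simp add: distr_hyp_def abs_minus_commute)
    hence "decr_rearr u (s + \<eta>) \<le> decr_rearr (\<phi> k) s + e / 2"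
      by (intro decr_rearr_shift[OF u \<phi>]) (use elim \<eta> e s in auto)
    ultimately have "decr_rearr (\<phi> k) s - decr_rearr u s < e" "decr_rearr u s - decr_rearr (\<phi> k) s < e"
      using near[unfolded abs_less_iff] unfolding diff_add_cancel by linarith+
    thus ?case by (simp add: abs_less_iff)
  qed
  thus "\<exists>k0. \<forall>k\<ge>k0. norm (decr_rearr (\<phi> k) s - decr_rearr u s) < e" by (simp add: eventually_sequentially)
qed

lemma decr_rearr_isCont_AE:
  assumes u: "rearrangeable u"
  shows "AE s in lborel. s > 0 \<longrightarrow> isCont (decr_rearr u) s"
proof -
  have "mono_on {0<..} (\<lambda>s. - decr_rearr u s)"
    by (auto intro!: mono_onI decr_rearr_antimono[OF u])
  hence "countable {s \<in> {0<..}. \<not> isCont (\<lambda>s. - decr_rearr u s) s}"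
    by (intro mono_on_ctble_discont_open) auto
  moreover have "isCont (\<lambda>s. - decr_rearr u s) s \<longleftrightarrow> isCont (decr_rearr u) s" for s
    by (simp add: isCont_def tendsto_minus_cancel_left[symmetric])
  ultimately have "countable {s. 0 < s \<and> \<not> isCont (decr_rearr u) s}" by simp
  hence "{s. 0 < s \<and> \<not> isCont (decr_rearr u) s} \<in> null_sets lborel" by (rule countable_imp_null_set_lborel)
  from AE_not_in[OF this] show ?thesis by eventually_elim auto
qed

section \<open>Level sets of test functions\<close>

lemma DERIV_pos_part_square: "((\<lambda>u::real. (max 0 u)\<^sup>2) has_real_derivative 2 * max 0 u) (at u)"
proof (cases u "0::real" rule: linorder_cases)
  case less
  have "((\<lambda>u::real. 0) has_real_derivative 0) (at u)" by simp
  hence "((\<lambda>u::real. (max 0 u)\<^sup>2) has_real_derivative 0) (at u)"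
    by (rule has_field_derivative_transform_within_open[of _ _ _ "{..<0}"]) (use less in auto)
  thus ?thesis using less by simp
next
  case greater
  have "((\<lambda>u::real. u\<^sup>2) has_real_derivative 2 * u) (at u)" by (auto intro!: derivative_eq_intros)
  hence "((\<lambda>u::real. (max 0 u)\<^sup>2) has_real_derivative 2 * u) (at u)"
    by (rule has_field_derivative_transform_within_open[of _ _ _ "{0<..}"]) (use greater in auto)
  thus ?thesis using greater by simp
next
  case equal
  have "((\<lambda>h::real. (max 0 h)\<^sup>2 / h) \<longlongrightarrow> 0) (at 0)"
  proof (rule Lim_null_comparison)
    show "\<forall>\<^sub>F h in at (0::real). norm ((max 0 h)\<^sup>2 / h) \<le> \<bar>h\<bar>"
      by (intro always_eventually allI) (auto simp: max_def power2_eq_square)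
    show "((\<lambda>h::real. \<bar>h\<bar>) \<longlongrightarrow> 0) (at 0)" by (auto intro!: tendsto_eq_intros)
  qed
  thus ?thesis using equal by (simp add: DERIV_def)
qed

text \<open>A transition from 0 to 1 of class C1, made of two parabolas: \<open>2 * u ^ 2\<close> up
  to \<open>1 / 2\<close> and \<open>1 - 2 * (1 - u) ^ 2\<close> from there to 1. Writing it with
  positive parts avoids case distinctions in the differentiation; the derivative
  \<open>dstep\<close> is a tent of height 2.\<close>

definition step :: "real \<Rightarrow> real" where
  "step u = 2 * ((max 0 u)\<^sup>2 - 2 * (max 0 (u - 1/2))\<^sup>2 + (max 0 (u - 1))\<^sup>2)"

definition dstep :: "real \<Rightarrow> real" where
  "dstep u = 4 * (max 0 u - 2 * max 0 (u - 1/2) + max 0 (u - 1))"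

lemma DERIV_step: "(step has_real_derivative dstep u) (at u)"
proof -
  have shift: "((\<lambda>u::real. (max 0 (u - c))\<^sup>2) has_real_derivative 2 * max 0 (u - c) * 1) (at u)" for c
    by (rule DERIV_chain2[OF DERIV_pos_part_square]) (auto intro!: derivative_eq_intros)
  show ?thesis unfolding step_def[abs_def] dstep_def
    by (rule derivative_eq_intros DERIV_pos_part_square shift refl)+ (simp add: algebra_simps)
qed

lemma continuous_on_dstep: "continuous_on S dstep"
  unfolding dstep_def[abs_def] by (intro continuous_intros)

lemma step_bounds: "0 \<le> step u" "step u \<le> 1" "u \<le> 0 \<Longrightarrow> step u = 0" "1 \<le> u \<Longrightarrow> step u = 1"
proof -
  have A: "step u = 0" if "u \<le> 0" using that by (simp add: step_def)
  have B: "step u = 1" if "1 \<le> u" using that by (simp add: step_def power2_eq_square algebra_simps)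
  show "u \<le> 0 \<Longrightarrow> step u = 0" "1 \<le> u \<Longrightarrow> step u = 1" by (fact A, fact B)
  consider "u \<le> 0" | "0 \<le> u" "u \<le> 1/2" | "1/2 \<le> u" "u \<le> 1" | "1 \<le> u" by linarith
  hence "0 \<le> step u \<and> step u \<le> 1"
  proof cases
    case 2
    have "step u = 2 * u\<^sup>2" using 2 by (simp add: step_def)
    moreover have "u\<^sup>2 \<le> (1/2)\<^sup>2" using 2 by (intro power_mono) auto
    ultimately show ?thesis by (simp add: power2_eq_square)
  next
    case 3
    have "step u = 1 - 2 * (1 - u)\<^sup>2" using 3 by (simp add: step_def power2_eq_square algebra_simps)
    moreover have "(1 - u)\<^sup>2 \<le> (1/2)\<^sup>2" using 3 by (intro power_mono) auto
    ultimately show ?thesis by (simp add: power_divide)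
  qed (simp_all add: A B)
  thus "0 \<le> step u" "step u \<le> 1" by auto
qed

lemma dstep_bounds: "0 \<le> dstep u" "dstep u \<le> 2" "u \<le> 0 \<or> 1 \<le> u \<Longrightarrow> dstep u = 0"
  by (auto simp: dstep_def max_def)

text \<open>A C1 version of clamping the absolute value of \<open>f\<close> to the range from
  \<open>\<tau>\<close> to \<open>t\<close> and subtracting \<open>\<tau>\<close>. One rescaled
  \<open>step\<close> acts on \<open>f\<close> and one on \<open>- f\<close>; at most one of them is
  nonzero at any point since \<open>\<tau> \<ge> 0\<close>. The slope 2 of \<open>step\<close> is
  the factor 2 in the gradient bound, and the gradient lives on the open band because
  \<open>dstep\<close> vanishes at both ends.\<close>

lemma C1c_truncation:
  fixes f :: "'a::euclidean_space \<Rightarrow> real"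
  assumes f: "C1c f D" and \<tau>: "0 \<le> \<tau>" "\<tau> < t"
  obtains v Dv where "C1c v Dv" "\<And>x. 0 \<le> v x" "\<And>x. v x \<le> t - \<tau>" "\<And>x. t \<le> \<bar>f x\<bar> \<Longrightarrow> v x = t - \<tau>"
    "\<And>x. v x \<noteq> 0 \<Longrightarrow> \<tau> < \<bar>f x\<bar>" "\<And>x. norm (Dv x) \<le> 2 * norm (D x) * (if \<tau> < \<bar>f x\<bar> \<and> \<bar>f x\<bar> < t then 1 else 0)"
proof -
  define a where "a = t - \<tau>"
  have a: "a > 0" using \<tau> by (simp add: a_def)
  define v where "v x = a * step ((f x - \<tau>) / a) + a * step ((- f x - \<tau>) / a)" for x
  define c where "c x = dstep ((f x - \<tau>) / a) - dstep ((- f x - \<tau>) / a)" for x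
  have arg: "(y - \<tau>) / a \<le> 0 \<longleftrightarrow> y \<le> \<tau>" "1 \<le> (y - \<tau>) / a \<longleftrightarrow> t \<le> y" for y
    using a by (auto simp: divide_le_0_iff le_divide_eq_1_pos a_def)
  have st: "v x \<ge> 0" "v x \<le> a" "t \<le> \<bar>f x\<bar> \<Longrightarrow> v x = a" "v x \<noteq> 0 \<Longrightarrow> \<tau> < \<bar>f x\<bar>" for x
  proof -
    have z: "step ((f x - \<tau>) / a) = 0 \<or> step ((- f x - \<tau>) / a) = 0"
      using step_bounds(3)[of "(f x - \<tau>) / a"] step_bounds(3)[of "(- f x - \<tau>) / a"] arg(1) \<tau> by (cases "f x \<ge> 0") auto
    show "v x \<ge> 0" using a step_bounds(1) by (simp add: v_def)
    show "v x \<le> a" using z a step_bounds(2) by (auto simp: v_def)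
    show "v x = a" if "t \<le> \<bar>f x\<bar>"
    proof -
      have "step ((f x - \<tau>) / a) = 1 \<or> step ((- f x - \<tau>) / a) = 1"
        using that step_bounds(4)[of "(f x - \<tau>) / a"] step_bounds(4)[of "(- f x - \<tau>) / a"] arg(2) by (cases "f x \<ge> 0") auto
      thus ?thesis using z by (auto simp: v_def)
    qed
    show "\<tau> < \<bar>f x\<bar>" if "v x \<noteq> 0"
    proof (rule ccontr)
      assume "\<not> \<tau> < \<bar>f x\<bar>"
      hence "f x \<le> \<tau>" "- f x \<le> \<tau>" by auto
      hence "step ((f x - \<tau>) / a) = 0" "step ((- f x - \<tau>) / a) = 0"
        using step_bounds(3) arg(1) by blast+
      thus False using that by (simp add: v_def)
    qed
  qed
  have cb: "\<bar>c x\<bar> \<le> 2 * (if \<tau> < \<bar>f x\<bar> \<and> \<bar>f x\<bar> < t then 1 else 0)" for x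
  proof (cases "\<tau> < \<bar>f x\<bar> \<and> \<bar>f x\<bar> < t")
    case True
    thus ?thesis using dstep_bounds(1,2)[of "(f x - \<tau>) / a"] dstep_bounds(1,2)[of "(- f x - \<tau>) / a"]
      by (simp add: c_def)
  next
    case False
    hence "(f x \<le> \<tau> \<or> t \<le> f x) \<and> (- f x \<le> \<tau> \<or> t \<le> - f x)" using \<tau> by auto
    hence "dstep ((f x - \<tau>) / a) = 0" "dstep ((- f x - \<tau>) / a) = 0"
      using dstep_bounds(3) arg by blast+
    thus ?thesis by (simp add: c_def)
  qed
  have "C1c v (\<lambda>x. c x *\<^sub>R D x)"
    unfolding C1c_def
  proof (intro conjI allI)
    fix x
    have "((\<lambda>y. a * step ((y - \<tau>) / a) + a * step ((- y - \<tau>) / a)) has_real_derivative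
        a * (dstep ((f x - \<tau>) / a) * (1 / a)) + a * (dstep ((- f x - \<tau>) / a) * (- 1 / a))) (at (f x))"
      using a by (intro DERIV_add DERIV_cmult DERIV_chain2[OF DERIV_step]) (auto intro!: derivative_eq_intros)
    also have "a * (dstep ((f x - \<tau>) / a) * (1 / a)) + a * (dstep ((- f x - \<tau>) / a) * (- 1 / a)) = c x"
      using a by (simp add: c_def)
    finally have "((\<lambda>y. a * step ((y - \<tau>) / a) + a * step ((- y - \<tau>) / a)) has_derivative (\<lambda>h. c x * h)) (at (f x))"
      by (simp only: has_field_derivative_def)
    from has_derivative_compose[OF C1c_derivative[OF f] this]
    show "(v has_derivative (\<lambda>h. (c x *\<^sub>R D x) \<bullet> h)) (at x)"
      unfolding v_def by simp
  next
    show "continuous_on UNIV (\<lambda>x. c x *\<^sub>R D x)"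
      unfolding c_def using a
      by (intro continuous_intros continuous_on_compose2[OF continuous_on_dstep[of UNIV]] C1c_continuous[OF f] C1c_continuous_grad[OF f]) auto
    have "{x. v x \<noteq> 0} \<subseteq> {x. f x \<noteq> 0}" using st(4) \<tau> by fastforce
    thus "bounded {x. v x \<noteq> 0}" using f by (auto simp: C1c_def intro: bounded_subset)
  qed
  moreover have "norm (c x *\<^sub>R D x) \<le> 2 * norm (D x) * (if \<tau> < \<bar>f x\<bar> \<and> \<bar>f x\<bar> < t then 1 else 0)" for x
    using mult_right_mono[OF cb[of x] norm_ge_zero[of "D x"]] by (simp add: mult_ac)
  ultimately show ?thesis using st that[of v "\<lambda>x. c x *\<^sub>R D x"] unfolding a_def by blast
qed

lemma test_fun_support:
  assumes "test_fun (ball 0 1) \<phi>"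
  obtains \<rho> where "\<rho> < 1" "\<And>x. norm x \<ge> \<rho> \<Longrightarrow> \<phi> x = 0"
proof -
  define K where "K = closure {x. \<phi> x \<noteq> 0}"
  have K: "compact K" "K \<subseteq> ball 0 1" using assms by (auto simp: test_fun_def K_def)
  have sub: "{x. \<phi> x \<noteq> 0} \<subseteq> K" by (simp add: K_def closure_subset)
  show ?thesis
  proof (cases "K = {}")
    case True
    thus ?thesis using sub by (intro that[of 0]) auto
  next
    case False
    then obtain x0 where x0: "x0 \<in> K" "\<And>x. x \<in> K \<Longrightarrow> norm x \<le> norm x0"
      using continuous_attains_sup[OF K(1) False, of norm] by (auto intro: continuous_on_norm_id)
    have "norm x0 < 1" using x0 K by auto
    have "\<phi> x = 0" if "norm x \<ge> (1 + norm x0) / 2" for x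
    proof (rule ccontr)
      assume "\<phi> x \<noteq> 0"
      hence "norm x \<le> norm x0" using sub x0 by auto
      thus False using that \<open>norm x0 < 1\<close> by simp
    qed
    thus ?thesis using \<open>norm x0 < 1\<close> by (intro that[of "(1 + norm x0) / 2"]) auto
  qed
qed

lemma test_fun_rearrangeable:
  fixes \<phi> :: "real^'n::finite \<Rightarrow> real"
  assumes "test_fun (ball 0 1) \<phi>"
  shows "rearrangeable \<phi>"
proof (rule rearrangeable_Lp[of _ 1])
  note \<phi> = C1c_test_fun(1)[OF assms]
  note [measurable] = C1c_borel_measurable(1)[OF \<phi>]
  show m: "\<phi> \<in> borel_measurable hypV" by (rule borel_measurable_hypV) simp
  obtain \<rho>0 where \<rho>0: "\<rho>0 < 1" "\<And>x. norm x \<ge> \<rho>0 \<Longrightarrow> \<phi> x = 0" using test_fun_support[OF assms] by metis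
  define \<rho> where "\<rho> = max \<rho>0 0"
  have \<rho>: "0 \<le> \<rho>" "\<rho> < 1" "\<And>x. norm x \<ge> \<rho> \<Longrightarrow> \<phi> x = 0" using \<rho>0 by (auto simp: \<rho>_def)
  obtain B where B: "B > 0" "\<And>x. \<bar>\<phi> x\<bar> \<le> B" using C1c_bounded[OF \<phi>] by metis
  have "(\<integral>\<^sup>+x. ennreal (\<bar>\<phi> x\<bar> powr 1) \<partial>hypV) \<le> (\<integral>\<^sup>+x. ennreal B * indicator (ball 0 \<rho>) x \<partial>(hypV :: (real^'n) measure))"
    using B \<rho>(3) by (intro nn_integral_mono) (auto simp: indicator_def not_less intro: ennreal_leI)
  also have "\<dots> = ennreal B * emeasure (hypV :: (real^'n) measure) (ball 0 \<rho>)"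
  proof (rule nn_integral_cmult_indicator)
    have "ball 0 1 \<inter> ball (0::real^'n) \<rho> = ball 0 \<rho>" using subset_ball[of \<rho> 1 "0::real^'n"] \<rho> by auto
    thus "ball (0::real^'n) \<rho> \<in> sets hypV" unfolding sets_hypV sets_restrict_space
      by (metis (no_types, lifting) imageI lmeasurable_ball fmeasurableD)
  qed
  also have "\<dots> < \<infinity>" unfolding emeasure_hypV_ball[OF \<rho>(1,2)] by (simp add: ennreal_mult_less_top)
  finally show "(\<integral>\<^sup>+x. ennreal (\<bar>\<phi> x\<bar> powr 1) \<partial>hypV) < \<infinity>" .
qed simp

text \<open>The summand 4 comes from the divergence estimate and the other from the estimate for
  small sets at support volume \<open>2 * s\<close>; each contains a factor 2 from the slope of the
  truncation.\<close>

definition iso_const :: "'n::finite itself \<Rightarrow> real" where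
  "iso_const _ = 4 + 48 * real CARD('n) * (8 / unit_ball_vol TYPE('n)) powr (1 / real CARD('n))"

text \<open>Both isoperimetric bounds are applied to the truncation of the test function between the
  levels. The divergence bound gives the term linear in \<open>s\<close>, the bound for small sets
  the term \<open>s powr (1 - 1 / n)\<close>. The assumption \<open>hi\<close> keeps the volume of
  the support comparable to \<open>s\<close>, on which the constant of the second bound
  depends.\<close>

lemma level_gap_estimate:
  fixes \<phi> :: "real^'n::finite \<Rightarrow> real"
  assumes \<phi>: "test_fun (ball 0 1) \<phi>" and n: "CARD('n) \<ge> 2"
    and s: "s > 0" and \<tau>: "0 \<le> \<tau>" "\<tau> < t"
    and lo: "ennreal s \<le> distr_hyp \<phi> t" and hi: "distr_hyp \<phi> \<tau> \<le> ennreal (2 * s)"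
  shows "ennreal ((t - \<tau>) * (s + s powr (1 - 1 / real CARD('n))))
     \<le> ennreal (iso_const TYPE('n)) * (\<integral>\<^sup>+x. ennreal (hyp_norm x (egrad \<phi> x) * (if \<tau> < \<bar>\<phi> x\<bar> \<and> \<bar>\<phi> x\<bar> < t then 1 else 0)) \<partial>hypV)"
proof -
  let ?d = "CARD('n)" and ?\<sigma> = "unit_ball_vol TYPE('n)"
  have \<sigma>: "?\<sigma> > 0" by (simp add: unit_ball_vol_def content_ball_pos)
  define D where "D = egrad \<phi>"
  have \<phi>c: "C1c \<phi> D" using C1c_test_fun(1)[OF \<phi>] by (simp add: D_def)
  note [measurable] = C1c_borel_measurable[OF \<phi>c]
  obtain \<rho> where \<rho>: "\<rho> < 1" "\<And>x. norm x \<ge> \<rho> \<Longrightarrow> \<phi> x = 0" using test_fun_support[OF \<phi>] by metis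
  obtain v Dv where v: "C1c v Dv" "\<And>x. 0 \<le> v x" "\<And>x. v x \<le> t - \<tau>" "\<And>x. t \<le> \<bar>\<phi> x\<bar> \<Longrightarrow> v x = t - \<tau>"
    "\<And>x. v x \<noteq> 0 \<Longrightarrow> \<tau> < \<bar>\<phi> x\<bar>"
    and Dv: "\<And>x. norm (Dv x) \<le> 2 * norm (D x) * (if \<tau> < \<bar>\<phi> x\<bar> \<and> \<bar>\<phi> x\<bar> < t then 1 else 0)"
    using C1c_truncation[OF \<phi>c \<tau>] by metis
  note [measurable] = C1c_borel_measurable[OF v(1)]
  have vsupp: "v x = 0" if "norm x \<ge> \<rho>" for x using \<rho>(2)[OF that] v(5)[of x] \<tau> by auto
  define a where "a = t - \<tau>"
  have a: "a > 0" using \<tau> by (simp add: a_def)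
  define w where "w x = conf (norm x)" for x :: "real^'n"
  have w2: "w x \<ge> 2" if "norm x < 1" for x using conf_ge[of "norm x"] that by (simp add: w_def)
  have [measurable]: "w \<in> borel_measurable borel" unfolding w_def by measurable
  have ballm [measurable]: "ball (0::real^'n) r \<in> sets borel" for r by simp
  define G where "G = (\<integral>\<^sup>+x. ennreal (hyp_norm x (D x) * (if \<tau> < \<bar>\<phi> x\<bar> \<and> \<bar>\<phi> x\<bar> < t then 1 else 0)) \<partial>hypV)"
  define P where "P = (\<integral>\<^sup>+x. ennreal (norm (Dv x) * w x ^ (?d - 1)) * indicator (ball 0 1) x \<partial>lborel)"
  \<comment> \<open>The factor \<open>hyp_norm\<close> takes away one power of \<open>w\<close> from
    the volume density \<open>w ^ ?d\<close>, leaving the weight \<open>w ^ (?d - 1)\<close> of the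
    isoperimetric bounds.\<close>
  have PG: "P \<le> 2 * G"
  proof -
    have [measurable]: "(\<lambda>x. hyp_norm x (D x)) \<in> borel_measurable borel" unfolding hyp_norm_def by measurable
    have "2 * G = 2 * (\<integral>\<^sup>+x. ennreal (hyp_norm x (D x) * (if \<tau> < \<bar>\<phi> x\<bar> \<and> \<bar>\<phi> x\<bar> < t then 1 else 0)) * ennreal (hyp_weight x) * indicator (ball 0 1) x \<partial>lborel)"
      unfolding G_def by (subst nn_integral_hypV, rule borel_measurable_hypV) measurable
    also have "\<dots> = (\<integral>\<^sup>+x. 2 * (ennreal (hyp_norm x (D x) * (if \<tau> < \<bar>\<phi> x\<bar> \<and> \<bar>\<phi> x\<bar> < t then 1 else 0)) * ennreal (hyp_weight x) * indicator (ball 0 1) x) \<partial>lborel)"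
      by (rule nn_integral_cmult[symmetric]) measurable
    also have "P \<le> \<dots>"
      unfolding P_def
    proof (rule nn_integral_mono)
      fix x :: "real^'n"
      show "ennreal (norm (Dv x) * w x ^ (?d - 1)) * indicator (ball 0 1) x \<le> 2 * (ennreal (hyp_norm x (D x) * (if \<tau> < \<bar>\<phi> x\<bar> \<and> \<bar>\<phi> x\<bar> < t then 1 else 0)) * ennreal (hyp_weight x) * indicator (ball 0 1) x)"
      proof (cases "norm x < 1")
        case True
        let ?i = "if \<tau> < \<bar>\<phi> x\<bar> \<and> \<bar>\<phi> x\<bar> < t then 1 else 0 :: real"
        have w0: "w x > 0" using w2[OF True] by simp
        have hn: "hyp_norm x (D x) * w x = norm (D x)"
          using one_minus_square_pos[of "norm x"] True by (simp add: hyp_norm_def w_def conf_def)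
        have wd: "w x ^ ?d = w x * w x ^ (?d - 1)" by (metis One_nat_def Suc_pred zero_less_card_finite power_Suc)
        have "norm (Dv x) * w x ^ (?d - 1) \<le> (2 * norm (D x) * ?i) * w x ^ (?d - 1)"
          using Dv[of x] w0 by (intro mult_right_mono) auto
        also have "\<dots> = 2 * ((hyp_norm x (D x) * ?i) * hyp_weight x)"
          unfolding hn[symmetric] hyp_weight_conf w_def[symmetric] wd by simp
        finally have "ennreal (norm (Dv x) * w x ^ (?d - 1)) \<le> ennreal (2 * ((hyp_norm x (D x) * ?i) * hyp_weight x))"
          by (rule ennreal_leI)
        also have "\<dots> = 2 * (ennreal (hyp_norm x (D x) * ?i) * ennreal (hyp_weight x))"
        proof -
          have "hyp_norm x (D x) * ?i \<ge> 0" using one_minus_square_pos[of "norm x"] True by (simp add: hyp_norm_def)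
          thus ?thesis by (simp only: ennreal_mult' ennreal_numeral zero_le_numeral)
        qed
        finally show ?thesis using True by simp
      qed simp
    qed
    finally show ?thesis .
  qed
  have dist_eq: "distr_hyp \<phi> y = (\<integral>\<^sup>+x. ennreal (w x ^ ?d) * indicator {x \<in> ball 0 1. y < \<bar>\<phi> x\<bar>} x \<partial>lborel)" for y
  proof -
    have m: "\<phi> \<in> borel_measurable hypV" by (rule borel_measurable_hypV) simp
    have "distr_hyp \<phi> y = (\<integral>\<^sup>+x. indicator {x \<in> space hypV. y < \<bar>\<phi> x\<bar>} x \<partial>hypV)"
      unfolding distr_hyp_def using m by (subst nn_integral_indicator) (auto simp del: space_hypV)
    also have "\<dots> = (\<integral>\<^sup>+x. indicator {x \<in> space hypV. y < \<bar>\<phi> x\<bar>} x * ennreal (hyp_weight x) * indicator (ball 0 1) x \<partial>lborel)"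
      using m by (intro nn_integral_hypV borel_measurable_indicator) (auto simp del: space_hypV)
    also have "\<dots> = (\<integral>\<^sup>+x. ennreal (w x ^ ?d) * indicator {x \<in> ball 0 1. y < \<bar>\<phi> x\<bar>} x \<partial>lborel)"
      by (intro nn_integral_cong) (auto simp: indicator_def hyp_weight_conf w_def)
    finally show ?thesis .
  qed
  have 1: "ennreal (a * s) \<le> 4 * G"
  proof -
    have "ennreal a * distr_hyp \<phi> t \<le> (\<integral>\<^sup>+x. ennreal (v x * w x ^ ?d) * indicator (ball 0 1) x \<partial>lborel)"
    proof -
      have "ennreal a * distr_hyp \<phi> t = (\<integral>\<^sup>+x. ennreal a * (ennreal (w x ^ ?d) * indicator {x \<in> ball 0 1. t < \<bar>\<phi> x\<bar>} x) \<partial>lborel)"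
        unfolding dist_eq by (rule nn_integral_cmult[symmetric]) measurable
      also have "\<dots> \<le> (\<integral>\<^sup>+x. ennreal (v x * w x ^ ?d) * indicator (ball 0 1) x \<partial>lborel)"
        using v(4) a by (intro nn_integral_mono) (auto simp: indicator_def a_def ennreal_mult')
      finally show ?thesis .
    qed
    moreover have "(\<integral>\<^sup>+x. ennreal (v x * w x ^ ?d) * indicator (ball 0 1) x \<partial>lborel) \<le> ennreal (real ?d) * (\<integral>\<^sup>+x. ennreal (v x * w x ^ ?d) * indicator (ball 0 1) x \<partial>lborel)"
      using mult_right_mono[of 1 "ennreal (real ?d)" "\<integral>\<^sup>+x. ennreal (v x * w x ^ ?d) * indicator (ball 0 1) x \<partial>lborel"] n by simp
    moreover have "ennreal (real ?d) * (\<integral>\<^sup>+x. ennreal (v x * w x ^ ?d) * indicator (ball 0 1) x \<partial>lborel) \<le> 2 * P"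
      using hyperbolic_Cheeger[OF v(1) _ \<rho>(1) v(2)] vsupp n unfolding P_def w_def by simp
    moreover have "ennreal (a * s) \<le> ennreal a * distr_hyp \<phi> t"
      using lo a by (simp add: ennreal_mult' mult_left_mono)
    moreover have "2 * P \<le> 2 * (2 * G)" using PG by (intro mult_left_mono) auto
    ultimately have "ennreal (a * s) \<le> 2 * (2 * G)" by (meson order_trans)
    thus ?thesis by (simp add: mult.assoc[symmetric])
  qed
  have 2: "ennreal (a * s powr (1 - 1 / real ?d)) \<le> ennreal (48 * real ?d * (8 / ?\<sigma>) powr (1 / real ?d)) * G"
  proof -
    define R where "R = (8 / ?\<sigma>) powr (1 / real ?d)"
    have "ennreal a * (\<integral>\<^sup>+x. ennreal (w x ^ ?d) * indicator {x \<in> ball 0 1. t < \<bar>\<phi> x\<bar>} x \<partial>lborel)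
       \<le> ennreal (24 * real ?d * (4 * (2 * s) / ?\<sigma>) powr (1 / real ?d)) * P"
    proof -
      have "(\<integral>\<^sup>+x. ennreal (w x ^ ?d) * indicator {x \<in> ball 0 1. v x > 0} x \<partial>lborel) \<le> distr_hyp \<phi> \<tau>"
        unfolding dist_eq using v(5) by (intro nn_integral_mono) (auto simp: indicator_def)
      hence M: "(\<integral>\<^sup>+x. ennreal (w x ^ ?d) * indicator {x \<in> ball 0 1. v x > 0} x \<partial>lborel) \<le> ennreal (2 * s)"
        using hi by (rule order_trans)
      have dim: "DIM(real^'n) = ?d" by simp
      show ?thesis
        unfolding P_def a_def w_def unit_ball_vol_def
      proof (rule hyperbolic_isoperimetric[where 'a = "real^'n", unfolded dim, OF v(1) _ \<rho>(1) v(2,3)])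
        show "(\<integral>\<^sup>+x. ennreal (conf (norm x) ^ ?d) * indicator {x \<in> ball 0 1. v x > 0} x \<partial>lborel) \<le> ennreal (2 * s)"
          using M by (simp only: w_def)
        show "norm x < 1 \<and> v x = t - \<tau>" if "x \<in> {x \<in> ball 0 1. t < \<bar>\<phi> x\<bar>}" for x
          using that v(4)[of x] by auto
      qed (use vsupp \<tau> n s in auto)
    qed
    also have "\<dots> \<le> ennreal (24 * real ?d * (4 * (2 * s) / ?\<sigma>) powr (1 / real ?d)) * (2 * G)"
      using PG by (intro mult_left_mono) auto
    also have "(4 * (2 * s) / ?\<sigma>) powr (1 / real ?d) = R * s powr (1 / real ?d)"
    proof -
      have "4 * (2 * s) / ?\<sigma> = (8 / ?\<sigma>) * s" by simp
      thus ?thesis unfolding R_def by (simp only: powr_mult)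
    qed
    finally have le: "ennreal a * distr_hyp \<phi> t \<le> ennreal (24 * real ?d * (R * s powr (1 / real ?d))) * (2 * G)"
      unfolding dist_eq .
    have "ennreal (a * s powr (1 - 1 / real ?d)) = ennreal (s powr (- 1 / real ?d)) * (ennreal a * ennreal s)"
    proof -
      have "a * s powr (1 - 1 / real ?d) = s powr (- 1 / real ?d) * (a * s)"
        using s by (simp add: powr_diff powr_minus_divide)
      thus ?thesis using a s by (simp add: ennreal_mult' mult_ac)
    qed
    also have "\<dots> \<le> ennreal (s powr (- 1 / real ?d)) * (ennreal (24 * real ?d * (R * s powr (1 / real ?d))) * (2 * G))"
    proof (intro mult_left_mono)
      have "ennreal a * ennreal s \<le> ennreal a * distr_hyp \<phi> t" using lo by (intro mult_left_mono) auto
      thus "ennreal a * ennreal s \<le> ennreal (24 * real ?d * (R * s powr (1 / real ?d))) * (2 * G)" using le by (rule order_trans)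
    qed simp
    also have "\<dots> = ennreal (s powr (- 1 / real ?d) * (24 * real ?d * (R * s powr (1 / real ?d))) * 2) * G"
      by (simp add: R_def ennreal_mult' ennreal_mult'' mult_ac)
    also have "s powr (- 1 / real ?d) * (24 * real ?d * (R * s powr (1 / real ?d))) * 2 = 48 * real ?d * R"
      using s by (simp add: powr_minus_divide)
    finally show ?thesis by (simp add: R_def)
  qed
  have "ennreal (a * (s + s powr (1 - 1 / real ?d))) = ennreal (a * s) + ennreal (a * s powr (1 - 1 / real ?d))"
    using a s by (simp add: distrib_left ennreal_plus)
  also have "\<dots> \<le> 4 * G + ennreal (48 * real ?d * (8 / ?\<sigma>) powr (1 / real ?d)) * G"
    by (rule add_mono[OF 1 2])
  also have "\<dots> = ennreal (iso_const TYPE('n)) * G"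
    by (simp add: iso_const_def ennreal_plus distrib_right)
  finally show ?thesis by (simp add: a_def G_def D_def)
qed

text \<open>The integral of the differences telescopes: the shifted interval sticks out of the
  original one only by a piece of length \<open>d\<close> at the right end, where \<open>e\<close>
  is at most \<open>m\<close>.\<close>

lemma nn_integral_mono_difference:
  fixes e :: "real \<Rightarrow> real"
  assumes e: "mono e" "\<And>s. 0 \<le> e s" "\<And>s. e s \<le> m" and d: "d > 0" and ab: "a < b"
  shows "(\<integral>\<^sup>+s. ennreal (e (s + d) - e s) * indicator {a<..<b} s \<partial>lborel) \<le> ennreal (d * m)"
proof -
  have [measurable]: "e \<in> borel_measurable borel" using e(1) by (rule borel_measurable_mono)
  define I where "I = (\<integral>\<^sup>+s. ennreal (e s) * indicator {a<..<b} s \<partial>lborel)"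
  have m0: "m \<ge> 0" using e(2)[of 0] e(3)[of 0] by linarith
  have "I \<le> (\<integral>\<^sup>+s. ennreal m * indicator {a<..<b} s \<partial>lborel)"
    unfolding I_def using e by (intro nn_integral_mono mult_right_mono ennreal_leI) auto
  also have "\<dots> < \<infinity>" using ab by (simp add: nn_integral_cmult_indicator ennreal_mult_less_top)
  finally have fin: "I \<noteq> top" by simp
  have "I + (\<integral>\<^sup>+s. ennreal (e (s + d) - e s) * indicator {a<..<b} s \<partial>lborel)
      = (\<integral>\<^sup>+s. ennreal (e s) * indicator {a<..<b} s + ennreal (e (s + d) - e s) * indicator {a<..<b} s \<partial>lborel)"
    unfolding I_def by (rule nn_integral_add[symmetric]) measurable
  also have "\<dots> = (\<integral>\<^sup>+s. ennreal (e (d + s)) * indicator {a + d<..<b + d} (d + s) \<partial>lborel)"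
    using e(2) monoD[OF e(1)] d by (intro nn_integral_cong) (auto simp: indicator_def add.commute simp flip: ennreal_plus)
  also have "\<dots> = (\<integral>\<^sup>+s. ennreal (e s) * indicator {a + d<..<b + d} s \<partial>distr lborel borel ((+) d))"
    by (subst nn_integral_distr) auto
  also have "\<dots> = (\<integral>\<^sup>+s. ennreal (e s) * indicator {a + d<..<b + d} s \<partial>lborel)"
    by (simp add: lborel_distr_plus)
  also have "\<dots> \<le> (\<integral>\<^sup>+s. ennreal (e s) * indicator {a<..<b} s + ennreal m * indicator {b..b + d} s \<partial>lborel)"
    using e d m0 by (intro nn_integral_mono) (auto simp: indicator_def intro: ennreal_leI)
  also have "\<dots> = I + ennreal m * ennreal d"
    unfolding I_def using d by (subst nn_integral_add) (auto simp: nn_integral_cmult_indicator)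
  finally have "I + (\<integral>\<^sup>+s. ennreal (e (s + d) - e s) * indicator {a<..<b} s \<partial>lborel) \<le> I + ennreal m * ennreal d" .
  thus ?thesis using fin m0 d by (simp add: ennreal_add_left_cancel_le ennreal_mult mult.commute)
qed

text \<open>The band between the levels \<open>f (s + d)\<close> and \<open>f s\<close> has volume
  at most \<open>d\<close>, so Hoelder turns the level gap estimate into a bound of
  \<open>((f s - f (s + d)) * L s) powr p\<close> by \<open>d powr (p - 1)\<close> times the
  gradient energy of the band. That energy is at most the increment of the monotone function
  \<open>e\<close>, the energy above the level \<open>f s\<close>, and these increments telescope.
  The restriction \<open>d \<le> a\<close> guarantees \<open>s + d \<le> 2 * s\<close>, as the level
  gap estimate demands.\<close>

lemma decr_rearr_difference_test_fun:
  fixes \<phi> :: "real^'n::finite \<Rightarrow> real"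
  assumes \<phi>: "test_fun (ball 0 1) \<phi>" and n: "CARD('n) \<ge> 2" and p: "p > 1"
    and E0: "(\<integral>\<^sup>+x. ennreal (hyp_norm x (egrad \<phi> x) powr p) \<partial>hypV) \<le> ennreal E0" "E0 \<ge> 0"
    and ab: "0 < a" "a < b" and d: "0 < d" "d \<le> a"
  shows "(\<integral>\<^sup>+s. ennreal (((decr_rearr \<phi> s - decr_rearr \<phi> (s + d)) / d * (s + s powr (1 - 1 / real CARD('n)))) powr p)
      * indicator {a<..<b} s \<partial>lborel) \<le> ennreal (iso_const TYPE('n) powr p * E0)"
proof -
  define q where "q = p / (p - 1)"
  have pq: "p > 1" "q > 1" "1 / p + 1 / q = 1" using p by (auto simp: q_def field_simps)
  define f where "f = decr_rearr \<phi>"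
  define L where "L s = s + s powr (1 - 1 / real CARD('n))" for s :: real
  define c where "c = iso_const TYPE('n)"
  have c0: "c > 0" unfolding c_def iso_const_def by (intro add_pos_nonneg) auto
  have r: "rearrangeable \<phi>" by (rule test_fun_rearrangeable[OF \<phi>])
  note \<phi>c = C1c_test_fun(1)[OF \<phi>]
  note [measurable] = C1c_borel_measurable[OF \<phi>c]
  define g where "g x = hyp_norm x (egrad \<phi> x)" for x
  have gb: "g \<in> borel_measurable borel" unfolding g_def hyp_norm_def by measurable
  have gm [measurable]: "g \<in> borel_measurable hypV" by (rule borel_measurable_hypV[OF gb])
  have \<phi>m [measurable]: "\<phi> \<in> borel_measurable hypV" by (rule borel_measurable_hypV) simp
  have g0: "g x \<ge> 0" if "x \<in> space hypV" for x
    using that one_minus_square_pos[of "norm x"] by (simp add: g_def hyp_norm_def)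
  have f0: "f s \<ge> 0" if "s > 0" for s using decr_rearr_nonneg[OF r that] by (simp add: f_def)
  define F where "F s = (\<integral>\<^sup>+x. ennreal (g x powr p) * (if f s < \<bar>\<phi> x\<bar> then 1 else 0) \<partial>hypV)" for s
  have Fle: "F s \<le> ennreal E0" for s
    unfolding F_def using E0(1) by (rule order_trans[rotated]) (auto simp: g_def intro!: nn_integral_mono)
  have Ffin: "F s < top" for s using Fle[of s] by (simp add: le_less_trans)
  \<comment> \<open>Extended by 0 to nonpositive arguments, so that \<open>e\<close> is monotone on
    the whole line.\<close>
  define e where "e s = (if s > 0 then enn2real (F s) else 0)" for s
  have Fe: "F s = ennreal (e s)" if "s > 0" for s using Ffin[of s] that by (simp add: e_def)
  have e_bound: "0 \<le> e s" "e s \<le> E0" for s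
    using enn2real_leI[OF E0(2) Fle[of s]] E0(2) by (auto simp: e_def)
  have e_mono: "mono e"
  proof (rule monoI)
    fix s t :: real assume "s \<le> t"
    show "e s \<le> e t"
    proof (cases "s > 0")
      case True
      have "f t \<le> f s" using decr_rearr_antimono[OF r True \<open>s \<le> t\<close>] by (simp add: f_def)
      hence "F s \<le> F t" unfolding F_def by (intro nn_integral_mono mult_left_mono) auto
      thus ?thesis using True \<open>s \<le> t\<close> Fe e_bound(1)[of t] by (simp add: ennreal_le_iff)
    next
      case False
      thus ?thesis using e_bound(1)[of t] by (simp add: e_def)
    qed
  qed
  have key: "((f s - f (s + d)) * L s) powr p \<le> c powr p * (e (s + d) - e s) * d powr (p - 1)" if s: "s > a" for s
  proof -
    have s0: "s > 0" "d \<le> s" using s ab d by auto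
    have L0: "L s > 0" using s0 by (simp add: L_def add_pos_nonneg)
    define \<tau> where "\<tau> = f (s + d)"
    have \<tau>: "0 \<le> \<tau>" "\<tau> \<le> f s" using f0[of "s + d"] s0 d decr_rearr_antimono[OF r s0(1), of "s + d"] by (auto simp: \<tau>_def f_def)
    have hi: "distr_hyp \<phi> \<tau> \<le> ennreal (s + d)"
      using distr_hyp_decr_rearr_le[OF r, of "s + d"] s0 d by (simp add: \<tau>_def f_def)
    \<comment> \<open>Levels \<open>t\<close> strictly below \<open>f s\<close> have superlevel
      volume above \<open>s\<close>, whereas at \<open>f s\<close> itself only an upper bound by
      \<open>s\<close> is available; hence the estimate for \<open>t < f s\<close> and a limit
      afterwards. The \<open>\<epsilon>\<close> keeps the Hoelder bound positive when the increment
      of \<open>e\<close> vanishes.\<close>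
    have lev: "((t - \<tau>) * L s) powr p \<le> c powr p * (e (s + d) - e s + \<epsilon>) * d powr (p - 1)"
      if t: "\<tau> < t" "t < f s" and \<epsilon>: "\<epsilon> > 0" for t \<epsilon>
    proof -
      define band where "band x = (if \<tau> < \<bar>\<phi> x\<bar> \<and> \<bar>\<phi> x\<bar> < t then 1 else 0 :: real)" for x
      have [measurable]: "band \<in> borel_measurable hypV" unfolding band_def by measurable
      have lo: "ennreal s < distr_hyp \<phi> t"
        using decr_rearr_gt_iff[OF r s0(1), of t] t \<tau> by (simp add: f_def)
      have "ennreal ((t - \<tau>) * L s) \<le> ennreal c * (\<integral>\<^sup>+x. ennreal (g x * band x) \<partial>hypV)"
        unfolding L_def c_def g_def band_def
      proof (rule level_gap_estimate[OF \<phi> n s0(1) \<tau>(1) t(1)])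
        show "ennreal s \<le> distr_hyp \<phi> t" using lo by simp
        have "ennreal (s + d) \<le> ennreal (2 * s)" using s0 by (intro ennreal_leI) simp
        thus "distr_hyp \<phi> \<tau> \<le> ennreal (2 * s)" using hi by (rule order_trans[rotated])
      qed
      also have "(\<integral>\<^sup>+x. ennreal (g x * band x) \<partial>hypV) = (\<integral>\<^sup>+x. ennreal ((g x * band x) * band x) \<partial>hypV)"
        by (intro nn_integral_cong) (auto simp: band_def)
      also have "ennreal c * \<dots> \<le> ennreal c * ennreal ((e (s + d) - e s + \<epsilon>) powr (1 / p) * d powr (1 / q))"
      proof (intro mult_left_mono nn_integral_Holder[OF pq])
        have "F s + (\<integral>\<^sup>+x. ennreal ((g x * band x) powr p) \<partial>hypV) = (\<integral>\<^sup>+x. ennreal (g x powr p) * (if f s < \<bar>\<phi> x\<bar> then 1 else 0) + ennreal ((g x * band x) powr p) \<partial>hypV)"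
          unfolding F_def by (rule nn_integral_add[symmetric]) measurable
        also have "\<dots> \<le> F (s + d)"
          unfolding F_def using t \<tau> p
          by (intro nn_integral_mono) (auto simp: band_def \<tau>_def)
        finally have "ennreal (e s) + (\<integral>\<^sup>+x. ennreal ((g x * band x) powr p) \<partial>hypV) \<le> ennreal (e s) + ennreal (e (s + d) - e s)"
          using Fe[of s] Fe[of "s + d"] s0 d e_bound(1)[of s] monoD[OF e_mono, of s "s + d"] by (simp flip: ennreal_plus)
        hence "(\<integral>\<^sup>+x. ennreal ((g x * band x) powr p) \<partial>hypV) \<le> ennreal (e (s + d) - e s)"
          by (simp add: ennreal_add_left_cancel_le)
        also have "\<dots> \<le> ennreal (e (s + d) - e s + \<epsilon>)" using \<epsilon> by (intro ennreal_leI) simp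
        finally show "(\<integral>\<^sup>+x. ennreal ((g x * band x) powr p) \<partial>hypV) \<le> ennreal (e (s + d) - e s + \<epsilon>)" .
        show "0 < e (s + d) - e s + \<epsilon>" using monoD[OF e_mono, of s "s + d"] d \<epsilon> by simp
        \<comment> \<open>The band lies between a superlevel set of volume more than
          \<open>s\<close> and one of volume at most \<open>s + d\<close>.\<close>
        have "ennreal s + (\<integral>\<^sup>+x. ennreal (band x powr q) \<partial>hypV) \<le> distr_hyp \<phi> t + (\<integral>\<^sup>+x. ennreal (band x powr q) \<partial>hypV)"
          using lo by (intro add_right_mono) simp
        also have "distr_hyp \<phi> t = (\<integral>\<^sup>+x. (if t < \<bar>\<phi> x\<bar> then 1 else 0) \<partial>hypV)"
        proof -
          have "distr_hyp \<phi> t = (\<integral>\<^sup>+x. indicator {x \<in> space hypV. t < \<bar>\<phi> x\<bar>} x \<partial>hypV)"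
            unfolding distr_hyp_def by (subst nn_integral_indicator) (auto simp del: space_hypV)
          thus ?thesis by (auto intro!: nn_integral_cong simp: indicator_def)
        qed
        also have "(\<integral>\<^sup>+x. (if t < \<bar>\<phi> x\<bar> then 1 else 0) \<partial>hypV) + (\<integral>\<^sup>+x. ennreal (band x powr q) \<partial>hypV)
            = (\<integral>\<^sup>+x. (if t < \<bar>\<phi> x\<bar> then 1 else 0) + ennreal (band x powr q) \<partial>hypV)"
          by (rule nn_integral_add[symmetric]) measurable
        also have "\<dots> \<le> (\<integral>\<^sup>+x. indicator {x \<in> space hypV. \<tau> < \<bar>\<phi> x\<bar>} x \<partial>hypV)"
          using t pq by (intro nn_integral_mono) (auto simp: band_def indicator_def)
        also have "\<dots> = distr_hyp \<phi> \<tau>"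
          unfolding distr_hyp_def by (subst nn_integral_indicator) (auto simp del: space_hypV)
        also have "\<dots> \<le> ennreal s + ennreal d" using hi s0 d by simp
        finally show "(\<integral>\<^sup>+x. ennreal (band x powr q) \<partial>hypV) \<le> ennreal d"
          by (simp add: ennreal_add_left_cancel_le)
      qed (use g0 d in \<open>auto simp: band_def\<close>)
      also have "\<dots> = ennreal (c * ((e (s + d) - e s + \<epsilon>) powr (1 / p) * d powr (1 / q)))"
        using c0 by (simp add: ennreal_mult')
      finally have "(t - \<tau>) * L s \<le> c * ((e (s + d) - e s + \<epsilon>) powr (1 / p) * d powr (1 / q))"
        using c0 by (subst (asm) ennreal_le_iff) auto
      hence "((t - \<tau>) * L s) powr p \<le> (c * ((e (s + d) - e s + \<epsilon>) powr (1 / p) * d powr (1 / q))) powr p"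
        using t L0 p by (intro powr_mono2) auto
      also have "\<dots> = c powr p * (((e (s + d) - e s + \<epsilon>) powr (1 / p)) powr p * (d powr (1 / q)) powr p)"
        using c0 by (simp add: powr_mult)
      also have "((e (s + d) - e s + \<epsilon>) powr (1 / p)) powr p = e (s + d) - e s + \<epsilon>"
        using monoD[OF e_mono, of s "s + d"] d \<epsilon> p by (simp add: powr_powr)
      also have "(d powr (1 / q)) powr p = d powr (p - 1)"
        using p by (simp add: powr_powr q_def)
      finally show ?thesis by (simp add: mult.assoc)
    qed
    have lev2: "((t - \<tau>) * L s) powr p \<le> c powr p * (e (s + d) - e s) * d powr (p - 1)" if t: "\<tau> < t" "t < f s" for t
    proof (rule tendsto_lowerbound)
      show "((\<lambda>\<epsilon>. c powr p * (e (s + d) - e s + \<epsilon>) * d powr (p - 1)) \<longlongrightarrow> c powr p * (e (s + d) - e s) * d powr (p - 1)) (at_right 0)"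
        by (auto intro!: tendsto_eq_intros)
      show "\<forall>\<^sub>F \<epsilon> in at_right 0. ((t - \<tau>) * L s) powr p \<le> c powr p * (e (s + d) - e s + \<epsilon>) * d powr (p - 1)"
        using eventually_at_right_less[of "0::real"] by eventually_elim (rule lev[OF t])
    qed simp
    show ?thesis
    proof (cases "\<tau> = f s")
      case True
      have "0 \<le> c powr p * (e (s + d) - e s) * d powr (p - 1)"
        using monoD[OF e_mono, of s "s + d"] d by (intro mult_nonneg_nonneg) auto
      thus ?thesis using True p by (simp add: \<tau>_def)
    next
      case False
      hence lt: "\<tau> < f s" using \<tau> by simp
      have "((f s - \<tau>) * L s) powr p \<le> c powr p * (e (s + d) - e s) * d powr (p - 1)"
      proof (rule tendsto_upperbound)
        show "((\<lambda>t. ((t - \<tau>) * L s) powr p) \<longlongrightarrow> ((f s - \<tau>) * L s) powr p) (at_left (f s))"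
          using lt L0 by (intro tendsto_intros) auto
        have "\<forall>\<^sub>F t in at_left (f s). t \<in> {\<tau><..<f s}" by (rule eventually_at_left_real[OF lt])
        thus "\<forall>\<^sub>F t in at_left (f s). ((t - \<tau>) * L s) powr p \<le> c powr p * (e (s + d) - e s) * d powr (p - 1)"
          by eventually_elim (use lev2 in auto)
      qed simp
      thus ?thesis by (simp add: \<tau>_def)
    qed
  qed
  have "(\<integral>\<^sup>+s. ennreal (((f s - f (s + d)) / d * L s) powr p) * indicator {a<..<b} s \<partial>lborel)
     \<le> (\<integral>\<^sup>+s. ennreal (c powr p / d) * (ennreal (e (s + d) - e s) * indicator {a<..<b} s) \<partial>lborel)"
  proof (rule nn_integral_mono)
    fix s
    show "ennreal (((f s - f (s + d)) / d * L s) powr p) * indicator {a<..<b} s \<le> ennreal (c powr p / d) * (ennreal (e (s + d) - e s) * indicator {a<..<b} s)"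
    proof (cases "s \<in> {a<..<b}")
      case True
      have s0: "s > 0" using True ab by auto
      have fd: "f s - f (s + d) \<ge> 0" using decr_rearr_antimono[OF r s0, of "s + d"] d by (simp add: f_def)
      have L0: "L s > 0" using s0 by (simp add: L_def add_pos_nonneg)
      have "(f s - f (s + d)) / d * L s = ((f s - f (s + d)) * L s) / d" by simp
      hence "((f s - f (s + d)) / d * L s) powr p = ((f s - f (s + d)) * L s) powr p / d powr p"
        using fd d L0 by (simp only: powr_divide)
      also have "\<dots> \<le> c powr p * (e (s + d) - e s) * d powr (p - 1) / d powr p"
        using key[of s] True by (intro divide_right_mono) auto
      also have "\<dots> = c powr p / d * (e (s + d) - e s)" using d by (simp add: powr_diff)
      finally have "ennreal (((f s - f (s + d)) / d * L s) powr p) \<le> ennreal (c powr p / d) * ennreal (e (s + d) - e s)"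
        using d by (simp add: ennreal_leI flip: ennreal_mult')
      thus ?thesis using True by simp
    qed simp
  qed
  also have "\<dots> = ennreal (c powr p / d) * (\<integral>\<^sup>+s. ennreal (e (s + d) - e s) * indicator {a<..<b} s \<partial>lborel)"
  proof (rule nn_integral_cmult)
    have [measurable]: "e \<in> borel_measurable borel" by (rule borel_measurable_mono[OF e_mono])
    show "(\<lambda>s. ennreal (e (s + d) - e s) * indicator {a<..<b} s) \<in> borel_measurable lborel" by measurable
  qed
  also have "\<dots> \<le> ennreal (c powr p / d) * ennreal (d * E0)"
    using nn_integral_mono_difference[OF e_mono e_bound d(1) ab(2)] by (intro mult_left_mono) auto
  also have "\<dots> = ennreal (c powr p * E0)" using d by (simp flip: ennreal_mult')
  finally show ?thesis by (simp add: f_def L_def c_def)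
qed

section \<open>Absolute continuity from difference quotients\<close>

lemma Lebesgue_differentiation_right:
  fixes g :: "real \<Rightarrow> real"
  assumes "\<And>a b. g integrable_on cbox a b"
  obtains N where "negligible N" "\<And>x. x \<notin> N \<Longrightarrow> ((\<lambda>t. integral {x..x + t} g / t) \<longlongrightarrow> g x) (at_right 0)"
proof -
  obtain N where N: "negligible N" "\<And>x e. x \<notin> N \<Longrightarrow> 0 < e \<Longrightarrow>
      \<exists>d>0. \<forall>h. 0 < h \<and> h < d \<longrightarrow> norm (integral (cbox x (x + h *\<^sub>R One)) g /\<^sub>R h ^ DIM(real) - g x) < e"
    by (rule integrable_ccontinuous_explicit[OF assms], rule that)
  have "((\<lambda>t. integral {x..x + t} g / t) \<longlongrightarrow> g x) (at_right 0)" if x: "x \<notin> N" for x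
  proof (rule tendstoI)
    fix e :: real assume "e > 0"
    obtain d where d: "d > 0" "\<And>h. 0 < h \<Longrightarrow> h < d \<Longrightarrow> norm (integral (cbox x (x + h *\<^sub>R One)) g /\<^sub>R h ^ DIM(real) - g x) < e"
      using N(2)[OF x \<open>e > 0\<close>] by blast
    show "\<forall>\<^sub>F t in at_right 0. dist (integral {x..x + t} g / t) (g x) < e"
      using eventually_at_right_real[OF d(1)]
    proof eventually_elim
      case (elim t)
      thus ?case using d(2)[of t] by (simp add: dist_real_def divide_inverse mult.commute)
    qed
  qed
  thus ?thesis using N(1) that by blast
qed

text \<open>A decreasing function with difference quotients bounded in \<open>L^p\<close> is locally absolutely
  continuous: its Stieltjes measure is controlled on open sets by Fatou's lemma.\<close>
lemma decreasing_difference_quotients: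
  fixes f L :: "real \<Rightarrow> real"
  assumes p: "p > 1"
    and decr: "\<And>s t. 0 < s \<Longrightarrow> s \<le> t \<Longrightarrow> f t \<le> f s"
    and rcont: "\<And>s. 0 < s \<Longrightarrow> (f \<longlongrightarrow> f s) (at_right s)"
    and Lm [measurable]: "L \<in> borel_measurable borel"
    and L0: "\<And>s. 0 < s \<Longrightarrow> L s > 0" and Lmono: "\<And>s t. 0 < s \<Longrightarrow> s \<le> t \<Longrightarrow> L s \<le> L t"
    and fm [measurable]: "(\<lambda>s. f s * indicator {0<..} s) \<in> borel_measurable borel"
    and bound: "\<And>a b d. 0 < a \<Longrightarrow> a < b \<Longrightarrow> 0 < d \<Longrightarrow> d \<le> a \<Longrightarrow>
       (\<integral>\<^sup>+s. ennreal (((f s - f (s + d)) / d * L s) powr p) * indicator {a<..<b} s \<partial>lborel) \<le> ennreal C"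
  obtains h where "h \<in> borel_measurable borel" "\<And>s. h s \<ge> 0"
    "\<And>a b. 0 < a \<Longrightarrow> a < b \<Longrightarrow> (\<integral>\<^sup>+s. ennreal (h s) * indicator {a<..<b} s \<partial>lborel) = ennreal (f a - f b)"
    "(\<integral>\<^sup>+s. ennreal ((h s * L s) powr p) * indicator {0<..} s \<partial>lborel) \<le> ennreal C"
proof -
  \<comment> \<open>The rearrangement is controlled on the positive half-line only. The exponential
    moves it to the whole line, where the Stieltjes measure is formed, and \<open>m\<close> is its
    image on the positive half-line.\<close>
  define I where "I = interval_measure (\<lambda>y. - f (exp y))"
  have Fmono: "- f (exp x) \<le> - f (exp y)" if "x \<le> y" for x y using decr[of "exp x" "exp y"] that by simp
  have Fcont: "continuous (at_right y) (\<lambda>y. - f (exp y))" for y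
  proof -
    have "filterlim exp (at_right (exp y)) (at_right y)"
      unfolding filterlim_at
      by (auto intro!: tendsto_eq_intros eventually_at_right_less[THEN eventually_mono])
    from filterlim_compose[OF rcont[of "exp y"] this] show ?thesis
      by (auto simp: continuous_within intro!: tendsto_minus)
  qed
  interpret I: sigma_finite_measure I
    unfolding I_def by (rule sigma_finite_interval_measure[OF Fmono Fcont])
  have I_sets [measurable_cong, simp]: "sets I = sets borel" "space I = UNIV" unfolding I_def by simp_all
  define m where "m = distr I borel exp"
  have [measurable]: "exp \<in> measurable I borel" unfolding measurable_cong_sets[OF I_sets(1) refl] by simp
  have m_sets [simp]: "sets m = sets borel" by (simp add: m_def)
  have mIoc: "emeasure m {a<..b} = ennreal (f a - f b)" if "0 < a" "a \<le> b" for a b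
  proof -
    have "exp -` {a<..b} = {ln a<..ln b}"
    proof (intro set_eqI)
      fix x show "x \<in> exp -` {a<..b} \<longleftrightarrow> x \<in> {ln a<..ln b}"
        using that ln_less_cancel_iff[of a "exp x"] ln_le_cancel_iff[of "exp x" b] by auto
    qed
    hence "emeasure m {a<..b} = emeasure I {ln a<..ln b}" unfolding m_def by (subst emeasure_distr) auto
    also have "\<dots> = ennreal (- f (exp (ln b)) - - f (exp (ln a)))"
      unfolding I_def using that by (intro emeasure_interval_measure_Ioc Fmono Fcont) auto
    finally show ?thesis using that by simp
  qed
  have m0: "emeasure m {..0} = 0"
  proof -
    have "exp -` {..0} = ({} :: real set)" by (auto simp: not_le)
    thus ?thesis unfolding m_def by (subst emeasure_distr) auto
  qed
  \<comment> \<open>By Fubini the integral of the difference quotient over \<open>U\<close>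
    averages, with respect to \<open>m\<close>, the fraction of the interval of length
    \<open>d k\<close> to the left of a point that lies in \<open>U\<close>. For open
    \<open>U\<close> this fraction is eventually 1 at every point of \<open>U\<close>, so Fatou
    bounds the mass of \<open>U\<close> by the quotients. Hoelder against the indicator of
    \<open>U\<close> then gives a positive power of its Lebesgue measure.\<close>
  have open_bound: "emeasure m U \<le> ennreal ((\<bar>C\<bar> / L a powr p + 1) powr (1 / p) * B powr (1 - 1 / p))"
    if U: "open U" "U \<subseteq> {a<..<b}" and a: "0 < a" "a < b" and B: "emeasure lborel U \<le> ennreal B" "B > 0" for U a b B
  proof -
    define q where "q = p / (p - 1)"
    have pq: "p > 1" "q > 1" "1 / p + 1 / q = 1" using p by (auto simp: q_def field_simps)
    define d where "d k = a / real (Suc k)" for k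
    have d: "0 < d k" "d k \<le> a" for k using a by (auto simp: d_def divide_le_eq mult_le_cancel_left1)
    have [measurable]: "U \<in> sets borel" using U by simp
    \<comment> \<open>The absolute value and the added 1 make the first bound positive for every
      real \<open>C\<close>, as Hoelder requires.\<close>
    define K where "K = (\<bar>C\<bar> / L a powr p + 1) powr (1 / p) * B powr (1 - 1 / p)"
    have quot: "(\<integral>\<^sup>+s. ennreal ((f s - f (s + d k)) / d k) * indicator U s \<partial>lborel) \<le> ennreal K" for k
    proof -
      have La: "L a > 0" using L0 a by simp
      let ?g = "\<lambda>s. ((f s * indicator {0<..} s) - (f (s + d k) * indicator {0<..} (s + d k))) / d k * indicator U s"
      have g: "?g s = (f s - f (s + d k)) / d k * indicator U s" for s
        using U a d[of k] by (auto simp: indicator_def)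
      have g0: "?g s \<ge> 0" for s
        using decr[of s "s + d k"] d[of k] U a unfolding g by (auto simp: indicator_def subset_eq)
      have "(\<integral>\<^sup>+s. ennreal ((f s - f (s + d k)) / d k) * indicator U s \<partial>lborel) = (\<integral>\<^sup>+s. ennreal (?g s * indicator U s) \<partial>lborel)"
        unfolding g by (intro nn_integral_cong) (auto simp: indicator_def)
      also have "\<dots> \<le> ennreal ((\<bar>C\<bar> / L a powr p + 1) powr (1 / p) * B powr (1 / q))"
      proof (rule nn_integral_Holder[OF pq])
        have "(\<integral>\<^sup>+s. ennreal (?g s powr p) \<partial>lborel) \<le> (\<integral>\<^sup>+s. ennreal (1 / L a powr p) * (ennreal (((f s - f (s + d k)) / d k * L s) powr p) * indicator {a<..<b} s) \<partial>lborel)"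
        proof (rule nn_integral_mono)
          fix s
          show "ennreal (?g s powr p) \<le> ennreal (1 / L a powr p) * (ennreal (((f s - f (s + d k)) / d k * L s) powr p) * indicator {a<..<b} s)"
          proof (cases "s \<in> U")
            case True
            hence s: "a < s" "s < b" using U by auto
            define G where "G = (f s - f (s + d k)) / d k"
            have "G \<ge> 0" using decr[of s "s + d k"] d[of k] s a by (simp add: G_def)
            have "L a powr p * G powr p = (L a * G) powr p" using La \<open>G \<ge> 0\<close> by (simp add: powr_mult)
            also have "\<dots> \<le> (G * L s) powr p" using Lmono[of a s] s a La \<open>G \<ge> 0\<close> p
              by (intro powr_mono2) (auto simp: mult.commute mult_left_mono)
            finally have "G powr p \<le> 1 / L a powr p * (G * L s) powr p" using La by (simp add: field_simps)
            hence "ennreal (G powr p) \<le> ennreal (1 / L a powr p) * ennreal ((G * L s) powr p)"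
              by (simp add: ennreal_leI flip: ennreal_mult')
            thus ?thesis unfolding g using True s by (simp add: G_def)
          next
            case False
            thus ?thesis using p by simp
          qed
        qed
        also have "\<dots> = ennreal (1 / L a powr p) * (\<integral>\<^sup>+s. (ennreal (((f s - f (s + d k)) / d k * L s) powr p) * indicator {a<..<b} s) \<partial>lborel)"
        proof (rule nn_integral_cmult)
          have "(\<lambda>s. ennreal (((f s - f (s + d k)) / d k * L s) powr p) * indicator {a<..<b} s)
             = (\<lambda>s. ennreal ((((f s * indicator {0<..} s) - (f (s + d k) * indicator {0<..} (s + d k))) / d k * L s) powr p) * indicator {a<..<b} s)"
            using a d[of k] by (auto simp: fun_eq_iff indicator_def)
          also have "\<dots> \<in> borel_measurable lborel" by measurable
          finally show "(\<lambda>s. ennreal (((f s - f (s + d k)) / d k * L s) powr p) * indicator {a<..<b} s) \<in> borel_measurable lborel" .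
        qed
        also have "\<dots> \<le> ennreal (1 / L a powr p) * ennreal C"
          using bound[OF a d] by (intro mult_left_mono) auto
        also have "\<dots> \<le> ennreal (\<bar>C\<bar> / L a powr p + 1)"
        proof -
          have "1 / L a powr p * C \<le> \<bar>C\<bar> / L a powr p + 1" using La by (simp add: field_simps add_nonneg_nonneg le_add_same_cancel1 abs_le_D1)
          from ennreal_leI[OF this] show ?thesis by (subst ennreal_mult'[symmetric]) simp_all
        qed
        finally show "(\<integral>\<^sup>+s. ennreal (?g s powr p) \<partial>lborel) \<le> ennreal (\<bar>C\<bar> / L a powr p + 1)" .
        have "(\<integral>\<^sup>+s. ennreal (indicator U s powr q) \<partial>lborel) = (\<integral>\<^sup>+s. indicator U s \<partial>lborel)"
          using pq by (intro nn_integral_cong) (auto simp: indicator_def)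
        thus "(\<integral>\<^sup>+s. ennreal (indicator U s powr q) \<partial>lborel) \<le> ennreal B" using B by simp
        show "0 < \<bar>C\<bar> / L a powr p + 1" by (intro add_nonneg_pos) auto
      qed (use g0 B in auto)
      also have "1 / q = 1 - 1 / p" using pq by simp
      finally show ?thesis by (simp add: K_def)
    qed
    have quot_eq: "(\<integral>\<^sup>+y. (\<integral>\<^sup>+s. ennreal (1 / d k) * indicator U s * (if s < exp y \<and> exp y \<le> s + d k then 1 else 0) \<partial>lborel) \<partial>I)
        = (\<integral>\<^sup>+s. ennreal ((f s - f (s + d k)) / d k) * indicator U s \<partial>lborel)" for k
    proof -
      interpret P: pair_sigma_finite lborel I ..
      have "(\<integral>\<^sup>+y. (\<integral>\<^sup>+s. ennreal (1 / d k) * indicator U s * (if s < exp y \<and> exp y \<le> s + d k then 1 else 0) \<partial>lborel) \<partial>I)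
        = (\<integral>\<^sup>+s. (\<integral>\<^sup>+y. ennreal (1 / d k) * indicator U s * (if s < exp y \<and> exp y \<le> s + d k then 1 else 0) \<partial>I) \<partial>lborel)"
        by (rule P.Fubini') measurable
      also have "\<dots> = (\<integral>\<^sup>+s. ennreal ((f s - f (s + d k)) / d k) * indicator U s \<partial>lborel)"
      proof (rule nn_integral_cong)
        fix s
        show "(\<integral>\<^sup>+y. ennreal (1 / d k) * indicator U s * (if s < exp y \<and> exp y \<le> s + d k then 1 else 0) \<partial>I)
           = ennreal ((f s - f (s + d k)) / d k) * indicator U s"
        proof (cases "s \<in> U")
          case True
          hence s: "s > 0" using U a by auto
          have "(\<integral>\<^sup>+y. ennreal (1 / d k) * indicator U s * (if s < exp y \<and> exp y \<le> s + d k then 1 else 0) \<partial>I)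
             = (\<integral>\<^sup>+y. ennreal (1 / d k) * indicator {s<..s + d k} (exp y) \<partial>I)"
            using True by (intro nn_integral_cong) (auto simp: indicator_def)
          also have "\<dots> = (\<integral>\<^sup>+x. ennreal (1 / d k) * indicator {s<..s + d k} x \<partial>m)"
            unfolding m_def by (subst nn_integral_distr) auto
          also have "\<dots> = ennreal (1 / d k) * ennreal (f s - f (s + d k))"
            using mIoc[of s "s + d k"] s d[of k] by (subst nn_integral_cmult_indicator) auto
          also have "\<dots> = ennreal ((f s - f (s + d k)) / d k)"
            using d[of k] by (simp flip: ennreal_mult')
          finally show ?thesis using True by simp
        qed simp
      qed
      finally show ?thesis .
    qed
    have "emeasure m U = (\<integral>\<^sup>+x. indicator U x \<partial>m)" by simp
    also have "\<dots> = (\<integral>\<^sup>+y. indicator U (exp y) \<partial>I)" unfolding m_def by (subst nn_integral_distr) auto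
    also have "\<dots> \<le> (\<integral>\<^sup>+y. liminf (\<lambda>k. \<integral>\<^sup>+s. ennreal (1 / d k) * indicator U s * (if s < exp y \<and> exp y \<le> s + d k then 1 else 0) \<partial>lborel) \<partial>I)"
    proof (rule nn_integral_mono)
      fix y :: real
      show "indicator U (exp y) \<le> liminf (\<lambda>k. \<integral>\<^sup>+s. ennreal (1 / d k) * indicator U s * (if s < exp y \<and> exp y \<le> s + d k then 1 else 0) \<partial>lborel)"
      proof (cases "exp y \<in> U")
        case True
        then obtain r where r: "r > 0" "ball (exp y) r \<subseteq> U" using U openE by blast
        have "d \<longlonglongrightarrow> 0" unfolding d_def
          using tendsto_mult_right_zero[OF LIMSEQ_inverse_real_of_nat, of a] by (simp add: divide_inverse)
        hence "\<forall>\<^sub>F k in sequentially. d k < r" using r(1) by (rule order_tendstoD)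
        hence "\<forall>\<^sub>F k in sequentially. 1 \<le> (\<integral>\<^sup>+s. ennreal (1 / d k) * indicator U s * (if s < exp y \<and> exp y \<le> s + d k then 1 else 0) \<partial>lborel)"
        proof eventually_elim
          case (elim k)
          have "(\<integral>\<^sup>+s. ennreal (1 / d k) * indicator {exp y - d k..<exp y} s \<partial>lborel) = ennreal (1 / d k) * ennreal (d k)"
            using d[of k] by (subst nn_integral_cmult_indicator) auto
          also have "\<dots> = 1" using d[of k] by (simp flip: ennreal_mult')
          finally have "1 = (\<integral>\<^sup>+s. ennreal (1 / d k) * indicator {exp y - d k..<exp y} s \<partial>lborel)" by simp
          also have "\<dots> \<le> (\<integral>\<^sup>+s. ennreal (1 / d k) * indicator U s * (if s < exp y \<and> exp y \<le> s + d k then 1 else 0) \<partial>lborel)"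
          proof (rule nn_integral_mono)
            fix s
            show "ennreal (1 / d k) * indicator {exp y - d k..<exp y} s \<le> ennreal (1 / d k) * indicator U s * (if s < exp y \<and> exp y \<le> s + d k then 1 else 0)"
            proof (cases "s \<in> {exp y - d k..<exp y}")
              case True
              hence "s \<in> ball (exp y) r" using elim by (auto simp: dist_real_def)
              hence "s \<in> U" using r by blast
              thus ?thesis using True by auto
            qed simp
          qed
          finally show ?case .
        qed
        hence "1 \<le> liminf (\<lambda>k. \<integral>\<^sup>+s. ennreal (1 / d k) * indicator U s * (if s < exp y \<and> exp y \<le> s + d k then 1 else 0) \<partial>lborel)"
          by (intro Liminf_bounded)
        thus ?thesis using True by simp
      qed simp
    qed
    also have "\<dots> \<le> liminf (\<lambda>k. \<integral>\<^sup>+y. (\<integral>\<^sup>+s. ennreal (1 / d k) * indicator U s * (if s < exp y \<and> exp y \<le> s + d k then 1 else 0) \<partial>lborel) \<partial>I)"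
      by (rule nn_integral_liminf) measurable
    also have "\<dots> \<le> ennreal K"
      unfolding quot_eq using quot by (intro Liminf_le always_eventually) auto
    finally show ?thesis by (simp add: K_def)
  qed
  \<comment> \<open>Outer regularity of Lebesgue measure puts a null set into open sets of measure
    at most \<open>B\<close>; their \<open>m\<close>-mass is of order
    \<open>B powr (1 - 1 / p)\<close> and tends to 0 with \<open>B\<close>.\<close>
  have null_piece: "emeasure m A = 0" if A: "A \<in> sets borel" "emeasure lborel A = 0" "A \<subseteq> {a<..<b}" and a: "0 < a" "a < b" for A a b
  proof -
    define K where "K = (\<bar>C\<bar> / L a powr p + 1) powr (1 / p)"
    have le: "emeasure m A \<le> ennreal (K * B powr (1 - 1 / p))" if B: "B > 0" for B
    proof -
      obtain U where U: "open U" "A \<subseteq> U" "emeasure lborel (U - A) < ennreal B"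
        using outer_regular_lborel[OF A(1) B] by blast
      have "emeasure lborel (U \<inter> {a<..<b}) \<le> emeasure lborel U" using U by (intro emeasure_mono) auto
      also have "\<dots> = emeasure lborel ((U - A) \<union> A)" using U by (intro arg_cong[where f = "emeasure lborel"]) auto
      also have "\<dots> \<le> emeasure lborel (U - A) + emeasure lborel A" using U A by (intro emeasure_subadditive) auto
      also have "\<dots> \<le> ennreal B" using U A by simp
      finally have "emeasure m (U \<inter> {a<..<b}) \<le> ennreal (K * B powr (1 - 1 / p))"
        unfolding K_def using U B a by (intro open_bound[where b = b]) auto
      moreover have "emeasure m A \<le> emeasure m (U \<inter> {a<..<b})" using A U by (intro emeasure_mono) auto
      ultimately show ?thesis by (rule order_trans[rotated])
    qed
    have "((\<lambda>B. ennreal (K * B powr (1 - 1 / p))) \<longlongrightarrow> ennreal (K * 0 powr (1 - 1 / p))) (at_right 0)"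
      using p by (intro tendsto_ennrealI tendsto_mult_left tendsto_powr2) (auto intro!: tendsto_eq_intros eventually_at_right_less[THEN eventually_mono])
    hence "emeasure m A \<le> ennreal (K * 0 powr (1 - 1 / p))"
    proof (rule tendsto_lowerbound)
      show "\<forall>\<^sub>F B in at_right 0. emeasure m A \<le> ennreal (K * B powr (1 - 1 / p))"
        using eventually_at_right_less by eventually_elim (rule le)
    qed simp
    thus ?thesis by simp
  qed
  have ac: "absolutely_continuous lborel m"
    unfolding absolutely_continuous_def
  proof
    fix A assume "A \<in> null_sets (lborel :: real measure)"
    hence A [measurable]: "A \<in> sets borel" and A0: "emeasure lborel A = 0" by auto
    let ?S = "\<lambda>k::nat. A \<inter> {1 / real (k + 2)<..<real (k + 2)}"
    have "emeasure m (?S k) = 0" for k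
    proof (rule null_piece[of _ "1 / real (k + 2)" "real (k + 2)"])
      show "emeasure lborel (?S k) = 0" using emeasure_mono[of "?S k" A lborel] A0 by auto
      show "1 / real (k + 2) < real (k + 2)"
        by (rule less_le_trans[of _ 1]) auto
    qed auto
    hence "(\<Union>k. ?S k) \<in> null_sets m" by (intro null_sets_UN) (auto simp: null_sets_def)
    moreover have "{..0} \<in> null_sets m" using m0 by (simp add: null_sets_def)
    ultimately have "(\<Union>k. ?S k) \<union> {..0} \<in> null_sets m" by (rule null_sets.Un)
    moreover have "A \<subseteq> (\<Union>k. ?S k) \<union> {..0}"
    proof
      fix x assume "x \<in> A"
      show "x \<in> (\<Union>k. ?S k) \<union> {..0}"
      proof (cases "x > 0")
        case True
        obtain k1 where k1: "x < real k1" using reals_Archimedean2 by blast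
        obtain k2 where k2: "1 / x < real k2" using reals_Archimedean2 by blast
        have "1 / x < real (k1 + k2 + 2)" "x < real (k1 + k2 + 2)" using k1 k2 by auto
        hence "1 / real (k1 + k2 + 2) < x" using True by (simp add: field_simps)
        hence "x \<in> {1 / real (k1 + k2 + 2)<..<real (k1 + k2 + 2)}"
          using \<open>x < real (k1 + k2 + 2)\<close> by (simp only: greaterThanLessThan_iff simp_thms)
        thus ?thesis using \<open>x \<in> A\<close> by (intro UnI1 UN_I[of "k1 + k2"] IntI UNIV_I)
      qed simp
    qed
    ultimately show "A \<in> null_sets m" using A by (auto intro: null_sets_subset)
  qed
  obtain H where H [measurable]: "H \<in> borel_measurable lborel" and mH: "density lborel H = m"
    using sigma_finite_measure.Radon_Nikodym[OF sigma_finite_lborel ac] by auto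
  define h where "h s = enn2real (H s) * indicator {0<..} s" for s
  have h [measurable]: "h \<in> borel_measurable borel" unfolding h_def using H by measurable
  have h0: "h s \<ge> 0" for s by (simp add: h_def)
  have Hint: "(\<integral>\<^sup>+s. H s * indicator {a<..b} s \<partial>lborel) = ennreal (f a - f b)" if "0 < a" "a \<le> b" for a b
    using mIoc[OF that] unfolding mH[symmetric] by (subst (asm) emeasure_density) auto
  have hH: "AE s in lborel. s \<in> {a<..b} \<longrightarrow> ennreal (h s) = H s" if "0 < a" "a \<le> b" for a b
  proof -
    have "AE s in lborel. H s * indicator {a<..b} s \<noteq> \<infinity>"
      by (rule nn_integral_noteq_infinite) (use Hint[OF that] in auto)
    thus ?thesis by eventually_elim (use that in \<open>auto simp: h_def less_top\<close>)
  qed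
  have hint: "(\<integral>\<^sup>+s. ennreal (h s) * indicator {a<..<b} s \<partial>lborel) = ennreal (f a - f b)" if ab: "0 < a" "a < b" for a b
  proof -
    have "(\<integral>\<^sup>+s. ennreal (h s) * indicator {a<..<b} s \<partial>lborel) = (\<integral>\<^sup>+s. H s * indicator {a<..b} s \<partial>lborel)"
    proof (rule nn_integral_cong_AE)
      have "AE s in lborel. s \<in> {a<..b} \<longrightarrow> ennreal (h s) = H s" using hH ab by simp
      thus "AE s in lborel. ennreal (h s) * indicator {a<..<b} s = H s * indicator {a<..b} s"
        using AE_lborel_singleton[of b] by eventually_elim (auto simp: indicator_def)
    qed
    thus ?thesis using Hint[of a b] ab by simp
  qed
  have piece: "(\<integral>\<^sup>+s. ennreal ((h s * L s) powr p) * indicator {a<..<b} s \<partial>lborel) \<le> ennreal C" if ab: "0 < a" "a < b" for a b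
  proof -
    define d where "d k = a / real (Suc k)" for k
    have d: "0 < d k" "d k \<le> a" for k using ab by (auto simp: d_def divide_le_eq mult_le_cancel_left1)
    have dlim: "d \<longlonglongrightarrow> 0" unfolding d_def
      using tendsto_mult_right_zero[OF LIMSEQ_inverse_real_of_nat, of a] by (simp add: divide_inverse)
    let ?h = "\<lambda>s. h s * indicator {a<..<b} s"
    have "integrable lborel ?h"
      using hint[OF ab] h0 by (intro integrableI_bounded) (auto simp: ennreal_mult'' ennreal_indicator abs_mult)
    hence hh: "?h integrable_on cbox x y" for x y
      using integrable_on_lborel integrable_on_subcbox by blast
    obtain N where N: "negligible N" "\<And>x. x \<notin> N \<Longrightarrow> ((\<lambda>t. integral {x..x + t} ?h / t) \<longlongrightarrow> ?h x) (at_right 0)"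
      by (rule Lebesgue_differentiation_right[OF hh], rule that)
    \<comment> \<open>The quotient is the mean of \<open>h\<close> over the interval from
      \<open>s\<close> to \<open>s + d k\<close>, and it tends to \<open>h s\<close> at Lebesgue
      points. Fatou then transfers the weighted bound from the quotients to
      \<open>h\<close>.\<close>
    have lim: "(\<lambda>k. (f s - f (s + d k)) / d k) \<longlonglongrightarrow> h s" if s: "s \<notin> N" "s \<in> {a<..<b}" for s
    proof -
      have "filterlim d (at_right 0) sequentially"
        unfolding filterlim_at using dlim d(1) by (auto intro!: always_eventually simp: less_le)
      from filterlim_compose[OF N(2)[OF s(1)] this]
      have "(\<lambda>k. integral {s..s + d k} ?h / d k) \<longlonglongrightarrow> h s" using s by simp
      moreover have "\<forall>\<^sub>F k in sequentially. d k < b - s"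
        using order_tendstoD(2)[OF dlim, of "b - s"] s by simp
      hence "\<forall>\<^sub>F k in sequentially. integral {s..s + d k} ?h / d k = (f s - f (s + d k)) / d k"
      proof eventually_elim
        case (elim k)
        have sk: "0 < s" "s < s + d k" "s + d k < b" using elim s ab d[of k] by auto
        have "(?h has_integral (f s - f (s + d k))) {s..s + d k}"
        proof -
          have "(\<integral>\<^sup>+x. ennreal (?h x * indicator {s..s + d k} x) \<partial>lborel) = (\<integral>\<^sup>+x. ennreal (h x) * indicator {s<..<s + d k} x \<partial>lborel)"
          proof (rule nn_integral_cong_AE)
            show "AE x in lborel. ennreal (?h x * indicator {s..s + d k} x) = ennreal (h x) * indicator {s<..<s + d k} x"
              using AE_lborel_singleton[of s] AE_lborel_singleton[of "s + d k"]
              by eventually_elim (use s sk in \<open>auto simp: indicator_def\<close>)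
          qed
          also have "\<dots> = ennreal (f s - f (s + d k))" using hint[of s "s + d k"] sk by simp
          finally have "has_bochner_integral lborel (\<lambda>x. ?h x * indicator {s..s + d k} x) (f s - f (s + d k))"
            using h0 decr[of s "s + d k"] sk by (intro has_bochner_integral_nn_integral) auto
          hence J: "integrable lborel (\<lambda>x. ?h x * indicator {s..s + d k} x)"
            "(\<integral>x. ?h x * indicator {s..s + d k} x \<partial>lborel) = f s - f (s + d k)"
            unfolding has_bochner_integral_iff by blast+
          from has_integral_integral_lborel[OF J(1)]
          have "((\<lambda>x. ?h x * indicator {s..s + d k} x) has_integral (f s - f (s + d k))) UNIV"
            unfolding J(2) .
          moreover have "(\<lambda>x. ?h x * indicator {s..s + d k} x) = (\<lambda>x. if x \<in> {s..s + d k} then ?h x else 0)"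
            by (auto simp: fun_eq_iff indicator_def)
          ultimately show ?thesis by (simp only: has_integral_restrict_UNIV)
        qed
        thus ?case by (simp add: integral_unique)
      qed
      ultimately show ?thesis by (rule Lim_transform_eventually)
    qed
    let ?Q = "\<lambda>k s. ennreal (((f s - f (s + d k)) / d k * L s) powr p) * indicator {a<..<b} s"
    have Qm: "?Q k \<in> borel_measurable lborel" for k
    proof -
      have "?Q k = (\<lambda>s. ennreal ((((f s * indicator {0<..} s) - (f (s + d k) * indicator {0<..} (s + d k))) / d k * L s) powr p) * indicator {a<..<b} s)"
        using ab d[of k] by (auto simp: fun_eq_iff indicator_def)
      also have "\<dots> \<in> borel_measurable lborel" by measurable
      finally show ?thesis .
    qed
    have "AE s in lebesgue. s \<notin> N" using N(1) by (auto simp: negligible_iff_null_sets intro: AE_not_in)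
    hence "AE s in lborel. s \<notin> N" by (rule AE_completion_iff[THEN iffD1])
    hence "AE s in lborel. ennreal ((h s * L s) powr p) * indicator {a<..<b} s \<le> liminf (\<lambda>k. ?Q k s)"
    proof eventually_elim
      case (elim s)
      show ?case
      proof (cases "s \<in> {a<..<b}")
        case True
        have "(\<lambda>k. ennreal (((f s - f (s + d k)) / d k * L s) powr p)) \<longlonglongrightarrow> ennreal ((h s * L s) powr p)"
        proof (intro tendsto_ennrealI tendsto_powr2 tendsto_mult_right lim)
          show "\<forall>\<^sub>F k in sequentially. 0 \<le> (f s - f (s + d k)) / d k * L s"
          proof (intro always_eventually allI)
            fix k show "0 \<le> (f s - f (s + d k)) / d k * L s"
              using decr[of s "s + d k"] d[of k] L0[of s] True ab by simp
          qed
        qed (use p elim True in auto)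
        hence "liminf (\<lambda>k. ennreal (((f s - f (s + d k)) / d k * L s) powr p)) = ennreal ((h s * L s) powr p)"
          by (intro lim_imp_Liminf) auto
        thus ?thesis using True by simp
      qed simp
    qed
    hence "(\<integral>\<^sup>+s. ennreal ((h s * L s) powr p) * indicator {a<..<b} s \<partial>lborel) \<le> (\<integral>\<^sup>+s. liminf (\<lambda>k. ?Q k s) \<partial>lborel)"
      by (rule nn_integral_mono_AE)
    also have "\<dots> \<le> liminf (\<lambda>k. \<integral>\<^sup>+s. ?Q k s \<partial>lborel)" by (rule nn_integral_liminf[OF Qm])
    also have "\<dots> \<le> ennreal C" using bound[OF ab d] by (intro Liminf_le always_eventually) auto
    finally show ?thesis .
  qed
  have "(\<integral>\<^sup>+s. ennreal ((h s * L s) powr p) * indicator {0<..} s \<partial>lborel)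
     \<le> (\<integral>\<^sup>+s. liminf (\<lambda>k. ennreal ((h s * L s) powr p) * indicator {1 / real (k + 2)<..<real (k + 2)} s) \<partial>lborel)"
  proof (rule nn_integral_mono)
    fix s :: real
    show "ennreal ((h s * L s) powr p) * indicator {0<..} s \<le> liminf (\<lambda>k. ennreal ((h s * L s) powr p) * indicator {1 / real (k + 2)<..<real (k + 2)} s)"
    proof (cases "s > 0")
      case True
      obtain k1 where k1: "s < real k1" using reals_Archimedean2 by blast
      obtain k2 where k2: "1 / s < real k2" using reals_Archimedean2 by blast
      have "\<forall>\<^sub>F k in sequentially. ennreal ((h s * L s) powr p) * indicator {0<..} s \<le> ennreal ((h s * L s) powr p) * indicator {1 / real (k + 2)<..<real (k + 2)} s"
        using eventually_ge_at_top[of "k1 + k2"]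
      proof eventually_elim
        case (elim k)
        have "1 / s < real (k + 2)" "s < real (k + 2)" using k1 k2 elim by auto
        hence "1 / real (k + 2) < s" using True by (simp add: field_simps)
        thus ?case using \<open>s < real (k + 2)\<close> True by simp
      qed
      thus ?thesis by (rule Liminf_bounded)
    qed simp
  qed
  also have "\<dots> \<le> liminf (\<lambda>k. \<integral>\<^sup>+s. ennreal ((h s * L s) powr p) * indicator {1 / real (k + 2)<..<real (k + 2)} s \<partial>lborel)"
    by (rule nn_integral_liminf) measurable
  also have "\<dots> \<le> ennreal C"
  proof (intro Liminf_le always_eventually allI piece)
    fix k :: nat show "1 / real (k + 2) < real (k + 2)" by (rule less_le_trans[of _ 1]) auto
  qed auto
  finally show ?thesis using that[of h] h h0 hint by blast
qed

section \<open>The derivative of the rearrangement\<close>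

text \<open>Pointwise \<open>g \<le> 1 + g powr p\<close>, and the interval has finite length. This
  supplies the local integrability that weak gradients require.\<close>

lemma nn_integral_Lp_finite_interval:
  fixes g :: "real \<Rightarrow> real"
  assumes [measurable]: "g \<in> borel_measurable borel" and g0: "\<And>s. 0 < s \<Longrightarrow> g s \<ge> 0" and p: "p \<ge> 1"
    and fin: "(\<integral>\<^sup>+s. ennreal (g s powr p) * indicator {0<..} s \<partial>lborel) < \<infinity>"
  shows "(\<integral>\<^sup>+s. ennreal (g s) * indicator {0<..<S} s \<partial>lborel) < \<infinity>"
proof -
  have "(\<integral>\<^sup>+s. ennreal (g s) * indicator {0<..<S} s \<partial>lborel)
      \<le> (\<integral>\<^sup>+s. indicator {0<..<S} s + ennreal (g s powr p) * indicator {0<..} s \<partial>lborel)"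
  proof (rule nn_integral_mono)
    fix s
    show "ennreal (g s) * indicator {0<..<S} s \<le> indicator {0<..<S} s + ennreal (g s powr p) * indicator {0<..} s"
    proof (cases "s \<in> {0<..<S}")
      case True
      have "g s \<le> 1 + g s powr p"
      proof (cases "g s \<ge> 1")
        case True
        have "g s powr 1 \<le> g s powr p" using True p by (intro powr_mono) auto
        thus ?thesis using True by simp
      qed (simp add: add_increasing2)
      hence "ennreal (g s) \<le> 1 + ennreal (g s powr p)" by (metis ennreal_1 ennreal_leI ennreal_plus powr_ge_zero zero_le_one)
      thus ?thesis using True by simp
    qed simp
  qed
  also have "\<dots> = emeasure lborel {0<..<S} + (\<integral>\<^sup>+s. ennreal (g s powr p) * indicator {0<..} s \<partial>lborel)"
    by (subst nn_integral_add) auto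
  also have "\<dots> < \<infinity>"
    using fin emeasure_bounded_finite[of "{0<..<S}"] by (simp add: ennreal_add_less_top less_top[symmetric])
  finally show ?thesis .
qed

lemma decr_rearr_tendsto_0:
  fixes u :: "real^'n::finite \<Rightarrow> real"
  assumes u: "rearrangeable u" and e: "e > 0"
  obtains b where "b > 0" "\<And>s. s \<ge> b \<Longrightarrow> decr_rearr u s \<le> e"
proof -
  have "distr_hyp u e < \<infinity>" using u e by (simp add: rearrangeable_def)
  then obtain r where r: "distr_hyp u e = ennreal r" "r \<ge> 0" by (cases "distr_hyp u e") auto
  have "decr_rearr u s \<le> e" if "s \<ge> r + 1" for s
  proof (rule ccontr)
    assume "\<not> decr_rearr u s \<le> e"
    hence "ennreal s < distr_hyp u e" using decr_rearr_gt_iff[OF u, of s e] e that r by simp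
    thus False using r that by (simp add: ennreal_less_iff)
  qed
  thus ?thesis using r by (intro that[of "r + 1"]) auto
qed

lemma powr_add_le:
  fixes a b :: real
  assumes "a \<ge> 0" "b \<ge> 0" "p \<ge> 0"
  shows "(a + b) powr p \<le> 2 powr p * (a powr p + b powr p)"
proof -
  have "(a + b) powr p \<le> (2 * max a b) powr p" using assms by (intro powr_mono2) auto
  also have "\<dots> = 2 powr p * (max a b) powr p" using assms by (simp add: powr_mult)
  also have "(max a b) powr p \<le> a powr p + b powr p" by (simp add: max_def)
  finally show ?thesis by simp
qed

text \<open>The approximating test functions have uniformly bounded energies and converge to
  \<open>u\<close> in measure by Markov's inequality. Their rearrangements therefore converge almost
  everywhere, and the weighted bounds on difference quotients pass to the rearrangement of
  \<open>u\<close>, where they produce the density \<open>h\<close>.\<close>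

lemma decr_rearr_density:
  fixes u :: "real^'n::finite \<Rightarrow> real" and p :: real
  assumes n: "CARD('n) \<ge> 2" and p: "p > 1" and hu: "u \<in> W1p_hyp p"
  obtains h where "rearrangeable u" "(\<integral>\<^sup>+x. ennreal (\<bar>u x\<bar> powr p) \<partial>hypV) < \<infinity>"
    "h \<in> borel_measurable borel" "\<And>s. h s \<ge> 0"
    "\<And>a b. 0 < a \<Longrightarrow> a < b \<Longrightarrow> (\<integral>\<^sup>+s. ennreal (h s) * indicator {a<..<b} s \<partial>lborel) = ennreal (decr_rearr u a - decr_rearr u b)"
    "(\<integral>\<^sup>+s. ennreal ((h s * (s + s powr (1 - 1 / real CARD('n)))) powr p) * indicator {0<..} s \<partial>lborel) < \<infinity>"
proof -
  obtain G \<phi> where um [measurable]: "u \<in> borel_measurable hypV" and Gm [measurable]: "G \<in> borel_measurable hypV"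
    and ufin: "(\<integral>\<^sup>+x. ennreal (\<bar>u x\<bar> powr p) \<partial>hypV) < \<infinity>"
    and Gfin: "(\<integral>\<^sup>+x. ennreal (hyp_norm x (G x) powr p) \<partial>hypV) < \<infinity>"
    and \<phi>: "\<And>k. test_fun (ball 0 1) (\<phi> k)"
    and lim0: "(\<lambda>k. \<integral>\<^sup>+x. ennreal (\<bar>\<phi> k x - u x\<bar> powr p) \<partial>hypV) \<longlonglongrightarrow> 0"
    and lim1: "(\<lambda>k. \<integral>\<^sup>+x. ennreal (hyp_norm x (egrad (\<phi> k) x - G x) powr p) \<partial>hypV) \<longlonglongrightarrow> 0"
    using hu unfolding W1p_hyp_def by blast
  have u: "rearrangeable u" by (rule rearrangeable_Lp[OF um _ ufin]) (use p in simp)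
  have \<phi>r: "rearrangeable (\<phi> k)" for k by (rule test_fun_rearrangeable[OF \<phi>])
  have \<phi>m [measurable]: "\<phi> k \<in> borel_measurable hypV" for k using \<phi>r[of k] by (simp add: rearrangeable_def)
  have Dm [measurable]: "egrad (\<phi> k) \<in> borel_measurable hypV" for k
    by (rule borel_measurable_hypV[OF C1c_borel_measurable(2)[OF C1c_test_fun(1)[OF \<phi>]]])
  have nm [measurable]: "(\<lambda>x::real^'n. (1 - (norm x)\<^sup>2) / 2) \<in> borel_measurable hypV"
    by (rule borel_measurable_hypV) measurable
  define IG where "IG = enn2real (\<integral>\<^sup>+x. ennreal (hyp_norm x (G x) powr p) \<partial>hypV)"
  have IG: "(\<integral>\<^sup>+x. ennreal (hyp_norm x (G x) powr p) \<partial>hypV) = ennreal IG" "IG \<ge> 0"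
    using Gfin by (simp_all add: IG_def)
  \<comment> \<open>From \<open>powr_add_le\<close> applied to the gradient of the approximation:
    the distance to \<open>G\<close> is eventually below 1 in the \<open>p\<close>-th power, and
    \<open>IG\<close> is the energy of \<open>G\<close>.\<close>
  define E0 where "E0 = 2 powr p * (1 + IG)"
  have E0: "E0 \<ge> 0" using IG by (simp add: E0_def)
  have ev: "\<forall>\<^sub>F k in sequentially. (\<integral>\<^sup>+x. ennreal (hyp_norm x (egrad (\<phi> k) x) powr p) \<partial>hypV) \<le> ennreal E0"
  proof -
    have "\<forall>\<^sub>F k in sequentially. (\<integral>\<^sup>+x. ennreal (hyp_norm x (egrad (\<phi> k) x - G x) powr p) \<partial>hypV) < 1"
      using lim1 by (rule order_tendstoD) simp
    thus ?thesis
    proof eventually_elim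
      case (elim k)
      have "(\<integral>\<^sup>+x. ennreal (hyp_norm x (egrad (\<phi> k) x) powr p) \<partial>hypV)
         \<le> (\<integral>\<^sup>+x. ennreal (2 powr p) * (ennreal (hyp_norm x (egrad (\<phi> k) x - G x) powr p) + ennreal (hyp_norm x (G x) powr p)) \<partial>hypV)"
      proof (rule nn_integral_mono)
        fix x assume "x \<in> space (hypV :: (real^'n) measure)"
        hence x: "norm x < 1" by simp
        define c where "c = (1 - (norm x)\<^sup>2) / 2"
        have c: "c > 0" using one_minus_square_pos[of "norm x"] x by (simp add: c_def)
        have "norm (egrad (\<phi> k) x) \<le> norm (egrad (\<phi> k) x - G x) + norm (G x)"
          by (metis diff_add_cancel norm_triangle_ineq)
        hence "c * norm (egrad (\<phi> k) x) \<le> c * (norm (egrad (\<phi> k) x - G x) + norm (G x))" using c by (intro mult_left_mono) auto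
        hence "hyp_norm x (egrad (\<phi> k) x) \<le> hyp_norm x (egrad (\<phi> k) x - G x) + hyp_norm x (G x)"
          unfolding hyp_norm_def c_def[symmetric] by (simp add: distrib_left)
        hence "hyp_norm x (egrad (\<phi> k) x) powr p \<le> (hyp_norm x (egrad (\<phi> k) x - G x) + hyp_norm x (G x)) powr p"
          using c p by (intro powr_mono2) (auto simp: hyp_norm_def c_def[symmetric])
        also have "\<dots> \<le> 2 powr p * (hyp_norm x (egrad (\<phi> k) x - G x) powr p + hyp_norm x (G x) powr p)"
          using c p by (intro powr_add_le) (auto simp: hyp_norm_def c_def[symmetric])
        finally show "ennreal (hyp_norm x (egrad (\<phi> k) x) powr p) \<le> ennreal (2 powr p) * (ennreal (hyp_norm x (egrad (\<phi> k) x - G x) powr p) + ennreal (hyp_norm x (G x) powr p))"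
          by (simp add: ennreal_leI flip: ennreal_plus ennreal_mult')
      qed
      also have "\<dots> = ennreal (2 powr p) * ((\<integral>\<^sup>+x. ennreal (hyp_norm x (egrad (\<phi> k) x - G x) powr p) \<partial>hypV) + ennreal IG)"
      proof -
        have m1: "(\<lambda>x. ennreal (hyp_norm x (egrad (\<phi> k) x - G x) powr p)) \<in> borel_measurable hypV"
          unfolding hyp_norm_def by measurable
        have m2: "(\<lambda>x. ennreal (hyp_norm x (G x) powr p)) \<in> borel_measurable hypV"
          unfolding hyp_norm_def by measurable
        show ?thesis
          by (simp only: nn_integral_cmult[OF borel_measurable_add[OF m1 m2]] nn_integral_add[OF m1 m2] IG(1))
      qed
      also have "\<dots> \<le> ennreal (2 powr p) * (1 + ennreal IG)"
        using elim by (intro mult_left_mono add_right_mono) auto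
      also have "\<dots> = ennreal E0" using IG(2) unfolding E0_def by (subst ennreal_mult') (simp_all add: ennreal_plus)
      finally show ?case .
    qed
  qed
  have dconv: "(\<lambda>k. distr_hyp (\<lambda>x. \<phi> k x - u x) \<epsilon>) \<longlonglongrightarrow> 0" if \<epsilon>: "\<epsilon> > 0" for \<epsilon>
  proof (rule tendsto_sandwich)
    show "\<forall>\<^sub>F k in sequentially. 0 \<le> distr_hyp (\<lambda>x. \<phi> k x - u x) \<epsilon>" by simp
    show "\<forall>\<^sub>F k in sequentially. distr_hyp (\<lambda>x. \<phi> k x - u x) \<epsilon> \<le> ennreal (1 / \<epsilon> powr p) * (\<integral>\<^sup>+x. ennreal (\<bar>\<phi> k x - u x\<bar> powr p) \<partial>hypV)"
      using \<epsilon> p by (intro always_eventually allI distr_hyp_Markov) auto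
    show "(\<lambda>k. ennreal (1 / \<epsilon> powr p) * (\<integral>\<^sup>+x. ennreal (\<bar>\<phi> k x - u x\<bar> powr p) \<partial>hypV)) \<longlonglongrightarrow> 0"
      using ennreal_tendsto_cmult[OF _ lim0, of "ennreal (1 / \<epsilon> powr p)"] by simp
  qed simp
  define f where "f = decr_rearr u"
  define L where "L s = s + s powr (1 - 1 / real CARD('n))" for s :: real
  define C where "C = iso_const TYPE('n) powr p * E0"
  have Lm [measurable]: "L \<in> borel_measurable borel" unfolding L_def by measurable
  have L0: "L s > 0" if "s > 0" for s using that by (simp add: L_def add_pos_nonneg)
  have Lmono: "L s \<le> L t" if "0 < s" "s \<le> t" for s t
    unfolding L_def using that n by (intro add_mono powr_mono2) auto
  have fm [measurable]: "(\<lambda>s. decr_rearr v s * indicator {0<..} s) \<in> borel_measurable borel" if "rearrangeable v" for v :: "real^'n \<Rightarrow> real"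
    by (rule decr_rearr_borel_measurable[OF that])
  have bound: "(\<integral>\<^sup>+s. ennreal (((f s - f (s + d)) / d * L s) powr p) * indicator {a<..<b} s \<partial>lborel) \<le> ennreal C"
    if ab: "0 < a" "a < b" and d: "0 < d" "d \<le> a" for a b d
  proof -
    let ?Q = "\<lambda>v s. ennreal (((decr_rearr v s - decr_rearr v (s + d)) / d * L s) powr p) * indicator {a<..<b} s"
    have Qm: "?Q v \<in> borel_measurable lborel" if v: "rearrangeable v" for v :: "real^'n \<Rightarrow> real"
    proof -
      note [measurable] = fm[OF v]
      have "?Q v = (\<lambda>s. ennreal ((((decr_rearr v s * indicator {0<..} s) - (decr_rearr v (s + d) * indicator {0<..} (s + d))) / d * L s) powr p) * indicator {a<..<b} s)"
        using ab d by (auto simp: fun_eq_iff indicator_def)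
      also have "\<dots> \<in> borel_measurable lborel" by measurable
      finally show ?thesis .
    qed
    have c1: "AE s in lborel. s > 0 \<longrightarrow> isCont f s" unfolding f_def by (rule decr_rearr_isCont_AE[OF u])
    \<comment> \<open>Convergence is needed at \<open>s\<close> and at \<open>s + d\<close>
      simultaneously; the exceptional set for the second point is a translate of the one for the
      first, hence null as well.\<close>
    have "AE s in distr lborel borel ((+) d). s > 0 \<longrightarrow> isCont f s" using c1 unfolding lborel_distr_plus .
    hence c2: "AE s in lborel. d + s > 0 \<longrightarrow> isCont f (d + s)" by (rule AE_distrD[rotated]) simp
    have "AE s in lborel. ennreal (((f s - f (s + d)) / d * L s) powr p) * indicator {a<..<b} s \<le> liminf (\<lambda>k. ?Q (\<phi> k) s)"
      using c1 c2
    proof eventually_elim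
      case (elim s)
      show ?case
      proof (cases "s \<in> {a<..<b}")
        case True
        hence s: "s > 0" using ab by simp
        have l1: "(\<lambda>k. decr_rearr (\<phi> k) s) \<longlonglongrightarrow> f s"
          unfolding f_def using elim s by (intro decr_rearr_tendsto[OF u \<phi>r dconv]) (auto simp: f_def)
        have l2: "(\<lambda>k. decr_rearr (\<phi> k) (s + d)) \<longlonglongrightarrow> f (s + d)"
          unfolding f_def using elim s d by (intro decr_rearr_tendsto[OF u \<phi>r dconv]) (auto simp: f_def add.commute)
        have "(\<lambda>k. ennreal (((decr_rearr (\<phi> k) s - decr_rearr (\<phi> k) (s + d)) / d * L s) powr p)) \<longlonglongrightarrow> ennreal (((f s - f (s + d)) / d * L s) powr p)"
        proof (intro tendsto_ennrealI tendsto_powr2 tendsto_mult_right tendsto_divide tendsto_diff l1 l2 tendsto_const)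
          show "\<forall>\<^sub>F k in sequentially. 0 \<le> (decr_rearr (\<phi> k) s - decr_rearr (\<phi> k) (s + d)) / d * L s"
          proof (intro always_eventually allI)
            fix k show "0 \<le> (decr_rearr (\<phi> k) s - decr_rearr (\<phi> k) (s + d)) / d * L s"
              using decr_rearr_antimono[OF \<phi>r s, of "s + d" k] d L0[OF s] by simp
          qed
        qed (use p d in auto)
        hence "liminf (\<lambda>k. ennreal (((decr_rearr (\<phi> k) s - decr_rearr (\<phi> k) (s + d)) / d * L s) powr p)) = ennreal (((f s - f (s + d)) / d * L s) powr p)"
          by (intro lim_imp_Liminf) auto
        thus ?thesis using True by simp
      qed simp
    qed
    hence "(\<integral>\<^sup>+s. ennreal (((f s - f (s + d)) / d * L s) powr p) * indicator {a<..<b} s \<partial>lborel) \<le> (\<integral>\<^sup>+s. liminf (\<lambda>k. ?Q (\<phi> k) s) \<partial>lborel)"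
      by (rule nn_integral_mono_AE)
    also have "\<dots> \<le> liminf (\<lambda>k. \<integral>\<^sup>+s. ?Q (\<phi> k) s \<partial>lborel)" by (rule nn_integral_liminf[OF Qm[OF \<phi>r]])
    also have "\<dots> \<le> ennreal C"
    proof (rule Liminf_le)
      show "\<forall>\<^sub>F k in sequentially. (\<integral>\<^sup>+s. ?Q (\<phi> k) s \<partial>lborel) \<le> ennreal C"
        using ev
      proof eventually_elim
        case (elim k)
        show ?case unfolding C_def L_def by (rule decr_rearr_difference_test_fun[OF \<phi> n p elim E0 ab d])
      qed
    qed simp
    finally show ?thesis .
  qed
  obtain h where h: "h \<in> borel_measurable borel" "\<And>s. h s \<ge> 0"
    "\<And>a b. 0 < a \<Longrightarrow> a < b \<Longrightarrow> (\<integral>\<^sup>+s. ennreal (h s) * indicator {a<..<b} s \<partial>lborel) = ennreal (f a - f b)"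
    "(\<integral>\<^sup>+s. ennreal ((h s * L s) powr p) * indicator {0<..} s \<partial>lborel) \<le> ennreal C"
  proof (rule decreasing_difference_quotients[OF p, of f L C])
    show "f t \<le> f s" if "0 < s" "s \<le> t" for s t using decr_rearr_antimono[OF u that] by (simp add: f_def)
    show "(f \<longlongrightarrow> f s) (at_right s)" if "0 < s" for s using decr_rearr_right_continuous[OF u that] by (simp add: f_def)
    show "(\<lambda>s. f s * indicator {0<..} s) \<in> borel_measurable borel" unfolding f_def by (rule fm[OF u])
  qed (use Lm L0 Lmono bound in auto)
  show ?thesis
  proof (rule that[OF u ufin h(1,2)])
    show "(\<integral>\<^sup>+s. ennreal (h s) * indicator {a<..<b} s \<partial>lborel) = ennreal (decr_rearr u a - decr_rearr u b)" if "0 < a" "a < b" for a b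
      using h(3)[OF that] by (simp add: f_def)
    show "(\<integral>\<^sup>+s. ennreal ((h s * (s + s powr (1 - 1 / real CARD('n)))) powr p) * indicator {0<..} s \<partial>lborel) < \<infinity>"
      using h(4) by (simp add: L_def le_less_trans)
  qed
qed

section \<open>Comparison of the energies\<close>

text \<open>The chain rule for the profile \<open>f\<close> composed with the volume function
  \<open>V\<close>, in integrated form: substituting \<open>s = V t\<close> turns the density
  \<open>h\<close> of \<open>f\<close> into the density \<open>h (V t) * V' t\<close> in the
  radius.\<close>

lemma nn_integral_density_volume:
  fixes f h V V' :: "real \<Rightarrow> real"
  assumes h [measurable]: "h \<in> borel_measurable borel" and h0: "\<And>s. h s \<ge> 0"
    and hint: "\<And>a b. 0 < a \<Longrightarrow> a < b \<Longrightarrow> (\<integral>\<^sup>+s. ennreal (h s) * indicator {a<..<b} s \<partial>lborel) = ennreal (f a - f b)"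
    and rb: "r < b" and V: "0 < V r" "V r < V b"
    and deriv: "\<And>x. x \<in> {r..b} \<Longrightarrow> (V has_real_derivative V' x) (at x)"
    and cont: "continuous_on {r..b} V'" and V'0: "\<And>x. x \<in> {r..b} \<Longrightarrow> V' x \<ge> 0"
  shows "ennreal (f (V r) - f (V b)) = (\<integral>\<^sup>+t. ennreal (h (V t) * V' t) * indicator {r<..<b} t \<partial>lborel)"
proof -
  have "ennreal (f (V r) - f (V b)) = (\<integral>\<^sup>+s. ennreal (h s) * indicator {V r<..<V b} s \<partial>lborel)"
    using hint[OF V] by simp
  also have "\<dots> = (\<integral>\<^sup>+s. ennreal (h s) * indicator {V r..V b} s \<partial>lborel)"
  proof (rule nn_integral_cong_AE)
    show "AE s in lborel. ennreal (h s) * indicator {V r<..<V b} s = ennreal (h s) * indicator {V r..V b} s"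
      using AE_lborel_singleton[of "V r"] AE_lborel_singleton[of "V b"]
      by eventually_elim (auto simp: indicator_def)
  qed
  also have "\<dots> = (\<integral>\<^sup>+t. ennreal (h (V t)) * ennreal (V' t) * indicator {r..b} t \<partial>lborel)"
    by (rule nn_integral_substitution_aux[OF _ _ deriv cont V'0 rb]) auto
  also have "\<dots> = (\<integral>\<^sup>+t. ennreal (h (V t) * V' t) * indicator {r<..<b} t \<partial>lborel)"
  proof (rule nn_integral_cong_AE)
    show "AE t in lborel. ennreal (h (V t)) * ennreal (V' t) * indicator {r..b} t = ennreal (h (V t) * V' t) * indicator {r<..<b} t"
      using AE_lborel_singleton[of r] AE_lborel_singleton[of b]
    proof eventually_elim
      case (elim t)
      show ?case using elim h0[of "V t"] by (auto simp: indicator_def ennreal_mult')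
    qed
  qed
  finally show ?thesis .
qed

lemma norm_radial_field:
  assumes "k \<ge> 0"
  shows "norm ((- k / norm x) *\<^sub>R x) = (if x = 0 then 0 else (k::real))"
  using assms by simp

text \<open>The gradients are produced as weak gradients, which determine them up to null sets.
  Integrability of the three integrands is part of the conclusion because the real-valued integral
  of a nonintegrable function is 0 by convention, which would distort the inequality.\<close>

theorem theorem2p2:
  fixes u :: "real^'n::finite \<Rightarrow> real" and p :: real
  assumes n2: "CARD('n) \<ge> 2"
    and hp: "(CARD('n) = 2 \<and> p \<ge> 2) \<or>
             (CARD('n) \<ge> 3 \<and> p \<ge> 2 * real CARD('n) / (real CARD('n) - 1))"
    and hu: "u \<in> W1p_hyp p"
  shows "\<exists>Gg Ge.
           weak_grad (ball 0 1) (hyp_sym_rearr u) Gg \<and>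
           weak_grad UNIV (euc_sym_rearr u) Ge \<and>
           integrable hypV (\<lambda>x. hyp_norm x (Gg x) powr p) \<and>
           integrable hypV (\<lambda>x. \<bar>hyp_sym_rearr u x\<bar> powr p) \<and>
           integrable lebesgue (\<lambda>x. norm (Ge x) powr p) \<and>
           (\<integral>x. hyp_norm x (Gg x) powr p \<partial>hypV)
             - ((real CARD('n) - 1) / p) powr p * (\<integral>x. \<bar>hyp_sym_rearr u x\<bar> powr p \<partial>hypV)
           \<ge> (\<integral>x. norm (Ge x) powr p \<partial>lebesgue)"
proof -
  define n where "n = CARD('n)"
  define \<sigma> where "\<sigma> = unit_ball_vol TYPE('n)"
  have \<sigma>: "\<sigma> > 0" by (simp add: \<sigma>_def unit_ball_vol_def content_ball_pos)
  have n: "n \<ge> 2" "real n \<ge> 2" using n2 by (simp_all add: n_def)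
  have p: "p > 1"
  proof -
    have "2 * real n / (real n - 1) > 1" using n by (simp add: field_simps)
    thus ?thesis using hp[folded n_def] by (elim disjE conjE) linarith+
  qed
  define L where "L s = s + s powr (1 - 1 / real n)" for s :: real
  obtain h where u: "rearrangeable u" and ufin: "(\<integral>\<^sup>+x. ennreal (\<bar>u x\<bar> powr p) \<partial>hypV) < \<infinity>"
    and h [measurable]: "h \<in> borel_measurable borel" and h0: "\<And>s. h s \<ge> 0"
    and hint: "\<And>a b. 0 < a \<Longrightarrow> a < b \<Longrightarrow> (\<integral>\<^sup>+s. ennreal (h s) * indicator {a<..<b} s \<partial>lborel) = ennreal (decr_rearr u a - decr_rearr u b)"
    and hL': "(\<integral>\<^sup>+s. ennreal ((h s * (s + s powr (1 - 1 / real CARD('n)))) powr p) * indicator {0<..} s \<partial>lborel) < \<infinity>"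
    by (rule decr_rearr_density[OF n2 p hu], rule that)
  have hL: "(\<integral>\<^sup>+s. ennreal ((h s * L s) powr p) * indicator {0<..} s \<partial>lborel) < \<infinity>"
    unfolding L_def n_def by (rule hL')
  have Lm [measurable]: "L \<in> borel_measurable borel" unfolding L_def by measurable
  have L0: "L s \<ge> 0" if "s > 0" for s using that by (simp add: L_def)
  text \<open>The argument \<open>0\<close> is masked because the supremum defining the rearrangement there may be
    taken over an unbounded set.\<close>
  define f where "f s = decr_rearr u s * indicator {0<..} s" for s
  have fm [measurable]: "f \<in> borel_measurable borel" unfolding f_def by (rule decr_rearr_borel_measurable[OF u])
  have f0: "f s \<ge> 0" for s using decr_rearr_nonneg[OF u] by (simp add: f_def indicator_def)
  have f_eq: "f s = decr_rearr u s" if "s > 0" for s using that by (simp add: f_def)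
  have fanti: "f t \<le> f s" if "0 < s" "s \<le> t" for s t using decr_rearr_antimono[OF u that] that by (simp add: f_def)
  have fint: "(\<integral>\<^sup>+s. ennreal (h s) * indicator {a<..<b} s \<partial>lborel) = ennreal (f a - f b)" if "0 < a" "a < b" for a b
    using hint[OF that] that by (simp add: f_eq)
  have fp: "(\<integral>\<^sup>+s. ennreal (f s powr p) * indicator {0<..} s \<partial>lborel) < \<infinity>"
  proof -
    have "(\<integral>\<^sup>+s. ennreal (f s powr p) * indicator {0<..} s \<partial>lborel) = (\<integral>\<^sup>+s. ennreal (decr_rearr u s powr p) * indicator {0<..} s \<partial>lborel)"
      by (intro nn_integral_cong) (auto simp: f_def indicator_def)
    thus ?thesis using nn_integral_decr_rearr_powr[OF u, of p] ufin p by simp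
  qed
  have f_tail: "ennreal (f s) \<le> (\<integral>\<^sup>+t. ennreal (h t) * indicator {s..} t \<partial>lborel)" if s: "s > 0" for s
  proof (rule ennreal_le_epsilon)
    fix e :: real assume e: "e > 0"
    obtain b where b: "b > 0" "\<And>t. t \<ge> b \<Longrightarrow> decr_rearr u t \<le> e" using decr_rearr_tendsto_0[OF u e] by metis
    define c where "c = max b (s + 1)"
    have c: "s < c" "f c \<le> e" using b s by (auto simp: c_def f_def)
    have "ennreal (f s) \<le> ennreal ((f s - f c) + e)" using c by (intro ennreal_leI) simp
    also have "\<dots> = ennreal (f s - f c) + ennreal e" using fanti[of s c] s c e by (intro ennreal_plus) auto
    also have "ennreal (f s - f c) = (\<integral>\<^sup>+t. ennreal (h t) * indicator {s<..<c} t \<partial>lborel)" using fint[of s c] s c by simp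
    also have "\<dots> \<le> (\<integral>\<^sup>+t. ennreal (h t) * indicator {s..} t \<partial>lborel)"
      by (intro nn_integral_mono) (auto simp: indicator_def)
    finally show "ennreal (f s) \<le> (\<integral>\<^sup>+t. ennreal (h t) * indicator {s..} t \<partial>lborel) + ennreal e"
      by (simp add: add_right_mono)
  qed
  have Hardy: "(\<integral>\<^sup>+s. ennreal (f s powr p) * indicator {0<..} s \<partial>lborel)
      \<le> ennreal (p powr p) * (\<integral>\<^sup>+t. ennreal ((t * h t) powr p) * indicator {0<..} t \<partial>lborel)"
    by (rule Hardy_inequality_tail[OF p fm h h0 f0 f_tail])

  \<comment> \<open>Perimeters as functions of the volume\<close>
  define c0 where "c0 = 2 * real n * (1 + \<sigma> powr (1 / real n))"
  have c0: "c0 > 0" using n by (auto simp: c0_def intro!: mult_pos_pos add_pos_nonneg)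
  text \<open>Perimeters of balls of volume \<open>s\<close>: Euclidean as a function of \<open>s\<close>, hyperbolic as a function
    of the Euclidean radius.\<close>
  define Ke where "Ke s = real n * \<sigma> powr (1 / real n) * s powr (1 - 1 / real n)" for s :: real
  have Kem [measurable]: "Ke \<in> borel_measurable borel" unfolding Ke_def by measurable
  have Ke0: "Ke s \<ge> 0" for s by (simp add: Ke_def)
  \<comment> \<open>\<open>L\<close> is the weight for which \<open>h * L\<close> has a finite
    \<open>p\<close>-norm, so both perimeters have to be dominated by a multiple of it. In
    \<open>c0\<close> the factor 2 comes from \<open>hsinh_power_le\<close>, and
    \<open>\<sigma> powr (1 / n)\<close> from the normalization of volumes.\<close>
  have KeL: "Ke s \<le> c0 * L s" if "s > 0" for s
  proof -
    have "Ke s = real n * (\<sigma> powr (1 / real n) * s powr (1 - 1 / real n))" by (simp add: Ke_def)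
    also have "\<dots> \<le> (2 * real n) * ((1 + \<sigma> powr (1 / real n)) * L s)"
      using that n by (intro mult_mono) (auto simp: L_def)
    finally show ?thesis by (simp add: c0_def mult_ac)
  qed
  have \<sigma>n: "\<sigma> * (s / \<sigma>) powr (1 - 1 / real n) = \<sigma> powr (1 / real n) * s powr (1 - 1 / real n)" if "s \<ge> 0" for s
  proof -
    have "\<sigma> * (s / \<sigma>) powr (1 - 1 / real n) = (\<sigma> powr 1 / \<sigma> powr (1 - 1 / real n)) * s powr (1 - 1 / real n)"
      using that \<sigma> by (simp add: powr_divide)
    also have "\<sigma> powr 1 / \<sigma> powr (1 - 1 / real n) = \<sigma> powr (1 / real n)" by (simp only: powr_diff[symmetric]) simp
    finally show ?thesis .
  qed
  \<comment> \<open>The indicator confines \<open>hball\<close> to the interval on which it is known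
    to be continuous and so makes \<open>V\<close> Borel measurable on the line.\<close>
  define V where "V r = \<sigma> * (hball n r * indicator {0..<1} r)" for r
  define Kg where "Kg r = \<sigma> * (real n * hsinh r ^ (n - 1))" for r
  have Kgm [measurable]: "Kg \<in> borel_measurable borel" unfolding Kg_def by measurable
  have Vm [measurable]: "V \<in> borel_measurable borel"
  proof -
    have "set_borel_measurable borel {0..<1} (hball n)"
      by (intro set_measurable_continuous_on continuous_on_hball) auto
    hence "(\<lambda>r. hball n r * indicator {0..<1} r) \<in> borel_measurable borel" by (simp add: set_borel_measurable_def mult.commute)
    thus ?thesis unfolding V_def by measurable
  qed
  have V_eq: "V r = \<sigma> * hball n r" if "0 \<le> r" "r < 1" for r using that by (simp add: V_def)
  have Vpos: "V r > 0" if "0 < r" "r < 1" for r using that \<sigma> n hball_pos[of r n] by (simp add: V_eq)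
  have Vmono: "V r < V r'" if "0 \<le> r" "r < r'" "r' < 1" for r r' using that \<sigma> n hball_strict_mono[of r r' n] by (simp add: V_eq)
  have Kg0: "Kg r \<ge> 0" if "0 \<le> r" "r < 1" for r using that \<sigma> hsinh_nonneg[of r] by (simp add: Kg_def)
  have KgL: "Kg r \<le> c0 * L (V r)" if r: "0 < r" "r < 1" for r
  proof -
    define q where "q = hball n r"
    have q: "q > 0" "V r = \<sigma> * q" using r n hball_pos[of r n] by (auto simp: q_def V_eq)
    have "Kg r \<le> \<sigma> * (real n * (2 * (q + q powr (1 - 1 / real n))))"
      unfolding Kg_def q_def using hsinh_power_le[of r n] r n \<sigma> by (intro mult_left_mono) auto
    also have "\<dots> = 2 * real n * (V r + \<sigma> * (V r / \<sigma>) powr (1 - 1 / real n))" using \<sigma> q by (simp add: algebra_simps)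
    also have "\<dots> = 2 * real n * (V r + \<sigma> powr (1 / real n) * V r powr (1 - 1 / real n))" using q \<sigma> by (subst \<sigma>n) auto
    also have "\<dots> \<le> 2 * real n * ((1 + \<sigma> powr (1 / real n)) * L (V r))"
      using q \<sigma> n by (intro mult_left_mono) (auto simp: L_def algebra_simps)
    finally show ?thesis by (simp add: c0_def mult_ac)
  qed
  have perim: "Ke (V r) powr p + ((real n - 1) * V r) powr p \<le> Kg r powr p" if r: "0 < r" "r < 1" for r
  proof -
    define q where "q = hball n r"
    have q: "q > 0" "V r = \<sigma> * q" using r n hball_pos[of r n] by (auto simp: q_def V_eq)
    have "(real n * q powr ((real n - 1) / real n)) powr p + ((real n - 1) * q) powr p \<le> (real n * hsinh r ^ (n - 1)) powr p"
      unfolding q_def using r hp by (intro perimeter_comparison) (auto simp: n_def)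
    hence "\<sigma> powr p * ((real n * q powr ((real n - 1) / real n)) powr p + ((real n - 1) * q) powr p) \<le> \<sigma> powr p * (real n * hsinh r ^ (n - 1)) powr p"
      by (intro mult_left_mono) auto
    moreover have "\<sigma> powr p * (real n * hsinh r ^ (n - 1)) powr p = Kg r powr p"
      unfolding Kg_def using \<sigma> r hsinh_nonneg[of r] by (subst powr_mult) auto
    moreover have "\<sigma> powr p * (real n * q powr ((real n - 1) / real n)) powr p = Ke (V r) powr p"
    proof -
      have "(real n - 1) / real n = 1 - 1 / real n" using n by (simp add: field_simps)
      moreover have "\<sigma> * q powr (1 - 1 / real n) = \<sigma> powr (1 / real n) * V r powr (1 - 1 / real n)"
        using \<sigma>n[of "V r"] q \<sigma> by simp
      ultimately have "\<sigma> * (real n * q powr ((real n - 1) / real n)) = Ke (V r)" by (simp add: Ke_def)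
      thus ?thesis using \<sigma> n by (simp flip: powr_mult)
    qed
    moreover have "\<sigma> powr p * ((real n - 1) * q) powr p = ((real n - 1) * V r) powr p"
    proof -
      have "(real n - 1) * V r = \<sigma> * ((real n - 1) * q)" by (simp add: q(2))
      thus ?thesis using \<sigma> n q by (simp only: powr_mult)
    qed
    ultimately show ?thesis by (simp add: distrib_left)
  qed

  \<comment> \<open>Candidate gradients and their local integrability\<close>
  define kg where "kg r = h (V r) * (Kg r * conf r) * indicator {0<..<1} r" for r
  have kgm [measurable]: "kg \<in> borel_measurable borel" unfolding kg_def by measurable
  have kg0: "kg r \<ge> 0" for r using h0 Kg0[of r] conf_ge[of r] by (auto simp: kg_def indicator_def)
  define Gg where "Gg = (\<lambda>x::real^'n. (- kg (norm x) / norm x) *\<^sub>R x)"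
  \<comment> \<open>At volume \<open>\<sigma> * r ^ n\<close> the Euclidean perimeter is the
    derivative of the volume in \<open>r\<close>, so the chain rule adds no further factor. In
    \<open>kg\<close> the factor \<open>conf\<close> appears because the derivative is taken in the
    Euclidean radius.\<close>
  define ke where "ke r = h (\<sigma> * r ^ n) * Ke (\<sigma> * r ^ n) * indicator {0<..} r" for r
  have kem [measurable]: "ke \<in> borel_measurable borel" unfolding ke_def by measurable
  have ke0: "ke r \<ge> 0" for r using h0 Ke0 by (simp add: ke_def)
  define Ge where "Ge = (\<lambda>x::real^'n. (- ke (norm x) / norm x) *\<^sub>R x)"
  have Ke_r: "Ke (\<sigma> * r ^ n) = \<sigma> * real n * r ^ (n - 1)" if "r > 0" for r
  proof -
    have "\<sigma> powr (1 / real n) * (\<sigma> * r ^ n) powr (1 - 1 / real n) = \<sigma> * (r ^ n) powr (1 - 1 / real n)"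
      using \<sigma>n[of "\<sigma> * r ^ n"] that \<sigma> by simp
    also have "(r ^ n) powr (1 - 1 / real n) = r powr (real n * (1 - 1 / real n))"
      using that n by (intro power_powr) auto
    also have "real n * (1 - 1 / real n) = real (n - 1)" using n by (simp add: of_nat_diff field_simps)
    also have "r powr real (n - 1) = r ^ (n - 1)" using that by (rule powr_realpow)
    finally show ?thesis by (simp add: Ke_def mult_ac)
  qed
  have hyp_coord: "(\<integral>\<^sup>+x. g (V (norm x)) \<partial>(hypV :: (real^'n) measure)) = (\<integral>\<^sup>+s. g s * indicator {0<..} s \<partial>lborel)"
    if "g \<in> borel_measurable borel" for g :: "real \<Rightarrow> ennreal"
  proof -
    have "(\<integral>\<^sup>+x. g (V (norm x)) \<partial>(hypV :: (real^'n) measure)) = (\<integral>\<^sup>+x. g (\<sigma> * hball n (norm x)) \<partial>(hypV :: (real^'n) measure))"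
      by (intro nn_integral_cong) (auto simp: V_eq)
    thus ?thesis using hyp_volume_coordinate[OF n2 that] by (simp add: \<sigma>_def n_def)
  qed
  have euc_coord: "(\<integral>\<^sup>+x. g (\<sigma> * norm x ^ n) \<partial>(lborel :: (real^'n) measure)) = (\<integral>\<^sup>+s. g s * indicator {0<..} s \<partial>lborel)"
    if "g \<in> borel_measurable borel" for g :: "real \<Rightarrow> ennreal"
    using euc_volume_coordinate[OF that, where 'n='n] by (simp add: \<sigma>_def n_def)
  have ballm [measurable]: "ball (0::real^'n) r \<in> sets borel" for r by simp
  \<comment> \<open>In the ball the hyperbolic density is at least 1, so Lebesgue integrals over
    smaller balls are bounded by hyperbolic ones and hence by integrals over bounded intervals of
    volume.\<close>
  have hyp_local: "(\<integral>\<^sup>+x. ennreal (g (V (norm x))) * indicator (ball 0 b) x \<partial>(lborel :: (real^'n) measure)) < \<infinity>"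
    if g [measurable]: "g \<in> borel_measurable borel" and g0: "\<And>s. s > 0 \<Longrightarrow> g s \<ge> 0"
      and gp: "(\<integral>\<^sup>+s. ennreal (g s powr p) * indicator {0<..} s \<partial>lborel) < \<infinity>" and b: "0 < b" "b < 1" for g :: "real \<Rightarrow> real" and b
  proof -
    have [measurable]: "(\<lambda>x::real^'n. ennreal (g (V (norm x))) * indicator {0<..<V b} (V (norm x))) \<in> borel_measurable hypV"
      by (rule borel_measurable_hypV) measurable
    have "(\<integral>\<^sup>+x. ennreal (g (V (norm x))) * indicator (ball 0 b) x \<partial>(lborel :: (real^'n) measure))
        \<le> (\<integral>\<^sup>+x. (ennreal (g (V (norm x))) * indicator {0<..<V b} (V (norm x))) * ennreal (hyp_weight x) * indicator (ball 0 1) x \<partial>(lborel :: (real^'n) measure))"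
    proof (rule nn_integral_mono_AE)
      show "AE x in lborel. ennreal (g (V (norm x))) * indicator (ball 0 b) x
          \<le> (ennreal (g (V (norm x))) * indicator {0<..<V b} (V (norm x))) * ennreal (hyp_weight x) * indicator (ball 0 1) (x::real^'n)"
        using AE_lborel_singleton[of "0::real^'n"]
      proof eventually_elim
        case (elim x)
        show ?case
        proof (cases "norm x < b")
          case True
          have "conf (norm x) \<ge> 1" using conf_ge[of "norm x"] True b by simp
          hence "1 \<le> hyp_weight x" unfolding hyp_weight_conf by (rule one_le_power)
          hence "ennreal (g (V (norm x))) * 1 \<le> ennreal (g (V (norm x))) * ennreal (hyp_weight x)"
            by (intro mult_left_mono) (auto simp: ennreal_ge_1)
          moreover have "V (norm x) \<in> {0<..<V b}" using Vpos[of "norm x"] Vmono[of "norm x" b] True b elim by simp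
          ultimately show ?thesis using True b by simp
        qed simp
      qed
    qed
    also have "\<dots> = (\<integral>\<^sup>+x. ennreal (g (V (norm x))) * indicator {0<..<V b} (V (norm x)) \<partial>(hypV :: (real^'n) measure))"
      by (rule nn_integral_hypV[symmetric]) measurable
    also have "\<dots> = (\<integral>\<^sup>+s. (ennreal (g s) * indicator {0<..<V b} s) * indicator {0<..} s \<partial>lborel)"
      by (rule hyp_coord[of "\<lambda>s. ennreal (g s) * indicator {0<..<V b} s"]) measurable
    also have "\<dots> = (\<integral>\<^sup>+s. ennreal (g s) * indicator {0<..<V b} s \<partial>lborel)"
      by (intro nn_integral_cong) (auto simp: indicator_def)
    also have "\<dots> < \<infinity>" by (rule nn_integral_Lp_finite_interval[OF g g0 _ gp]) (use p in auto)
    finally show ?thesis .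
  qed
  have hLm: "(\<lambda>s. h s * L s) \<in> borel_measurable borel" by measurable
  have hL0: "h s * L s \<ge> 0" if "s > 0" for s using h0 L0[OF that] by simp

  \<comment> \<open>Weak gradient of the hyperbolic rearrangement\<close>
  have wg: "weak_grad (ball 0 1) (hyp_sym_rearr u) Gg"
    unfolding Gg_def
  proof (rule weak_grad_radial[where F = "\<lambda>r. f (V r)" and radii = "{0<..<1}"])
    fix K :: "(real^'n) set" assume K: "compact K" "K \<subseteq> ball 0 1"
    show "\<exists>b\<in>{0<..<1}. K \<subseteq> ball 0 b"
    proof (cases "K = {}")
      case True
      thus ?thesis by (intro bexI[of _ "1/2"]) auto
    next
      case False
      then obtain x0 where x0: "x0 \<in> K" "\<And>x. x \<in> K \<Longrightarrow> norm x \<le> norm x0"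
        using continuous_attains_sup[OF K(1) False, of norm] by (auto intro: continuous_on_norm_id)
      have lt: "norm x0 < 1" using x0 K by auto
      have "x \<in> ball 0 ((1 + norm x0) / 2)" if "x \<in> K" for x using x0(2)[OF that] lt by simp
      thus ?thesis using lt by (intro bexI[of _ "(1 + norm x0) / 2"]) (auto intro: add_pos_nonneg)
    qed
  next
    fix x :: "real^'n" assume x: "x \<in> ball 0 1" "x \<noteq> 0"
    have "hyp_sym_rearr u x = decr_rearr u (V (norm x))"
      unfolding hyp_sym_rearr_def using x by (subst hyp_ball_vol_dist0) (auto simp: V_eq \<sigma>_def n_def)
    thus "hyp_sym_rearr u x = f (V (norm x))" using Vpos[of "norm x"] x by (simp add: f_eq)
  next
    fix b :: real assume b: "b \<in> {0<..<1}"
    show "b > 0 \<and> ball 0 b \<subseteq> ball (0::real^'n) 1" using b by auto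
    have "(\<integral>\<^sup>+x. ennreal (\<bar>f (V (norm x))\<bar> * indicator (ball 0 b) (x::real^'n)) \<partial>lborel) = (\<integral>\<^sup>+x. ennreal (f (V (norm x))) * indicator (ball 0 b) (x::real^'n) \<partial>lborel)"
      using f0 by (intro nn_integral_cong) (auto simp: indicator_def)
    also have "\<dots> < \<infinity>" by (rule hyp_local[OF fm f0 fp]) (use b in auto)
    finally show "(\<integral>\<^sup>+x. ennreal (\<bar>f (V (norm x))\<bar> * indicator (ball 0 b) (x::real^'n)) \<partial>lborel) < \<infinity>" .
    have "(\<integral>\<^sup>+x. ennreal (kg (norm x) * indicator (ball 0 b) (x::real^'n)) \<partial>lborel)
        \<le> (\<integral>\<^sup>+x. ennreal (c0 * conf b) * (ennreal (h (V (norm x)) * L (V (norm x))) * indicator (ball 0 b) x) \<partial>(lborel :: (real^'n) measure))"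
    proof (rule nn_integral_mono)
      fix x :: "real^'n"
      show "ennreal (kg (norm x) * indicator (ball 0 b) x) \<le> ennreal (c0 * conf b) * (ennreal (h (V (norm x)) * L (V (norm x))) * indicator (ball 0 b) x)"
      proof (cases "x \<noteq> 0 \<and> norm x < b")
        case True
        define r where "r = norm x"
        have r: "0 < r" "r < b" "r < 1" using True b by (auto simp: r_def)
        have "conf r \<le> conf b"
        proof -
          have "r\<^sup>2 \<le> b\<^sup>2" using r by (intro power_mono) auto
          thus ?thesis unfolding conf_def using b one_minus_square_pos[of b] by (intro divide_left_mono) auto
        qed
        hence "Kg r * conf r \<le> (c0 * L (V r)) * conf b"
          using KgL[OF r(1,3)] Kg0[of r] conf_ge[of r] r by (intro mult_mono) auto
        hence "h (V r) * (Kg r * conf r) \<le> h (V r) * ((c0 * L (V r)) * conf b)" using h0 by (intro mult_left_mono)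
        hence "kg r \<le> (c0 * conf b) * (h (V r) * L (V r))" using r by (simp add: kg_def mult_ac)
        moreover have "c0 * conf b \<ge> 0" using c0 conf_ge[of b] b by simp
        ultimately show ?thesis using True by (simp add: r_def ennreal_leI flip: ennreal_mult')
      next
        case False
        thus ?thesis by (auto simp: kg_def indicator_def)
      qed
    qed
    also have "\<dots> = ennreal (c0 * conf b) * (\<integral>\<^sup>+x. ennreal (h (V (norm x)) * L (V (norm x))) * indicator (ball 0 b) x \<partial>(lborel :: (real^'n) measure))"
      by (rule nn_integral_cmult) measurable
    also have "\<dots> < \<infinity>"
      using hyp_local[OF hLm hL0 hL, of b] b by (simp add: ennreal_mult_less_top)
    finally show "(\<integral>\<^sup>+x. ennreal (kg (norm x) * indicator (ball 0 b) (x::real^'n)) \<partial>lborel) < \<infinity>" .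
    fix r :: real assume r: "0 < r" "r < b"
    have r1: "r < 1" "b < 1" "0 < b" using r b by auto
    show "f (V b) \<le> f (V r) \<and> ennreal (f (V r) - f (V b)) = (\<integral>\<^sup>+t. ennreal (kg t) * indicator {r<..<b} t \<partial>lborel)"
    proof
      have Vrb: "0 < V r" "V r < V b" using Vpos[of r] Vmono[of r b] r r1 by auto
      show "f (V b) \<le> f (V r)" using Vrb by (intro fanti) auto
      have "ennreal (f (V r) - f (V b)) = (\<integral>\<^sup>+t. ennreal (h (V t) * (Kg t * conf t)) * indicator {r<..<b} t \<partial>lborel)"
      proof (rule nn_integral_density_volume[OF h h0 fint r(2) Vrb])
        fix x assume x: "x \<in> {r..b}"
        hence x1: "0 < x" "x < 1" using r r1 by auto
        have "((\<lambda>r. \<sigma> * hball n r) has_real_derivative \<sigma> * (real n * hsinh x ^ (n - 1) * conf x)) (at x)"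
          by (intro DERIV_cmult DERIV_hball x1)
        hence "(V has_real_derivative \<sigma> * (real n * hsinh x ^ (n - 1) * conf x)) (at x)"
          by (rule has_field_derivative_transform_within_open[of _ _ _ "{0<..<1}"]) (use x1 in \<open>auto simp: V_eq\<close>)
        thus "(V has_real_derivative Kg x * conf x) (at x)" by (simp add: Kg_def mult_ac)
        show "0 \<le> Kg x * conf x" using Kg0[of x] conf_ge[of x] x1 by simp
      next
        show "continuous_on {r..b} (\<lambda>t. Kg t * conf t)" unfolding Kg_def
          by (intro continuous_intros continuous_on_subset[OF continuous_on_hsinh] continuous_on_subset[OF continuous_on_conf]) (use r r1 in auto)
      qed
      also have "\<dots> = (\<integral>\<^sup>+t. ennreal (kg t) * indicator {r<..<b} t \<partial>lborel)"
        using r r1 by (intro nn_integral_cong) (auto simp: kg_def indicator_def)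
      finally show "ennreal (f (V r) - f (V b)) = (\<integral>\<^sup>+t. ennreal (kg t) * indicator {r<..<b} t \<partial>lborel)" .
    qed
  qed (use kg0 in auto)

  \<comment> \<open>Weak gradient of the Euclidean rearrangement\<close>
  have euc_local: "(\<integral>\<^sup>+x. ennreal (g (\<sigma> * norm x ^ n)) * indicator (ball 0 b) x \<partial>(lborel :: (real^'n) measure)) < \<infinity>"
    if g [measurable]: "g \<in> borel_measurable borel" and g0: "\<And>s. s > 0 \<Longrightarrow> g s \<ge> 0"
      and gp: "(\<integral>\<^sup>+s. ennreal (g s powr p) * indicator {0<..} s \<partial>lborel) < \<infinity>" and b: "0 < b" for g :: "real \<Rightarrow> real" and b
  proof -
    have "(\<integral>\<^sup>+x. ennreal (g (\<sigma> * norm x ^ n)) * indicator (ball 0 b) x \<partial>(lborel :: (real^'n) measure))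
        \<le> (\<integral>\<^sup>+x. ennreal (g (\<sigma> * norm x ^ n)) * indicator {0<..<\<sigma> * b ^ n} (\<sigma> * norm x ^ n) \<partial>(lborel :: (real^'n) measure))"
    proof (rule nn_integral_mono_AE)
      show "AE x in lborel. ennreal (g (\<sigma> * norm x ^ n)) * indicator (ball 0 b) x
          \<le> ennreal (g (\<sigma> * norm x ^ n)) * indicator {0<..<\<sigma> * b ^ n} (\<sigma> * norm (x::real^'n) ^ n)"
        using AE_lborel_singleton[of "0::real^'n"]
      proof eventually_elim
        case (elim x)
        show ?case
        proof (cases "norm x < b")
          case True
          have "norm x ^ n < b ^ n" using True n by (intro power_strict_mono) auto
          thus ?thesis using True elim \<sigma> by simp
        qed simp
      qed
    qed
    also have "\<dots> = (\<integral>\<^sup>+s. (ennreal (g s) * indicator {0<..<\<sigma> * b ^ n} s) * indicator {0<..} s \<partial>lborel)"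
      by (rule euc_coord[of "\<lambda>s. ennreal (g s) * indicator {0<..<\<sigma> * b ^ n} s"]) measurable
    also have "\<dots> = (\<integral>\<^sup>+s. ennreal (g s) * indicator {0<..<\<sigma> * b ^ n} s \<partial>lborel)"
      by (intro nn_integral_cong) (auto simp: indicator_def)
    also have "\<dots> < \<infinity>" by (rule nn_integral_Lp_finite_interval[OF g g0 _ gp]) (use p in auto)
    finally show ?thesis .
  qed
  have we: "weak_grad UNIV (euc_sym_rearr u) Ge"
    unfolding Ge_def
  proof (rule weak_grad_radial[where F = "\<lambda>r. f (\<sigma> * r ^ n)" and radii = "{0<..}"])
    fix K :: "(real^'n) set" assume K: "compact K"
    obtain b where b: "0 < b" "K \<subseteq> ball 0 b" using compact_imp_bounded[OF K] bounded_subset_ballD[of K 0] by blast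
    thus "\<exists>b\<in>{0<..}. K \<subseteq> ball 0 b" by auto
  next
    fix x :: "real^'n" assume x: "x \<noteq> 0"
    show "euc_sym_rearr u x = f (\<sigma> * norm x ^ n)"
      unfolding euc_sym_rearr_def using x \<sigma> by (simp add: f_eq \<sigma>_def[symmetric] n_def[symmetric])
  next
    fix b :: real assume b: "b \<in> {0<..}"
    show "b > 0 \<and> ball 0 b \<subseteq> (UNIV :: (real^'n) set)" using b by auto
    have "(\<integral>\<^sup>+x. ennreal (\<bar>f (\<sigma> * norm x ^ n)\<bar> * indicator (ball 0 b) (x::real^'n)) \<partial>lborel) = (\<integral>\<^sup>+x. ennreal (f (\<sigma> * norm x ^ n)) * indicator (ball 0 b) (x::real^'n) \<partial>lborel)"
      using f0 by (intro nn_integral_cong) (auto simp: indicator_def)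
    also have "\<dots> < \<infinity>" by (rule euc_local[OF fm f0 fp]) (use b in auto)
    finally show "(\<integral>\<^sup>+x. ennreal (\<bar>f (\<sigma> * norm x ^ n)\<bar> * indicator (ball 0 b) (x::real^'n)) \<partial>lborel) < \<infinity>" .
    have "(\<integral>\<^sup>+x. ennreal (ke (norm x) * indicator (ball 0 b) (x::real^'n)) \<partial>lborel)
        \<le> (\<integral>\<^sup>+x. ennreal c0 * (ennreal (h (\<sigma> * norm x ^ n) * L (\<sigma> * norm x ^ n)) * indicator (ball 0 b) x) \<partial>(lborel :: (real^'n) measure))"
    proof (rule nn_integral_mono)
      fix x :: "real^'n"
      show "ennreal (ke (norm x) * indicator (ball 0 b) x) \<le> ennreal c0 * (ennreal (h (\<sigma> * norm x ^ n) * L (\<sigma> * norm x ^ n)) * indicator (ball 0 b) x)"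
      proof (cases "x \<noteq> 0 \<and> norm x < b")
        case True
        define s where "s = \<sigma> * norm x ^ n"
        have s: "s > 0" using True \<sigma> by (simp add: s_def)
        have "h s * Ke s \<le> h s * (c0 * L s)" using KeL[OF s] h0 by (intro mult_left_mono)
        hence "ennreal (h s * Ke s) \<le> ennreal c0 * ennreal (h s * L s)"
          using c0 by (simp add: ennreal_leI mult_ac flip: ennreal_mult')
        thus ?thesis using True by (simp add: ke_def s_def)
      next
        case False
        thus ?thesis by (auto simp: ke_def indicator_def)
      qed
    qed
    also have "\<dots> = ennreal c0 * (\<integral>\<^sup>+x. ennreal (h (\<sigma> * norm x ^ n) * L (\<sigma> * norm x ^ n)) * indicator (ball 0 b) x \<partial>(lborel :: (real^'n) measure))"
      by (rule nn_integral_cmult) measurable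
    also have "\<dots> < \<infinity>"
      using euc_local[OF hLm hL0 hL, of b] b by (simp add: ennreal_mult_less_top)
    finally show "(\<integral>\<^sup>+x. ennreal (ke (norm x) * indicator (ball 0 b) (x::real^'n)) \<partial>lborel) < \<infinity>" .
    fix r :: real assume r: "0 < r" "r < b"
    show "f (\<sigma> * b ^ n) \<le> f (\<sigma> * r ^ n) \<and> ennreal (f (\<sigma> * r ^ n) - f (\<sigma> * b ^ n)) = (\<integral>\<^sup>+t. ennreal (ke t) * indicator {r<..<b} t \<partial>lborel)"
    proof
      have "r ^ n < b ^ n" using r n by (intro power_strict_mono) auto
      hence Vrb: "0 < \<sigma> * r ^ n" "\<sigma> * r ^ n < \<sigma> * b ^ n" using r \<sigma> by auto
      show "f (\<sigma> * b ^ n) \<le> f (\<sigma> * r ^ n)" using Vrb by (intro fanti) auto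
      have "ennreal (f (\<sigma> * r ^ n) - f (\<sigma> * b ^ n)) = (\<integral>\<^sup>+t. ennreal (h (\<sigma> * t ^ n) * (\<sigma> * real n * t ^ (n - 1))) * indicator {r<..<b} t \<partial>lborel)"
      proof (rule nn_integral_density_volume[OF h h0 fint r(2), of "\<lambda>r. \<sigma> * r ^ n"])
        show "((\<lambda>r. \<sigma> * r ^ n) has_real_derivative \<sigma> * real n * x ^ (n - 1)) (at x)" for x
          by (auto intro!: derivative_eq_intros)
      qed (use Vrb r \<sigma> in \<open>auto intro!: continuous_intros\<close>)
      also have "\<dots> = (\<integral>\<^sup>+t. ennreal (ke t) * indicator {r<..<b} t \<partial>lborel)"
        using r by (intro nn_integral_cong) (auto simp: ke_def indicator_def Ke_r)
      finally show "ennreal (f (\<sigma> * r ^ n) - f (\<sigma> * b ^ n)) = (\<integral>\<^sup>+t. ennreal (ke t) * indicator {r<..<b} t \<partial>lborel)" .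
    qed
  qed (use ke0 in auto)

  \<comment> \<open>Energies in the volume coordinate\<close>
  define Ig where "Ig = (\<integral>\<^sup>+x. ennreal (hyp_norm x (Gg x) powr p) \<partial>hypV)"
  define Iu where "Iu = (\<integral>\<^sup>+x. ennreal (\<bar>hyp_sym_rearr u x\<bar> powr p) \<partial>hypV)"
  define Ie where "Ie = (\<integral>\<^sup>+x. ennreal (norm (Ge x) powr p) \<partial>lebesgue)"
  have ne0: "AE x in lborel. x \<noteq> (0::real^'n)" using AE_lborel_singleton[of "0::real^'n"] .
  have ne0h: "AE x in hypV. x \<noteq> (0::real^'n)"
  proof -
    have "AE x in lebesgue. x \<noteq> (0::real^'n)" using ne0 by (rule AE_completion)
    hence "AE x in lebesgue_on (ball 0 1). x \<noteq> (0::real^'n)" by (subst AE_restrict_space_iff) auto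
    thus ?thesis unfolding hypV_def by (subst AE_density) auto
  qed
  \<comment> \<open>The factor in \<open>hyp_norm\<close> is the inverse of \<open>conf\<close>, so
    the hyperbolic length of the gradient is \<open>h\<close> times the perimeter, with no trace of
    the model.\<close>
  have Gg_norm: "hyp_norm x (Gg x) = h (V (norm x)) * Kg (norm x)" if "x \<noteq> 0" "norm x < 1" for x
  proof -
    have "norm (Gg x) = kg (norm x)" unfolding Gg_def using kg0 that by (subst norm_radial_field) auto
    also have "\<dots> = h (V (norm x)) * (Kg (norm x) * conf (norm x))" using that by (simp add: kg_def)
    finally show ?thesis using one_minus_square_pos[of "norm x"] that by (simp add: hyp_norm_def conf_def)
  qed
  have Gg_m: "(\<lambda>x. hyp_norm x (Gg x) powr p) \<in> borel_measurable hypV"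
    unfolding hyp_norm_def Gg_def by (rule borel_measurable_hypV) measurable
  have Ge_m: "(\<lambda>x. norm (Ge x) powr p) \<in> borel_measurable borel"
    unfolding Ge_def by measurable
  have sym_m: "hyp_sym_rearr u \<in> borel_measurable hypV"
  proof (rule measurable_cong[THEN iffD2])
    show "(\<lambda>x::real^'n. if x = 0 then hyp_sym_rearr u 0 else f (V (norm x))) \<in> borel_measurable hypV"
      by (rule borel_measurable_hypV) measurable
    show "hyp_sym_rearr u x = (if x = 0 then hyp_sym_rearr u 0 else f (V (norm x)))" if "x \<in> space hypV" for x
    proof (cases "x = 0")
      case False
      have "hyp_sym_rearr u x = decr_rearr u (V (norm x))"
        unfolding hyp_sym_rearr_def using that by (subst hyp_ball_vol_dist0) (auto simp: V_eq \<sigma>_def n_def)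
      thus ?thesis using Vpos[of "norm x"] that False by (simp add: f_eq)
    qed simp
  qed
  have Iu_eq: "Iu = (\<integral>\<^sup>+s. ennreal (f s powr p) * indicator {0<..} s \<partial>lborel)"
  proof -
    have "Iu = (\<integral>\<^sup>+x. ennreal (f (V (norm x)) powr p) \<partial>(hypV :: (real^'n) measure))"
      unfolding Iu_def
    proof (rule nn_integral_cong_AE)
      show "AE x in hypV. ennreal (\<bar>hyp_sym_rearr u x\<bar> powr p) = ennreal (f (V (norm x)) powr p)"
        using ne0h AE_space
      proof eventually_elim
        case (elim x)
        have "hyp_sym_rearr u x = decr_rearr u (V (norm x))"
          unfolding hyp_sym_rearr_def using elim by (subst hyp_ball_vol_dist0) (auto simp: V_eq \<sigma>_def n_def)
        hence "hyp_sym_rearr u x = f (V (norm x))" using Vpos[of "norm x"] elim by (simp add: f_eq)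
        thus ?case using f0 by simp
      qed
    qed
    also have "\<dots> = (\<integral>\<^sup>+s. ennreal (f s powr p) * indicator {0<..} s \<partial>lborel)"
      by (rule hyp_coord[of "\<lambda>s. ennreal (f s powr p)"]) measurable
    finally show ?thesis .
  qed
  have Ie_eq: "Ie = (\<integral>\<^sup>+s. ennreal ((h s * Ke s) powr p) * indicator {0<..} s \<partial>lborel)"
  proof -
    have "Ie = (\<integral>\<^sup>+x. ennreal (norm (Ge x) powr p) \<partial>lborel)" unfolding Ie_def by (rule nn_integral_completion)
    also have "\<dots> = (\<integral>\<^sup>+x. ennreal ((h (\<sigma> * norm x ^ n) * Ke (\<sigma> * norm x ^ n)) powr p) \<partial>(lborel :: (real^'n) measure))"
    proof (rule nn_integral_cong_AE)
      show "AE x in lborel. ennreal (norm (Ge x) powr p) = ennreal ((h (\<sigma> * norm x ^ n) * Ke (\<sigma> * norm x ^ n)) powr p)"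
        using ne0
      proof eventually_elim
        case (elim x)
        have "norm (Ge x) = ke (norm x)" unfolding Ge_def using ke0 elim by (subst norm_radial_field) auto
        thus ?case using elim by (simp add: ke_def)
      qed
    qed
    also have "\<dots> = (\<integral>\<^sup>+s. ennreal ((h s * Ke s) powr p) * indicator {0<..} s \<partial>lborel)"
      by (rule euc_coord[of "\<lambda>s. ennreal ((h s * Ke s) powr p)"]) measurable
    finally show ?thesis .
  qed
  have Ig_fin: "Ig < \<infinity>"
  proof -
    have "Ig \<le> (\<integral>\<^sup>+x. ennreal (c0 powr p) * ennreal ((h (V (norm x)) * L (V (norm x))) powr p) \<partial>(hypV :: (real^'n) measure))"
      unfolding Ig_def
    proof (rule nn_integral_mono_AE)
      show "AE x in hypV. ennreal (hyp_norm x (Gg x) powr p) \<le> ennreal (c0 powr p) * ennreal ((h (V (norm x)) * L (V (norm x))) powr p)"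
        using ne0h AE_space
      proof eventually_elim
        case (elim x)
        define r where "r = norm x"
        have r: "0 < r" "r < 1" using elim by (auto simp: r_def)
        have "h (V r) * Kg r \<le> h (V r) * (c0 * L (V r))" using KgL[OF r] h0 by (intro mult_left_mono)
        hence "(h (V r) * Kg r) powr p \<le> (c0 * (h (V r) * L (V r))) powr p"
          using h0 Kg0[of r] r p by (intro powr_mono2) (auto simp: mult_ac)
        also have "\<dots> = c0 powr p * (h (V r) * L (V r)) powr p"
          using c0 hL0[OF Vpos[OF r]] by (simp add: powr_mult)
        finally show ?case using Gg_norm[of x] elim by (simp add: r_def ennreal_leI flip: ennreal_mult')
      qed
    qed
    also have "\<dots> = (\<integral>\<^sup>+s. (ennreal (c0 powr p) * ennreal ((h s * L s) powr p)) * indicator {0<..} s \<partial>lborel)"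
      by (rule hyp_coord[of "\<lambda>s. ennreal (c0 powr p) * ennreal ((h s * L s) powr p)"]) measurable
    also have "\<dots> = ennreal (c0 powr p) * (\<integral>\<^sup>+s. ennreal ((h s * L s) powr p) * indicator {0<..} s \<partial>lborel)"
      unfolding mult.assoc by (rule nn_integral_cmult) measurable
    also have "\<dots> < \<infinity>" using hL by (simp add: ennreal_mult_less_top)
    finally show ?thesis .
  qed
  \<comment> \<open>The inequality is kept additive in the extended nonnegative reals until
    finiteness of all three terms is available. Hardy replaces the norm of the rearrangement by that
    of \<open>s * h\<close>, and the powers \<open>p powr p\<close> cancel, leaving the coefficient
    \<open>(n - 1) powr p\<close> that matches \<open>perim\<close> exactly.\<close>
  have main: "Ie + ennreal (((real n - 1) / p) powr p) * Iu \<le> Ig"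
  proof -
    let ?S = "\<integral>\<^sup>+t. ennreal ((t * h t) powr p) * indicator {0<..} t \<partial>lborel"
    have "ennreal (((real n - 1) / p) powr p) * Iu \<le> ennreal (((real n - 1) / p) powr p) * (ennreal (p powr p) * ?S)"
      unfolding Iu_eq using Hardy by (intro mult_left_mono) auto
    also have "\<dots> = ennreal ((real n - 1) powr p) * ?S"
    proof -
      have "((real n - 1) / p) powr p * p powr p = (real n - 1) powr p" using p n by (simp add: powr_divide)
      thus ?thesis by (simp add: mult.assoc[symmetric] flip: ennreal_mult')
    qed
    finally have 1: "Ie + ennreal (((real n - 1) / p) powr p) * Iu \<le> Ie + ennreal ((real n - 1) powr p) * ?S"
      by (intro add_left_mono)
    have "Ie + ennreal ((real n - 1) powr p) * ?S = (\<integral>\<^sup>+s. (ennreal ((h s * Ke s) powr p) + ennreal ((real n - 1) powr p) * ennreal ((s * h s) powr p)) * indicator {0<..} s \<partial>lborel)"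
      unfolding Ie_eq distrib_right mult.assoc
      by (subst nn_integral_add) (auto simp: nn_integral_cmult)
    also have "\<dots> = (\<integral>\<^sup>+x. ennreal ((h (V (norm x)) * Ke (V (norm x))) powr p) + ennreal ((real n - 1) powr p) * ennreal ((V (norm x) * h (V (norm x))) powr p) \<partial>(hypV :: (real^'n) measure))"
      by (rule hyp_coord[of "\<lambda>s. ennreal ((h s * Ke s) powr p) + ennreal ((real n - 1) powr p) * ennreal ((s * h s) powr p)", symmetric]) measurable
    also have "\<dots> \<le> Ig"
      unfolding Ig_def
    proof (rule nn_integral_mono_AE)
      show "AE x in hypV. ennreal ((h (V (norm x)) * Ke (V (norm x))) powr p) + ennreal ((real n - 1) powr p) * ennreal ((V (norm x) * h (V (norm x))) powr p) \<le> ennreal (hyp_norm x (Gg x) powr p)"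
        using ne0h AE_space
      proof eventually_elim
        case (elim x)
        define r where "r = norm x"
        have r: "0 < r" "r < 1" using elim by (auto simp: r_def)
        define H where "H = h (V r)"
        have H0: "H \<ge> 0" using h0 by (simp add: H_def)
        have "(H * Ke (V r)) powr p + (real n - 1) powr p * (V r * H) powr p = H powr p * (Ke (V r) powr p + ((real n - 1) * V r) powr p)"
          using H0 Ke0[of "V r"] Vpos[OF r] n by (simp only: powr_mult) (simp add: algebra_simps)
        also have "\<dots> \<le> H powr p * Kg r powr p" using perim[OF r] by (intro mult_left_mono) auto
        also have "\<dots> = (H * Kg r) powr p" using H0 Kg0[of r] r by (simp add: powr_mult)
        also have "\<dots> = hyp_norm x (Gg x) powr p" using Gg_norm[of x] elim by (simp add: H_def r_def)
        finally have "ennreal ((H * Ke (V r)) powr p + (real n - 1) powr p * (V r * H) powr p) \<le> ennreal (hyp_norm x (Gg x) powr p)"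
          by (rule ennreal_leI)
        thus ?case by (simp add: H_def r_def ennreal_plus ennreal_mult')
      qed
    qed
    finally show ?thesis using 1 by (rule order_trans[rotated])
  qed
  have Iu_fin: "Iu < \<infinity>" unfolding Iu_eq by (rule fp)
  have Ie_fin: "Ie < \<infinity>"
  proof -
    \<comment> \<open>The Euclidean energy inherits its finiteness from the hyperbolic one through
      \<open>main\<close>.\<close>
    have "Ie \<le> Ie + ennreal (((real n - 1) / p) powr p) * Iu" by simp
    thus ?thesis using main Ig_fin by (meson le_less_trans)
  qed
  have i1: "integrable hypV (\<lambda>x. hyp_norm x (Gg x) powr p)"
    using Ig_fin Gg_m unfolding Ig_def by (intro integrableI_bounded) auto
  have i2: "integrable hypV (\<lambda>x. \<bar>hyp_sym_rearr u x\<bar> powr p)"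
    using Iu_fin sym_m unfolding Iu_def by (intro integrableI_bounded) auto
  have i3: "integrable lebesgue (\<lambda>x. norm (Ge x) powr p)"
    using Ie_fin Ge_m unfolding Ie_def by (intro integrableI_bounded measurable_completion) auto
  have e1: "(\<integral>x. hyp_norm x (Gg x) powr p \<partial>hypV) = enn2real Ig"
    unfolding Ig_def using Gg_m by (intro integral_eq_nn_integral) auto
  have e2: "(\<integral>x. \<bar>hyp_sym_rearr u x\<bar> powr p \<partial>hypV) = enn2real Iu"
    unfolding Iu_def using sym_m by (intro integral_eq_nn_integral) auto
  have e3: "(\<integral>x. norm (Ge x) powr p \<partial>lebesgue) = enn2real Ie"
    unfolding Ie_def using Ge_m by (intro integral_eq_nn_integral measurable_completion) auto
  have "enn2real (Ie + ennreal (((real n - 1) / p) powr p) * Iu) \<le> enn2real Ig"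
    using main Ig_fin by (intro enn2real_mono) auto
  also have "enn2real (Ie + ennreal (((real n - 1) / p) powr p) * Iu) = enn2real Ie + ((real n - 1) / p) powr p * enn2real Iu"
    using Ie_fin Iu_fin by (subst enn2real_plus) (auto simp: enn2real_mult ennreal_mult_less_top)
  finally have "(\<integral>x. norm (Ge x) powr p \<partial>lebesgue) \<le> (\<integral>x. hyp_norm x (Gg x) powr p \<partial>hypV)
             - ((real CARD('n) - 1) / p) powr p * (\<integral>x. \<bar>hyp_sym_rearr u x\<bar> powr p \<partial>hypV)"
    unfolding e1 e2 e3 by (simp add: n_def)
  thus ?thesis using wg we i1 i2 i3 by blast
qed

end
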